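(* Let $r$ be a positive integer, $d>0$ real, $A(t)=\begin{pmatrix}1&rt\\0&1\end{pmatrix}$, $G=\mathbb{R}^2\rtimes_A\mathbb{R}$ (the three-dimensional Heisenberg group), $\Gamma=\mathbb{Z}^2\rtimes_A\mathbb{Z}$. Let $\mathcal{H}$ be the left-invariant distribution spanned by $s_2=-d\,e_2$ and $s_3=\frac{d}{r}b$, with the left-invariant metric $g$ for which $s_2,s_3$ are orthonormal, and let $\nabla$ be the connection in $\mathcal{H}$ defined by the Koszul formula $$2g(\nabla_XY,Z)=X(g(Y,Z))+Y(g(X,Z))-Z(g(X,Y))+g(\mathrm{pr}[X,Y],Z)-g(\mathrm{pr}[X,Z],Y)-g(\mathrm{pr}[Y,Z],X)$$ for the projection $\mathrm{pr}$ onto $\mathcal{H}$ along $\mathcal{V}=\mathbb{R}\cdot e_1$. Let $\varepsilon:\Gamma\to\mathbb{Z}_2$ be a homomorphism and $D$ the associated sub-Dirac operator on $\Gamma\setminus G$. If $\varepsilon_1=0$, then the spectral multiplicity function of $D$ is $$m(D)=|\mathbb{N}|\cdot\delta(0)+m_1^+(D)+m_1^-(D)+m_2^+(D)+m_2^-(D),$$ where $$m_1^\pm(D)=\sum_{k\in\mathbb{Z}}\sum_{l\in\mathbb{Z}}\delta\Big(\pm\frac{\pi d}{r}\big((2k+\dot\varepsilon(1))^2+r^2(2l+\varepsilon_2)^2\big)^{1/2}\Big),\qquad m_2^\pm(D)=\sum_{l=1}^\infty2rl\sum_{k=1}^\infty\delta\big(\pm(4\pi d^2kl)^{1/2}\big).$$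 If $\varepsilon_1=1$, then $$m(D)=|\mathbb{N}|\cdot\delta(0)+\sum_{l=0}^\infty(2l+1)r\sum_{k=1}^\infty\Big(\delta\big((2\pi d^2k(2l+1))^{1/2}\big)+\delta\big(-(2\pi d^2k(2l+1))^{1/2}\big)\Big).$$
   Context: The group law of $G$ is $(x,s)(y,t)=(x+A(s)y,s+t)$. The Lie algebra of $G$ has basis $e_1,e_2,b$ with only nontrivial bracket $[b,e_2]=re_1$; its elements are identified with left-invariant vector fields. $\mathbb{Z}_2=\{0,1\}$; $\varepsilon_\nu:=\varepsilon(e_\nu,0)$ for $\nu=1,2$ and $\dot\varepsilon(l)=\varepsilon(0,l)$, values viewed as integers ($\varepsilon_1=1$ can occur only if $r$ is even). $L^2(G,\varepsilon)$ is the completion of the space of continuous $\varphi:G\to\mathbb{C}$ with $\varphi(\gamma y)=e^{i\pi\varepsilon(\gamma)}\varphi(y)$ ($\gamma\in\Gamma,y\in G$) with respect to the $L^2$-norm over $\Gamma\setminus G$ for the normalised invariant measure. Let $\Delta=\mathbb{C}^2$ be the simple complex module of the Clifford algebra of $\mathrm{span}\{s_2,s_3\}$ (convention $v\cdot v=-|v|^2$). The sub-Dirac operator acts on smooth $\varepsilon$-equivariant functions $G\to\Delta$ by $D=\sum_i d\rho(s_i)\otimes s_i+\frac14\sum_{i,j,k}\Gamma_{ij}^k\,I\otimes s_is_js_k$ (indices in $\{2,3\}$), where $d\rho(s_i)$ is differentiation along $s_i$ and $\Gamma_{ij}^k=g(\nabla_{s_i}s_j,s_k)$; for the present connection all $\Gamma_{ij}^k$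 vanish. The spectral multiplicity function is $m(D):\mathbb{R}\to\mathbb{N}\cup\{|\mathbb{N}|\}$, $m(D)(\lambda)=\dim\ker(D-\lambda I)$ (Hilbert space dimension, for the closure of $D$ in $L^2(G,\varepsilon)\otimes\mathbb{C}^2$). $\delta(\lambda)$ denotes the function on $\mathbb{R}$ with value $1$ at $\lambda$ and $0$ elsewhere; sums of such functions with values in $\mathbb{N}\cup\{|\mathbb{N}|\}$ are pointwise. *)

theory Defs
  imports "HOL-Analysis.Analysis" "HOL-Algebra.Elementary_Groups"
begin

text \<open>A point \<open>((x1, x2), s)\<close> is the element \<open>(x, s)\<close> of the semidirect product.\<close>

type_synonym heis = "(real \<times> real) \<times> real"

text \<open>The linear map with matrix \<open>(1, r t; 0, 1)\<close>.\<close>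

definition A_map :: "nat \<Rightarrow> real \<Rightarrow> real \<times> real \<Rightarrow> real \<times> real" where
  "A_map r t y = (fst y + real r * t * snd y, snd y)"

definition heis_mult :: "nat \<Rightarrow> heis \<Rightarrow> heis \<Rightarrow> heis" where
  "heis_mult r p q = (fst p + A_map r (snd p) (fst q), snd p + snd q)"

definition heis_group :: "nat \<Rightarrow> heis monoid" where
  "heis_group r = \<lparr>carrier = UNIV, monoid.mult = heis_mult r, one = ((0, 0), 0)\<rparr>"

definition lattice_pts :: "heis set" where
  "lattice_pts = (\<int> \<times> \<int>) \<times> \<int>"

definition heis_lattice :: "nat \<Rightarrow> heis monoid" where
  "heis_lattice r = heis_group r \<lparr>carrier := lattice_pts\<rparr>"

text \<open>
  \<open>G\<close> has a global chart, so a vector field is given by its components in the coordinates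
  \<open>((x1, x2), s)\<close>.
\<close>

type_synonym vfield = "heis \<Rightarrow> heis"

primrec C_k :: "nat \<Rightarrow> ('a::real_normed_vector \<Rightarrow> 'b::real_normed_vector) \<Rightarrow> bool" where
  "C_k 0 f \<longleftrightarrow> continuous_on UNIV f"
| "C_k (Suc n) f \<longleftrightarrow>
     (\<forall>x. f differentiable (at x)) \<and> (\<forall>v. C_k n (\<lambda>x. frechet_derivative f (at x) v))"

definition smooth :: "('a::real_normed_vector \<Rightarrow> 'b::real_normed_vector) \<Rightarrow> bool" where
  "smooth f \<longleftrightarrow> (\<forall>n. C_k n f)"

definition along :: "vfield \<Rightarrow> (heis \<Rightarrow> 'b::real_normed_vector) \<Rightarrow> heis \<Rightarrow> 'b" where
  "along X f p = frechet_derivative f (at p) (X p)"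

definition lie_bracket :: "vfield \<Rightarrow> vfield \<Rightarrow> vfield" where
  "lie_bracket X Y p = along X Y p - along Y X p"

definition left_inv :: "nat \<Rightarrow> heis \<Rightarrow> vfield" where
  "left_inv r v p = frechet_derivative (heis_mult r p) (at ((0, 0), 0)) v"

definition e1 :: "nat \<Rightarrow> vfield" where "e1 r = left_inv r ((1, 0), 0)"
definition e2 :: "nat \<Rightarrow> vfield" where "e2 r = left_inv r ((0, 1), 0)"
definition b_field :: "nat \<Rightarrow> vfield" where "b_field r = left_inv r ((0, 0), 1)"

text \<open>The orthonormal frame; only the indices 2 and 3 are used.\<close>

definition s_frame :: "nat \<Rightarrow> real \<Rightarrow> nat \<Rightarrow> vfield" where
  "s_frame r d i p = (if i = 2 then - (d *\<^sub>R e2 r p) else (d / real r) *\<^sub>R b_field r p)"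

text \<open>The \<open>i\<close>-th coordinate of the tangent vector \<open>u\<close> at \<open>p\<close> in the basis \<open>e1, s2, s3\<close>.\<close>

definition s_coord :: "nat \<Rightarrow> real \<Rightarrow> nat \<Rightarrow> heis \<Rightarrow> heis \<Rightarrow> real" where
  "s_coord r d i p u =
     representation {e1 r p, s_frame r d 2 p, s_frame r d 3 p} u (s_frame r d i p)"

definition horizontal :: "nat \<Rightarrow> real \<Rightarrow> vfield \<Rightarrow> bool" where
  "horizontal r d X \<longleftrightarrow>
     smooth X \<and> (\<forall>p. X p \<in> span {s_frame r d 2 p, s_frame r d 3 p})"

definition pr :: "nat \<Rightarrow> real \<Rightarrow> vfield \<Rightarrow> vfield" where
  "pr r d X p = (\<Sum>i\<in>{2, 3}. s_coord r d i p (X p) *\<^sub>R s_frame r d i p)"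

text \<open>The function \<open>g(X, Y)\<close> on \<open>G\<close>; it is only used for horizontal fields.\<close>

definition g_metric :: "nat \<Rightarrow> real \<Rightarrow> vfield \<Rightarrow> vfield \<Rightarrow> heis \<Rightarrow> real" where
  "g_metric r d X Y p = (\<Sum>i\<in>{2, 3}. s_coord r d i p (X p) * s_coord r d i p (Y p))"

definition koszul_connection ::
    "nat \<Rightarrow> real \<Rightarrow> (vfield \<Rightarrow> vfield \<Rightarrow> vfield) \<Rightarrow> bool" where
  "koszul_connection r d nabla \<longleftrightarrow>
     (\<forall>X Y. horizontal r d X \<longrightarrow> horizontal r d Y \<longrightarrow>
        horizontal r d (nabla X Y) \<and>
        (\<forall>Z p. horizontal r d Z \<longrightarrow>
           2 * g_metric r d (nabla X Y) Z p =
             along X (g_metric r d Y Z) p + along Y (g_metric r d X Z) p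
             - along Z (g_metric r d X Y) p
             + g_metric r d (pr r d (lie_bracket X Y)) Z p
             - g_metric r d (pr r d (lie_bracket X Z)) Y p
             - g_metric r d (pr r d (lie_bracket Y Z)) X p))"

definition christoffel ::
    "nat \<Rightarrow> real \<Rightarrow> (vfield \<Rightarrow> vfield \<Rightarrow> vfield) \<Rightarrow> nat \<Rightarrow> nat \<Rightarrow> nat \<Rightarrow> heis \<Rightarrow> real" where
  "christoffel r d nabla i j k =
     g_metric r d (nabla (s_frame r d i) (s_frame r d j)) (s_frame r d k)"

type_synonym spinor_fun = "heis \<Rightarrow> complex^2"

text \<open>
  \<open>c 2\<close> and \<open>c 3\<close> are the actions of \<open>s2\<close> and \<open>s3\<close>. A complex module of this Clifford
  algebra of dimension 2 is automatically simple, and unique up to isomorphism.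
\<close>

definition clifford_module :: "(nat \<Rightarrow> complex^2^2) \<Rightarrow> bool" where
  "clifford_module c \<longleftrightarrow>
     (\<forall>a b :: real. (a *\<^sub>R c 2 + b *\<^sub>R c 3) ** (a *\<^sub>R c 2 + b *\<^sub>R c 3) = - ((a\<^sup>2 + b\<^sup>2) *\<^sub>R mat 1))"

definition equivariant :: "nat \<Rightarrow> (heis \<Rightarrow> int) \<Rightarrow> spinor_fun \<Rightarrow> bool" where
  "equivariant r eps \<phi> \<longleftrightarrow>
     (\<forall>\<gamma>\<in>lattice_pts. \<forall>y. \<phi> (heis_mult r \<gamma> y) = exp (\<i> * of_real pi * of_int (eps \<gamma>)) *s \<phi> y)"

definition cont_sections :: "nat \<Rightarrow> (heis \<Rightarrow> int) \<Rightarrow> spinor_fun set" where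
  "cont_sections r eps = {\<phi>. continuous_on UNIV \<phi> \<and> equivariant r eps \<phi>}"

definition smooth_sections :: "nat \<Rightarrow> (heis \<Rightarrow> int) \<Rightarrow> spinor_fun set" where
  "smooth_sections r eps = {\<phi>. smooth \<phi> \<and> equivariant r eps \<phi>}"

definition sub_dirac ::
    "nat \<Rightarrow> real \<Rightarrow> (vfield \<Rightarrow> vfield \<Rightarrow> vfield) \<Rightarrow> (nat \<Rightarrow> complex^2^2) \<Rightarrow> spinor_fun \<Rightarrow> spinor_fun"
  where
  "sub_dirac r d nabla c \<phi> p =
     (\<Sum>i\<in>{2, 3}. c i *v along (s_frame r d i) \<phi> p)
     + (1 / 4) *\<^sub>R (\<Sum>i\<in>{2, 3}. \<Sum>j\<in>{2, 3}. \<Sum>k\<in>{2, 3}.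
           christoffel r d nabla i j k p *\<^sub>R ((c i ** c j ** c k) *v \<phi> p))"

text \<open>
  The half-open unit cube meets every \<open>\<Gamma>\<close>-orbit in exactly one point, and Lebesgue measure
  is a Haar measure of \<open>G\<close>; so integrating a \<open>\<Gamma>\<close>-invariant function over the cube is
  integrating it over the quotient for the normalised invariant measure.
\<close>

definition unit_cube :: "heis set" where
  "unit_cube = ({0..<1} \<times> {0..<1}) \<times> {0..<1}"

definition sec_inner :: "spinor_fun \<Rightarrow> spinor_fun \<Rightarrow> complex" where
  "sec_inner \<phi> \<psi> = (LINT y:unit_cube|lborel. (\<Sum>j\<in>UNIV. \<phi> y $ j * cnj (\<psi> y $ j)))"

definition sec_dist :: "spinor_fun \<Rightarrow> spinor_fun \<Rightarrow> real" where
  "sec_dist \<phi> \<psi> = sqrt (LINT y:unit_cube|lborel. (norm (\<phi> y - \<psi> y))\<^sup>2)"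

text \<open>
  \<open>L2 r eps\<close> is the completion of the continuous sections, that is \<open>L\<^sup>2(G, \<epsilon>) \<otimes> \<complex>\<^sup>2\<close>:
  its elements are represented by Cauchy sequences, and two sequences at \<open>L2_dist\<close> zero
  represent the same element. Quotients are not formed; every notion below depends only on the
  elements represented.
\<close>

type_synonym l2_vec = "nat \<Rightarrow> spinor_fun"

definition L2 :: "nat \<Rightarrow> (heis \<Rightarrow> int) \<Rightarrow> l2_vec set" where
  "L2 r eps = {\<Phi>. (\<forall>n. \<Phi> n \<in> cont_sections r eps) \<and>
                  (\<forall>e>0. \<exists>N. \<forall>m\<ge>N. \<forall>n\<ge>N. sec_dist (\<Phi> m) (\<Phi> n) < e)}"

definition L2_inner :: "l2_vec \<Rightarrow> l2_vec \<Rightarrow> complex" where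
  "L2_inner \<Phi> \<Psi> = lim (\<lambda>n. sec_inner (\<Phi> n) (\<Psi> n))"

definition L2_dist :: "l2_vec \<Rightarrow> l2_vec \<Rightarrow> real" where
  "L2_dist \<Phi> \<Psi> = lim (\<lambda>n. sec_dist (\<Phi> n) (\<Psi> n))"

definition L2_embed :: "spinor_fun \<Rightarrow> l2_vec" where
  "L2_embed \<phi> = (\<lambda>n. \<phi>)"

definition L2_scale :: "real \<Rightarrow> l2_vec \<Rightarrow> l2_vec" where
  "L2_scale a \<Phi> = (\<lambda>n y. a *\<^sub>R \<Phi> n y)"

definition closure_graph ::
    "nat \<Rightarrow> (heis \<Rightarrow> int) \<Rightarrow> (spinor_fun \<Rightarrow> spinor_fun) \<Rightarrow> (l2_vec \<times> l2_vec) set" where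
  "closure_graph r eps T =
     {(\<Phi>, \<Psi>). \<Phi> \<in> L2 r eps \<and> \<Psi> \<in> L2 r eps \<and>
        (\<exists>f. (\<forall>k. f k \<in> smooth_sections r eps) \<and>
             (\<lambda>k. L2_dist (L2_embed (f k)) \<Phi>) \<longlonglongrightarrow> 0 \<and>
             (\<lambda>k. L2_dist (L2_embed (T (f k))) \<Psi>) \<longlonglongrightarrow> 0)}"

definition eigenspace ::
    "nat \<Rightarrow> (heis \<Rightarrow> int) \<Rightarrow> (spinor_fun \<Rightarrow> spinor_fun) \<Rightarrow> real \<Rightarrow> l2_vec set" where
  "eigenspace r eps T \<mu> = {\<Phi>. (\<Phi>, L2_scale \<mu> \<Phi>) \<in> closure_graph r eps T}"

text \<open>
  Orthonormal bases of a closed subspace \<open>K\<close>, indexed by the naturals below \<open>n\<close>; for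
  \<open>n = \<infinity>\<close> the index set is all of \<open>\<nat>\<close>, so that \<open>\<infinity>\<close> is the cardinal of \<open>\<nat>\<close>.
\<close>

definition orthonormal_basis :: "l2_vec set \<Rightarrow> enat \<Rightarrow> (nat \<Rightarrow> l2_vec) \<Rightarrow> bool" where
  "orthonormal_basis K n E \<longleftrightarrow>
     (\<forall>i. enat i < n \<longrightarrow> E i \<in> K) \<and>
     (\<forall>i j. enat i < n \<longrightarrow> enat j < n \<longrightarrow> L2_inner (E i) (E j) = (if i = j then 1 else 0)) \<and>
     (\<forall>\<Phi>\<in>K. (\<forall>i. enat i < n \<longrightarrow> L2_inner \<Phi> (E i) = 0) \<longrightarrow> L2_inner \<Phi> \<Phi> = 0)"

definition hilbert_dim :: "l2_vec set \<Rightarrow> enat" where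
  "hilbert_dim K = (THE n. \<exists>E. orthonormal_basis K n E)"

definition spectral_mult ::
    "nat \<Rightarrow> (heis \<Rightarrow> int) \<Rightarrow> (spinor_fun \<Rightarrow> spinor_fun) \<Rightarrow> real \<Rightarrow> enat" where
  "spectral_mult r eps T \<mu> = hilbert_dim (eigenspace r eps T \<mu>)"

definition delta :: "real \<Rightarrow> real \<Rightarrow> enat" where
  "delta \<mu> x = (if x = \<mu> then 1 else 0)"

text \<open>The functions \<open>m\<^sub>1\<^sup>\<plusminus>\<close> and \<open>m\<^sub>2\<^sup>\<plusminus>\<close>; the argument \<open>\<sigma>\<close> is the sign 1 or -1.\<close>

definition m1 :: "real \<Rightarrow> nat \<Rightarrow> real \<Rightarrow> (heis \<Rightarrow> int) \<Rightarrow> real \<Rightarrow> enat" where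
  "m1 \<sigma> r d eps x =
     (\<Sum>\<^sub>\<infinity>k\<in>(UNIV :: int set). \<Sum>\<^sub>\<infinity>l\<in>(UNIV :: int set).
        delta (\<sigma> * (pi * d / real r *
          sqrt ((2 * of_int k + of_int (eps ((0, 0), 1)))\<^sup>2
                + (real r)\<^sup>2 * (2 * of_int l + of_int (eps ((0, 1), 0)))\<^sup>2))) x)"

definition m2 :: "real \<Rightarrow> nat \<Rightarrow> real \<Rightarrow> real \<Rightarrow> enat" where
  "m2 \<sigma> r d x =
     (\<Sum>\<^sub>\<infinity>l\<in>{1 :: nat..}. of_nat (2 * r * l) *
        (\<Sum>\<^sub>\<infinity>k\<in>{1 :: nat..}. delta (\<sigma> * sqrt (4 * pi * d\<^sup>2 * real k * real l)) x))"

end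

theory Submission
  imports Defs "HOL-Computational_Algebra.Polynomial"
begin

text \<open>
  In suitable bases of \<open>\<complex>\<^sup>2\<close> the operator becomes the pair of scalar equations
  \<open>- Z f\<^sub>- = \<mu> f\<^sub>+\<close>, \<open>Z\<^sup>\<dagger> f\<^sub>+ = \<mu> f\<^sub>-\<close> with \<open>Z = s\<^sub>2 + \<i> \<sigma> s\<^sub>3\<close> and
  \<open>Z\<^sup>\<dagger> = s\<^sub>2 - \<i> \<sigma> s\<^sub>3\<close>; the Clifford action need not be unitary, so only the scalar
  components are compared. Where the central frequency \<open>N\<close> is nonzero, the sections are theta series
  over the functions \<open>q(\<tau>) exp (- \<kappa> \<tau>\<^sup>2 / 2)\<close>, \<open>q\<close> a polynomial, on which \<open>Z\<close> and
  \<open>Z\<^sup>\<dagger>\<close> are the ladder operators of a harmonic oscillator; where it vanishes, they are exponentials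
  on a torus. Testing an element \<open>\<Phi>\<close> of the eigenspace of the closure against this family and
  integrating by parts gives a recurrence which kills all coefficients of \<open>\<Phi>\<close> but the expected ones.
  As the family is complete, no regularity theory is needed, and the eigenspace has an explicit orthonormal
  basis indexed by frequencies.

  Completeness: by Stone and Weierstrass and cutoffs, continuous functions on the cube are approximated by
  sums of products \<open>exp (\<i> \<pi> N x\<^sub>1) exp (\<i> \<pi> M x\<^sub>2) c(s)\<close> with \<open>c\<close> supported in
  \<open>[0, 1]\<close>, and such a product is the theta series of \<open>c\<close>. Finally \<open>c\<close> is approximated by
  a trigonometric polynomial of large period times the Gaussian, and that by polynomials times the Gaussian.
\<close>

subsection \<open>Semi-inner product spaces and Hilbert dimension\<close>

text \<open>The constants of the formula come from parity. Equivariance under the centre forces the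
  central frequency \<open>N\<close> to have the parity of \<open>eps ((1, 0), 0)\<close>, so
  \<open>N = 0\<close>, and with it the torus spectrum \<open>m1\<close>, occurs only if that value
  is 0. For \<open>N \<noteq> 0\<close> the frequency \<open>M\<close> in the second coordinate has
  a fixed parity as well and matters only modulo \<open>r * \<bar>N\<bar>\<close>. This leaves
  \<open>r * \<bar>N\<bar> / 2\<close> oscillators; \<open>N\<close> and \<open>- N\<close> together
  give \<open>r * \<bar>N\<bar>\<close>, that is \<open>2 * r * l\<close> or
  \<open>(2 * l + 1) * r\<close>. Each oscillator has the simple eigenvalues
  \<open>\<plusminus> sqrt (2 * pi * d^2 * \<bar>N\<bar> * k)\<close> with \<open>k \<ge> 1\<close>
  and one ground state at 0. As all admissible \<open>N\<close> contribute a ground state, the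
  kernel has infinite dimension.

  Elements of the completion are Cauchy sequences, not classes, so a vector of norm 0 need not be 0.
  The spaces below therefore know their vectors only through inner products and assume no laws of
  addition.\<close>

locale semi_inner =
  fixes V :: "'a set" and add :: "'a \<Rightarrow> 'a \<Rightarrow> 'a" and scl :: "complex \<Rightarrow> 'a \<Rightarrow> 'a"
    and ip :: "'a \<Rightarrow> 'a \<Rightarrow> complex"
  assumes add_in: "x \<in> V \<Longrightarrow> y \<in> V \<Longrightarrow> add x y \<in> V"
    and scl_in: "x \<in> V \<Longrightarrow> scl a x \<in> V"
    and ip_add: "x \<in> V \<Longrightarrow> y \<in> V \<Longrightarrow> z \<in> V \<Longrightarrow> ip (add x y) z = ip x z + ip y z"
    and ip_scl: "x \<in> V \<Longrightarrow> z \<in> V \<Longrightarrow> ip (scl a x) z = a * ip x z"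
    and ip_herm: "x \<in> V \<Longrightarrow> y \<in> V \<Longrightarrow> ip y x = cnj (ip x y)"
    and ip_nonneg: "x \<in> V \<Longrightarrow> Re (ip x x) \<ge> 0"
begin

lemma ip_add_right: "x \<in> V \<Longrightarrow> y \<in> V \<Longrightarrow> z \<in> V \<Longrightarrow> ip z (add x y) = ip z x + ip z y"
  by (metis add_in complex_cnj_add ip_add ip_herm)

lemma ip_scl_right: "x \<in> V \<Longrightarrow> z \<in> V \<Longrightarrow> ip z (scl a x) = cnj a * ip z x"
  by (metis scl_in complex_cnj_mult ip_scl ip_herm)

lemma ip_self_real: "x \<in> V \<Longrightarrow> ip x x = of_real (Re (ip x x))"
  using ip_herm[of x x] by (simp add: complex_eq_iff)

definition nrm :: "'a \<Rightarrow> real" where "nrm x = sqrt (Re (ip x x))"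

lemma nrm_nonneg: "x \<in> V \<Longrightarrow> nrm x \<ge> 0"
  using ip_nonneg by (simp add: nrm_def)

lemma nrm_sq: "x \<in> V \<Longrightarrow> (nrm x)\<^sup>2 = Re (ip x x)"
  using ip_nonneg by (simp add: nrm_def)

text \<open>Replaces equality of vectors: a rearranged sum is recognised by its inner products with
  all of \<open>V\<close>.\<close>

lemma nrm_cong:
  assumes "u \<in> V" "v \<in> V" "\<And>z. z \<in> V \<Longrightarrow> ip u z = ip v z"
  shows "nrm u = nrm v"
  using assms by (metis nrm_def ip_herm)

lemma Cauchy_Schwarz:
  assumes x: "x \<in> V" and y: "y \<in> V"
  shows "cmod (ip x y) \<le> nrm x * nrm y"
proof -
  define X Y A where "X = Re (ip x x)" and "Y = Re (ip y y)" and "A = (cmod (ip x y))\<^sup>2"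
  have XY: "X \<ge> 0" "Y \<ge> 0" using ip_nonneg x y by (auto simp: X_def Y_def)
  \<comment> \<open>The squared norm of \<open>x - t <x, y> y\<close>. Putting \<open><x, y>\<close>
    itself into the coefficient removes the phase, so that a real quadratic in \<open>t\<close>
    remains.\<close>
  have ineq: "0 \<le> X - 2 * t * A + t\<^sup>2 * A * Y" for t
  proof -
    let ?c = "- (of_real t * ip x y)"
    let ?z = "add x (scl ?c y)"
    have zV: "scl ?c y \<in> V" "?z \<in> V" using x y add_in scl_in by auto
    have "ip ?z ?z = ip x x + cnj ?c * ip x y + ?c * ip y x + ?c * cnj ?c * ip y y"
      using x y zV by (simp add: ip_add ip_add_right ip_scl ip_scl_right algebra_simps)
    also have "\<dots> = of_real (X - 2 * t * A + t\<^sup>2 * A * Y)"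
      using ip_self_real[OF x] ip_self_real[OF y] ip_herm[OF x y]
      unfolding X_def Y_def A_def complex_norm_square of_real_add of_real_diff of_real_mult
      by (simp add: complex_norm_square power2_eq_square algebra_simps)
    finally show ?thesis using ip_nonneg[OF zV(2)] by simp
  qed
  have "A \<le> X * Y"
  proof (cases "Y = 0")
    case True
    have "A = 0"
    proof (rule ccontr)
      assume "A \<noteq> 0"
      then have "A > 0" by (simp add: A_def)
      \<comment> \<open>With \<open>Y = 0\<close> the inequality is affine in \<open>t\<close>; at
        this \<open>t\<close> its right-hand side is -1.\<close>
      then show False using ineq[of "(X+1)/(2*A)"] True by (simp add: field_simps)
    qed
    then show ?thesis using XY by simp
  next
    case False
    then have "Y > 0" using XY by simp
    then show ?thesis using ineq[of "1/Y"] by (simp add: field_simps power2_eq_square)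
  qed
  then have "sqrt A \<le> sqrt (X * Y)" by simp
  then show ?thesis by (simp add: A_def X_def Y_def nrm_def real_sqrt_mult)
qed

lemma nrm_add:
  assumes x: "x \<in> V" and y: "y \<in> V"
  shows "nrm (add x y) \<le> nrm x + nrm y"
proof -
  have "(nrm (add x y))\<^sup>2 = Re (ip x x) + Re (ip x y) + Re (ip y x) + Re (ip y y)"
    using x y add_in by (simp add: nrm_sq ip_add ip_add_right)
  also have "\<dots> = (nrm x)\<^sup>2 + 2 * Re (ip x y) + (nrm y)\<^sup>2"
    using x y ip_herm[OF x y] by (simp add: nrm_sq)
  also have "Re (ip x y) \<le> nrm x * nrm y"
    using Cauchy_Schwarz[OF x y] complex_Re_le_cmod[of "ip x y"] by linarith
  finally have "(nrm (add x y))\<^sup>2 \<le> (nrm x + nrm y)\<^sup>2" by (simp add: power2_sum)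
  then show ?thesis using nrm_nonneg x y by (meson add_nonneg_nonneg power2_le_imp_le)
qed

lemma nrm_scl:
  assumes x: "x \<in> V" shows "nrm (scl a x) = cmod a * nrm x"
proof -
  have "ip (scl a x) (scl a x) = of_real ((cmod a)\<^sup>2) * of_real (Re (ip x x))"
    using x ip_self_real[OF x] unfolding complex_norm_square by (simp add: ip_scl ip_scl_right scl_in)
  then have "Re (ip (scl a x) (scl a x)) = (cmod a)\<^sup>2 * Re (ip x x)"
    by (simp del: of_real_power)
  then show ?thesis by (simp add: nrm_def real_sqrt_mult)
qed

definition dst :: "'a \<Rightarrow> 'a \<Rightarrow> real" where "dst x y = nrm (add x (scl (-1) y))"

lemma dst_nonneg: "x \<in> V \<Longrightarrow> y \<in> V \<Longrightarrow> dst x y \<ge> 0"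
  by (simp add: dst_def nrm_nonneg add_in scl_in)

lemma nrm_le_dst:
  assumes "x \<in> V" "y \<in> V" shows "nrm x \<le> nrm y + dst x y"
proof -
  have "nrm x = nrm (add y (add x (scl (-1) y)))"
    by (rule nrm_cong) (use assms in \<open>simp_all add: add_in scl_in ip_add ip_scl\<close>)
  then show ?thesis using nrm_add[of y "add x (scl (-1) y)"] assms
    by (simp add: dst_def add_in scl_in)
qed

lemma dst_add:
  assumes "x \<in> V" "y \<in> V" "x' \<in> V" "y' \<in> V"
  shows "dst (add x y) (add x' y') \<le> dst x x' + dst y y'"
proof -
  have "dst (add x y) (add x' y') = nrm (add (add x (scl (-1) x')) (add y (scl (-1) y')))"
    unfolding dst_def
    by (rule nrm_cong) (use assms in \<open>simp_all add: add_in scl_in ip_add ip_scl ring_distribs\<close>)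
  then show ?thesis using nrm_add assms by (simp add: add_in scl_in dst_def)
qed

lemma dst_scl:
  assumes "x \<in> V" "y \<in> V"
  shows "dst (scl a x) (scl a y) = cmod a * dst x y"
proof -
  have "dst (scl a x) (scl a y) = nrm (scl a (add x (scl (-1) y)))"
    unfolding dst_def
    by (rule nrm_cong) (use assms in \<open>simp_all add: add_in scl_in ip_add ip_scl algebra_simps\<close>)
  then show ?thesis using assms by (simp add: nrm_scl add_in scl_in dst_def)
qed

lemma ip_diff_le:
  assumes "x \<in> V" "y \<in> V" "x' \<in> V" "y' \<in> V"
  shows "cmod (ip x y - ip x' y') \<le> dst x x' * nrm y + nrm x' * dst y y'"
proof -
  have "ip x y - ip x' y' = ip (add x (scl (-1) x')) y + ip x' (add y (scl (-1) y'))"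
    using assms by (simp add: add_in scl_in ip_add ip_scl ip_add_right ip_scl_right)
  also have "cmod \<dots> \<le> dst x x' * nrm y + nrm x' * dst y y'" unfolding dst_def
    by (intro order_trans[OF norm_triangle_ineq] add_mono Cauchy_Schwarz)
       (use assms in \<open>auto intro: add_in scl_in\<close>)
  finally show ?thesis .
qed

section \<open>Completion by Cauchy sequences\<close>

definition Cseq :: "(nat \<Rightarrow> 'a) set" where
  "Cseq = {x. (\<forall>n. x n \<in> V) \<and> (\<forall>e>0. \<exists>N. \<forall>m\<ge>N. \<forall>n\<ge>N. dst (x m) (x n) < e)}"

definition lip :: "(nat \<Rightarrow> 'a) \<Rightarrow> (nat \<Rightarrow> 'a) \<Rightarrow> complex" where
  "lip x y = lim (\<lambda>n. ip (x n) (y n))"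

lemma CseqD: "x \<in> Cseq \<Longrightarrow> e > 0 \<Longrightarrow> \<exists>N. \<forall>m\<ge>N. \<forall>n\<ge>N. dst (x m) (x n) < e"
  by (simp add: Cseq_def)

lemma Cseq_bounded:
  assumes "x \<in> Cseq" shows "\<exists>B>0. \<forall>n. nrm (x n) \<le> B"
proof -
  have V: "x n \<in> V" for n using assms by (simp add: Cseq_def)
  obtain N where N: "\<And>m n. m \<ge> N \<Longrightarrow> n \<ge> N \<Longrightarrow> dst (x m) (x n) < 1"
    using CseqD[OF assms, of 1] by auto
  define B where "B = 1 + (\<Sum>i\<le>N. nrm (x i))"
  have le: "nrm (x i) \<le> (\<Sum>i\<le>N. nrm (x i))" if "i \<le> N" for i
    by (rule member_le_sum) (use that V nrm_nonneg in auto)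
  have "nrm (x n) \<le> B" for n
  proof (cases "n \<le> N")
    case True then show ?thesis using le by (simp add: B_def add_increasing)
  next
    case False
    then show ?thesis using nrm_le_dst[OF V V, of n N] N[of n N] le[of N] by (simp add: B_def)
  qed
  moreover have "B > 0" using le[of 0] nrm_nonneg[OF V, of 0] by (simp add: B_def)
  ultimately show ?thesis by blast
qed

lemma lip_conv:
  assumes x: "x \<in> Cseq" and y: "y \<in> Cseq"
  shows "(\<lambda>n. ip (x n) (y n)) \<longlonglongrightarrow> lip x y"
proof -
  have V: "x n \<in> V" "y n \<in> V" for n using assms by (auto simp: Cseq_def)
  obtain B C where B: "B > 0" "\<And>n. nrm (x n) \<le> B" and C: "C > 0" "\<And>n. nrm (y n) \<le> C"
    using Cseq_bounded x y by metis
  have "Cauchy (\<lambda>n. ip (x n) (y n))"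
  proof (rule CauchyI)
    fix e :: real assume e: "e > 0"
    obtain N where N: "\<And>m n. m \<ge> N \<Longrightarrow> n \<ge> N \<Longrightarrow> dst (x m) (x n) < e / (2 * C)"
      using CseqD[OF x, of "e / (2 * C)"] e C(1) by auto
    obtain M where M: "\<And>m n. m \<ge> M \<Longrightarrow> n \<ge> M \<Longrightarrow> dst (y m) (y n) < e / (2 * B)"
      using CseqD[OF y, of "e / (2 * B)"] e B(1) by auto
    show "\<exists>M. \<forall>m\<ge>M. \<forall>n\<ge>M. norm (ip (x m) (y m) - ip (x n) (y n)) < e"
    proof (intro exI allI impI)
      fix m n assume mn: "m \<ge> max M N" "n \<ge> max M N"
      have "norm (ip (x m) (y m) - ip (x n) (y n)) \<le> dst (x m) (x n) * nrm (y m) + nrm (x n) * dst (y m) (y n)"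
        by (rule ip_diff_le) (use V in auto)
      also have "\<dots> \<le> dst (x m) (x n) * C + B * dst (y m) (y n)"
        by (intro add_mono mult_left_mono mult_right_mono) (use B C V dst_nonneg in auto)
      also have "\<dots> < (e / (2 * C)) * C + B * (e / (2 * B))"
        by (intro add_strict_mono mult_strict_right_mono mult_strict_left_mono) (use mn N M B C in auto)
      also have "\<dots> = e" using B C by (simp add: field_simps)
      finally show "norm (ip (x m) (y m) - ip (x n) (y n)) < e" .
    qed
  qed
  then show ?thesis unfolding lip_def
    by (simp add: convergent_LIMSEQ_iff[symmetric] Cauchy_convergent)
qed

lemma dst_self:
  assumes x: "x \<in> V" shows "dst x x = 0"
proof -
  have "(dst x x)\<^sup>2 = 0" unfolding dst_def
    using x by (simp add: nrm_sq add_in scl_in ip_add ip_scl ip_add_right ip_scl_right)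
  then show ?thesis by simp
qed

lemma const_Cseq: "x \<in> V \<Longrightarrow> (\<lambda>n. x) \<in> Cseq"
  by (simp add: Cseq_def dst_self)

text \<open>The completion is again a space of the same kind, so every lemma of the locale serves
  twice: for sections and for elements of L^2.\<close>

lemma completion: "semi_inner Cseq (\<lambda>x y n. add (x n) (y n)) (\<lambda>a x n. scl a (x n)) lip"
proof
  fix x y z :: "nat \<Rightarrow> 'a" and a :: complex
  have add_C: "(\<lambda>n. add (x n) (y n)) \<in> Cseq" if x: "x \<in> Cseq" and y: "y \<in> Cseq" for x y
  proof -
    have V: "x n \<in> V" "y n \<in> V" for n using x y by (auto simp: Cseq_def)
    show ?thesis unfolding Cseq_def
    proof (intro CollectI conjI allI impI)
      fix e :: real assume "e > 0"
      then obtain N M where NM: "\<And>m n. m \<ge> N \<Longrightarrow> n \<ge> N \<Longrightarrow> dst (x m) (x n) < e/2"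
        "\<And>m n. m \<ge> M \<Longrightarrow> n \<ge> M \<Longrightarrow> dst (y m) (y n) < e/2"
        using CseqD[OF x, of "e/2"] CseqD[OF y, of "e/2"] by (metis half_gt_zero)
      have "dst (add (x m) (y m)) (add (x n) (y n)) < e" if "m \<ge> max N M" "n \<ge> max N M" for m n
        using dst_add[OF V(1) V(2) V(1) V(2), of m m n n] NM[of m n] that by fastforce
      then show "\<exists>N. \<forall>m\<ge>N. \<forall>n\<ge>N. dst (add (x m) (y m)) (add (x n) (y n)) < e" by blast
    qed (use V add_in in auto)
  qed
  have scl_C: "(\<lambda>n. scl a (x n)) \<in> Cseq" if x: "x \<in> Cseq" for x a
  proof -
    have V: "x n \<in> V" for n using x by (auto simp: Cseq_def)
    show ?thesis unfolding Cseq_def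
    proof (intro CollectI conjI allI impI)
      fix e :: real assume "e > 0"
      \<comment> \<open>The summand 1 covers \<open>a = 0\<close>.\<close>
      then have "e / (cmod a + 1) > 0" by (simp add: add_nonneg_pos)
      then obtain N where N: "\<forall>m\<ge>N. \<forall>n\<ge>N. dst (x m) (x n) < e / (cmod a + 1)"
        using CseqD[OF x] by blast
      have "dst (scl a (x m)) (scl a (x n)) < e" if "m \<ge> N" "n \<ge> N" for m n
      proof -
        have "dst (scl a (x m)) (scl a (x n)) \<le> (cmod a + 1) * dst (x m) (x n)"
          using V dst_nonneg by (simp add: dst_scl ring_distribs)
        also have "\<dots> < (cmod a + 1) * (e / (cmod a + 1))"
          by (rule mult_strict_left_mono) (use N that in \<open>auto simp: add_nonneg_pos\<close>)
        also have "\<dots> = e" by (simp add: add_nonneg_eq_0_iff)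
        finally show ?thesis .
      qed
      then show "\<exists>N. \<forall>m\<ge>N. \<forall>n\<ge>N. dst (scl a (x m)) (scl a (x n)) < e" by blast
    qed (use V scl_in in auto)
  qed
  show "x \<in> Cseq \<Longrightarrow> y \<in> Cseq \<Longrightarrow> (\<lambda>n. add (x n) (y n)) \<in> Cseq" by (rule add_C)
  show "x \<in> Cseq \<Longrightarrow> (\<lambda>n. scl a (x n)) \<in> Cseq" by (rule scl_C)
  show "lip (\<lambda>n. add (x n) (y n)) z = lip x z + lip y z" if "x \<in> Cseq" "y \<in> Cseq" "z \<in> Cseq"
  proof (rule LIMSEQ_unique)
    show "(\<lambda>n. ip (add (x n) (y n)) (z n)) \<longlonglongrightarrow> lip (\<lambda>n. add (x n) (y n)) z"
      by (rule lip_conv) (use that add_C in auto)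
    have "ip (add (x n) (y n)) (z n) = ip (x n) (z n) + ip (y n) (z n)" for n
      using that by (simp add: Cseq_def ip_add)
    then show "(\<lambda>n. ip (add (x n) (y n)) (z n)) \<longlonglongrightarrow> lip x z + lip y z"
      using tendsto_add[OF lip_conv lip_conv] that by auto
  qed
  show "lip (\<lambda>n. scl a (x n)) z = a * lip x z" if "x \<in> Cseq" "z \<in> Cseq"
  proof (rule LIMSEQ_unique)
    show "(\<lambda>n. ip (scl a (x n)) (z n)) \<longlonglongrightarrow> lip (\<lambda>n. scl a (x n)) z"
      by (rule lip_conv) (use that scl_C in auto)
    have "ip (scl a (x n)) (z n) = a * ip (x n) (z n)" for n
      using that by (simp add: Cseq_def ip_scl)
    then show "(\<lambda>n. ip (scl a (x n)) (z n)) \<longlonglongrightarrow> a * lip x z"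
      using tendsto_mult_left[OF lip_conv] that by auto
  qed
  show "lip y x = cnj (lip x y)" if "x \<in> Cseq" "y \<in> Cseq"
  proof (rule LIMSEQ_unique)
    show "(\<lambda>n. ip (y n) (x n)) \<longlonglongrightarrow> lip y x"
      by (rule lip_conv) (use that in auto)
    have "ip (y n) (x n) = cnj (ip (x n) (y n))" for n
      using that ip_herm[of "x n" "y n"] by (simp add: Cseq_def)
    then show "(\<lambda>n. ip (y n) (x n)) \<longlonglongrightarrow> cnj (lip x y)"
      using tendsto_cnj[OF lip_conv] that by auto
  qed
  show "0 \<le> Re (lip x x)" if "x \<in> Cseq"
    by (rule LIMSEQ_le_const[OF tendsto_Re[OF lip_conv[OF that that]]])
       (use that ip_nonneg in \<open>auto simp: Cseq_def\<close>)
qed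

lemma dst_conv:
  assumes x: "x \<in> Cseq" and y: "y \<in> Cseq"
  shows "(\<lambda>n. dst (x n) (y n)) \<longlonglongrightarrow>
    semi_inner.dst (\<lambda>x y n. add (x n) (y n)) (\<lambda>a x n. scl a (x n)) lip x y"
proof -
  interpret L: semi_inner Cseq "\<lambda>x y n. add (x n) (y n)" "\<lambda>a x n. scl a (x n)" lip
    by (rule completion)
  have *: "(\<lambda>n. add (x n) (scl (-1) (y n))) \<in> Cseq" using L.add_in L.scl_in x y by blast
  show ?thesis unfolding L.dst_def L.nrm_def dst_def nrm_def
    by (intro tendsto_real_sqrt tendsto_Re lip_conv[OF * *])
qed

section \<open>Orthonormal bases and their length\<close>

definition onb :: "'a set \<Rightarrow> enat \<Rightarrow> (nat \<Rightarrow> 'a) \<Rightarrow> bool" where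
  "onb K n E \<longleftrightarrow> (\<forall>i. enat i < n \<longrightarrow> E i \<in> K) \<and>
     (\<forall>i j. enat i < n \<longrightarrow> enat j < n \<longrightarrow> ip (E i) (E j) = (if i = j then 1 else 0)) \<and>
     (\<forall>x\<in>K. (\<forall>i. enat i < n \<longrightarrow> ip x (E i) = 0) \<longrightarrow> ip x x = 0)"

definition subsp :: "'a set \<Rightarrow> bool" where
  "subsp K \<longleftrightarrow> K \<subseteq> V \<and> (\<forall>x\<in>K. \<forall>y\<in>K. add x y \<in> K) \<and> (\<forall>x\<in>K. \<forall>a. scl a x \<in> K)"

text \<open>The vector \<open>y\<close> is \<open>x\<close> minus its components along the
  \<open>E i\<close>, built one vector at a time and described by its inner products alone.\<close>

lemma projection:
  fixes m :: nat
  assumes K: "subsp K" and E: "\<And>i. i < m \<Longrightarrow> E i \<in> K" and x: "x \<in> K"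
  shows "\<exists>y\<in>K. \<forall>z\<in>V. ip y z = ip x z - (\<Sum>i<m. ip x (E i) * ip (E i) z)"
  using E
proof (induction m)
  case 0 then show ?case using x by (intro bexI[of _ x]) auto
next
  case (Suc m)
  then obtain y where y: "y \<in> K" "\<forall>z\<in>V. ip y z = ip x z - (\<Sum>i<m. ip x (E i) * ip (E i) z)" by auto
  have Em: "E m \<in> K" using Suc by auto
  let ?w = "add y (scl (- ip x (E m)) (E m))"
  have "?w \<in> K" using K y Em unfolding subsp_def by blast
  moreover have "ip ?w z = ip x z - (\<Sum>i<Suc m. ip x (E i) * ip (E i) z)" if "z \<in> V" for z
  proof -
    have "y \<in> V" "E m \<in> V" using K y Em unfolding subsp_def by auto
    then show ?thesis using that y by (simp add: ip_add ip_scl scl_in)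
  qed
  ultimately show ?case by blast
qed

text \<open>The remainder \<open>y\<close> of the projection is orthogonal to all
  \<open>E i\<close>, so \<open><y, y>\<close> equals the defect in Bessel's inequality. It is
  nonnegative, and it vanishes when the \<open>E i\<close> are total in \<open>K\<close>.\<close>

lemma Bessel_Parseval:
  fixes m :: nat
  assumes K: "subsp K" and E: "\<And>i. i < m \<Longrightarrow> E i \<in> K" and x: "x \<in> K"
    and on: "\<And>i j. i < m \<Longrightarrow> j < m \<Longrightarrow> ip (E i) (E j) = (if i = j then 1 else 0)"
  shows "(\<Sum>i<m. (cmod (ip x (E i)))\<^sup>2) \<le> Re (ip x x)"
    and "(\<And>y. y \<in> K \<Longrightarrow> (\<forall>i<m. ip y (E i) = 0) \<Longrightarrow> ip y y = 0) \<Longrightarrow>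
      (\<Sum>i<m. (cmod (ip x (E i)))\<^sup>2) = Re (ip x x)"
proof -
  obtain y where yK: "y \<in> K" and y: "\<And>z. z\<in>V \<Longrightarrow> ip y z = ip x z - (\<Sum>i<m. ip x (E i) * ip (E i) z)"
    using projection[OF K _ x, of m E] E by metis
  have V: "y \<in> V" "x \<in> V" "\<And>i. i < m \<Longrightarrow> E i \<in> V" using K E x yK unfolding subsp_def by auto
  have 0: "ip y (E j) = 0" if "j < m" for j
  proof -
    have "(\<Sum>i<m. ip x (E i) * ip (E i) (E j)) = (\<Sum>i<m. if i = j then ip x (E i) else 0)"
      by (rule sum.cong) (use on that in auto)
    then show ?thesis using y[OF V(3)[OF that]] that by simp
  qed
  have "ip y y = ip x y - (\<Sum>i<m. ip x (E i) * ip (E i) y)" using y V by blast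
  also have "(\<Sum>i<m. ip x (E i) * ip (E i) y) = 0"
    by (rule sum.neutral) (use 0 V ip_herm in \<open>metis complex_cnj_zero lessThan_iff mult_zero_right\<close>)
  finally have "ip y y = cnj (ip y x)" using ip_herm[OF V(1) V(2)] by simp
  also have "ip y x = of_real (Re (ip x x) - (\<Sum>i<m. (cmod (ip x (E i)))\<^sup>2))"
  proof -
    have "ip x (E i) * ip (E i) x = of_real ((cmod (ip x (E i)))\<^sup>2)" if "i < m" for i
      using ip_herm[OF V(2) V(3)[OF that]] by (simp add: complex_norm_square del: of_real_power)
    then show ?thesis using y[OF V(2)] ip_self_real[OF V(2)] by simp
  qed
  finally have *: "ip y y = of_real (Re (ip x x) - (\<Sum>i<m. (cmod (ip x (E i)))\<^sup>2))" by simp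
  then show "(\<Sum>i<m. (cmod (ip x (E i)))\<^sup>2) \<le> Re (ip x x)" using ip_nonneg[OF V(1)] by simp
  show "(\<Sum>i<m. (cmod (ip x (E i)))\<^sup>2) = Re (ip x x)"
    if "(\<And>y. y \<in> K \<Longrightarrow> (\<forall>i<m. ip y (E i) = 0) \<Longrightarrow> ip y y = 0)"
  proof -
    have "ip y y = 0" using that[OF yK] 0 by blast
    with * have "Re (ip x x) - (\<Sum>i<m. (cmod (ip x (E i)))\<^sup>2) = 0" by (metis of_real_eq_0_iff)
    then show ?thesis by simp
  qed
qed

text \<open>Counting \<open>\<bar>\<langle>F\<^sub>i, E\<^sub>j\<rangle>\<bar>\<^sup>2\<close> in both orders, by Parseval for \<open>E\<close> and by Bessel for \<open>F\<close>.\<close>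

lemma onb_le:
  assumes K: "subsp K" and E: "onb K n E" and F: "onb K m F"
  shows "m \<le> n"
proof (rule ccontr)
  assume "\<not> m \<le> n"
  then have "n < m" by simp
  \<comment> \<open>A length below another one is finite, so \<open>p + 1\<close> vectors of
    \<open>F\<close> against the \<open>p\<close> vectors of \<open>E\<close> suffice and all sums
    are finite.\<close>
  then obtain p where p: "n = enat p" by (cases n) auto
  with \<open>n < m\<close> have lt: "enat i < m" if "i < Suc p" for i
    using that by (cases m) auto
  have EV: "i < p \<Longrightarrow> E i \<in> K" and FV: "i < Suc p \<Longrightarrow> F i \<in> K" for i
    using E F lt p by (auto simp: onb_def)
  have Eo: "ip (E i) (E j) = (if i = j then 1 else 0)" if "i < p" "j < p" for i j
    using E that p by (auto simp: onb_def)
  have Fo: "ip (F i) (F j) = (if i = j then 1 else 0)" if "i < Suc p" "j < Suc p" for i j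
    using F lt that by (auto simp: onb_def)
  have "real (Suc p) = (\<Sum>i<Suc p. Re (ip (F i) (F i)))" using Fo by simp
  also have "\<dots> = (\<Sum>i<Suc p. \<Sum>j<p. (cmod (ip (F i) (E j)))\<^sup>2)"
  proof (rule sum.cong)
    fix i assume "i \<in> {..<Suc p}"
    then show "Re (ip (F i) (F i)) = (\<Sum>j<p. (cmod (ip (F i) (E j)))\<^sup>2)"
      using Bessel_Parseval(2)[OF K, of p E "F i"] EV FV Eo E p by (simp add: onb_def)
  qed simp
  also have "\<dots> = (\<Sum>j<p. \<Sum>i<Suc p. (cmod (ip (F i) (E j)))\<^sup>2)" by (rule sum.swap)
  also have "\<dots> = (\<Sum>j<p. \<Sum>i<Suc p. (cmod (ip (E j) (F i)))\<^sup>2)"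
  proof (intro sum.cong refl)
    fix i j assume "j \<in> {..<p}" "i \<in> {..<Suc p}"
    then have "E j \<in> V" "F i \<in> V" using EV FV K by (auto simp: subsp_def)
    from ip_herm[OF this] show "(cmod (ip (F i) (E j)))\<^sup>2 = (cmod (ip (E j) (F i)))\<^sup>2" by simp
  qed
  also have "\<dots> \<le> (\<Sum>j<p. Re (ip (E j) (E j)))"
    by (intro sum_mono Bessel_Parseval(1)[OF K]) (use EV FV Fo in auto)
  also have "\<dots> = real p" using Eo by simp
  finally show False by simp
qed

text \<open>The eigenbases will be indexed by frequencies, a countable set without preferred
  enumeration; only its cardinality enters the dimension.\<close>

lemma onb_from_countable:
  assumes J: "countable J" and E: "\<And>i. i \<in> J \<Longrightarrow> E i \<in> K"
    and on: "\<And>i j. i \<in> J \<Longrightarrow> j \<in> J \<Longrightarrow> ip (E i) (E j) = (if i = j then 1 else 0)"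
    and tot: "\<And>x. x \<in> K \<Longrightarrow> (\<And>i. i \<in> J \<Longrightarrow> ip x (E i) = 0) \<Longrightarrow> ip x x = 0"
  shows "\<exists>F. onb K (if finite J then enat (card J) else \<infinity>) F"
proof -
  define n where "n = (if finite J then enat (card J) else \<infinity>)"
  obtain h where h: "bij_betw h {i. enat i < n} J"
  proof (cases "finite J")
    case True
    then obtain h where "bij_betw h {0..<card J} J" using ex_bij_betw_nat_finite by blast
    moreover have "{i. enat i < n} = {0..<card J}" using True by (auto simp: n_def)
    ultimately show ?thesis using that by metis
  next
    case False
    then have "bij_betw (from_nat_into J) UNIV J" using J by (simp add: bij_betw_from_nat_into)
    moreover have "{i. enat i < n} = UNIV" using False by (auto simp: n_def)
    ultimately show ?thesis using that by metis
  qed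
  have hJ: "h i \<in> J" if "enat i < n" for i using h that by (auto simp: bij_betw_def)
  have hi: "h i = h j \<longleftrightarrow> i = j" if "enat i < n" "enat j < n" for i j
    using h that by (auto simp: bij_betw_def inj_on_def)
  have hs: "\<exists>k. enat k < n \<and> i = h k" if "i \<in> J" for i
    using h that by (auto simp: bij_betw_def)
  have "onb K n (\<lambda>i. E (h i))" unfolding onb_def
  proof (intro conjI allI impI ballI)
    fix x assume "x \<in> K" "\<forall>i. enat i < n \<longrightarrow> ip x (E (h i)) = 0"
    then show "ip x x = 0" using tot hs by blast
  qed (use E on hJ hi in auto)
  then show ?thesis unfolding n_def by blast
qed

end

subsection \<open>Integration over the unit cube\<close>

abbreviation cub :: "heis set" where "cub \<equiv> cbox ((0, 0), 0) ((1, 1), 1)"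

lemma cub_eq: "cub = (({0..1} \<times> {0..1}) \<times> {0..1})"
  by (simp add: cbox_Pair_eq)

text \<open>The half-open cube differs from the closed one by part of the frontier, a null set; on
  the closed box, continuous functions can be integrated iteratively in any order.\<close>

lemma cube_LINT:
  fixes f :: "heis \<Rightarrow> 'b::euclidean_space"
  assumes f: "continuous_on UNIV f"
  shows "(LINT y:unit_cube|lborel. f y) = integral cub f"
proof -
  have fc: "continuous_on cub f" using f continuous_on_subset by blast
  have "set_integrable lborel cub f"
    unfolding set_integrable_def by (rule borel_integrable_compact[OF compact_cbox fc])
  moreover have "unit_cube \<in> sets lborel"
    unfolding unit_cube_def sets_lborel borel_prod[symmetric] by auto
  moreover have sub: "unit_cube \<subseteq> cub" by (auto simp: unit_cube_def cub_eq)
  ultimately have "set_integrable lborel unit_cube f" using set_integrable_subset by blast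
  then have "(LINT y:unit_cube|lborel. f y) = integral unit_cube f"
    by (rule set_borel_integral_eq_integral(2))
  also have "\<dots> = integral cub f"
  proof (rule integral_spike_set)
    have "cub - unit_cube \<subseteq> frontier cub"
    proof -
      have "box ((0, 0), 0) ((1, 1), 1) \<subseteq> unit_cube"
        by (auto simp: unit_cube_def box_def Basis_prod_def inner_prod_def)
      then show ?thesis by (auto simp: frontier_def)
    qed
    then have "negligible (cub - unit_cube)"
      using negligible_frontier_interval negligible_subset frontier_cbox by (metis Diff_subset)
    then show "negligible {x \<in> cub - unit_cube. f x \<noteq> 0}"
      by (rule negligible_subset) auto
    show "negligible {x \<in> unit_cube - cub. f x \<noteq> 0}" using sub by (auto intro: negligible_subset[of "{}"])
  qed
  finally show ?thesis .
qed

text \<open>Several orders are recorded because each integration by parts wants its own variable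
  innermost; the last order also keeps \<open>x\<close> next to \<open>s\<close>, since the gluing
  in \<open>s\<close> shears \<open>x\<close>.\<close>

lemma cub_iter:
  fixes f :: "heis \<Rightarrow> 'b::euclidean_space"
  assumes f: "continuous_on UNIV f"
  shows "integral cub f = integral {0..1} (\<lambda>x. integral {0..1} (\<lambda>y. integral {0..1} (\<lambda>s. f ((x, y), s))))" (is ?A)
    and "integral cub f = integral {0..1} (\<lambda>s. integral {0..1} (\<lambda>x. integral {0..1} (\<lambda>y. f ((x, y), s))))" (is ?B)
    and "integral cub f = integral {0..1} (\<lambda>s. integral {0..1} (\<lambda>y. integral {0..1} (\<lambda>x. f ((x, y), s))))" (is ?C)
    and "integral cub f = integral {0..1} (\<lambda>y. integral {0..1} (\<lambda>x. integral {0..1} (\<lambda>s. f ((x, y), s))))" (is ?D)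
proof -
  have 1: "integral cub f = integral (cbox (0,0) (1,1)) (\<lambda>x. integral (cbox 0 1) (\<lambda>s. f (x, s)))"
    by (rule integral_prod_continuous) (use f continuous_on_subset in blast)
  have c1: "continuous_on UNIV (\<lambda>x. integral (cbox 0 1) (\<lambda>s. f (x, s)))"
    by (rule integral_continuous_on_param)
       (use f continuous_on_subset in \<open>auto simp: case_prod_unfold\<close>)
  have c2: "continuous_on UNIV (\<lambda>x. f (x, s))" for s
    by (rule continuous_on_compose2[OF f]) (auto intro!: continuous_intros)
  have 2: "integral (cbox (0,0) (1,1)) (\<lambda>x. integral (cbox 0 1) (\<lambda>s. f (x, s)))
     = integral (cbox 0 1) (\<lambda>s. integral (cbox (0,0) (1,1)) (\<lambda>x. f (x, s)))"
    by (rule integral_swap_continuous)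
       (use f continuous_on_subset in \<open>auto simp: case_prod_unfold\<close>)
  have P: "integral (cbox (0,0) (1,1)) g = integral (cbox 0 1) (\<lambda>x. integral (cbox 0 1) (\<lambda>y. g (x, y)))"
    if "continuous_on UNIV g" for g :: "real \<times> real \<Rightarrow> 'b"
    by (rule integral_prod_continuous) (use that continuous_on_subset in blast)
  have Q: "integral (cbox 0 1) (\<lambda>x. integral (cbox 0 1) (\<lambda>y. g (x, y))) =
      integral (cbox 0 1) (\<lambda>y. integral (cbox 0 1) (\<lambda>x. g (x, y)))"
    if "continuous_on UNIV g" for g :: "real \<times> real \<Rightarrow> 'b"
    by (rule integral_swap_continuous) (use that continuous_on_subset in auto)
  show ?A using 1 P[OF c1] by simp
  show ?D using 1 P[OF c1] Q[OF c1] by simp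
  show ?B using 1 2 P[OF c2] by simp
  show ?C using 1 2 P[OF c2] Q[OF c2] by simp
qed

text \<open>For an antiderivative \<open>P\<close> of \<open>g\<close>, the function
  \<open>P (u + 1) - P u\<close> has derivative \<open>g (u + 1) - g u = 0\<close>, so the integral
  over a period does not depend on where it starts.\<close>

lemma integral_periodic_shift:
  fixes g :: "real \<Rightarrow> complex"
  assumes g: "continuous_on UNIV g" and per: "\<And>x. g (x + 1) = g x"
  shows "integral {0..1} (\<lambda>x. g (x + t)) = integral {0..1} g"
proof -
  \<comment> \<open>Large enough that \<open>u\<close> and \<open>u + 1\<close> stay inside the
    interval for \<open>\<bar>u\<bar> \<le> \<bar>t\<bar>\<close>.\<close>
  define R where "R = \<bar>t\<bar> + 2"
  obtain P where P: "\<And>x. x \<in> {-R..R} \<Longrightarrow> (P has_vector_derivative g x) (at x within {-R..R})"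
    using antiderivative_continuous[of "-R" R g] g continuous_on_subset by blast
  have P': "(P has_vector_derivative g x) (at x)" if "-R < x" "x < R" for x
    using P[of x] that by (simp add: at_within_Icc_at)
  let ?S = "{-\<bar>t\<bar>..\<bar>t\<bar>}"
  have sh: "((\<lambda>u. P (u + c)) has_vector_derivative g (u + c)) (at u)" if "\<bar>u + c\<bar> < R" for u c
  proof -
    have "((P \<circ> (\<lambda>u. u + c)) has_vector_derivative 1 *\<^sub>R g (u + c)) (at u)"
      by (rule vector_diff_chain_at) (use P' that in \<open>auto intro!: derivative_eq_intros\<close>)
    then show ?thesis by (simp add: o_def)
  qed
  have "((\<lambda>u. P (u + 1) - P (u + 0)) has_vector_derivative 0) (at u within ?S)" if "u \<in> ?S" for u
  proof -
    have "((\<lambda>u. P (u + 1) - P (u + 0)) has_vector_derivative (g (u + 1) - g (u + 0))) (at u)"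
      by (intro has_vector_derivative_diff sh) (use that R_def in auto)
    then show ?thesis using per by (simp add: has_vector_derivative_at_within)
  qed
  then obtain k where k: "\<And>u. u \<in> ?S \<Longrightarrow> P (u + 1) - P u = k"
    using has_vector_derivative_zero_constant[of ?S "\<lambda>u. P (u + 1) - P u"] by auto
  have "integral {0..1} (\<lambda>x. g (x + u)) = P (u + 1) - P u" if "u \<in> ?S" for u
  proof -
    have "((\<lambda>x. g (x + u)) has_integral (P (1 + u) - P (0 + u))) {0..1}"
      by (rule fundamental_theorem_of_calculus)
         (use that R_def in \<open>auto intro!: has_vector_derivative_at_within sh\<close>)
    then show ?thesis by (simp add: integral_unique add.commute)
  qed
  moreover have "t \<in> ?S" "0 \<in> ?S" by auto
  ultimately have "integral {0..1} (\<lambda>x. g (x + t)) = k" "integral {0..1} (\<lambda>x. g (x + 0)) = k"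
    using k by metis+
  then show ?thesis by simp
qed

subsection \<open>The frame in coordinates\<close>

lemma left_inv_eq:
  "left_inv r v p = ((fst (fst v) + real r * snd p * snd (fst v), snd (fst v)), snd v)"
proof -
  have "(heis_mult r p has_derivative
      (\<lambda>v. ((fst (fst v) + real r * snd p * snd (fst v), snd (fst v)), snd v))) (at ((0, 0), 0))"
    unfolding heis_mult_def A_map_def
    by (auto intro!: derivative_eq_intros simp: plus_prod_def algebra_simps)
  then have "frechet_derivative (heis_mult r p) (at ((0, 0), 0)) =
      (\<lambda>v. ((fst (fst v) + real r * snd p * snd (fst v), snd (fst v)), snd v))"
    by (rule frechet_derivative_at[symmetric])
  then show ?thesis by (simp add: left_inv_def)
qed

lemma s_frame_eq:
  "s_frame r d i p = (if i = 2 then ((- (d * real r * snd p), - d), 0) else ((0, 0), d / real r))"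
  by (simp add: s_frame_def e2_def b_field_def left_inv_eq)

text \<open>The index 0 stands for the central coordinate; 2 and 3 are numbered after the frame
  vectors that project to these directions.\<close>

definition ptl :: "nat \<Rightarrow> (heis \<Rightarrow> 'b::real_normed_vector) \<Rightarrow> heis \<Rightarrow> 'b" where
  "ptl k f p = frechet_derivative f (at p) (if k = 0 then ((1, 0), 0) else if k = 2 then ((0, 1), 0) else ((0, 0), 1))"

lemma fd_ptl:
  assumes "f differentiable (at p)"
  shows "frechet_derivative f (at p) v =
    fst (fst v) *\<^sub>R ptl 0 f p + snd (fst v) *\<^sub>R ptl 2 f p + snd v *\<^sub>R ptl 3 f p"
proof -
  have l: "linear (frechet_derivative f (at p))" by (rule linear_frechet_derivative[OF assms])
  have "v = fst (fst v) *\<^sub>R ((1, 0), 0) + snd (fst v) *\<^sub>R ((0, 1), 0) + snd v *\<^sub>R ((0, 0), 1)"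
    by (cases v; cases "fst v") auto
  then have "frechet_derivative f (at p) v = frechet_derivative f (at p)
    (fst (fst v) *\<^sub>R ((1, 0), 0) + snd (fst v) *\<^sub>R ((0, 1), 0) + snd v *\<^sub>R ((0, 0), 1))" by (rule arg_cong)
  then show ?thesis by (simp only: linear_add[OF l] linear_scale[OF l] ptl_def) simp
qed

lemma C_1D:
  assumes "C_k (Suc 0) f"
  shows "f differentiable (at p)" "continuous_on UNIV (ptl k f)" "continuous_on UNIV f"
proof -
  show d: "f differentiable (at p)" for p using assms by (simp only: C_k.simps)
  show "continuous_on UNIV (ptl k f)" unfolding ptl_def[abs_def] using assms by simp
  show "continuous_on UNIV f" using d
    by (intro differentiable_imp_continuous_on) (auto simp: differentiable_on_def intro: differentiable_at_withinI)
qed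

lemma C_1I:
  fixes f :: "heis \<Rightarrow> 'b::real_normed_vector"
  assumes d: "\<And>p. f differentiable (at p)" and c: "\<And>k. continuous_on UNIV (ptl k f)"
  shows "C_k (Suc 0) f"
  using d by (simp add: fd_ptl) (auto intro!: continuous_intros c)

lemma along_frame:
  assumes "f differentiable (at p)"
  shows "along (s_frame r d i) f p = (if i = 2 then (- d) *\<^sub>R ((real r * snd p) *\<^sub>R ptl 0 f p + ptl 2 f p)
     else (d / real r) *\<^sub>R ptl 3 f p)"
  unfolding along_def fd_ptl[OF assms] s_frame_eq by (simp add: algebra_simps)

lemma along_frame_cont:
  assumes "C_k (Suc 0) f"
  shows "continuous_on UNIV (along (s_frame r d i) f)"
proof -
  have "along (s_frame r d i) f = (\<lambda>p. if i = 2 then (- d) *\<^sub>R ((real r * snd p) *\<^sub>R ptl 0 f p + ptl 2 f p)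
     else (d / real r) *\<^sub>R ptl 3 f p)"
    by (rule ext) (rule along_frame[OF C_1D(1)[OF assms]])
  then show ?thesis using C_1D(2)[OF assms] by (cases "i = 2") (auto intro!: continuous_intros)
qed

section \<open>Integration by parts for lattice-invariant functions\<close>

definition lat_inv :: "nat \<Rightarrow> (heis \<Rightarrow> complex) \<Rightarrow> bool" where
  "lat_inv r G \<longleftrightarrow> (\<forall>\<gamma>\<in>lattice_pts. \<forall>y. G (heis_mult r \<gamma> y) = G y)"

lemma lat_invD:
  assumes "lat_inv r G"
  shows "G ((x + 1, y), s) = G ((x, y), s)" "G ((x, y + 1), s) = G ((x, y), s)"
    "G ((x + real r * y, y), s + 1) = G ((x, y), s)"
proof -
  have *: "G (heis_mult r ((of_int a, of_int b), of_int c) p) = G p" for a b c p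
  proof -
    have "((of_int a, of_int b), of_int c) \<in> lattice_pts" by (simp add: lattice_pts_def)
    then show ?thesis using assms unfolding lat_inv_def by blast
  qed
  show "G ((x + 1, y), s) = G ((x, y), s)" "G ((x, y + 1), s) = G ((x, y), s)"
    "G ((x + real r * y, y), s + 1) = G ((x, y), s)"
    using *[of 1 0 0 "((x, y), s)"] *[of 0 1 0 "((x, y), s)"] *[of 0 0 1 "((x, y), s)"]
    by (simp_all add: heis_mult_def A_map_def add.commute)
qed

lemma ptl_vd:
  fixes G :: "heis \<Rightarrow> complex"
  assumes "G differentiable (at ((x, y), s))"
  shows "((\<lambda>x. G ((x, y), s)) has_vector_derivative ptl 0 G ((x, y), s)) (at x within T)"
    and "((\<lambda>y. G ((x, y), s)) has_vector_derivative ptl 2 G ((x, y), s)) (at y within T)"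
    and "((\<lambda>s. G ((x, y), s)) has_vector_derivative ptl 3 G ((x, y), s)) (at s within T)"
proof -
  have D: "(G has_derivative frechet_derivative G (at ((x, y), s))) (at ((x, y), s))"
    using assms frechet_derivative_works by blast
  have *: "frechet_derivative G (at ((x, y), s)) (t *\<^sub>R v) = t *\<^sub>R frechet_derivative G (at ((x, y), s)) v" for t v
    using linear_frechet_derivative[OF assms] by (simp add: linear_scale)
  have "((\<lambda>x. G ((x, y), s)) has_derivative (\<lambda>t. frechet_derivative G (at ((x, y), s)) ((t, 0), 0))) (at x)"
    by (rule has_derivative_compose[where g=G and f="\<lambda>x. ((x, y), s)"]) (auto intro!: derivative_eq_intros D)
  moreover have "((\<lambda>y. G ((x, y), s)) has_derivative (\<lambda>t. frechet_derivative G (at ((x, y), s)) ((0, t), 0))) (at y)"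
    by (rule has_derivative_compose[where g=G and f="\<lambda>y. ((x, y), s)"]) (auto intro!: derivative_eq_intros D)
  moreover have "((\<lambda>s. G ((x, y), s)) has_derivative (\<lambda>t. frechet_derivative G (at ((x, y), s)) ((0, 0), t))) (at s)"
    by (rule has_derivative_compose[where g=G and f="\<lambda>s. ((x, y), s)"]) (auto intro!: derivative_eq_intros D simp: zero_prod_def)
  moreover have "(\<lambda>t. frechet_derivative G (at ((x, y), s)) ((t, 0), 0)) = (\<lambda>t. t *\<^sub>R ptl 0 G ((x, y), s))"
    "(\<lambda>t. frechet_derivative G (at ((x, y), s)) ((0, t), 0)) = (\<lambda>t. t *\<^sub>R ptl 2 G ((x, y), s))"
    "(\<lambda>t. frechet_derivative G (at ((x, y), s)) ((0, 0), t)) = (\<lambda>t. t *\<^sub>R ptl 3 G ((x, y), s))"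
    unfolding ptl_def *[symmetric] by simp_all
  ultimately show "((\<lambda>x. G ((x, y), s)) has_vector_derivative ptl 0 G ((x, y), s)) (at x within T)"
    "((\<lambda>y. G ((x, y), s)) has_vector_derivative ptl 2 G ((x, y), s)) (at y within T)"
    "((\<lambda>s. G ((x, y), s)) has_vector_derivative ptl 3 G ((x, y), s)) (at s within T)"
    unfolding has_vector_derivative_def by (metis has_derivative_at_withinI)+
qed

text \<open>In the first two coordinates the boundary terms cancel by periodicity. In the third, the
  faces \<open>s = 0\<close> and \<open>s = 1\<close> are glued by a shear \<open>x + r * y\<close>,
  so the boundary terms agree only after integration over \<open>x\<close>, where the shear is a
  shift of a periodic function.\<close>

lemma integral_ptl_zero:
  fixes G :: "heis \<Rightarrow> complex"
  assumes G: "C_k (Suc 0) G" and inv: "lat_inv r G"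
  shows "integral {0..1} (\<lambda>x. ptl 0 G ((x, y), s)) = 0"
    and "integral {0..1} (\<lambda>y. ptl 2 G ((x, y), s)) = 0"
    and "integral cub (ptl 3 G) = 0"
proof -
  have "((\<lambda>x. ptl 0 G ((x, y), s)) has_integral (G ((1, y), s) - G ((0, y), s))) {0..1}"
    by (rule fundamental_theorem_of_calculus) (auto intro!: ptl_vd C_1D[OF G])
  then show "integral {0..1} (\<lambda>x. ptl 0 G ((x, y), s)) = 0"
    using lat_invD(1)[OF inv, of 0 y s] by (simp add: integral_unique)
  have "((\<lambda>y. ptl 2 G ((x, y), s)) has_integral (G ((x, 1), s) - G ((x, 0), s))) {0..1}"
    by (rule fundamental_theorem_of_calculus) (auto intro!: ptl_vd C_1D[OF G])
  then show "integral {0..1} (\<lambda>y. ptl 2 G ((x, y), s)) = 0"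
    using lat_invD(2)[OF inv, of x 0 s] by (simp add: integral_unique)
  have c: "continuous_on UNIV (\<lambda>x. G ((x, y), s))" for y s
    by (rule continuous_on_compose2[OF C_1D(3)[OF G]]) (auto intro!: continuous_intros)
  have i: "(\<lambda>x. G ((x, y), s)) integrable_on {0..1}" for y s
    by (rule integrable_continuous_interval) (use c continuous_on_subset in blast)
  have "integral {0..1} (\<lambda>x. integral {0..1} (\<lambda>s. ptl 3 G ((x, y), s))) = 0" for y
  proof -
    have "((\<lambda>s. ptl 3 G ((x, y), s)) has_integral (G ((x, y), 1) - G ((x, y), 0))) {0..1}" for x
      by (rule fundamental_theorem_of_calculus) (auto intro!: ptl_vd C_1D[OF G])
    then have "integral {0..1} (\<lambda>x. integral {0..1} (\<lambda>s. ptl 3 G ((x, y), s))) =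
       integral {0..1} (\<lambda>x. G ((x, y), 1) - G ((x, y), 0))"
      by (intro integral_cong) (rule integral_unique)
    also have "\<dots> = integral {0..1} (\<lambda>x. G ((x, y), 1)) - integral {0..1} (\<lambda>x. G ((x, y), 0))"
      by (rule integral_diff[OF i i])
    also have "(\<lambda>x. G ((x, y), 0)) = (\<lambda>x. G ((x + real r * y, y), 1))"
      using lat_invD(3)[OF inv, of _ y 0] by simp
    also have "integral {0..1} \<dots> = integral {0..1} (\<lambda>x. G ((x, y), 1))"
      by (rule integral_periodic_shift[OF c]) (rule lat_invD(1)[OF inv])
    finally show ?thesis by simp
  qed
  then show "integral cub (ptl 3 G) = 0"
    using cub_iter(4)[OF C_1D(2)[OF G]] by simp
qed

lemma integral_along_zero:
  fixes G :: "heis \<Rightarrow> complex"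
  assumes G: "C_k (Suc 0) G" and inv: "lat_inv r G"
  shows "integral cub (ptl 0 G) = 0" "integral cub (along (s_frame r d i) G) = 0"
proof -
  note c = C_1D(2)[OF G]
  show "integral cub (ptl 0 G) = 0"
    using cub_iter(3)[OF c] integral_ptl_zero(1)[OF G inv] by simp
  have 2: "integral cub (ptl 2 G) = 0"
    using cub_iter(2)[OF c] integral_ptl_zero(2)[OF G inv] by simp
  have sc: "continuous_on UNIV (\<lambda>p. (real r * snd p) *\<^sub>R ptl 0 G p)"
    by (intro continuous_intros c)
  \<comment> \<open>The coefficient \<open>r * s\<close> does not depend on the central coordinate,
    so integrating over that coordinate first still gives 0.\<close>
  have 1: "integral cub (\<lambda>p. (real r * snd p) *\<^sub>R ptl 0 G p) = 0"
    using cub_iter(3)[OF sc] integral_ptl_zero(1)[OF G inv] by simp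
  have i: "f integrable_on cub" if "continuous_on UNIV f" for f :: "heis \<Rightarrow> complex"
    by (rule integrable_continuous) (use that continuous_on_subset in blast)
  show "integral cub (along (s_frame r d i) G) = 0"
    using integral_add[OF i[OF sc] i[OF c[of 2]]] 1 2 integral_ptl_zero(3)[OF G inv]
    by (cases "i = 2") (simp_all add: along_frame[OF C_1D(1)[OF G]] cong: integral_cong)
qed

definition sip :: "(heis \<Rightarrow> complex) \<Rightarrow> (heis \<Rightarrow> complex) \<Rightarrow> complex" where
  "sip f g = integral cub (\<lambda>p. f p * cnj (g p))"

lemma prod_cnj:
  assumes f: "C_k (Suc 0) f" and g: "C_k (Suc 0) (g :: heis \<Rightarrow> complex)"
  shows "C_k (Suc 0) (\<lambda>p. f p * cnj (g p))"
    and "frechet_derivative (\<lambda>p. f p * cnj (g p)) (at p) v =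
      frechet_derivative f (at p) v * cnj (g p) + f p * cnj (frechet_derivative g (at p) v)"
proof -
  have D: "((\<lambda>p. f p * cnj (g p)) has_derivative (\<lambda>v.
      frechet_derivative f (at p) v * cnj (g p) + f p * cnj (frechet_derivative g (at p) v))) (at p)" for p
  proof -
    have df: "(f has_derivative frechet_derivative f (at p)) (at p)"
      using C_1D(1)[OF f] frechet_derivative_works by blast
    have "(g has_derivative frechet_derivative g (at p)) (at p)"
      using C_1D(1)[OF g] frechet_derivative_works by blast
    then have "((\<lambda>p. cnj (g p)) has_derivative (\<lambda>v. cnj (frechet_derivative g (at p) v))) (at p)"
      by (rule bounded_linear.has_derivative[OF bounded_linear_cnj])
    from has_derivative_mult[OF df this] show ?thesis by (simp add: add.commute)
  qed
  show *: "frechet_derivative (\<lambda>p. f p * cnj (g p)) (at p) v =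
      frechet_derivative f (at p) v * cnj (g p) + f p * cnj (frechet_derivative g (at p) v)" for p v
    by (simp add: frechet_derivative_at[OF D, symmetric])
  show "C_k (Suc 0) (\<lambda>p. f p * cnj (g p))"
  proof (rule C_1I)
    show "(\<lambda>p. f p * cnj (g p)) differentiable at p" for p using D differentiable_def by blast
    have "ptl k (\<lambda>p. f p * cnj (g p)) = (\<lambda>p. ptl k f p * cnj (g p) + f p * cnj (ptl k g p))" for k
      by (simp add: ptl_def * fun_eq_iff)
    then show "continuous_on UNIV (ptl k (\<lambda>p. f p * cnj (g p)))" for k
      using C_1D[OF f] C_1D[OF g] by (auto intro!: continuous_intros)
  qed
qed

lemma integrable_cub: "continuous_on UNIV f \<Longrightarrow> f integrable_on cub" for f :: "heis \<Rightarrow> 'b::euclidean_space"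
  by (rule integrable_continuous) (use continuous_on_subset in blast)

text \<open>The derivative of the invariant function \<open>f * cnj g\<close> has integral 0, and
  the product rule splits it into the two sides.\<close>

lemma sip_skew:
  assumes f: "C_k (Suc 0) f" and g: "C_k (Suc 0) g" and inv: "lat_inv r (\<lambda>p. f p * cnj (g p))"
  shows "sip (along (s_frame r d i) f) g = - sip f (along (s_frame r d i) g)"
    and "sip (ptl 0 f) g = - sip f (ptl 0 g)"
proof -
  note c = C_1D(2,3)[OF f] C_1D(2,3)[OF g] along_frame_cont[OF f] along_frame_cont[OF g]
  have "sip (along (s_frame r d i) f) g + sip f (along (s_frame r d i) g) =
     integral cub (along (s_frame r d i) (\<lambda>p. f p * cnj (g p)))"
    unfolding sip_def along_def prod_cnj(2)[OF f g]
    by (rule integral_add[symmetric]; rule integrable_cub; intro continuous_intros c[unfolded along_def])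
  then show "sip (along (s_frame r d i) f) g = - sip f (along (s_frame r d i) g)"
    using integral_along_zero(2)[OF prod_cnj(1)[OF f g] inv] by (simp add: eq_neg_iff_add_eq_0)
  have "sip (ptl 0 f) g + sip f (ptl 0 g) = integral cub (ptl 0 (\<lambda>p. f p * cnj (g p)))"
    unfolding sip_def ptl_def prod_cnj(2)[OF f g]
    by (rule integral_add[symmetric]; rule integrable_cub; intro continuous_intros c[unfolded ptl_def])
  then show "sip (ptl 0 f) g = - sip f (ptl 0 g)"
    using integral_along_zero(1)[OF prod_cnj(1)[OF f g] inv] by (simp add: eq_neg_iff_add_eq_0)
qed

subsection \<open>Smoothness\<close>

lemma C_k_const: "C_k n (\<lambda>x. c)"
  by (induction n arbitrary: c) (simp_all add: frechet_derivative_const)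

lemma C_k_mono: "C_k (Suc n) f \<Longrightarrow> C_k n f"
proof (induction n arbitrary: f)
  case 0
  then show ?case
    by (auto intro!: differentiable_imp_continuous_on simp: differentiable_on_def intro: differentiable_at_withinI)
next
  case (Suc n)
  have "\<forall>x. f differentiable at x" using Suc.prems by simp
  moreover have "C_k n (\<lambda>x. frechet_derivative f (at x) v)" for v
    by (rule Suc.IH) (use Suc.prems C_k.simps(2)[of "Suc n" f] in blast)
  ultimately show ?case by simp
qed

lemma C_k_SucI:
  assumes "\<And>x. (f has_derivative f' x) (at x)" "\<And>v. C_k n (\<lambda>x. f' x v)"
  shows "C_k (Suc n) f"
proof -
  have "frechet_derivative f (at x) = f' x" for x using assms(1) frechet_derivative_at by metis
  then show ?thesis using assms by (auto simp: differentiable_def)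
qed

lemma C_k_SucD:
  assumes "C_k (Suc n) f"
  shows "(f has_derivative frechet_derivative f (at x)) (at x)"
    "C_k n (\<lambda>x. frechet_derivative f (at x) v)"
  using assms frechet_derivative_works by (auto simp: C_k.simps(2) simp del: split_paired_All)

lemma C_k_add: "C_k n f \<Longrightarrow> C_k n g \<Longrightarrow> C_k n (\<lambda>x. f x + g x)"
proof (induction n arbitrary: f g)
  case 0 then show ?case by (auto intro: continuous_intros)
next
  case (Suc n)
  show ?case
    by (rule C_k_SucI[OF has_derivative_add[OF C_k_SucD(1)[OF Suc.prems(1)] C_k_SucD(1)[OF Suc.prems(2)]]])
       (intro Suc.IH C_k_SucD(2)[OF Suc.prems(1)] C_k_SucD(2)[OF Suc.prems(2)])
qed

lemma C_k_bounded_linear: "bounded_linear L \<Longrightarrow> C_k n f \<Longrightarrow> C_k n (\<lambda>x. L (f x))"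
proof (induction n arbitrary: f)
  case 0 then show ?case by (auto intro: bounded_linear.continuous_on)
next
  case (Suc n)
  show ?case
    by (rule C_k_SucI[OF bounded_linear.has_derivative[OF Suc.prems(1) C_k_SucD(1)[OF Suc.prems(2)]]])
       (intro Suc.IH Suc.prems(1) C_k_SucD(2)[OF Suc.prems(2)])
qed

lemma C_k_linear: "bounded_linear L \<Longrightarrow> C_k n L"
proof (cases n)
  case 0 then show "bounded_linear L \<Longrightarrow> C_k n L" by (simp add: linear_continuous_on)
next
  case (Suc m)
  assume L: "bounded_linear L"
  then show ?thesis unfolding Suc
    by (intro C_k_SucI[OF bounded_linear_imp_has_derivative] C_k_const)
qed

subsection \<open>Vanishing of the connection coefficients\<close>

lemma frame_deriv:
  "(s_frame r d i has_derivative (\<lambda>v. if i = 2 then ((- (d * real r * snd v), 0), 0) else 0)) (at p)"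
  unfolding s_frame_eq[abs_def] by (cases "i = 2") (auto intro!: derivative_eq_intros simp: zero_prod_def)

lemma frame_smooth: "smooth (s_frame r d i)"
proof -
  let ?L = "\<lambda>p::heis. if i = 2 then ((- (d * real r * snd p), 0::real), 0::real) else 0"
  have "bounded_linear ?L"
    by (rule has_derivative_bounded_linear[OF frame_deriv])
  then have "C_k n (\<lambda>p. ?L p + (if i = 2 then ((0, - d), 0) else ((0, 0), d / real r)))" for n
    by (intro C_k_add C_k_linear C_k_const)
  moreover have "(\<lambda>p. ?L p + (if i = 2 then ((0, - d), 0) else ((0, 0), d / real r))) = s_frame r d i"
    by (auto simp: s_frame_eq fun_eq_iff)
  ultimately show ?thesis by (simp add: smooth_def)
qed

lemma frame_independent:
  assumes "r > 0" "d > 0"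
  shows "independent {e1 r p, s_frame r d 2 p, s_frame r d 3 p}"
  using assms by (simp add: independent_insert span_insert e1_def left_inv_eq s_frame_eq zero_prod_def)

lemma s_coord_frame:
  assumes "r > 0" "d > 0" "i \<in> {2, 3}" "j \<in> {2, 3}"
  shows "s_coord r d i p (s_frame r d j p) = (if i = j then 1 else 0)"
    and "s_coord r d i p (a *\<^sub>R e1 r p) = 0"
proof -
  have inj: "s_frame r d 2 p \<noteq> s_frame r d 3 p" "e1 r p \<noteq> s_frame r d 2 p" "e1 r p \<noteq> s_frame r d 3 p"
    using assms by (auto simp: e1_def left_inv_eq s_frame_eq)
  show "s_coord r d i p (s_frame r d j p) = (if i = j then 1 else 0)"
    unfolding s_coord_def using assms(3,4) inj
    by (subst representation_basis[OF frame_independent[OF assms(1,2)]]) auto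
  have "representation {e1 r p, s_frame r d 2 p, s_frame r d 3 p} (a *\<^sub>R e1 r p) (s_frame r d i p)
    = a * representation {e1 r p, s_frame r d 2 p, s_frame r d 3 p} (e1 r p) (s_frame r d i p)"
    by (subst representation_scale[OF frame_independent[OF assms(1,2)]]) (auto intro: span_base)
  also have "representation {e1 r p, s_frame r d 2 p, s_frame r d 3 p} (e1 r p) (s_frame r d i p) = 0"
    using assms(3) inj
    by (subst representation_basis[OF frame_independent[OF assms(1,2)]]) auto
  finally show "s_coord r d i p (a *\<^sub>R e1 r p) = 0" by (simp add: s_coord_def)
qed

text \<open>On frame vectors every term of the Koszul formula vanishes: the metric coefficients are
  constant, and all brackets are multiples of \<open>e1\<close>, which \<open>pr\<close>
  kills.\<close>

lemma christoffel_zero: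
  assumes rd: "r > 0" "d > 0" and K: "koszul_connection r d nabla"
    and ijk: "i \<in> {2, 3}" "j \<in> {2, 3}" "k \<in> {2, 3}"
  shows "christoffel r d nabla i j k p = 0"
proof -
  have hor: "horizontal r d (s_frame r d i)" if "i \<in> {2, 3}" for i
    using that frame_smooth by (auto simp: horizontal_def intro: span_base)
  have gc: "g_metric r d (s_frame r d i) (s_frame r d j) = (\<lambda>p. if i = j then 1 else 0)"
    if "i \<in> {2, 3}" "j \<in> {2, 3}" for i j
    using that by (auto simp: g_metric_def fun_eq_iff s_coord_frame[OF rd])
  have al0: "along X (\<lambda>p. c) p = 0" for X and c :: real and p
    by (simp add: along_def frechet_derivative_const)
  have al: "\<exists>a. along (s_frame r d i) (s_frame r d j) p = a *\<^sub>R e1 r p" for i j p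
  proof -
    have "along (s_frame r d i) (s_frame r d j) p = (if j = 2 then - (d * real r * snd (s_frame r d i p)) else 0) *\<^sub>R e1 r p"
      unfolding along_def frechet_derivative_at[OF frame_deriv, symmetric]
      by (auto simp: e1_def left_inv_eq zero_prod_def)
    then show ?thesis by blast
  qed
  have br: "\<exists>a. lie_bracket (s_frame r d i) (s_frame r d j) p = a *\<^sub>R e1 r p" for i j p
  proof -
    obtain a b where "along (s_frame r d i) (s_frame r d j) p = a *\<^sub>R e1 r p"
       "along (s_frame r d j) (s_frame r d i) p = b *\<^sub>R e1 r p" using al by blast
    then have "lie_bracket (s_frame r d i) (s_frame r d j) p = (a - b) *\<^sub>R e1 r p"
      by (simp add: lie_bracket_def scaleR_diff_left)
    then show ?thesis by blast
  qed
  have pr0: "pr r d (lie_bracket (s_frame r d i) (s_frame r d j)) p = 0" for i j p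
  proof -
    obtain a where a: "lie_bracket (s_frame r d i) (s_frame r d j) p = a *\<^sub>R e1 r p" using br by blast
    show ?thesis unfolding pr_def a
      by (rule sum.neutral) (use s_coord_frame(2)[OF rd] in auto)
  qed
  have s0: "s_coord r d i p 0 = 0" for i p
    by (simp add: s_coord_def representation_zero)
  have g0: "g_metric r d (pr r d (lie_bracket (s_frame r d i) (s_frame r d j))) Z p = 0" for i j Z p
    by (simp add: g_metric_def pr0 s0)
  have "2 * g_metric r d (nabla (s_frame r d i) (s_frame r d j)) (s_frame r d k) p = 0"
    using K hor[OF ijk(1)] hor[OF ijk(2)] hor[OF ijk(3)] ijk unfolding koszul_connection_def
    by (simp only: gc al0 g0)
  then show ?thesis by (simp add: christoffel_def)
qed

lemma sub_dirac_eq: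
  assumes "r > 0" "d > 0" "koszul_connection r d nabla"
  shows "sub_dirac r d nabla c \<phi> p = c 2 *v along (s_frame r d 2) \<phi> p + c 3 *v along (s_frame r d 3) \<phi> p"
  unfolding sub_dirac_def using christoffel_zero[OF assms] by simp

subsection \<open>The inner product on sections\<close>

definition cdot :: "complex^2 \<Rightarrow> complex^2 \<Rightarrow> complex" where
  "cdot u w = (\<Sum>j\<in>UNIV. u $ j * cnj (w $ j))"

lemma cdot_add: "cdot (u + v) w = cdot u w + cdot v w" "cdot w (u + v) = cdot w u + cdot w v"
  by (simp_all add: cdot_def sum_2 algebra_simps)

lemma cdot_scl: "cdot (a *s u) w = a * cdot u w" "cdot w (a *s u) = cnj a * cdot w u"
  by (simp_all add: cdot_def sum_2 algebra_simps)

lemma cdot_commute: "cdot w u = cnj (cdot u w)"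
  by (simp add: cdot_def mult.commute)

lemma cdot_self: "cdot u u = of_real ((norm u)\<^sup>2)"
proof -
  have "(norm u)\<^sup>2 = (\<Sum>j\<in>UNIV. (cmod (u $ j))\<^sup>2)"
    by (simp add: norm_vec_def L2_set_def sum_nonneg)
  then show ?thesis by (simp add: cdot_def complex_norm_square del: of_real_power)
qed

lemma bounded_linear_cdot: "bounded_linear (\<lambda>u. cdot u w)"
  unfolding cdot_def
  by (intro bounded_linear_sum bounded_linear_mult_const bounded_linear_vec_nth)

lemma bounded_linear_smult: "bounded_linear (\<lambda>z::complex. z *s (w::complex^2))"
proof (rule bounded_linear_intro[where K = "norm w"])
  show "norm (z *s w) \<le> norm z * norm w" for z :: complex
  proof -
    have "(norm (z *s w))\<^sup>2 = (cmod z * norm w)\<^sup>2"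
      by (simp add: norm_vec_def L2_set_def sum_nonneg norm_mult power_mult_distrib sum_distrib_left)
    then show ?thesis by (simp add: power2_eq_iff_nonneg)
  qed
qed (auto simp: vec_eq_iff algebra_simps)

lemma norm_smult: "norm (z *s (w::complex^2)) = cmod z * norm w"
  by (rule power2_eq_imp_eq)
     (auto simp: norm_vec_def L2_set_def sum_nonneg norm_mult power_mult_distrib sum_distrib_left)

lemma continuous_smult:
  "continuous_on S h \<Longrightarrow> continuous_on S \<phi> \<Longrightarrow> continuous_on S (\<lambda>p. (h p :: complex) *s (\<phi> p :: complex^2))"
  unfolding vector_scalar_mult_def by (intro continuous_intros)

lemma continuous_cdot:
  "continuous_on S \<phi> \<Longrightarrow> continuous_on S \<psi> \<Longrightarrow> continuous_on S (\<lambda>p. cdot (\<phi> p) (\<psi> p))"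
  unfolding cdot_def by (intro continuous_intros)

text \<open>Equivariance is dropped: the inner product only sees the cube. The test functions of the
  density argument, such as products of functions of one variable, are not equivariant.\<close>

abbreviation V0 :: "spinor_fun set" where "V0 \<equiv> {\<phi>. continuous_on UNIV \<phi>}"
abbreviation sadd :: "spinor_fun \<Rightarrow> spinor_fun \<Rightarrow> spinor_fun" where "sadd \<phi> \<psi> \<equiv> (\<lambda>p. \<phi> p + \<psi> p)"
abbreviation sscl :: "complex \<Rightarrow> spinor_fun \<Rightarrow> spinor_fun" where "sscl a \<phi> \<equiv> (\<lambda>p. a *s \<phi> p)"

lemma sec_inner_eq:
  assumes "\<phi> \<in> V0" "\<psi> \<in> V0"
  shows "sec_inner \<phi> \<psi> = integral cub (\<lambda>p. cdot (\<phi> p) (\<psi> p))"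
  using cube_LINT[OF continuous_cdot, of \<phi> \<psi>] assms by (simp add: sec_inner_def cdot_def)

lemma sec_inner_self:
  assumes "\<phi> \<in> V0"
  shows "sec_inner \<phi> \<phi> = of_real (integral cub (\<lambda>p. (norm (\<phi> p))\<^sup>2))"
proof -
  have "(\<lambda>p. (norm (\<phi> p))\<^sup>2) integrable_on cub"
    by (rule integrable_cub) (use assms in \<open>auto intro!: continuous_intros\<close>)
  then have "integral cub (complex_of_real \<circ> (\<lambda>p. (norm (\<phi> p))\<^sup>2)) = of_real (integral cub (\<lambda>p. (norm (\<phi> p))\<^sup>2))"
    by (rule integral_linear) (rule bounded_linear_of_real)
  then show ?thesis by (simp add: sec_inner_eq[OF assms assms] cdot_self o_def)
qed

interpretation S: semi_inner V0 sadd sscl sec_inner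
proof
  fix x y z :: spinor_fun and a :: complex
  show add: "x \<in> V0 \<Longrightarrow> y \<in> V0 \<Longrightarrow> sadd x y \<in> V0" by (auto intro: continuous_intros)
  show scl: "x \<in> V0 \<Longrightarrow> sscl a x \<in> V0" by (auto intro: continuous_smult continuous_intros)
  show "sec_inner (sadd x y) z = sec_inner x z + sec_inner y z" if "x \<in> V0" "y \<in> V0" "z \<in> V0"
  proof -
    have "sec_inner (sadd x y) z = integral cub (\<lambda>p. cdot (x p) (z p) + cdot (y p) (z p))"
      using that add by (subst sec_inner_eq) (auto simp: cdot_add intro: continuous_intros)
    also have "\<dots> = sec_inner x z + sec_inner y z"
      unfolding sec_inner_eq[OF that(1,3)] sec_inner_eq[OF that(2,3)]
      by (rule integral_add; rule integrable_cub; rule continuous_cdot) (use that in auto)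
    finally show ?thesis .
  qed
  show "sec_inner (sscl a x) z = a * sec_inner x z" if "x \<in> V0" "z \<in> V0"
    using that by (subst (1 2) sec_inner_eq) (auto simp: cdot_scl intro: continuous_smult continuous_intros)
  show "sec_inner y x = cnj (sec_inner x y)" if "x \<in> V0" "y \<in> V0"
  proof -
    have "cnj (sec_inner x y) = integral cub (\<lambda>p. cnj (cdot (x p) (y p)))"
      unfolding sec_inner_eq[OF that] by (rule integral_cnj)
    also have "(\<lambda>p. cnj (cdot (x p) (y p))) = (\<lambda>p. cdot (y p) (x p))"
      by (rule ext) (rule cdot_commute[symmetric])
    finally show ?thesis using that by (simp add: sec_inner_eq)
  qed
  show "0 \<le> Re (sec_inner x x)" if "x \<in> V0"
  proof -
    have "0 \<le> integral cub (\<lambda>p. (norm (x p))\<^sup>2)"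
      by (rule integral_nonneg; (rule integrable_cub)?) (use that in \<open>auto intro!: continuous_intros\<close>)
    then show ?thesis using sec_inner_self[OF that] by simp
  qed
qed

abbreviation ladd :: "l2_vec \<Rightarrow> l2_vec \<Rightarrow> l2_vec" where "ladd \<Phi> \<Psi> \<equiv> (\<lambda>n. sadd (\<Phi> n) (\<Psi> n))"
abbreviation lscl :: "complex \<Rightarrow> l2_vec \<Rightarrow> l2_vec" where "lscl a \<Phi> \<equiv> (\<lambda>n. sscl a (\<Phi> n))"

interpretation L: semi_inner S.Cseq ladd lscl S.lip
  by (rule S.completion)

lemma sec_dist_eq:
  assumes "\<phi> \<in> V0" "\<psi> \<in> V0" shows "sec_dist \<phi> \<psi> = S.dst \<phi> \<psi>"
proof -
  have *: "sadd \<phi> (sscl (-1) \<psi>) \<in> V0" using S.add_in S.scl_in assms by blast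
  have "(\<lambda>p. \<phi> p + (-1) *s \<psi> p) = (\<lambda>p. \<phi> p - \<psi> p)" by (simp add: fun_eq_iff vec_eq_iff)
  moreover have "continuous_on UNIV (\<lambda>p. (norm (\<phi> p - \<psi> p))\<^sup>2)"
    using assms by (auto intro!: continuous_intros)
  ultimately show ?thesis unfolding S.dst_def S.nrm_def sec_inner_self[OF *] sec_dist_def
    by (simp add: cube_LINT)
qed

lemma sections_V0: "cont_sections r eps \<subseteq> V0" "smooth_sections r eps \<subseteq> cont_sections r eps"
  by (auto simp: cont_sections_def smooth_sections_def smooth_def) (metis C_k.simps(1))

lemma L2_Cseq: "\<Phi> \<in> L2 r eps \<longleftrightarrow> \<Phi> \<in> S.Cseq \<and> (\<forall>n. \<Phi> n \<in> cont_sections r eps)"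
proof -
  have "sec_dist (\<Phi> m) (\<Phi> n) = S.dst (\<Phi> m) (\<Phi> n)" if "\<forall>n. \<Phi> n \<in> cont_sections r eps" for m n
    by (rule sec_dist_eq) (use that sections_V0 in blast)+
  moreover have "\<forall>n. \<Phi> n \<in> V0" if "\<forall>n. \<Phi> n \<in> cont_sections r eps"
    using that sections_V0(1) by blast
  ultimately show ?thesis unfolding L2_def S.Cseq_def mem_Collect_eq by auto
qed

lemma L2_inner_lip: "L2_inner = S.lip"
  by (simp add: fun_eq_iff L2_inner_def S.lip_def)

lemma L2_dist_eq:
  assumes "\<Phi> \<in> S.Cseq" "\<Psi> \<in> S.Cseq"
  shows "L2_dist \<Phi> \<Psi> = L.dst \<Phi> \<Psi>"
proof -
  have "sec_dist (\<Phi> n) (\<Psi> n) = S.dst (\<Phi> n) (\<Psi> n)" for n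
    by (rule sec_dist_eq) (use assms in \<open>auto simp: S.Cseq_def\<close>)
  then show ?thesis using S.dst_conv[OF assms] by (simp add: L2_dist_def limI)
qed

lemma embed_Cseq: "\<phi> \<in> V0 \<Longrightarrow> L2_embed \<phi> \<in> S.Cseq"
  unfolding L2_embed_def by (rule S.const_Cseq)

lemma lip_embed: "S.lip (L2_embed \<phi>) (L2_embed \<psi>) = sec_inner \<phi> \<psi>"
  by (simp add: S.lip_def L2_embed_def)

lemma L2_scale_eq: "L2_scale a \<Phi> = lscl (of_real a) \<Phi>"
  by (simp add: L2_scale_def fun_eq_iff vec_eq_iff) (simp add: scaleR_conv_of_real)

text \<open>By Cauchy and Schwarz, convergence in L^2 implies convergence of the pairings with a
  fixed continuous function. This is the only way in which the closure of the operator is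
  exploited.\<close>

lemma lip_limit:
  assumes f: "\<And>k::nat. f k \<in> V0" and \<Phi>: "\<Phi> \<in> S.Cseq" and \<psi>: "\<psi> \<in> V0"
    and lim: "(\<lambda>k. L2_dist (L2_embed (f k)) \<Phi>) \<longlonglongrightarrow> 0"
  shows "(\<lambda>k. sec_inner (f k) \<psi>) \<longlonglongrightarrow> S.lip \<Phi> (L2_embed \<psi>)"
proof -
  let ?C = "L.nrm (L2_embed \<psi>)"
  have le: "norm (sec_inner (f k) \<psi> - S.lip \<Phi> (L2_embed \<psi>)) \<le> L2_dist (L2_embed (f k)) \<Phi> * ?C" for k
  proof -
    have "(L.dst (L2_embed \<psi>) (L2_embed \<psi>)) = 0"
      by (rule L.dst_self[OF embed_Cseq[OF \<psi>]])
    then show ?thesis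
      using L.ip_diff_le[OF embed_Cseq[OF f] embed_Cseq[OF \<psi>] \<Phi> embed_Cseq[OF \<psi>], of k]
      by (simp add: lip_embed L2_dist_eq embed_Cseq[OF f] \<Phi>)
  qed
  have lim': "(\<lambda>k. L2_dist (L2_embed (f k)) \<Phi> * ?C) \<longlonglongrightarrow> 0"
    using tendsto_mult_right[OF lim, of ?C] by simp
  have "(\<lambda>k. sec_inner (f k) \<psi> - S.lip \<Phi> (L2_embed \<psi>)) \<longlonglongrightarrow> 0"
    by (rule Lim_null_comparison[OF always_eventually[OF allI[OF le]] lim'])
  then show ?thesis by (rule LIM_zero_cancel)
qed

subsection \<open>The Clifford module\<close>

text \<open>\<open>vp\<close> and \<open>vm\<close> are the eigenvectors of
  \<open>c 2 ** c 3\<close> for the eigenvalues \<open>\<i> * \<sigma>\<close> and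
  \<open>- \<i> * \<sigma>\<close>, linked by \<open>c 2\<close>. They may fail to be orthogonal, so
  coordinates are read off with the dual basis \<open>wp\<close>, \<open>wm\<close>.\<close>

definition cpair :: "(nat \<Rightarrow> complex^2^2) \<Rightarrow> real \<Rightarrow> complex^2 \<Rightarrow> complex^2 \<Rightarrow> complex^2 \<Rightarrow> complex^2 \<Rightarrow> bool" where
  "cpair c \<sigma> vp vm wp wm \<longleftrightarrow>
     (\<forall>u. u = cdot u wp *s vp + cdot u wm *s vm) \<and>
     cdot vp wp = 1 \<and> cdot vp wm = 0 \<and> cdot vm wp = 0 \<and> cdot vm wm = 1 \<and>
     c 2 *v vp = vm \<and> c 2 *v vm = - vp \<and>
     c 3 *v vp = (- (\<i> * of_real \<sigma>)) *s vm \<and> c 3 *v vm = (- (\<i> * of_real \<sigma>)) *s vp"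

lemma dual_basis_exists:
  fixes vp vm :: "complex^2"
  assumes "\<And>a b. a *s vp + b *s vm = 0 \<Longrightarrow> a = 0 \<and> b = 0"
  shows "\<exists>wp wm. (\<forall>u. u = cdot u wp *s vp + cdot u wm *s vm) \<and>
     cdot vp wp = 1 \<and> cdot vp wm = 0 \<and> cdot vm wp = 0 \<and> cdot vm wm = 1"
proof -
  define D where "D = vp $ 1 * vm $ 2 - vp $ 2 * vm $ 1"
  have "D \<noteq> 0"
  proof
    assume D: "D = 0"
    have "(vm $ 2) *s vp + (- (vp $ 2)) *s vm = 0" "(vm $ 1) *s vp + (- (vp $ 1)) *s vm = 0"
      using D by (simp_all add: vec_eq_iff forall_2 D_def algebra_simps)
    from assms[OF this(1)] assms[OF this(2)] have "vp = 0" by (simp add: vec_eq_iff forall_2)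
    then show False using assms[of 1 0] by simp
  qed
  \<comment> \<open>Cramer's rule: the conjugated rows of the inverse of the matrix with columns
    \<open>vp\<close> and \<open>vm\<close>.\<close>
  define wp where "wp = (vector [cnj (vm $ 2 / D), - cnj (vm $ 1 / D)] :: complex^2)"
  define wm where "wm = (vector [- cnj (vp $ 2 / D), cnj (vp $ 1 / D)] :: complex^2)"
  have c: "cdot u wp = (u $ 1 * vm $ 2 - u $ 2 * vm $ 1) / D" "cdot u wm = (u $ 2 * vp $ 1 - u $ 1 * vp $ 2) / D" for u
    using \<open>D \<noteq> 0\<close> by (simp_all add: cdot_def sum_2 wp_def wm_def vector_2 field_simps)
  have "u = cdot u wp *s vp + cdot u wm *s vm" for u
  proof -
    have "u $ 1 * D = (u $ 1 * vm $ 2 - u $ 2 * vm $ 1) * vp $ 1 + (u $ 2 * vp $ 1 - u $ 1 * vp $ 2) * vm $ 1"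
      "u $ 2 * D = (u $ 1 * vm $ 2 - u $ 2 * vm $ 1) * vp $ 2 + (u $ 2 * vp $ 1 - u $ 1 * vp $ 2) * vm $ 2"
      by (simp_all add: D_def algebra_simps)
    then have "u $ 1 = cdot u wp * vp $ 1 + cdot u wm * vm $ 1" "u $ 2 = cdot u wp * vp $ 2 + cdot u wm * vm $ 2"
      unfolding c times_divide_eq_left add_divide_distrib[symmetric]
      using \<open>D \<noteq> 0\<close> by (simp_all add: eq_divide_eq)
    then show ?thesis by (simp add: vec_eq_iff forall_2)
  qed
  moreover have "cdot vp wp = 1" "cdot vp wm = 0" "cdot vm wp = 0" "cdot vm wm = 1"
    using \<open>D \<noteq> 0\<close> by (simp_all add: c) (simp_all add: D_def algebra_simps)
  ultimately show ?thesis by blast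
qed

text \<open>The product \<open>P\<close> of the two Clifford generators and the scalar
  \<open>t = \<i> * \<sigma>\<close> both have square -1, so \<open>(P - t) (P + t) = 0\<close>:
  every nonzero value of \<open>P + t\<close> is an eigenvector for \<open>t\<close>. As
  \<open>P\<close> anticommutes with \<open>c 2\<close>, applying \<open>c 2\<close> gives an
  eigenvector for \<open>- t\<close>.\<close>

lemma cpair_exists:
  assumes c: "clifford_module c" and s: "\<sigma> = 1 \<or> \<sigma> = - 1"
  shows "\<exists>vp vm wp wm. cpair c \<sigma> vp vm wp wm"
proof -
  have m: "(a *\<^sub>R c 2 + b *\<^sub>R c 3) ** (a *\<^sub>R c 2 + b *\<^sub>R c 3) = - ((a\<^sup>2 + b\<^sup>2) *\<^sub>R mat 1)" for a b :: real
    using c by (simp add: clifford_module_def)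
  have mn: "(- A) *v u = - (A *v u)" for A :: "complex^2^2" and u
    by (simp add: matrix_vector_mult_def vec_eq_iff sum_negf)
  have sm: "(k *\<^sub>R A) *v u = k *\<^sub>R (A *v u)" for k :: real and A :: "complex^2^2" and u
    by (simp add: matrix_vector_mult_def vec_eq_iff scaleR_sum_right)
  have sq: "c 2 *v (c 2 *v u) = - u" "c 3 *v (c 3 *v u) = - u" for u
    using m[of 1 0] m[of 0 1] by (simp_all add: matrix_vector_mul_assoc mn)
  have "(c 2 + c 3) *v ((c 2 + c 3) *v u) = - (2 *\<^sub>R u)" for u
    using m[of 1 1] by (simp add: matrix_vector_mul_assoc mn sm)
  then have ac: "c 2 *v (c 3 *v u) = - (c 3 *v (c 2 *v u))" for u
    by (simp add: matrix_vector_mult_add_rdistrib matrix_vector_right_distrib sq scaleR_2 eq_neg_iff_add_eq_0 algebra_simps)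
  note lin = matrix_vector_right_distrib vector_scalar_commute
  have neg: "A *v (- u) = - (A *v u)" for A :: "complex^2^2" and u
    using vector_scalar_commute[of A "-1" u] by (simp add: vec_eq_iff)
  define P where "P u = c 2 *v (c 3 *v u)" for u
  define t where "t = \<i> * complex_of_real \<sigma>"
  have tt: "t * t = - 1" "t \<noteq> 0" using s by (auto simp: t_def)
  have PP: "P (P u) = - u" for u
    unfolding P_def by (simp add: ac[of "c 2 *v (c 3 *v u)"] sq neg)
  have Pl: "P (u + v) = P u + P v" "P (a *s u) = a *s P u" for u v a
    by (simp_all add: P_def lin)
  \<comment> \<open>Otherwise \<open>P\<close> would be the scalar \<open>- t\<close>, which
    commutes with \<open>c 2\<close>, while \<open>P\<close> anticommutes with it.\<close>
  have "\<exists>u. P u + t *s u \<noteq> 0"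
  proof (rule ccontr)
    assume "\<not> ?thesis"
    then have Pt: "P u = - (t *s u)" for u by (simp add: add_eq_0_iff2)
    have "c 2 *v u = 0" for u
    proof -
      have "P (c 2 *v u) = - (c 2 *v P u)"
        by (simp add: P_def ac[of "c 2 *v u"] ac[of u] sq neg)
      then have "t *s (c 2 *v u) + t *s (c 2 *v u) = 0"
        by (simp add: Pt neg lin add_eq_0_iff2)
      then show ?thesis using tt(2) by (simp add: vec_eq_iff)
    qed
    then have "(u :: complex^2) = 0" for u using sq(1)[of u] by simp
    from this[of "axis 1 1"] show False by (simp add: axis_eq_0_iff)
  qed
  then obtain u where u: "P u + t *s u \<noteq> 0" by blast
  define vp where "vp = P u + t *s u"
  define vm where "vm = c 2 *v vp"
  have Pvp: "P vp = t *s vp"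
    unfolding vp_def using tt(1) by (simp add: Pl PP vec_eq_iff algebra_simps mult.assoc[symmetric])
  have c2m: "c 2 *v vm = - vp" by (simp add: vm_def sq)
  have c3p: "c 3 *v vp = (- t) *s vm"
  proof -
    have "c 2 *v (P vp) = t *s vm" by (simp add: Pvp lin vm_def)
    then have "- (c 3 *v vp) = t *s vm" by (simp add: P_def sq)
    from arg_cong[OF this, of uminus] show ?thesis by (simp add: vec_eq_iff)
  qed
  have "- (c 3 *v vm) = t *s vp" using Pvp ac[of vp] by (simp add: P_def vm_def)
  from arg_cong[OF this, of uminus] have c3m: "c 3 *v vm = (- t) *s vp" by (simp add: vec_eq_iff)
  have Pvm: "P vm = (- t) *s vm"
    by (simp add: P_def c3m lin neg) (simp add: vm_def)
  have "a = 0 \<and> b = 0" if "a *s vp + b *s vm = 0" for a b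
  proof -
    have "P (a *s vp + b *s vm) = 0" using that by (simp add: P_def)
    then have "t *s (a *s vp - b *s vm) = 0" by (simp add: Pl Pvp Pvm vec_eq_iff algebra_simps)
    then have "a *s vp - b *s vm = 0" using tt(2) by (simp add: vec_eq_iff)
    moreover have "(2 * a) *s vp = (a *s vp + b *s vm) + (a *s vp - b *s vm)"
      "(2 * b) *s vm = (a *s vp + b *s vm) - (a *s vp - b *s vm)" by (simp_all add: vec_eq_iff algebra_simps)
    ultimately have "(2 * a) *s vp = 0" "(2 * b) *s vm = 0" using that by simp_all
    moreover have "vp \<noteq> 0" using u vp_def by simp
    moreover have "vm \<noteq> 0" using c2m \<open>vp \<noteq> 0\<close> by auto
    ultimately show ?thesis by (auto simp: vec_eq_iff)
  qed
  from dual_basis_exists[OF this] obtain wp wm where "(\<forall>u. u = cdot u wp *s vp + cdot u wm *s vm) \<and>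
     cdot vp wp = 1 \<and> cdot vp wm = 0 \<and> cdot vm wp = 0 \<and> cdot vm wm = 1" by blast
  then have "cpair c \<sigma> vp vm wp wm"
    unfolding cpair_def using c2m c3p c3m by (simp only: vm_def[symmetric] t_def[symmetric]) simp
  then show ?thesis by blast
qed

lemma cpairD:
  assumes "cpair c \<sigma> vp vm wp wm"
  shows "u = cdot u wp *s vp + cdot u wm *s vm"
    "cdot vp wp = 1" "cdot vp wm = 0" "cdot vm wp = 0" "cdot vm wm = 1" "c 2 *v vp = vm" "c 2 *v vm = - vp"
    "c 3 *v vp = (- (\<i> * of_real \<sigma>)) *s vm" "c 3 *v vm = (- (\<i> * of_real \<sigma>)) *s vp"
  using assms unfolding cpair_def by blast+

lemma cpair_action:
  assumes "cpair c \<sigma> vp vm wp wm"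
  shows "cdot (c 2 *v u) wp = - cdot u wm" "cdot (c 2 *v u) wm = cdot u wp"
    "cdot (c 3 *v u) wp = - (\<i> * of_real \<sigma>) * cdot u wm" "cdot (c 3 *v u) wm = - (\<i> * of_real \<sigma>) * cdot u wp"
proof -
  note C = cpairD(2-)[OF assms]
  have "c k *v u = cdot u wp *s (c k *v vp) + cdot u wm *s (c k *v vm)" for k
    by (subst (1) cpairD(1)[OF assms, of u]) (simp only: matrix_vector_right_distrib vector_scalar_commute)
  from this[of 2] this[of 3]
  have 2: "c 2 *v u = cdot u wp *s vm + (- cdot u wm) *s vp"
    and 3: "c 3 *v u = (- (\<i> * of_real \<sigma>) * cdot u wp) *s vm + (- (\<i> * of_real \<sigma>) * cdot u wm) *s vp"
    unfolding C by (simp_all add: vec_eq_iff algebra_simps)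
  show "cdot (c 2 *v u) wp = - cdot u wm" "cdot (c 2 *v u) wm = cdot u wp"
    unfolding 2 cdot_add cdot_scl C by simp_all
  show "cdot (c 3 *v u) wp = - (\<i> * of_real \<sigma>) * cdot u wm" "cdot (c 3 *v u) wm = - (\<i> * of_real \<sigma>) * cdot u wp"
    unfolding 3 cdot_add cdot_scl C by simp_all
qed

subsection \<open>The weak eigenvalue equation\<close>

definition tens :: "(heis \<Rightarrow> complex) \<Rightarrow> complex^2 \<Rightarrow> spinor_fun" where
  "tens h w = (\<lambda>p. h p *s w)"

definition scal_equiv :: "nat \<Rightarrow> (heis \<Rightarrow> int) \<Rightarrow> (heis \<Rightarrow> complex) \<Rightarrow> bool" where
  "scal_equiv r eps h \<longleftrightarrow>
     (\<forall>\<gamma>\<in>lattice_pts. \<forall>y. h (heis_mult r \<gamma> y) = exp (\<i> * of_real pi * of_int (eps \<gamma>)) * h y)"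

definition Zop :: "nat \<Rightarrow> real \<Rightarrow> real \<Rightarrow> (heis \<Rightarrow> complex) \<Rightarrow> heis \<Rightarrow> complex" where
  "Zop r d \<sigma> h p = along (s_frame r d 2) h p + \<i> * of_real \<sigma> * along (s_frame r d 3) h p"

lemma tens_V0: "continuous_on UNIV h \<Longrightarrow> tens h w \<in> V0"
  unfolding tens_def by (auto intro: continuous_smult continuous_intros)

lemma sec_inner_tens:
  assumes "\<phi> \<in> V0" "continuous_on UNIV h"
  shows "sec_inner \<phi> (tens h w) = sip (\<lambda>p. cdot (\<phi> p) w) h"
  unfolding sec_inner_eq[OF assms(1) tens_V0[OF assms(2)]] sip_def by (simp add: tens_def cdot_scl mult.commute)

lemma sip_tens:
  assumes "continuous_on UNIV f" "continuous_on UNIV h"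
  shows "sec_inner (tens f v) (tens h w) = cdot v w * sip f h"
proof -
  have "sec_inner (tens f v) (tens h w) = integral cub (\<lambda>p. cdot v w * (f p * cnj (h p)))"
    unfolding sec_inner_tens[OF tens_V0[OF assms(1)] assms(2)] sip_def by (simp add: tens_def cdot_scl mult_ac)
  then show ?thesis by (simp add: sip_def)
qed

lemma lat_inv_equiv:
  assumes "scal_equiv r eps f" "scal_equiv r eps g"
  shows "lat_inv r (\<lambda>p. f p * cnj (g p))"
proof -
  have "exp (\<i> * of_real pi * of_int n) * cnj (exp (\<i> * of_real pi * of_int n)) = 1" for n
    by (simp add: complex_norm_square[symmetric] norm_exp_eq_Re del: of_real_power)
  then have "(exp (\<i> * of_real pi * of_int n) * u) * cnj (exp (\<i> * of_real pi * of_int n) * v) = u * cnj v" for n u v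
    by (metis (no_types, lifting) complex_cnj_mult mult.assoc mult.left_commute mult_1)
  then show ?thesis using assms unfolding lat_inv_def scal_equiv_def by simp
qed

lemma equivariant_cdot: "equivariant r eps \<phi> \<Longrightarrow> scal_equiv r eps (\<lambda>p. cdot (\<phi> p) w)"
  by (simp add: equivariant_def scal_equiv_def cdot_scl)

lemma equivariant_tens: "scal_equiv r eps h \<Longrightarrow> equivariant r eps (tens h w)"
  by (simp add: equivariant_def scal_equiv_def tens_def vec_eq_iff)

lemma along_bounded_linear:
  assumes "bounded_linear L" "f differentiable (at p)"
  shows "along X (\<lambda>p. L (f p)) p = L (along X f p)"
proof -
  have "(f has_derivative frechet_derivative f (at p)) (at p)" using assms(2) frechet_derivative_works by blast
  from frechet_derivative_at[OF bounded_linear.has_derivative[OF assms(1) this]]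
  show ?thesis unfolding along_def by metis
qed

lemma smooth_C1: "smooth f \<Longrightarrow> C_k (Suc 0) f"
  by (simp add: smooth_def del: C_k.simps)

lemma smooth_bounded_linear: "bounded_linear L \<Longrightarrow> smooth f \<Longrightarrow> smooth (\<lambda>p. L (f p))"
  by (simp add: smooth_def C_k_bounded_linear)

lemma Zop_cont: "C_k (Suc 0) h \<Longrightarrow> continuous_on UNIV (Zop r d \<sigma> h)"
  unfolding Zop_def[abs_def] by (intro continuous_intros along_frame_cont)

lemma sub_dirac_cont:
  assumes rd: "r > 0" "d > 0" and K: "koszul_connection r d nabla" and \<phi>: "C_k (Suc 0) \<phi>"
  shows "sub_dirac r d nabla c \<phi> \<in> V0"
proof -
  have "sub_dirac r d nabla c \<phi> = (\<lambda>p. c 2 *v along (s_frame r d 2) \<phi> p + c 3 *v along (s_frame r d 3) \<phi> p)"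
    by (rule ext) (rule sub_dirac_eq[OF rd K])
  moreover have "continuous_on UNIV (\<lambda>p. c k *v along (s_frame r d k) \<phi> p)" for k
    by (rule bounded_linear.continuous_on[OF matrix_vector_mul_bounded_linear along_frame_cont[OF \<phi>]])
  ultimately show ?thesis by (auto intro: continuous_intros)
qed

text \<open>Pairing with \<open>wp\<close> and \<open>wm\<close> reads off scalar components, and
  skewness of the frame derivatives moves them to \<open>h\<close>. The sign of
  \<open>\<sigma>\<close> flips in the first identity, because skewness and conjugation in the
  second argument act together on the imaginary term.\<close>

lemma dirac_weak:
  assumes rd: "r > 0" "d > 0" and K: "koszul_connection r d nabla" and c: "cpair c \<sigma> vp vm wp wm"
    and \<phi>: "\<phi> \<in> smooth_sections r eps" and h: "C_k (Suc 0) h" "scal_equiv r eps h"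
  shows "sec_inner (sub_dirac r d nabla c \<phi>) (tens h wp) = sec_inner \<phi> (tens (Zop r d (- \<sigma>) h) wm)"
    and "sec_inner (sub_dirac r d nabla c \<phi>) (tens h wm) = - sec_inner \<phi> (tens (Zop r d \<sigma> h) wp)"
proof -
  let ?D = "sub_dirac r d nabla c \<phi>"
  have sm: "smooth \<phi>" and eq: "equivariant r eps \<phi>" using \<phi> by (auto simp: smooth_sections_def)
  define fp fm where "fp = (\<lambda>p. cdot (\<phi> p) wp)" and "fm = (\<lambda>p. cdot (\<phi> p) wm)"
  have C: "C_k (Suc 0) fp" "C_k (Suc 0) fm" unfolding fp_def fm_def
    by (intro smooth_C1 smooth_bounded_linear[OF bounded_linear_cdot sm])+
  have E: "scal_equiv r eps fp" "scal_equiv r eps fm" unfolding fp_def fm_def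
    by (intro equivariant_cdot eq)+
  have cA: "continuous_on UNIV (along (s_frame r d k) f)" if "C_k (Suc 0) f" for k and f :: "heis \<Rightarrow> complex"
    by (rule along_frame_cont[OF that])
  have al: "along (s_frame r d k) fp p = cdot (along (s_frame r d k) \<phi> p) wp"
    "along (s_frame r d k) fm p = cdot (along (s_frame r d k) \<phi> p) wm" for k p
    unfolding fp_def fm_def
    by (rule along_bounded_linear[OF bounded_linear_cdot C_1D(1)[OF smooth_C1[OF sm]]])+
  have Dp: "cdot (?D p) wp = - along (s_frame r d 2) fm p - \<i> * of_real \<sigma> * along (s_frame r d 3) fm p"
    "cdot (?D p) wm = along (s_frame r d 2) fp p - \<i> * of_real \<sigma> * along (s_frame r d 3) fp p" for p
    unfolding sub_dirac_eq[OF rd K] cdot_add cpair_action[OF c] al by simp_all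
  note V = sub_dirac_cont[OF rd K smooth_C1[OF sm], of c]
  have phV: "\<phi> \<in> V0" using C_1D(3)[OF smooth_C1[OF sm]] by simp
  note hc = C_1D(3)[OF h(1)]
  note sk = sip_skew(1)[OF _ h(1) lat_inv_equiv[OF _ h(2)]]
  have lin: "integral cub (\<lambda>p. a * f p + b * g p) = a * integral cub f + b * integral cub g"
    if "continuous_on UNIV f" "continuous_on UNIV g" for a b :: complex and f g :: "heis \<Rightarrow> complex"
  proof -
    have "integral cub (\<lambda>p. a * f p + b * g p) = integral cub (\<lambda>p. a * f p) + integral cub (\<lambda>p. b * g p)"
      by (rule integral_add; rule integrable_cub; intro continuous_intros that)
    then show ?thesis by simp
  qed
  have L: "sip (\<lambda>p. a * f p + b * g p) h = a * sip f h + b * sip g h"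
    if "continuous_on UNIV f" "continuous_on UNIV g" for a b and f g :: "heis \<Rightarrow> complex"
  proof -
    have "sip (\<lambda>p. a * f p + b * g p) h = integral cub (\<lambda>p. a * (f p * cnj (h p)) + b * (g p * cnj (h p)))"
      by (simp add: sip_def algebra_simps)
    also have "\<dots> = a * sip f h + b * sip g h" unfolding sip_def
      by (rule lin) (intro continuous_intros that hc)+
    finally show ?thesis .
  qed
  have R: "sip f (Zop r d s h) = sip f (along (s_frame r d 2) h) - \<i> * of_real s * sip f (along (s_frame r d 3) h)"
    if "continuous_on UNIV f" for s and f :: "heis \<Rightarrow> complex"
  proof -
    have "sip f (Zop r d s h) = integral cub (\<lambda>p. 1 * (f p * cnj (along (s_frame r d 2) h p)) +
       (- (\<i> * of_real s)) * (f p * cnj (along (s_frame r d 3) h p)))"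
      by (simp add: sip_def Zop_def algebra_simps)
    also have "\<dots> = 1 * sip f (along (s_frame r d 2) h) + (- (\<i> * of_real s)) * sip f (along (s_frame r d 3) h)"
      unfolding sip_def by (rule lin) (intro continuous_intros that cA h(1))+
    finally show ?thesis by simp
  qed
  have "sec_inner ?D (tens h wp) = sip (\<lambda>p. (- 1) * along (s_frame r d 2) fm p + (- (\<i> * of_real \<sigma>)) * along (s_frame r d 3) fm p) h"
    unfolding sec_inner_tens[OF V hc] Dp by simp
  also have "\<dots> = sip fm (Zop r d (- \<sigma>) h)"
    unfolding L[OF cA[OF C(2)] cA[OF C(2)]] sk[OF C(2) E(2)] R[OF C_1D(3)[OF C(2)]] by simp
  also have "\<dots> = sec_inner \<phi> (tens (Zop r d (- \<sigma>) h) wm)"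
    unfolding sec_inner_tens[OF phV Zop_cont[OF h(1)]] fm_def ..
  finally show "sec_inner ?D (tens h wp) = sec_inner \<phi> (tens (Zop r d (- \<sigma>) h) wm)" .
  have "sec_inner ?D (tens h wm) = sip (\<lambda>p. 1 * along (s_frame r d 2) fp p + (- (\<i> * of_real \<sigma>)) * along (s_frame r d 3) fp p) h"
    unfolding sec_inner_tens[OF V hc] Dp by simp
  also have "\<dots> = - sip fp (Zop r d \<sigma> h)"
    unfolding L[OF cA[OF C(1)] cA[OF C(1)]] sk[OF C(1) E(1)] R[OF C_1D(3)[OF C(1)]] by simp
  also have "\<dots> = - sec_inner \<phi> (tens (Zop r d \<sigma> h) wp)"
    unfolding sec_inner_tens[OF phV Zop_cont[OF h(1)]] fp_def ..
  finally show "sec_inner ?D (tens h wm) = - sec_inner \<phi> (tens (Zop r d \<sigma> h) wp)" .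
qed

lemma eigenspaceD:
  assumes "\<Phi> \<in> eigenspace r eps T \<mu>"
  obtains f where "\<Phi> \<in> L2 r eps" "\<And>k. f k \<in> smooth_sections r eps"
    "(\<lambda>k. L2_dist (L2_embed (f k)) \<Phi>) \<longlonglongrightarrow> 0"
    "(\<lambda>k. L2_dist (L2_embed (T (f k))) (lscl (of_real \<mu>) \<Phi>)) \<longlonglongrightarrow> 0"
  using assms unfolding eigenspace_def closure_graph_def L2_scale_eq by auto

text \<open>The weak equation holds for the approximating smooth sections; in it both sides are
  pairings with fixed continuous functions, so it survives the limit that defines the
  closure.\<close>

lemma eigenspace_weak:
  assumes rd: "r > 0" "d > 0" and K: "koszul_connection r d nabla" and c: "cpair c \<sigma> vp vm wp wm"
    and \<Phi>: "\<Phi> \<in> eigenspace r eps (sub_dirac r d nabla c) \<mu>" and h: "C_k (Suc 0) h" "scal_equiv r eps h"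
  shows "of_real \<mu> * S.lip \<Phi> (L2_embed (tens h wp)) = S.lip \<Phi> (L2_embed (tens (Zop r d (- \<sigma>) h) wm))"
    and "of_real \<mu> * S.lip \<Phi> (L2_embed (tens h wm)) = - S.lip \<Phi> (L2_embed (tens (Zop r d \<sigma> h) wp))"
proof -
  let ?T = "sub_dirac r d nabla c"
  obtain f where f: "\<Phi> \<in> L2 r eps" "\<And>k. f k \<in> smooth_sections r eps"
    "(\<lambda>k. L2_dist (L2_embed (f k)) \<Phi>) \<longlonglongrightarrow> 0"
    "(\<lambda>k. L2_dist (L2_embed (?T (f k))) (lscl (of_real \<mu>) \<Phi>)) \<longlonglongrightarrow> 0"
    using eigenspaceD[OF \<Phi>] by blast
  have C: "\<Phi> \<in> S.Cseq" using f(1) L2_Cseq by blast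
  have sV: "f k \<in> V0" for k using f(2) sections_V0 by blast
  have TV: "?T (f k) \<in> V0" for k
    by (rule sub_dirac_cont[OF rd K]) (use f(2) in \<open>auto simp: smooth_sections_def intro!: smooth_C1 simp del: C_k.simps\<close>)
  have tV: "tens g w \<in> V0" if "continuous_on UNIV g" for g w using that by (rule tens_V0)
  note hc = C_1D(3)[OF h(1)]
  have 1: "(\<lambda>k. sec_inner (f k) (tens g w)) \<longlonglongrightarrow> S.lip \<Phi> (L2_embed (tens g w))"
    if "continuous_on UNIV g" for g w
    by (rule lip_limit[OF sV C tV[OF that] f(3)])
  have 2: "(\<lambda>k. sec_inner (?T (f k)) (tens h w)) \<longlonglongrightarrow> of_real \<mu> * S.lip \<Phi> (L2_embed (tens h w))" for w
    using lip_limit[OF TV L.scl_in[OF C] tV[OF hc] f(4)] by (simp add: L.ip_scl[OF C embed_Cseq[OF tV[OF hc]]])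
  show "of_real \<mu> * S.lip \<Phi> (L2_embed (tens h wp)) = S.lip \<Phi> (L2_embed (tens (Zop r d (- \<sigma>) h) wm))"
    using LIMSEQ_unique[OF 2[of wp]] 1[OF Zop_cont[OF h(1)]] dirac_weak(1)[OF rd K c f(2) h] by simp
  show "of_real \<mu> * S.lip \<Phi> (L2_embed (tens h wm)) = - S.lip \<Phi> (L2_embed (tens (Zop r d \<sigma> h) wp))"
    using LIMSEQ_unique[OF 2[of wm]] tendsto_minus[OF 1[OF Zop_cont[OF h(1)]]] dirac_weak(2)[OF rd K c f(2) h] by simp
qed

lemma cdot_diff: "cdot u (v - w) = cdot u v - cdot u w"
  by (simp add: cdot_def sum_2 algebra_simps)

text \<open>An arbitrary spinor is a combination of \<open>wp\<close> and \<open>wm\<close>, so the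
  two components treated by the weak equation determine all pairings.\<close>

lemma lip_tens_cpair:
  assumes c: "cpair c \<sigma> vp vm wp wm" and \<Phi>: "\<Phi> \<in> S.Cseq" and h: "continuous_on UNIV h"
  shows "S.lip \<Phi> (L2_embed (tens h w)) = cdot vp w * S.lip \<Phi> (L2_embed (tens h wp)) + cdot vm w * S.lip \<Phi> (L2_embed (tens h wm))"
proof -
  have "w = cnj (cdot vp w) *s wp + cnj (cdot vm w) *s wm"
  proof -
    have *: "cdot u w = cdot u (cnj (cdot vp w) *s wp + cnj (cdot vm w) *s wm)" for u
      by (subst (1) cpairD(1)[OF c, of u]) (simp add: cdot_add cdot_scl mult.commute)
    have "cdot u (w - (cnj (cdot vp w) *s wp + cnj (cdot vm w) *s wm)) = 0" for u
      unfolding cdot_diff right_minus_eq by (rule *)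
    from this[of "w - (cnj (cdot vp w) *s wp + cnj (cdot vm w) *s wm)"] show ?thesis
      by (simp add: cdot_self)
  qed
  then have "tens h w = (\<lambda>p. tens h (cnj (cdot vp w) *s wp + cnj (cdot vm w) *s wm) p)" by simp
  also have "\<dots> = sadd (sscl (cnj (cdot vp w)) (tens h wp)) (sscl (cnj (cdot vm w)) (tens h wm))"
    by (simp add: tens_def fun_eq_iff vec_eq_iff algebra_simps)
  finally have "L2_embed (tens h w) = ladd (lscl (cnj (cdot vp w)) (L2_embed (tens h wp))) (lscl (cnj (cdot vm w)) (L2_embed (tens h wm)))"
    by (simp add: L2_embed_def)
  then show ?thesis using embed_Cseq[OF tens_V0[OF h]] \<Phi>
    by (simp add: L.ip_add_right L.ip_scl_right L.scl_in)
qed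

subsection \<open>Eigenspaces\<close>

lemma along_add:
  assumes "f differentiable (at p)" "g differentiable (at p)"
  shows "along X (\<lambda>p. f p + g p) p = along X f p + along X g p"
proof -
  have "(f has_derivative frechet_derivative f (at p)) (at p)" "(g has_derivative frechet_derivative g (at p)) (at p)"
    using assms frechet_derivative_works by blast+
  from frechet_derivative_at[OF has_derivative_add[OF this]] show ?thesis unfolding along_def by metis
qed

lemma bounded_linear_scal: "bounded_linear (\<lambda>v::complex^2. a *s v)"
proof (rule bounded_linear_intro[where K = "cmod a"])
  show "norm (a *s v) \<le> norm v * cmod a" for v :: "complex^2"
    by (simp add: norm_smult)
qed (simp_all add: vec_eq_iff algebra_simps)

lemma smooth_sections_add:
  assumes "f \<in> smooth_sections r eps" "g \<in> smooth_sections r eps"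
  shows "sadd f g \<in> smooth_sections r eps"
  using assms by (auto simp: smooth_sections_def smooth_def equivariant_def vec_eq_iff algebra_simps intro!: C_k_add)

lemma smooth_sections_scl:
  assumes "f \<in> smooth_sections r eps"
  shows "sscl a f \<in> smooth_sections r eps"
  using assms by (auto simp: smooth_sections_def smooth_def equivariant_def vec_eq_iff algebra_simps
    intro!: C_k_bounded_linear[OF bounded_linear_scal])

lemma cont_sections_add:
  assumes "f \<in> cont_sections r eps" "g \<in> cont_sections r eps"
  shows "sadd f g \<in> cont_sections r eps"
  using assms by (auto simp: cont_sections_def equivariant_def vec_eq_iff algebra_simps intro!: continuous_intros)

lemma cont_sections_scl:
  assumes "f \<in> cont_sections r eps"
  shows "sscl a f \<in> cont_sections r eps"
  using assms by (auto simp: cont_sections_def equivariant_def vec_eq_iff algebra_simps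
    intro!: bounded_linear.continuous_on[OF bounded_linear_scal])

lemma L2_add: "\<Phi> \<in> L2 r eps \<Longrightarrow> \<Psi> \<in> L2 r eps \<Longrightarrow> ladd \<Phi> \<Psi> \<in> L2 r eps"
  using L.add_in cont_sections_add by (simp add: L2_Cseq)

lemma L2_scl: "\<Phi> \<in> L2 r eps \<Longrightarrow> lscl a \<Phi> \<in> L2 r eps"
  using L.scl_in cont_sections_scl by (simp add: L2_Cseq)

lemma smooth_section_diff: "f \<in> smooth_sections r eps \<Longrightarrow> C_k (Suc 0) f"
  unfolding smooth_sections_def by (auto intro: smooth_C1 simp del: C_k.simps)

text \<open>Uniqueness of the Hilbert dimension rests on Bessel's inequality inside a
  subspace.\<close>

lemma eigenspace_subsp:
  assumes rd: "r > 0" "d > 0" and K: "koszul_connection r d nabla"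
  shows "L.subsp (eigenspace r eps (sub_dirac r d nabla c) \<mu>)"
proof -
  let ?T = "sub_dirac r d nabla c" and ?K = "eigenspace r eps (sub_dirac r d nabla c) \<mu>"
  have T_add: "?T (sadd f g) = sadd (?T f) (?T g)" if f: "C_k (Suc 0) f" and g: "C_k (Suc 0) g" for f g
    by (rule ext) (simp add: sub_dirac_eq[OF rd K] along_add[OF C_1D(1)[OF f] C_1D(1)[OF g]] matrix_vector_right_distrib)
  have T_scl: "?T (sscl a f) = sscl a (?T f)" if f: "C_k (Suc 0) f" for f a
    unfolding sub_dirac_eq[OF rd K, abs_def] along_bounded_linear[OF bounded_linear_scal[of a] C_1D(1)[OF f]]
      vector_scalar_commute by (simp add: vec_eq_iff fun_eq_iff algebra_simps)
  have TV: "?T f \<in> V0" if "f \<in> smooth_sections r eps" for f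
    by (rule sub_dirac_cont[OF rd K smooth_section_diff[OF that]])
  have sV: "f \<in> V0" if "f \<in> smooth_sections r eps" for f using that sections_V0 by blast
  show ?thesis unfolding L.subsp_def
  proof (intro conjI ballI allI subsetI)
    show "\<Phi> \<in> S.Cseq" if "\<Phi> \<in> ?K" for \<Phi>
      using that by (auto simp: eigenspace_def closure_graph_def L2_Cseq)
    show "ladd \<Phi> \<Psi> \<in> ?K" if \<Phi>: "\<Phi> \<in> ?K" and \<Psi>: "\<Psi> \<in> ?K" for \<Phi> \<Psi>
    proof -
      obtain f where f: "\<Phi> \<in> L2 r eps" "\<And>k. f k \<in> smooth_sections r eps"
        "(\<lambda>k. L2_dist (L2_embed (f k)) \<Phi>) \<longlonglongrightarrow> 0"
        "(\<lambda>k. L2_dist (L2_embed (?T (f k))) (lscl (of_real \<mu>) \<Phi>)) \<longlonglongrightarrow> 0"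
        using eigenspaceD[OF \<Phi>] by blast
      obtain g where g: "\<Psi> \<in> L2 r eps" "\<And>k. g k \<in> smooth_sections r eps"
        "(\<lambda>k. L2_dist (L2_embed (g k)) \<Psi>) \<longlonglongrightarrow> 0"
        "(\<lambda>k. L2_dist (L2_embed (?T (g k))) (lscl (of_real \<mu>) \<Psi>)) \<longlonglongrightarrow> 0"
        using eigenspaceD[OF \<Psi>] by blast
      have C: "\<Phi> \<in> S.Cseq" "\<Psi> \<in> S.Cseq" using f(1) g(1) L2_Cseq by blast+
      have key: "(\<lambda>k. L2_dist (L2_embed (sadd (a k) (b k))) (ladd A B)) \<longlonglongrightarrow> 0"
        if "\<And>k. a k \<in> V0" "\<And>k. b k \<in> V0" "A \<in> S.Cseq" "B \<in> S.Cseq"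
          "(\<lambda>k. L2_dist (L2_embed (a k)) A) \<longlonglongrightarrow> 0" "(\<lambda>k. L2_dist (L2_embed (b k)) B) \<longlonglongrightarrow> 0"
        for a b :: "nat \<Rightarrow> spinor_fun" and A B
      proof (rule tendsto_sandwich[OF _ _ tendsto_const tendsto_add_zero[OF that(5,6)]])
        have e: "L2_embed (sadd (a k) (b k)) = ladd (L2_embed (a k)) (L2_embed (b k))" for k
          by (simp add: L2_embed_def)
        note E = embed_Cseq[OF that(1)] embed_Cseq[OF that(2)]
        have A: "L2_embed (sadd (a k) (b k)) \<in> S.Cseq" for k unfolding e by (rule L.add_in[OF E])
        show "\<forall>\<^sub>F k in sequentially. 0 \<le> L2_dist (L2_embed (sadd (a k) (b k))) (ladd A B)"
          unfolding L2_dist_eq[OF A L.add_in[OF that(3,4)]]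
          by (intro always_eventually allI L.dst_nonneg A L.add_in that(3,4))
        show "\<forall>\<^sub>F k in sequentially. L2_dist (L2_embed (sadd (a k) (b k))) (ladd A B) \<le>
           L2_dist (L2_embed (a k)) A + L2_dist (L2_embed (b k)) B"
          unfolding L2_dist_eq[OF A L.add_in[OF that(3,4)]] L2_dist_eq[OF E(1) that(3)] L2_dist_eq[OF E(2) that(4)]
          unfolding e by (intro always_eventually allI L.dst_add E that(3,4))
      qed
      have "lscl (of_real \<mu>) (ladd \<Phi> \<Psi>) = ladd (lscl (of_real \<mu>) \<Phi>) (lscl (of_real \<mu>) \<Psi>)"
        by (simp add: fun_eq_iff vec_eq_iff algebra_simps)
      moreover have "?T (sadd (f k) (g k)) = sadd (?T (f k)) (?T (g k))" for k
        by (rule T_add[OF smooth_section_diff[OF f(2)] smooth_section_diff[OF g(2)]])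
      ultimately show ?thesis
        unfolding eigenspace_def closure_graph_def mem_Collect_eq case_prod_conv L2_scale_eq
        by (auto intro!: exI[of _ "\<lambda>k. sadd (f k) (g k)"] L2_add L2_scl smooth_sections_add f g key sV TV C L.scl_in)
    qed
    show "lscl a \<Phi> \<in> ?K" if \<Phi>: "\<Phi> \<in> ?K" for a \<Phi>
    proof -
      obtain f where f: "\<Phi> \<in> L2 r eps" "\<And>k. f k \<in> smooth_sections r eps"
        "(\<lambda>k. L2_dist (L2_embed (f k)) \<Phi>) \<longlonglongrightarrow> 0"
        "(\<lambda>k. L2_dist (L2_embed (?T (f k))) (lscl (of_real \<mu>) \<Phi>)) \<longlonglongrightarrow> 0"
        using eigenspaceD[OF \<Phi>] by blast
      have C: "\<Phi> \<in> S.Cseq" using f(1) L2_Cseq by blast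
      have key: "(\<lambda>k. L2_dist (L2_embed (sscl a (b k))) (lscl a A)) \<longlonglongrightarrow> 0"
        if "\<And>k. b k \<in> V0" "A \<in> S.Cseq" "(\<lambda>k. L2_dist (L2_embed (b k)) A) \<longlonglongrightarrow> 0"
        for b :: "nat \<Rightarrow> spinor_fun" and A
      proof -
        have e: "L2_embed (sscl a (b k)) = lscl a (L2_embed (b k))" for k
          by (simp add: L2_embed_def)
        note E = embed_Cseq[OF that(1)]
        have "L2_dist (L2_embed (sscl a (b k))) (lscl a A) = cmod a * L2_dist (L2_embed (b k)) A" for k
          unfolding e L2_dist_eq[OF L.scl_in[OF E] L.scl_in[OF that(2)]] L2_dist_eq[OF E that(2)]
          by (rule L.dst_scl[OF E that(2)])
        then show ?thesis using tendsto_mult_left[OF that(3), of "cmod a"] by simp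
      qed
      have 1: "lscl (of_real \<mu>) (lscl a \<Phi>) = lscl a (lscl (of_real \<mu>) \<Phi>)"
        by (simp add: fun_eq_iff vec_eq_iff algebra_simps)
      have 2: "?T (sscl a (f k)) = sscl a (?T (f k))" for k
        by (rule T_scl[OF smooth_section_diff[OF f(2)]])
      have "(\<lambda>k. L2_dist (L2_embed (?T (sscl a (f k)))) (lscl (of_real \<mu>) (lscl a \<Phi>))) \<longlonglongrightarrow> 0"
        unfolding 1 2 by (rule key[OF TV[OF f(2)] L.scl_in[OF C] f(4)])
      then show ?thesis
        unfolding eigenspace_def closure_graph_def mem_Collect_eq case_prod_conv L2_scale_eq
        using L2_scl[OF f(1)] L2_scl[OF L2_scl[OF f(1)]] smooth_sections_scl[OF f(2)] key[OF sV[OF f(2)] C f(3)]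
        by (intro conjI exI[of _ "\<lambda>k. sscl a (f k)"] allI) simp_all
    qed
  qed
qed

lemma embed_eigenvector:
  assumes rd: "r > 0" "d > 0" and K: "koszul_connection r d nabla"
    and \<psi>: "\<psi> \<in> smooth_sections r eps" and e: "sub_dirac r d nabla c \<psi> = sscl (of_real \<mu>) \<psi>"
  shows "L2_embed \<psi> \<in> eigenspace r eps (sub_dirac r d nabla c) \<mu>"
proof -
  have \<psi>C: "\<psi> \<in> cont_sections r eps" and \<psi>V: "\<psi> \<in> V0" using \<psi> sections_V0 by blast+
  then have 1: "L2_embed \<psi> \<in> L2 r eps" by (simp add: L2_Cseq embed_Cseq) (simp add: L2_embed_def)
  have "L2_dist A A = 0" if "A \<in> S.Cseq" for A using L2_dist_eq[OF that that] L.dst_self[OF that] by simp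
  moreover have "lscl (of_real \<mu>) (L2_embed \<psi>) = L2_embed (sscl (of_real \<mu>) \<psi>)" by (simp add: L2_embed_def)
  ultimately show ?thesis
    unfolding eigenspace_def closure_graph_def mem_Collect_eq case_prod_conv L2_scale_eq
    using e 1 \<psi> L2_scl[OF 1, of "of_real \<mu>"] embed_Cseq[OF \<psi>V] embed_Cseq[OF S.scl_in[OF \<psi>V]]
    by (auto intro!: exI[of _ "\<lambda>k. \<psi>"])
qed

text \<open>Strong counterpart of the weak equation; it turns solutions of the two scalar equations
  into eigenvectors.\<close>

lemma dirac_tens:
  assumes rd: "r > 0" "d > 0" and K: "koszul_connection r d nabla" and c: "cpair c \<sigma> vp vm wp wm"
    and f: "C_k (Suc 0) f" and g: "C_k (Suc 0) g"
  shows "sub_dirac r d nabla c (sadd (tens f vp) (tens g vm)) =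
    sadd (tens (\<lambda>p. - Zop r d \<sigma> g p) vp) (tens (Zop r d (- \<sigma>) f) vm)"
proof
  fix p
  have al: "along X (tens h v) p = along X h p *s v" if "C_k (Suc 0) h" for X h v
    unfolding tens_def by (rule along_bounded_linear[OF bounded_linear_smult C_1D(1)[OF that]])
  have df: "tens h v differentiable (at p)" if "C_k (Suc 0) h" for h v
    using bounded_linear.has_derivative[OF bounded_linear_smult, of h _ "at p" v] C_1D(1)[OF that, of p]
    unfolding differentiable_def tens_def by blast
  show "sub_dirac r d nabla c (sadd (tens f vp) (tens g vm)) p =
    (tens (\<lambda>p. - Zop r d \<sigma> g p) vp p) + (tens (Zop r d (- \<sigma>) f) vm p)"
    unfolding sub_dirac_eq[OF rd K] along_add[OF df[OF f] df[OF g]] al[OF f] al[OF g]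
      matrix_vector_right_distrib vector_scalar_commute cpairD(6-)[OF c]
    by (simp add: tens_def Zop_def vec_eq_iff algebra_simps)
qed

subsection \<open>The character\<close>

lemma cis_pi_even: "even n \<Longrightarrow> cis (pi * of_int n) = 1"
proof (elim evenE)
  fix k assume "n = 2 * k"
  then show "cis (pi * of_int n) = 1" using cis_multiple_2pi[of "of_int k"] by (simp add: mult.commute mult.left_commute)
qed

lemma cis_pi_cong: "even (m - n) \<Longrightarrow> cis (pi * of_int m) = cis (pi * of_int n)"
  using cis_pi_even[of "m - n"] cis_mult[of "pi * of_int (m - n)" "pi * of_int n"] by (simp add: algebra_simps)

lemma cis_pi_odd: "odd n \<Longrightarrow> cis (pi * of_int n) \<noteq> 1"
  using cis_pi_cong[of n 1] by simp

lemma int_character: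
  fixes g :: "int \<Rightarrow> complex"
  assumes mult: "\<And>a b. g (a + b) = g a * g b" and g1: "g 1 = cis (pi * of_int e)" and nz: "g 0 \<noteq> 0"
  shows "g a = cis (pi * of_int (e * a))"
proof (induction a rule: int_induct[where k = 0])
  case base
  show ?case using mult[of 0 0] nz by simp
next
  case (step1 i)
  then show ?case using mult[of i 1] g1 by (simp add: cis_mult algebra_simps)
next
  case (step2 i)
  have "g i = g (i - 1) * g 1" using mult[of "i - 1" 1] by simp
  then have "g (i - 1) * cis (pi * of_int e) = cis (pi * of_int (e * (i - 1))) * cis (pi * of_int e)"
    using step2 g1 by (simp add: cis_mult algebra_simps)
  then show ?case by simp
qed

text \<open>The values of \<open>eps\<close> add only modulo 2, but the signs
  \<open>exp (\<i> * pi * eps)\<close> multiply, so they are determined by three generators.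
  Computing the product of the generators of the second and third coordinate in both orders yields a
  factor from the \<open>r\<close>-th power of the central generator, whose sign must therefore be
  1.\<close>

lemma eps_character:
  assumes eps: "eps \<in> hom (heis_lattice r) (integer_mod_group 2)"
  shows "\<And>\<gamma>. \<gamma> \<in> lattice_pts \<Longrightarrow> eps \<gamma> \<in> {0, 1}"
    and "exp (\<i> * of_real pi * of_int (eps ((of_int a, of_int b), of_int k))) =
      cis (pi * of_int (eps ((1, 0), 0) * a + eps ((0, 1), 0) * b + eps ((0, 0), 1) * k))"
    and "even (int r * eps ((1, 0), 0))"
proof -
  have car: "eps \<gamma> \<in> {0..<2}" if "\<gamma> \<in> lattice_pts" for \<gamma>
    using hom_in_carrier[OF eps, of \<gamma>] that by (simp add: heis_lattice_def integer_mod_group_def)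
  show "\<And>\<gamma>. \<gamma> \<in> lattice_pts \<Longrightarrow> eps \<gamma> \<in> {0, 1}" using car by fastforce
  have hm: "eps (heis_mult r \<gamma> \<delta>) = (eps \<gamma> + eps \<delta>) mod 2" if "\<gamma> \<in> lattice_pts" "\<delta> \<in> lattice_pts" for \<gamma> \<delta>
    using hom_mult[OF eps, of \<gamma> \<delta>] that by (simp add: heis_lattice_def heis_group_def integer_mod_group_def)
  define X where "X \<gamma> = cis (pi * of_int (eps \<gamma>))" for \<gamma>
  have X: "X (heis_mult r \<gamma> \<delta>) = X \<gamma> * X \<delta>" if "\<gamma> \<in> lattice_pts" "\<delta> \<in> lattice_pts" for \<gamma> \<delta>
  proof -
    have "X (heis_mult r \<gamma> \<delta>) = cis (pi * of_int (eps \<gamma> + eps \<delta>))"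
      unfolding X_def hm[OF that] by (rule cis_pi_cong) presburger
    then show ?thesis by (simp add: X_def cis_mult algebra_simps)
  qed
  have lat: "((of_int a, of_int b), of_int k) \<in> lattice_pts" for a b k by (simp add: lattice_pts_def)
  have Xm: "X ((of_int (a + a') + real r * of_int k * of_int b', of_int (b + b')), of_int (k + k')) =
     X ((of_int a, of_int b), of_int k) * X ((of_int a', of_int b'), of_int k')" for a b k a' b' k'
    using X[OF lat lat, of a b k a' b' k'] by (simp add: heis_mult_def A_map_def algebra_simps)
  have nz: "X \<gamma> \<noteq> 0" for \<gamma> by (simp add: X_def)
  have 1: "X ((of_int a, 0), 0) = cis (pi * of_int (eps ((1, 0), 0) * a))" for a
    using int_character[of "\<lambda>a. X ((of_int a, 0), 0)" "eps ((1, 0), 0)" a] Xm[of _ _ 0 0 0 0] nz by (simp add: X_def)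
  have 2: "X ((0, of_int a), 0) = cis (pi * of_int (eps ((0, 1), 0) * a))" for a
    using int_character[of "\<lambda>a. X ((0, of_int a), 0)" "eps ((0, 1), 0)" a] Xm[of 0 0 0 _ _ 0] nz by (simp add: X_def)
  have 3: "X ((0, 0), of_int a) = cis (pi * of_int (eps ((0, 0), 1) * a))" for a
    using int_character[of "\<lambda>a. X ((0, 0), of_int a)" "eps ((0, 0), 1)" a] Xm[of 0 0 _ 0 0 _] nz by (simp add: X_def)
  have all: "X ((of_int a, of_int b), of_int k) =
     cis (pi * of_int (eps ((1, 0), 0) * a + eps ((0, 1), 0) * b + eps ((0, 0), 1) * k))" for a b k
    using Xm[of a 0 0 b 0 k] Xm[of 0 0 0 0 b k] by (simp add: 1 2 3 cis_mult algebra_simps)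
  then show "exp (\<i> * of_real pi * of_int (eps ((of_int a, of_int b), of_int k))) =
      cis (pi * of_int (eps ((1, 0), 0) * a + eps ((0, 1), 0) * b + eps ((0, 0), 1) * k))"
    by (simp add: X_def cis_conv_exp mult.assoc)
  have "X ((of_int (int r), of_int 1), of_int 1) = X ((0, 0), 1) * X ((0, 1), 0)"
    using Xm[of 0 0 1 1 0 0] by simp
  then have "cis (pi * of_int (eps ((1, 0), 0) * int r)) * (X ((0, 0), 1) * X ((0, 1), 0)) = X ((0, 0), 1) * X ((0, 1), 0)"
  proof -
    have "X ((of_int (int r), of_int 1), of_int 1) =
        cis (pi * of_int (eps ((1, 0), 0) * int r)) * (X ((0, 0), 1) * X ((0, 1), 0))"
      using 2[of 1] 3[of 1] unfolding all by (simp add: cis_mult algebra_simps)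
    with \<open>X ((of_int (int r), of_int 1), of_int 1) = X ((0, 0), 1) * X ((0, 1), 0)\<close> show ?thesis by simp
  qed
  then have "cis (pi * of_int (eps ((1, 0), 0) * int r)) = 1" using nz by simp
  then show "even (int r * eps ((1, 0), 0))" using cis_pi_odd by (metis mult.commute)
qed

subsection \<open>Theta series\<close>

text \<open>Quadratic decay is the weakest convenient rate for which the sums over integer
  translates converge; \<open>wt\<close> below is the resulting majorant.\<close>

definition decay :: "real \<Rightarrow> (real \<Rightarrow> complex) \<Rightarrow> bool" where
  "decay C u \<longleftrightarrow> (\<forall>t. (1 + t\<^sup>2) * cmod (u t) \<le> C)"

definition wt :: "int \<Rightarrow> real" where "wt k = 1 / (1 + (of_int k)\<^sup>2)"

lemma wt_pos: "wt k > 0"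
  by (simp add: wt_def add_pos_nonneg)

lemma summable_wt: "summable (\<lambda>n. wt (int n))"
proof (rule summable_comparison_test'[where N = 1])
  show "summable (\<lambda>n. inverse (real n ^ 2))" by (rule inverse_power_summable) simp
  show "norm (wt (int n)) \<le> inverse (real n ^ 2)" if "1 \<le> n" for n
    using that by (simp add: wt_def divide_simps add_pos_nonneg)
qed

lemma wt_summable_on: "wt summable_on UNIV"
proof -
  have n: "(\<lambda>n. wt (int n)) summable_on A" for A
    by (rule summable_on_subset_banach[of _ UNIV])
       (use summable_wt wt_pos in \<open>auto intro!: norm_summable_imp_summable_on simp: less_imp_le\<close>)
  have "wt summable_on (int ` UNIV)"
    by (subst summable_on_reindex) (use n in \<open>auto simp: o_def\<close>)
  moreover have "wt summable_on ((\<lambda>n. - int n) ` UNIV)"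
    by (subst summable_on_reindex) (use n in \<open>auto simp: o_def wt_def inj_on_def\<close>)
  ultimately have "wt summable_on (int ` UNIV \<union> (\<lambda>n. - int n) ` UNIV)"
    by (rule summable_on_union)
  moreover have "int ` UNIV \<union> (\<lambda>n. - int n) ` UNIV = UNIV"
  proof -
    have "k \<in> int ` UNIV \<union> (\<lambda>n. - int n) ` UNIV" for k
      by (cases k rule: int_cases2) auto
    then show ?thesis by blast
  qed
  ultimately show ?thesis by simp
qed

lemma bij_int_decode_UNIV: "bij_betw int_decode UNIV UNIV"
  using bij_int_decode by simp

lemma summable_wt_decode: "summable (\<lambda>j. wt (int_decode j))"
proof -
  have "(\<lambda>j. wt (int_decode j)) summable_on UNIV"
    using wt_summable_on summable_on_reindex_bij_betw[OF bij_int_decode_UNIV, of wt] by simp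
  then show ?thesis using summable_on_imp_summable by blast
qed

text \<open>The sum over \<open>k\<close> is the Weil-Brezin transform of \<open>u\<close>. The
  translation \<open>s + 1\<close> sends the summand \<open>k\<close> to the next one; the
  accompanying shear changes its frequency in the second coordinate by \<open>N * r\<close>, which
  explains \<open>M - N * r * k\<close>. The sign with exponent \<open>e * k\<close> realises the
  character on the third generator.\<close>

definition thT :: "nat \<Rightarrow> int \<Rightarrow> int \<Rightarrow> int \<Rightarrow> (real \<Rightarrow> complex) \<Rightarrow> int \<Rightarrow> heis \<Rightarrow> complex" where
  "thT r e N M u k p = cis (pi * (of_int N * fst (fst p) + (of_int M - of_int N * real r * of_int k) * snd (fst p)
     + of_int (e * k))) * u (snd p - of_int k)"

definition theta :: "nat \<Rightarrow> int \<Rightarrow> int \<Rightarrow> int \<Rightarrow> (real \<Rightarrow> complex) \<Rightarrow> heis \<Rightarrow> complex" where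
  "theta r e N M u p = (\<Sum>\<^sub>\<infinity>k. thT r e N M u k p)"

text \<open>Peetre's inequality \<open>1 + k^2 \<le> 2 * (1 + (s - k)^2) * (1 + s^2)\<close> turns
  decay in \<open>s - k\<close> into decay in \<open>k\<close>, at the price of growth in
  \<open>s\<close>.\<close>

lemma thT_bound:
  assumes "decay C u"
  shows "cmod (thT r e N M u k p) \<le> 2 * C * (1 + (snd p)\<^sup>2) * wt k"
proof -
  let ?s = "snd p" and ?k = "real_of_int k"
  have 1: "(1 + (?s - ?k)\<^sup>2) * cmod (u (?s - ?k)) \<le> C" using assms by (simp add: decay_def)
  have "0 \<le> (?s - 2 * (?s - ?k))\<^sup>2 + 1 + ?s\<^sup>2 * (2 * (?s - ?k)\<^sup>2)" by simp
  moreover have "2 * (1 + (?s - ?k)\<^sup>2) * (1 + ?s\<^sup>2) - (1 + ?k\<^sup>2) =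
     1 + (2 * ?s - ?k)\<^sup>2 + 2 * ((?s - ?k)\<^sup>2 * ?s\<^sup>2)"
    by (simp add: power2_eq_square algebra_simps)
  ultimately have "1 + ?k\<^sup>2 \<le> 2 * (1 + (?s - ?k)\<^sup>2) * (1 + ?s\<^sup>2)"
    by (smt (verit) mult_nonneg_nonneg zero_le_power2)
  then have "(1 + ?k\<^sup>2) * cmod (u (?s - ?k)) \<le> 2 * (1 + (?s - ?k)\<^sup>2) * (1 + ?s\<^sup>2) * cmod (u (?s - ?k))"
    by (rule mult_right_mono) simp
  also have "\<dots> = 2 * (1 + ?s\<^sup>2) * ((1 + (?s - ?k)\<^sup>2) * cmod (u (?s - ?k)))" by (simp only: mult_ac)
  also have "\<dots> \<le> 2 * (1 + ?s\<^sup>2) * C" by (rule mult_left_mono[OF 1]) simp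
  finally have "(1 + ?k\<^sup>2) * cmod (u (?s - ?k)) \<le> 2 * C * (1 + ?s\<^sup>2)" by (simp add: mult_ac)
  then show ?thesis
    by (simp add: thT_def norm_mult wt_def pos_le_divide_eq add_pos_nonneg mult.commute)
qed

lemma decay_nonneg: "decay C u \<Longrightarrow> C \<ge> 0"
  unfolding decay_def by (metis (no_types, opaque_lifting) add_nonneg_nonneg mult_nonneg_nonneg norm_ge_zero order_trans zero_le_one zero_le_power2)

lemma thT_summable:
  assumes "decay C u" shows "(\<lambda>k. norm (thT r e N M u k p)) summable_on UNIV" "(\<lambda>k. thT r e N M u k p) summable_on UNIV"
proof -
  show *: "(\<lambda>k. norm (thT r e N M u k p)) summable_on UNIV"
    by (rule summable_on_comparison_test[OF summable_on_cmult_right[OF wt_summable_on, of "2 * C * (1 + (snd p)\<^sup>2)"]])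
       (simp_all add: thT_bound[OF assms])
  show "(\<lambda>k. thT r e N M u k p) summable_on UNIV" by (rule abs_summable_summable[OF *])
qed

lemma theta_bound:
  assumes "decay C u"
  shows "cmod (theta r e N M u p) \<le> 2 * C * (1 + (snd p)\<^sup>2) * infsum wt UNIV"
proof -
  have "cmod (theta r e N M u p) \<le> (\<Sum>\<^sub>\<infinity>k. norm (thT r e N M u k p))"
    unfolding theta_def by (rule norm_infsum_bound[OF thT_summable(1)[OF assms]])
  also have "\<dots> \<le> (\<Sum>\<^sub>\<infinity>k. 2 * C * (1 + (snd p)\<^sup>2) * wt k)"
    by (rule infsum_mono[OF thT_summable(1)[OF assms] summable_on_cmult_right[OF wt_summable_on] thT_bound[OF assms]])
  also have "\<dots> = 2 * C * (1 + (snd p)\<^sup>2) * infsum wt UNIV"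
    by (rule infsum_cmult_right) (use wt_summable_on in simp)
  finally show ?thesis .
qed

lemma theta_sums:
  assumes "decay C u" shows "(\<lambda>j. thT r e N M u (int_decode j) p) sums theta r e N M u p"
proof -
  have "((\<lambda>k. thT r e N M u k p) has_sum theta r e N M u p) UNIV"
    unfolding theta_def by (rule has_sum_infsum[OF thT_summable(2)[OF assms]])
  then have "((\<lambda>j. thT r e N M u (int_decode j) p) has_sum theta r e N M u p) UNIV"
    using has_sum_reindex_bij_betw[OF bij_int_decode_UNIV, of "\<lambda>k. thT r e N M u k p"] by simp
  then show ?thesis by (rule has_sum_imp_sums)
qed

text \<open>The majorant grows with \<open>s\<close>, so convergence is uniform only on slabs. The
  integers are enumerated by \<open>int_decode\<close> in order to use theorems on ordinary
  series.\<close>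

lemma theta_uniform:
  assumes u: "decay C u"
  shows "uniform_limit {p. \<bar>snd p\<bar> < R} (\<lambda>n p. \<Sum>j<n. thT r e N M u (int_decode j) p) (theta r e N M u) sequentially"
proof -
  have "uniform_limit {p. \<bar>snd p\<bar> < R} (\<lambda>n p. \<Sum>j<n. thT r e N M u (int_decode j) p)
     (\<lambda>p. suminf (\<lambda>j. thT r e N M u (int_decode j) p)) sequentially"
  proof (rule Weierstrass_m_test)
    show "summable (\<lambda>j. 2 * C * (1 + R\<^sup>2) * wt (int_decode j))"
      by (intro summable_mult summable_wt_decode)
    fix n :: nat and p :: heis assume "p \<in> {p. \<bar>snd p\<bar> < R}"
    then have "(snd p)\<^sup>2 \<le> R\<^sup>2" using abs_le_square_iff[of "snd p" R] by auto
    then have "2 * C * (1 + (snd p)\<^sup>2) * wt (int_decode n) \<le> 2 * C * (1 + R\<^sup>2) * wt (int_decode n)"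
      using wt_pos[of "int_decode n"] decay_nonneg[OF u] by (intro mult_right_mono mult_left_mono) auto
    then show "norm (thT r e N M u (int_decode n) p) \<le> 2 * C * (1 + R\<^sup>2) * wt (int_decode n)"
      using thT_bound[OF u] order_trans by blast
  qed
  moreover have "(\<lambda>p. suminf (\<lambda>j. thT r e N M u (int_decode j) p)) = theta r e N M u"
    using sums_unique[OF theta_sums[OF u]] by (simp add: fun_eq_iff)
  ultimately show ?thesis by simp
qed

lemma open_slab: "open {p::heis. \<bar>snd p\<bar> < R}"
  by (intro open_Collect_less continuous_intros)

lemma theta_cont:
  assumes u: "decay C u" and c: "continuous_on UNIV u"
  shows "continuous_on UNIV (theta r e N M u)"
proof -
  have "isCont (theta r e N M u) p" for p
  proof -
    have "continuous_on {q. \<bar>snd q\<bar> < \<bar>snd p\<bar> + 1} (theta r e N M u)"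
    proof (rule uniform_limit_theorem[OF _ theta_uniform[OF u]])
      have "continuous_on UNIV (\<lambda>q::heis. u (snd q - of_int k))" for k
        by (rule continuous_on_compose2[OF c]) (auto intro!: continuous_intros)
      then show "\<forall>\<^sub>F n in sequentially. continuous_on {q. \<bar>snd q\<bar> < \<bar>snd p\<bar> + 1}
          (\<lambda>p. \<Sum>j<n. thT r e N M u (int_decode j) p)"
        unfolding thT_def
        by (intro always_eventually allI continuous_intros) (auto intro: continuous_on_subset)
    qed simp
    then have "\<forall>q\<in>{q. \<bar>snd q\<bar> < \<bar>snd p\<bar> + 1}. isCont (theta r e N M u) q"
      unfolding continuous_on_eq_continuous_at[OF open_slab] .
    then show ?thesis by (rule bspec) simp
  qed
  then show ?thesis by (simp add: continuous_at_imp_continuous_on)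
qed

lemma theta_lin:
  assumes "decay C u" "decay C' v"
  shows "theta r e N M (\<lambda>t. a * u t + b * v t) p = a * theta r e N M u p + b * theta r e N M v p"
proof -
  have "theta r e N M (\<lambda>t. a * u t + b * v t) p = (\<Sum>\<^sub>\<infinity>k. a * thT r e N M u k p + b * thT r e N M v k p)"
    by (simp add: theta_def thT_def algebra_simps)
  also have "\<dots> = (\<Sum>\<^sub>\<infinity>k. a * thT r e N M u k p) + (\<Sum>\<^sub>\<infinity>k. b * thT r e N M v k p)"
    by (intro infsum_add summable_on_cmult_right thT_summable(2)[OF assms(1)] thT_summable(2)[OF assms(2)])
  also have "\<dots> = a * theta r e N M u p + b * theta r e N M v p"
    unfolding theta_def by (subst (1 2) infsum_cmult_right) (use thT_summable(2)[OF assms(1)] thT_summable(2)[OF assms(2)] in auto)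
  finally show ?thesis .
qed

text \<open>Differentiating in the second coordinate produces
  \<open>M - N * r * k = (M + N * r * (s - k)) - N * r * s\<close>. The bracket depends on
  \<open>s - k\<close> and is absorbed into the profile, the rest does not depend on
  \<open>k\<close>; thus derivatives of theta series are again theta series.\<close>

definition theta' :: "nat \<Rightarrow> int \<Rightarrow> int \<Rightarrow> int \<Rightarrow> (real \<Rightarrow> complex) \<Rightarrow> (real \<Rightarrow> complex) \<Rightarrow> heis \<Rightarrow> heis \<Rightarrow> complex" where
  "theta' r e N M u u' p v = \<i> * of_real (pi * of_int N * (fst (fst v) - real r * snd p * snd (fst v))) * theta r e N M u p
     + of_real (snd (fst v)) * theta r e N M (\<lambda>t. \<i> * of_real (pi * (of_int M + of_int N * real r * t)) * u t) p
     + of_real (snd v) * theta r e N M u' p"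

lemma theta_deriv:
  assumes u: "decay C u" and u1: "decay C1 (\<lambda>t. \<i> * of_real (pi * (of_int M + of_int N * real r * t)) * u t)"
    and u2: "decay C2 u'" and du: "\<And>t. (u has_vector_derivative u' t) (at t)"
  shows "(theta r e N M u has_derivative theta' r e N M u u' p) (at p)"
proof -
  define R where "R = \<bar>snd p\<bar> + 1"
  let ?S = "{p::heis. \<bar>snd p\<bar> < R}"
  define w where "w = (\<lambda>t. \<i> * of_real (pi * (of_int M + of_int N * real r * t)) * u t)"
  define D where "D k q v = \<i> * of_real (pi * of_int N * (fst (fst v) - real r * snd q * snd (fst v))) * thT r e N M u k q
     + of_real (snd (fst v)) * thT r e N M w k q
     + of_real (snd v) * thT r e N M u' k q" for k and q v :: heis
  have cis_d: "((\<lambda>q. cis (f q)) has_derivative (\<lambda>v. \<i> * of_real (f' v) * cis (f q))) (at q)"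
    if "(f has_derivative f') (at q)" for f f' and q :: heis
  proof -
    have "((\<lambda>q. \<i> * of_real (f q)) has_derivative (\<lambda>v. \<i> * of_real (f' v))) (at q)"
      by (intro has_derivative_mult_right has_derivative_of_real that)
    from has_derivative_compose[OF this DERIV_exp[THEN has_field_derivative_imp_has_derivative]]
    have "((\<lambda>q. exp (\<i> * of_real (f q))) has_derivative (\<lambda>v. \<i> * of_real (f' v) * exp (\<i> * of_real (f q)))) (at q)"
      by (simp add: mult.commute)
    then show ?thesis by (simp add: cis_conv_exp)
  qed
  have DT: "(thT r e N M u k has_derivative D k q) (at q)" for k q
  proof -
    have a: "((\<lambda>q. cis (pi * (of_int N * fst (fst q) + (of_int M - of_int N * real r * of_int k) * snd (fst q)
     + of_int (e * k)))) has_derivative (\<lambda>v. \<i> * of_real (pi * (of_int N * fst (fst v) + (of_int M - of_int N * real r * of_int k) * snd (fst v))) *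
        cis (pi * (of_int N * fst (fst q) + (of_int M - of_int N * real r * of_int k) * snd (fst q)
     + of_int (e * k))))) (at q)"
      by (rule cis_d) (auto intro!: derivative_eq_intros)
    have "(u has_derivative (\<lambda>h. h *\<^sub>R u' (snd q - of_int k))) (at (snd q - of_int k))"
      using du[of "snd q - of_int k"] by (simp add: has_vector_derivative_def)
    moreover have "((\<lambda>q. snd q - real_of_int k) has_derivative snd) (at q)"
      by (rule has_derivative_eq_rhs[OF has_derivative_diff[OF has_derivative_snd[OF has_derivative_ident] has_derivative_const]]) simp
    ultimately have b: "((\<lambda>q. u (snd q - of_int k)) has_derivative (\<lambda>v. snd v *\<^sub>R u' (snd q - of_int k))) (at q)"
      using has_derivative_compose[of "\<lambda>q. snd q - of_int k" snd q UNIV u "\<lambda>h. h *\<^sub>R u' (snd q - of_int k)"]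
      by blast
    show ?thesis unfolding thT_def[abs_def]
      by (rule has_derivative_eq_rhs[OF has_derivative_mult[OF a b]])
         (simp add: fun_eq_iff D_def thT_def w_def scaleR_conv_of_real algebra_simps)
  qed
  have sl: "\<forall>\<^sub>F n in sequentially. \<forall>q\<in>?S. cmod ((\<Sum>j<n. thT r e N M x (int_decode j) q) - theta r e N M x q) < \<epsilon>"
    if "decay B x" "\<epsilon> > 0" for B x \<epsilon>
    using theta_uniform[OF that(1), where R=R and r=r and e=e and N=N and M=M] that(2) by (auto simp: uniform_limit_iff dist_norm)
  \<comment> \<open>The sum of the bounds for the three coefficients in \<open>theta'\<close> on the
    slab, per unit length of the direction vector.\<close>
  define K where "K = pi * \<bar>of_int N\<bar> * (1 + real r * R) + 2"
  have K: "K > 0" unfolding K_def R_def by (intro add_nonneg_pos mult_nonneg_nonneg) auto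
  have "\<exists>g. \<forall>q\<in>?S. (\<lambda>j. thT r e N M u (int_decode j) q) sums g q \<and> (g has_derivative theta' r e N M u u' q) (at q within ?S)"
  proof (rule has_derivative_series[where x = p])
    show "convex ?S"
    proof -
      have "?S = UNIV \<times> {-R<..<R}" by auto
      then show ?thesis by (simp add: convex_Times)
    qed
    show "p \<in> ?S" by (simp add: R_def)
    show "(\<lambda>j. thT r e N M u (int_decode j) p) sums theta r e N M u p" by (rule theta_sums[OF u])
    show "(thT r e N M u (int_decode j) has_derivative D (int_decode j) q) (at q within ?S)" for j q
      using DT has_derivative_at_withinI by blast
    fix \<epsilon> :: real assume "\<epsilon> > 0"
    then have \<epsilon>: "\<epsilon> / K > 0" using K by simp
    show "\<forall>\<^sub>F n in sequentially. \<forall>q\<in>?S. \<forall>h. norm ((\<Sum>j<n. D (int_decode j) q h) - theta' r e N M u u' q h) \<le> \<epsilon> * norm h"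
      using sl[OF u \<epsilon>] sl[OF u1[folded w_def] \<epsilon>] sl[OF u2 \<epsilon>]
    proof eventually_elim
      case (elim n)
      show ?case
      proof (intro ballI allI)
        fix q h :: heis assume q: "q \<in> ?S"
        define h1 h2 h3 where "h1 = fst (fst h)" and "h2 = snd (fst h)" and "h3 = snd h"
        have hn: "\<bar>h1\<bar> \<le> norm h" "\<bar>h2\<bar> \<le> norm h" "\<bar>h3\<bar> \<le> norm h"
        proof -
          have "norm (fst h) \<le> norm h" "norm (snd h) \<le> norm h" by (simp_all add: norm_prod_def real_sqrt_ge_abs1 real_le_rsqrt)
          moreover have "norm (fst (fst h)) \<le> norm (fst h)" "norm (snd (fst h)) \<le> norm (fst h)"
            by (simp_all add: norm_prod_def real_le_rsqrt)
          ultimately show "\<bar>h1\<bar> \<le> norm h" "\<bar>h2\<bar> \<le> norm h" "\<bar>h3\<bar> \<le> norm h"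
            unfolding h1_def h2_def h3_def by simp_all
        qed
        let ?T = "\<lambda>x. (\<Sum>j<n. thT r e N M x (int_decode j) q) - theta r e N M x q"
        have T: "cmod (?T u) \<le> \<epsilon> / K" "cmod (?T w) \<le> \<epsilon> / K" "cmod (?T u') \<le> \<epsilon> / K"
          by (intro less_imp_le elim[rule_format] q)+
        have R0: "R \<ge> 0" by (simp add: R_def)
        let ?c = "pi * of_int N * (h1 - real r * snd q * h2)"
        have eq: "(\<Sum>j<n. D (int_decode j) q h) - theta' r e N M u u' q h =
          \<i> * of_real ?c * ?T u + of_real h2 * ?T w + of_real h3 * ?T u'"
          unfolding D_def theta'_def w_def[symmetric] h1_def h2_def h3_def sum.distrib sum_distrib_left[symmetric]
          by (simp add: algebra_simps)
        have c: "\<bar>?c\<bar> \<le> pi * \<bar>of_int N\<bar> * ((1 + real r * R) * norm h)"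
        proof -
          have "\<bar>h1 - real r * snd q * h2\<bar> \<le> \<bar>h1\<bar> + real r * (\<bar>snd q\<bar> * \<bar>h2\<bar>)"
            by (rule order_trans[OF abs_triangle_ineq4]) (simp add: abs_mult)
          also have "\<dots> \<le> norm h + real r * (R * norm h)"
            using q R0 hn by (intro add_mono mult_left_mono mult_mono) (simp_all add: less_imp_le)
          finally have "\<bar>h1 - real r * snd q * h2\<bar> \<le> (1 + real r * R) * norm h" by (simp add: algebra_simps)
          then show ?thesis by (simp add: abs_mult mult_left_mono)
        qed
        have nt: "norm (x + y + z) \<le> A + B + C" if "norm x \<le> A" "norm y \<le> B" "norm z \<le> C" for x y z :: complex and A B C
          using that norm_triangle_ineq[of "x + y" z] norm_triangle_ineq[of x y] by linarith
        have nm: "norm (of_real x * z) \<le> A * (\<epsilon> / K)" "norm (\<i> * of_real x * z) \<le> A * (\<epsilon> / K)"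
          if "\<bar>x\<bar> \<le> A" "cmod z \<le> \<epsilon> / K" for x z A
          using mult_mono[OF that(1) that(2)] that(1) by (simp_all add: norm_mult)
        have "norm ((\<Sum>j<n. D (int_decode j) q h) - theta' r e N M u u' q h) \<le>
          (pi * \<bar>of_int N\<bar> * ((1 + real r * R) * norm h)) * (\<epsilon> / K) + norm h * (\<epsilon> / K) + norm h * (\<epsilon> / K)"
          unfolding eq by (rule nt[OF nm(2)[OF c T(1)] nm(1)[OF hn(2) T(2)] nm(1)[OF hn(3) T(3)]])
        also have "\<dots> = (K * norm h) * (\<epsilon> / K)" by (simp only: K_def distrib_right mult.assoc mult_1_left mult_2)
        also have "\<dots> = \<epsilon> * norm h" using K by simp
        finally show "norm ((\<Sum>j<n. D (int_decode j) q h) - theta' r e N M u u' q h) \<le> \<epsilon> * norm h" .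
      qed
    qed
  qed
  then obtain g where g: "\<And>q. q \<in> ?S \<Longrightarrow> (\<lambda>j. thT r e N M u (int_decode j) q) sums g q"
    "\<And>q. q \<in> ?S \<Longrightarrow> (g has_derivative theta' r e N M u u' q) (at q within ?S)" by blast
  have eq: "g q = theta r e N M u q" if "q \<in> ?S" for q
    using sums_unique2[OF g(1)[OF that] theta_sums[OF u]] .
  have p: "p \<in> ?S" by (simp add: R_def)
  have "(theta r e N M u has_derivative theta' r e N M u u' p) (at p within ?S)"
    by (rule has_derivative_transform[OF p _ g(2)[OF p]]) (simp add: eq)
  then show ?thesis using at_within_open[OF p open_slab] by simp
qed

text \<open>A lattice element with third coordinate \<open>c\<close> moves the summand
  \<open>k\<close> to \<open>k + c\<close>. The shift of the second coordinate leaves an extra phase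
  \<open>N * r * b * (k + c)\<close>, which is invisible because \<open>N * r\<close> is
  even.\<close>

lemma theta_equiv:
  assumes eps: "eps \<in> hom (heis_lattice r) (integer_mod_group 2)"
    and N: "even (N - eps ((1, 0), 0))" and M: "even (M - eps ((0, 1), 0))" and u: "decay C u"
  shows "scal_equiv r eps (theta r (eps ((0, 0), 1)) N M u)"
  unfolding scal_equiv_def
proof (intro ballI allI)
  fix \<gamma> y assume "\<gamma> \<in> lattice_pts"
  then obtain a b c where \<gamma>: "\<gamma> = ((of_int a, of_int b), of_int c)"
    unfolding lattice_pts_def by (auto elim!: Ints_cases)
  define e where "e = eps ((0, 0), 1)"
  have Nr: "even (N * int r)"
    using eps_character(3)[OF eps] N by auto
  define z where "z = cis (pi * of_int (N * a + M * b + e * c))"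
  have "thT r e N M u (k + c) (heis_mult r \<gamma> y) = z * thT r e N M u k y" for k
  proof -
    have "pi * (of_int N * fst (fst (heis_mult r \<gamma> y)) + (of_int M - of_int N * real r * of_int (k + c)) * snd (fst (heis_mult r \<gamma> y)) + of_int (e * (k + c)))
      = pi * of_int (N * a + M * b + e * c) + pi * of_int (- (N * int r * b * (k + c)))
       + pi * (of_int N * fst (fst y) + (of_int M - of_int N * real r * of_int k) * snd (fst y) + of_int (e * k))"
      by (simp add: \<gamma> heis_mult_def A_map_def algebra_simps)
    moreover have "cis (pi * of_int (- (N * int r * b * (k + c)))) = 1"
      by (rule cis_pi_even) (use Nr in simp)
    moreover have "snd (heis_mult r \<gamma> y) - of_int (k + c) = snd y - of_int k"
      by (simp add: \<gamma> heis_mult_def)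
    ultimately show ?thesis unfolding thT_def z_def by (simp only: cis_mult[symmetric]) simp
  qed
  moreover have "bij_betw (\<lambda>k. k + c) UNIV UNIV" by (rule bij_betw_byWitness[of _ "\<lambda>k. k - c"]) auto
  ultimately have "theta r e N M u (heis_mult r \<gamma> y) = (\<Sum>\<^sub>\<infinity>k. z * thT r e N M u k y)"
    unfolding theta_def using infsum_reindex_bij_betw[of "\<lambda>k. k + c" UNIV UNIV "\<lambda>k. thT r e N M u k (heis_mult r \<gamma> y)"] by simp
  also have "\<dots> = z * theta r e N M u y" unfolding theta_def
    by (rule infsum_cmult_right) (use thT_summable(2)[OF u] in simp)
  also have "z = exp (\<i> * of_real pi * of_int (eps \<gamma>))"
    unfolding \<gamma> eps_character(2)[OF eps] z_def e_def
  proof (rule cis_pi_cong)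
    have "even ((N - eps ((1, 0), 0)) * a + (M - eps ((0, 1), 0)) * b)" using N M by simp
    then show "even (N * a + M * b + eps ((0, 0), 1) * c - (eps ((1, 0), 0) * a + eps ((0, 1), 0) * b + eps ((0, 0), 1) * c))"
      by (simp add: algebra_simps)
  qed
  finally show "theta r (eps ((0, 0), 1)) N M u (heis_mult r \<gamma> y) = exp (\<i> * of_real pi * of_int (eps \<gamma>)) * theta r (eps ((0, 0), 1)) N M u y"
    by (simp add: e_def)
qed

subsection \<open>Gaussian theta functions\<close>

definition gau :: "real \<Rightarrow> real \<Rightarrow> complex poly \<Rightarrow> real \<Rightarrow> complex" where
  "gau \<kappa> t0 q t = poly q (of_real (t + t0)) * of_real (exp (- \<kappa> * (t + t0)\<^sup>2 / 2))"

text \<open>Follows from \<open>(1 + y / m) ^ m \<le> exp y\<close> at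
  \<open>y = \<kappa> * (1 + x^2) / 2\<close>.\<close>

lemma gaussian_power_bound:
  assumes "\<kappa> > 0" shows "\<exists>C. \<forall>x::real. (1 + x\<^sup>2) ^ n * exp (- \<kappa> * x\<^sup>2 / 2) \<le> C"
proof -
  \<comment> \<open>One more than \<open>n\<close>, as \<open>m\<close> is divided by.\<close>
  define m where "m = Suc n"
  have "(1 + x\<^sup>2) ^ n * exp (- \<kappa> * x\<^sup>2 / 2) \<le> (2 * real m / \<kappa>) ^ m * exp (\<kappa> / 2)" for x :: real
  proof -
    let ?y = "\<kappa> * (1 + x\<^sup>2) / 2"
    have y: "?y \<ge> 0" using assms by simp
    have "(?y / real m) ^ m \<le> (1 + ?y / real m) ^ m"
      by (rule power_mono) (use y m_def in auto)
    also have "\<dots> \<le> exp ?y"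
      by (rule exp_ge_one_plus_x_over_n_power_n) (use y m_def in linarith)+
    finally have "(?y / real m) ^ m \<le> exp ?y" .
    moreover have "(1 + x\<^sup>2) ^ m = (2 * real m / \<kappa>) ^ m * (?y / real m) ^ m"
      using assms m_def by (simp add: power_mult_distrib[symmetric])
    ultimately have "(1 + x\<^sup>2) ^ m \<le> (2 * real m / \<kappa>) ^ m * exp ?y"
      using assms by (simp add: mult_left_mono)
    moreover have "(1 + x\<^sup>2) ^ n \<le> (1 + x\<^sup>2) ^ m" by (rule power_increasing) (auto simp: m_def)
    ultimately have "(1 + x\<^sup>2) ^ n * exp (- \<kappa> * x\<^sup>2 / 2) \<le> (2 * real m / \<kappa>) ^ m * exp ?y * exp (- \<kappa> * x\<^sup>2 / 2)"
      by (intro mult_right_mono) auto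
    also have "\<dots> = (2 * real m / \<kappa>) ^ m * exp (?y + (- \<kappa> * x\<^sup>2 / 2))" by (simp only: exp_add mult.assoc)
    also have "?y + (- \<kappa> * x\<^sup>2 / 2) = \<kappa> / 2" by (simp add: field_simps)
    finally show ?thesis .
  qed
  then show ?thesis by blast
qed

lemma poly_power_bound:
  fixes q :: "complex poly"
  shows "\<exists>C n. C \<ge> 0 \<and> (\<forall>x::real. cmod (poly q (of_real x)) \<le> C * (1 + x\<^sup>2) ^ n)"
proof (induction q)
  case 0 then show ?case by (intro exI[of _ 0]) auto
next
  case (pCons a q)
  then obtain C n where C: "C \<ge> 0" "\<And>x::real. cmod (poly q (of_real x)) \<le> C * (1 + x\<^sup>2) ^ n" by blast
  have "cmod (poly (pCons a q) (of_real x)) \<le> (cmod a + C) * (1 + x\<^sup>2) ^ Suc n" for x :: real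
  proof -
    have x: "\<bar>x\<bar> \<le> 1 + x\<^sup>2"
    proof -
      have "0 \<le> (\<bar>x\<bar> - 1)\<^sup>2" by simp
      then have "2 * \<bar>x\<bar> \<le> 1 + x\<^sup>2" by (simp add: power2_diff)
      then show ?thesis using zero_le_power2[of x] by linarith
    qed
    have "cmod (poly (pCons a q) (of_real x)) \<le> cmod a + \<bar>x\<bar> * cmod (poly q (of_real x))"
      using norm_triangle_ineq[of a "of_real x * poly q (of_real x)"] by (simp add: norm_mult)
    also have "\<dots> \<le> cmod a * (1 + x\<^sup>2) ^ Suc n + (1 + x\<^sup>2) * (C * (1 + x\<^sup>2) ^ n)"
    proof (intro add_mono mult_mono x C(2))
      have "1 \<le> (1 + x\<^sup>2) ^ Suc n" by (rule one_le_power) simp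
      then show "cmod a \<le> cmod a * (1 + x\<^sup>2) ^ Suc n" using mult_left_mono[of 1 _ "cmod a"] by simp
    qed auto
    finally show ?thesis by (simp add: algebra_simps)
  qed
  then show ?case using C(1) by (intro exI[of _ "cmod a + C"] exI[of _ "Suc n"]) auto
qed

lemma one_plus_sq_shift: "1 + (t::real)\<^sup>2 \<le> 2 * (1 + t0\<^sup>2) * (1 + (t + t0)\<^sup>2)"
proof -
  have "2 * (1 + t0\<^sup>2) * (1 + (t + t0)\<^sup>2) - (1 + t\<^sup>2) = 1 + (t + 2 * t0)\<^sup>2 + 2 * (t0\<^sup>2 * (t + t0)\<^sup>2)"
    by (simp add: power2_eq_square algebra_simps)
  moreover have "0 \<le> 1 + (t + 2 * t0)\<^sup>2 + 2 * (t0\<^sup>2 * (t + t0)\<^sup>2)" by simp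
  ultimately show ?thesis by linarith
qed

lemma decayI_shift:
  assumes "\<And>x. (1 + x\<^sup>2) * cmod (u (x - t0)) \<le> C"
  shows "decay (2 * (1 + t0\<^sup>2) * C) u"
  unfolding decay_def
proof
  fix t
  have "(1 + t\<^sup>2) * cmod (u t) \<le> 2 * (1 + t0\<^sup>2) * (1 + (t + t0)\<^sup>2) * cmod (u t)"
    by (intro mult_right_mono one_plus_sq_shift) simp
  also have "\<dots> \<le> 2 * (1 + t0\<^sup>2) * C"
    using mult_left_mono[OF assms[of "t + t0"], of "2 * (1 + t0\<^sup>2)"] by (simp add: mult.assoc)
  finally show "(1 + t\<^sup>2) * cmod (u t) \<le> 2 * (1 + t0\<^sup>2) * C" .
qed

lemma gau_decay:
  assumes "\<kappa> > 0" shows "\<exists>C. decay C (gau \<kappa> t0 q)"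
proof -
  obtain B n where B: "B \<ge> 0" "\<And>x::real. cmod (poly q (of_real x)) \<le> B * (1 + x\<^sup>2) ^ n" using poly_power_bound by blast
  obtain C where C: "\<And>x::real. (1 + x\<^sup>2) ^ Suc n * exp (- \<kappa> * x\<^sup>2 / 2) \<le> C" using gaussian_power_bound[OF assms] by blast
  have "(1 + x\<^sup>2) * cmod (gau \<kappa> t0 q (x - t0)) \<le> B * C" for x
  proof -
    have "(1 + x\<^sup>2) * cmod (gau \<kappa> t0 q (x - t0)) = (1 + x\<^sup>2) * (cmod (poly q (of_real x)) * exp (- \<kappa> * x\<^sup>2 / 2))"
      by (simp add: gau_def norm_mult)
    also have "\<dots> \<le> (1 + x\<^sup>2) * ((B * (1 + x\<^sup>2) ^ n) * exp (- \<kappa> * x\<^sup>2 / 2))"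
      by (intro mult_left_mono mult_right_mono B(2)) auto
    also have "\<dots> = B * ((1 + x\<^sup>2) ^ Suc n * exp (- \<kappa> * x\<^sup>2 / 2))" by simp
    also have "\<dots> \<le> B * C" by (rule mult_left_mono[OF C B(1)])
    finally show ?thesis .
  qed
  from decayI_shift[OF this] show ?thesis by blast
qed

lemma gau_deriv:
  "(gau \<kappa> t0 q has_vector_derivative gau \<kappa> t0 (pderiv q - smult (of_real \<kappa>) (pCons 0 q)) t) (at t)"
proof -
  have 1: "((\<lambda>t. poly q (of_real (t + t0))) has_vector_derivative poly (pderiv q) (of_real (t + t0))) (at t)"
  proof -
    have "((poly q \<circ> (\<lambda>t. of_real (t + t0))) has_vector_derivative 1 * poly (pderiv q) (of_real (t + t0))) (at t)"
      by (rule field_vector_diff_chain_at) (auto intro!: derivative_eq_intros poly_DERIV)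
    then show ?thesis by (simp add: o_def)
  qed
  have "((\<lambda>t. exp (- \<kappa> * (t + t0)\<^sup>2 / 2)) has_real_derivative (- \<kappa> * (t + t0)) * exp (- \<kappa> * (t + t0)\<^sup>2 / 2)) (at t)"
    by (auto intro!: derivative_eq_intros simp: field_simps)
  then have 2: "((\<lambda>t. complex_of_real (exp (- \<kappa> * (t + t0)\<^sup>2 / 2))) has_vector_derivative
      of_real ((- \<kappa> * (t + t0)) * exp (- \<kappa> * (t + t0)\<^sup>2 / 2))) (at t)"
    by (intro has_vector_derivative_of_real) (simp add: has_real_derivative_iff_has_vector_derivative)
  show ?thesis unfolding gau_def[abs_def]
    by (rule has_vector_derivative_eq_rhs[OF has_vector_derivative_mult[OF 1 2]])
       (simp add: algebra_simps)
qed

lemma gau_cont: "continuous_on UNIV (gau \<kappa> t0 q)"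
  by (intro continuous_at_imp_continuous_on ballI has_vector_derivative_continuous[OF gau_deriv])

text \<open>The width at which the Gaussian is annihilated by one of the two ladder operators: on
  profiles, the two frame derivatives act as multiplication by
  \<open>- \<i> * d * pi * N * r * \<tau>\<close> and as \<open>(d / r)\<close> times the
  derivative, and the two contributions must cancel.\<close>

definition kap :: "nat \<Rightarrow> int \<Rightarrow> real" where "kap r N = pi * \<bar>of_int N\<bar> * (real r)\<^sup>2"

lemma kap_pos: "r > 0 \<Longrightarrow> N \<noteq> 0 \<Longrightarrow> kap r N > 0"
  by (simp add: kap_def)

text \<open>The centre \<open>M / (N * r)\<close> is chosen so that \<open>M + N * r * t\<close>
  becomes \<open>N * r * \<tau>\<close>; the derivative in the second coordinate then multiplies the
  polynomial by its variable.\<close>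

definition tg :: "nat \<Rightarrow> int \<Rightarrow> int \<Rightarrow> int \<Rightarrow> complex poly \<Rightarrow> heis \<Rightarrow> complex" where
  "tg r e N M q = theta r e N M (gau (kap r N) (of_int M / (of_int N * real r)) q)"

lemma tg_lin:
  assumes "r > 0" "N \<noteq> 0"
  shows "tg r e N M (smult a q + smult b q') p = a * tg r e N M q p + b * tg r e N M q' p"
proof -
  obtain C C' where "decay C (gau (kap r N) (of_int M / (of_int N * real r)) q)"
    "decay C' (gau (kap r N) (of_int M / (of_int N * real r)) q')" using gau_decay[OF kap_pos[OF assms]] by blast
  from theta_lin[OF this, of r e N M a b p] show ?thesis
    by (simp add: tg_def gau_def[abs_def] algebra_simps)
qed

lemma tg_smult: "r > 0 \<Longrightarrow> N \<noteq> 0 \<Longrightarrow> tg r e N M (smult a q) p = a * tg r e N M q p"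
  using tg_lin[of r N e M a q 0 0 p] by simp

lemma tg_add: "r > 0 \<Longrightarrow> N \<noteq> 0 \<Longrightarrow> tg r e N M (q + q') p = tg r e N M q p + tg r e N M q' p"
  using tg_lin[of r N e M 1 q 1 q' p] by simp

lemma tg_cont:
  assumes "r > 0" "N \<noteq> 0" shows "continuous_on UNIV (tg r e N M q)"
proof -
  obtain C where "decay C (gau (kap r N) (of_int M / (of_int N * real r)) q)"
    using gau_decay[OF kap_pos[OF assms]] by blast
  then show ?thesis unfolding tg_def by (rule theta_cont) (rule gau_cont)
qed

definition tg' :: "nat \<Rightarrow> int \<Rightarrow> int \<Rightarrow> int \<Rightarrow> complex poly \<Rightarrow> heis \<Rightarrow> heis \<Rightarrow> complex" where
  "tg' r e N M q p v = \<i> * of_real (pi * of_int N * (fst (fst v) - real r * snd p * snd (fst v))) * tg r e N M q p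
     + of_real (snd (fst v)) * tg r e N M (smult (\<i> * of_real (pi * of_int N * real r)) (pCons 0 q)) p
     + of_real (snd v) * tg r e N M (pderiv q - smult (of_real (kap r N)) (pCons 0 q)) p"

lemma tg_deriv:
  assumes rN: "r > 0" "N \<noteq> 0"
  shows "(tg r e N M q has_derivative tg' r e N M q p) (at p)"
proof -
  let ?t0 = "of_int M / (of_int N * real r)"
  let ?g = "gau (kap r N) ?t0"
  have w: "(\<lambda>t. \<i> * of_real (pi * (of_int M + of_int N * real r * t)) * ?g q t) =
      ?g (smult (\<i> * of_real (pi * of_int N * real r)) (pCons 0 q))"
  proof
    fix t
    have "of_int M + of_int N * real r * t = of_int N * real r * (t + ?t0)" using rN by (simp add: field_simps)
    then show "\<i> * of_real (pi * (of_int M + of_int N * real r * t)) * ?g q t =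
      ?g (smult (\<i> * of_real (pi * of_int N * real r)) (pCons 0 q)) t"
      by (simp only: gau_def poly_smult poly_pCons of_real_mult) simp
  qed
  obtain C C1 C2 where C: "decay C (?g q)" "decay C1 (?g (smult (\<i> * of_real (pi * of_int N * real r)) (pCons 0 q)))"
    "decay C2 (?g (pderiv q - smult (of_real (kap r N)) (pCons 0 q)))"
    using gau_decay[OF kap_pos[OF rN]] by meson
  from theta_deriv[OF C(1) C(2)[folded w] C(3) gau_deriv, where e=e and p=p]
  show ?thesis unfolding theta'_def w tg_def tg'_def[abs_def] .
qed

text \<open>The derivative of a theta series carries the coefficient \<open>s\<close>, so the
  induction for smoothness has to admit this factor.\<close>

lemma C_k_mult_snd:
  fixes f :: "heis \<Rightarrow> complex"
  shows "C_k n f \<Longrightarrow> C_k n (\<lambda>p. of_real (snd p) * f p)"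
proof (induction n arbitrary: f)
  case 0 then show ?case by (auto intro!: continuous_intros)
next
  case (Suc n)
  have d: "((\<lambda>p::heis. complex_of_real (snd p)) has_derivative (\<lambda>v. of_real (snd v))) (at p)" for p
    by (intro has_derivative_of_real has_derivative_snd has_derivative_ident)
  show ?case
  proof (rule C_k_SucI[OF has_derivative_mult[OF d C_k_SucD(1)[OF Suc.prems]]])
    fix v
    show "C_k n (\<lambda>x. complex_of_real (snd x) * frechet_derivative f (at x) v + complex_of_real (snd v) * f x)"
      by (intro C_k_add Suc.IH C_k_SucD(2)[OF Suc.prems] C_k_bounded_linear[OF bounded_linear_mult_right] C_k_mono[OF Suc.prems])
  qed
qed

text \<open>All derivatives are combinations of theta series with other polynomials, so the
  induction runs over all \<open>q\<close> at once.\<close>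

lemma tg_smooth:
  assumes rN: "r > 0" "N \<noteq> 0" shows "smooth (tg r e N M q)"
proof -
  have "C_k n (tg r e N M q)" for n
  proof (induction n arbitrary: q)
    case 0 then show ?case using tg_cont[OF rN] by simp
  next
    case (Suc n)
    show ?case
    proof (rule C_k_SucI[OF tg_deriv[OF rN]])
      fix v
      have cm: "C_k n (\<lambda>p. a * f p)" if "C_k n f" for a :: complex and f :: "heis \<Rightarrow> complex"
        by (rule C_k_bounded_linear[OF bounded_linear_mult_right that])
      have "(\<lambda>p. tg' r e N M q p v) = (\<lambda>p. (\<i> * of_real (pi * of_int N * fst (fst v))) * tg r e N M q p
         + (- \<i> * of_real (pi * of_int N * real r * snd (fst v))) * (of_real (snd p) * tg r e N M q p)
         + of_real (snd (fst v)) * tg r e N M (smult (\<i> * of_real (pi * of_int N * real r)) (pCons 0 q)) p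
         + of_real (snd v) * tg r e N M (pderiv q - smult (of_real (kap r N)) (pCons 0 q)) p)"
        by (simp add: fun_eq_iff tg'_def algebra_simps)
      moreover have "C_k n \<dots>" by (intro C_k_add cm C_k_mult_snd Suc.IH)
      ultimately show "C_k n (\<lambda>p. tg' r e N M q p v)" by simp
    qed
  qed
  then show ?thesis by (simp add: smooth_def)
qed

lemma tg_equiv:
  assumes "eps \<in> hom (heis_lattice r) (integer_mod_group 2)" "r > 0" "N \<noteq> 0"
    and "even (N - eps ((1, 0), 0))" "even (M - eps ((0, 1), 0))"
  shows "scal_equiv r eps (tg r (eps ((0, 0), 1)) N M q)"
proof -
  obtain C where "decay C (gau (kap r N) (of_int M / (of_int N * real r)) q)"
    using gau_decay[OF kap_pos[OF assms(2,3)]] by blast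
  from theta_equiv[OF assms(1,4,5) this] show ?thesis by (simp add: tg_def)
qed

text \<open>In the direction of \<open>s_2\<close> the term \<open>r * s\<close> of the
  left-invariant field cancels the term \<open>- r * s\<close> in \<open>tg'\<close>, and only
  multiplication by the polynomial variable remains.\<close>

lemma along_tg:
  assumes "r > 0" "N \<noteq> 0"
  shows "along (s_frame r d 2) (tg r e N M q) p = - (\<i> * of_real (d * pi * of_int N * real r)) * tg r e N M (pCons 0 q) p"
    and "along (s_frame r d 3) (tg r e N M q) p = of_real (d / real r) *
      (tg r e N M (pderiv q) p - of_real (kap r N) * tg r e N M (pCons 0 q) p)"
    and "ptl 0 (tg r e N M q) p = \<i> * of_real (pi * of_int N) * tg r e N M q p"
proof -
  have fd: "frechet_derivative (tg r e N M q) (at p) = tg' r e N M q p"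
    using frechet_derivative_at[OF tg_deriv[OF assms]] by (rule sym)
  have df: "tg r e N M (pderiv q - smult a (pCons 0 q)) p = tg r e N M (pderiv q) p - a * tg r e N M (pCons 0 q) p" for a
  proof -
    have "pderiv q - smult a (pCons 0 q) = smult 1 (pderiv q) + smult (- a) (pCons 0 q)" by simp
    then show ?thesis using tg_lin[OF assms, of e M 1 "pderiv q" "- a" "pCons 0 q" p] by (simp only:) simp
  qed
  show "along (s_frame r d 2) (tg r e N M q) p = - (\<i> * of_real (d * pi * of_int N * real r)) * tg r e N M (pCons 0 q) p"
    by (simp add: along_def fd tg'_def s_frame_eq tg_smult[OF assms] algebra_simps del: smult_pCons)
  show "along (s_frame r d 3) (tg r e N M q) p = of_real (d / real r) *
      (tg r e N M (pderiv q) p - of_real (kap r N) * tg r e N M (pCons 0 q) p)"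
    unfolding along_def fd tg'_def df by (simp add: s_frame_eq del: smult_pCons)
  show "ptl 0 (tg r e N M q) p = \<i> * of_real (pi * of_int N) * tg r e N M q p"
    by (simp add: ptl_def fd tg'_def)
qed

text \<open>With \<open>\<sigma> = - sgn N\<close>, \<open>Zop \<sigma>\<close> lowers and \<open>Zop (- \<sigma>)\<close> raises the degree of the polynomial factor.\<close>

definition lad :: "nat \<Rightarrow> real \<Rightarrow> int \<Rightarrow> complex" where
  "lad r d N = - \<i> * of_real (of_int (sgn N) * d / real r)"

definition lower :: "nat \<Rightarrow> real \<Rightarrow> int \<Rightarrow> complex poly \<Rightarrow> complex poly" where
  "lower r d N q = smult (lad r d N) (pderiv q)"

definition raise :: "nat \<Rightarrow> real \<Rightarrow> int \<Rightarrow> complex poly \<Rightarrow> complex poly" where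
  "raise r d N q = smult (lad r d N) (smult (of_real (2 * kap r N)) (pCons 0 q) - pderiv q)"

lemma Zop_tg:
  assumes "r > 0" "N \<noteq> 0"
  shows "Zop r d (- of_int (sgn N)) (tg r e N M q) = tg r e N M (lower r d N q)"
    and "Zop r d (of_int (sgn N)) (tg r e N M q) = tg r e N M (raise r d N q)"
proof -
  have k: "of_real (d * pi * of_int N * real r) = of_int (sgn N) * of_real (d / real r) * complex_of_real (kap r N)"
  proof -
    have "d * pi * of_int N * real r = of_int (sgn N) * (d / real r) * kap r N"
      using assms by (cases "N > 0") (simp_all add: kap_def power2_eq_square)
    then show ?thesis by (metis of_real_mult of_real_of_int_eq)
  qed
  have r: "tg r e N M (raise r d N q) p = lad r d N * (of_real (2 * kap r N) * tg r e N M (pCons 0 q) p - tg r e N M (pderiv q) p)" for p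
    using tg_lin[OF assms, of e M "of_real (2 * kap r N)" "pCons 0 q" "-1" "pderiv q" p]
    by (simp add: raise_def tg_smult[OF assms])
  show "Zop r d (- of_int (sgn N)) (tg r e N M q) = tg r e N M (lower r d N q)"
    by (rule ext, unfold Zop_def along_tg[OF assms] k lower_def tg_smult[OF assms], simp add: lad_def algebra_simps)
  show "Zop r d (of_int (sgn N)) (tg r e N M q) = tg r e N M (raise r d N q)"
    by (rule ext, unfold Zop_def along_tg[OF assms] k r, simp add: lad_def algebra_simps)
qed

definition nu :: "real \<Rightarrow> int \<Rightarrow> real" where "nu d N = 2 * pi * d\<^sup>2 * \<bar>of_int N\<bar>"

text \<open>Hermite polynomials up to scaling, obtained by raising the ground state.\<close>

fun herm :: "nat \<Rightarrow> real \<Rightarrow> int \<Rightarrow> nat \<Rightarrow> complex poly" where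
  "herm r d N 0 = 1"
| "herm r d N (Suc k) = raise r d N (herm r d N k)"

text \<open>The canonical commutation relation. The constant arises from
  \<open>(d / r)^2 * 2 * kap r N = 2 * pi * d^2 * \<bar>N\<bar>\<close>; it becomes the spacing of
  the squared eigenvalues.\<close>

lemma lower_raise:
  assumes "r > 0" "N \<noteq> 0"
  shows "lower r d N (raise r d N q) = raise r d N (lower r d N q) - smult (of_real (nu d N)) q"
proof -
  have "lad r d N * lad r d N = - of_real ((d / real r)\<^sup>2)"
  proof -
    have s: "of_int (sgn N) * of_int (sgn N) = (1::complex)" using assms by (cases "N > 0") simp_all
    have "lad r d N * lad r d N = - ((of_int (sgn N) * of_int (sgn N)) * of_real ((d / real r)\<^sup>2))"
    proof -
      have "(- \<i> * z) * (- \<i> * z) = - (z * z)" for z by (simp add: complex_eq_iff)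
      then show ?thesis unfolding lad_def by (simp add: power2_eq_square)
    qed
    then show ?thesis using s by simp
  qed
  then have "lad r d N * lad r d N * of_real (2 * kap r N) = - complex_of_real ((d / real r)\<^sup>2 * (2 * kap r N))"
    by simp
  also have "(d / real r)\<^sup>2 * (2 * kap r N) = nu d N" using assms by (simp add: kap_def nu_def power2_eq_square)
  finally have a: "lad r d N * (lad r d N * of_real (2 * kap r N)) = - complex_of_real (nu d N)" by (simp add: mult.assoc)
  have "lower r d N (raise r d N q) = smult (lad r d N * (lad r d N * of_real (2 * kap r N))) q + raise r d N (lower r d N q)"
    by (simp add: lower_def raise_def pderiv_smult pderiv_diff pderiv_pCons smult_add_right smult_diff_right mult_ac)
  then show ?thesis unfolding a by simp
qed

lemma raise_smult: "raise r d N (smult a q) = smult a (raise r d N q)"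
  by (simp add: raise_def pderiv_smult smult_diff_right mult_ac)

text \<open>Each commutation of the lowering operator past a raising operator costs one
  \<open>nu\<close>, and the ground state is killed at the end.\<close>

lemma lower_herm:
  assumes "r > 0" "N \<noteq> 0"
  shows "lower r d N (herm r d N (Suc k)) = smult (- of_real (nu d N * real (Suc k))) (herm r d N k)"
    and "lower r d N (herm r d N 0) = 0"
proof -
  show 0: "lower r d N (herm r d N 0) = 0" by (simp add: lower_def pderiv_1)
  show "lower r d N (herm r d N (Suc k)) = smult (- of_real (nu d N * real (Suc k))) (herm r d N k)"
  proof (induction k)
    case 0
    have "raise r d N 0 = 0" by (simp add: raise_def)
    then show ?case using lower_raise[OF assms, of d 1] \<open>lower r d N (herm r d N 0) = 0\<close> by simp
  next
    case (Suc k)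
    have "lower r d N (herm r d N (Suc (Suc k))) = raise r d N (lower r d N (herm r d N (Suc k))) - smult (of_real (nu d N)) (herm r d N (Suc k))"
      using lower_raise[OF assms] by simp
    also have "\<dots> = smult (- of_real (nu d N * real (Suc (Suc k)))) (herm r d N (Suc k))"
      unfolding Suc raise_smult by (simp add: smult_diff_left[symmetric] algebra_simps)
    finally show ?case .
  qed
qed

inductive_set hspan :: "nat \<Rightarrow> real \<Rightarrow> int \<Rightarrow> complex poly set" for r d N where
  herm: "herm r d N k \<in> hspan r d N"
| add: "p \<in> hspan r d N \<Longrightarrow> q \<in> hspan r d N \<Longrightarrow> p + q \<in> hspan r d N"
| smult: "p \<in> hspan r d N \<Longrightarrow> smult a p \<in> hspan r d N"

text \<open>Multiplication by the variable is, up to a nonzero scalar, the sum of raising and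
  lowering. Hence the span of the Hermite polynomials is closed under it, and it contains the
  constants.\<close>

lemma hspan_UNIV:
  assumes "r > 0" "d > 0" "N \<noteq> 0"
  shows "q \<in> hspan r d N"
proof -
  have "0 \<in> hspan r d N" using hspan.smult[OF hspan.herm, of 0 r d N] by simp
  have nz: "lad r d N * of_real (2 * kap r N) \<noteq> 0"
    using assms kap_pos[of r N] by (auto simp: lad_def sgn_if)
  have low: "lower r d N (herm r d N k) \<in> hspan r d N" for k
  proof (cases k)
    case 0 show ?thesis unfolding 0 lower_herm(2)[OF assms(1,3)] by (rule \<open>0 \<in> hspan r d N\<close>)
  next
    case (Suc j) show ?thesis unfolding Suc lower_herm(1)[OF assms(1,3)] by (intro hspan.smult hspan.herm)
  qed
  have X: "pCons 0 q \<in> hspan r d N" if "q \<in> hspan r d N" for q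
    using that
  proof induction
    case (herm k)
    have "smult (lad r d N * of_real (2 * kap r N)) (pCons 0 (herm r d N k)) = herm r d N (Suc k) + lower r d N (herm r d N k)"
      by (simp add: raise_def lower_def smult_diff_right)
    then have "smult (lad r d N * of_real (2 * kap r N)) (pCons 0 (herm r d N k)) \<in> hspan r d N"
      using hspan.add[OF hspan.herm[of r d N "Suc k"] low[of k]] by (simp only:)
    from hspan.smult[OF this, of "inverse (lad r d N * of_real (2 * kap r N))"] show ?case
      by (simp only: smult_smult left_inverse[OF nz] smult_1_left)
  next
    case (add p q)
    then show ?case using hspan.add[of "pCons 0 p" r d N "pCons 0 q"] by simp
  next
    case (smult p a)
    then show ?case using hspan.smult[of "pCons 0 p" r d N a] by simp
  qed
  show ?thesis
  proof (induction q)
    case 0 then show ?case by (rule \<open>0 \<in> hspan r d N\<close>)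
  next
    case (pCons a q)
    have "pCons a q = smult a (herm r d N 0) + pCons 0 q" by simp
    then show ?case using hspan.add[OF hspan.smult[OF hspan.herm[of r d N 0], of a] X[OF pCons(2)]] by metis
  qed
qed

subsection \<open>The modes constant along the centre\<close>

definition mode :: "int \<Rightarrow> int \<Rightarrow> heis \<Rightarrow> complex" where
  "mode M K p = cis (pi * (of_int M * snd (fst p) + of_int K * snd p))"

lemma mode_deriv:
  "(mode M K has_derivative (\<lambda>v. \<i> * of_real (pi * (of_int M * snd (fst v) + of_int K * snd v)) * mode M K p)) (at p)"
proof -
  have "((\<lambda>p. \<i> * of_real (pi * (of_int M * snd (fst p) + of_int K * snd p))) has_derivative
     (\<lambda>v. \<i> * of_real (pi * (of_int M * snd (fst v) + of_int K * snd v)))) (at p)"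
    by (intro has_derivative_mult_right has_derivative_of_real has_derivative_add has_derivative_snd has_derivative_fst has_derivative_ident)
  from has_derivative_compose[OF this DERIV_exp[THEN has_field_derivative_imp_has_derivative]]
  show ?thesis unfolding mode_def[abs_def] cis_conv_exp by (simp add: mult.commute)
qed

lemma mode_smooth: "smooth (mode M K)"
proof -
  have "C_k n (mode M K)" for n
  proof (induction n)
    case 0 then show ?case
      by (simp add: mode_def[abs_def] cis_conv_exp) (intro continuous_intros)
  next
    case (Suc n)
    then show ?case by (intro C_k_SucI[OF mode_deriv] C_k_bounded_linear[OF bounded_linear_mult_right])
  qed
  then show ?thesis by (simp add: smooth_def)
qed

lemma along_mode:
  "along (s_frame r d 2) (mode M K) p = - (\<i> * of_real (d * pi * of_int M)) * mode M K p"
  "along (s_frame r d 3) (mode M K) p = \<i> * of_real (d / real r * pi * of_int K) * mode M K p"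
  "ptl 0 (mode M K) p = 0"
  by (simp_all add: along_def ptl_def frechet_derivative_at[OF mode_deriv, symmetric] s_frame_eq)

lemma mode_equiv:
  assumes eps: "eps \<in> hom (heis_lattice r) (integer_mod_group 2)"
    and "even (eps ((1, 0), 0))" "even (M - eps ((0, 1), 0))" "even (K - eps ((0, 0), 1))"
  shows "scal_equiv r eps (mode M K)"
  unfolding scal_equiv_def
proof (intro ballI allI)
  fix \<gamma> y assume "\<gamma> \<in> lattice_pts"
  then obtain a b c where \<gamma>: "\<gamma> = ((of_int a, of_int b), of_int c)"
    unfolding lattice_pts_def by (auto elim!: Ints_cases)
  have "mode M K (heis_mult r \<gamma> y) = cis (pi * of_int (M * b + K * c)) * mode M K y"
    by (simp add: mode_def \<gamma> heis_mult_def A_map_def cis_mult algebra_simps)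
  also have "cis (pi * of_int (M * b + K * c)) = exp (\<i> * of_real pi * of_int (eps \<gamma>))"
    unfolding \<gamma> eps_character(2)[OF eps]
  proof (rule cis_pi_cong)
    have "even ((M - eps ((0, 1), 0)) * b + (K - eps ((0, 0), 1)) * c - eps ((1, 0), 0) * a)" using assms by simp
    then show "even (M * b + K * c - (eps ((1, 0), 0) * a + eps ((0, 1), 0) * b + eps ((0, 0), 1) * c))"
      by (simp add: algebra_simps)
  qed
  finally show "mode M K (heis_mult r \<gamma> y) = exp (\<i> * of_real pi * of_int (eps \<gamma>)) * mode M K y" .
qed

subsection \<open>Trigonometric approximation\<close>

inductive_set trig :: "(real \<Rightarrow> complex) set" where
  basis: "(\<lambda>t. cis (of_int j * t)) \<in> trig"
| add: "f \<in> trig \<Longrightarrow> g \<in> trig \<Longrightarrow> (\<lambda>t. f t + g t) \<in> trig"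
| scl: "f \<in> trig \<Longrightarrow> (\<lambda>t. a * f t) \<in> trig"

lemma trig_const: "(\<lambda>t. a) \<in> trig"
  using trig.scl[OF trig.basis[of 0], of a] by simp

lemma trig_mult:
  assumes "f \<in> trig" "g \<in> trig" shows "(\<lambda>t. f t * g t) \<in> trig"
  using assms(1)
proof induction
  case (basis j)
  show ?case using assms(2)
  proof induction
    case (basis k)
    then show ?case using trig.basis[of "j + k"] by (simp add: cis_mult algebra_simps)
  next
    case (add f g) then show ?case using trig.add[OF add(3,4)] by (simp add: algebra_simps)
  next
    case (scl f a) then show ?case using trig.scl[OF scl(2), of a] by (simp add: mult_ac)
  qed
next
  case (add f h) then show ?case using trig.add[OF add(3,4)] by (simp add: algebra_simps)
next
  case (scl f a) then show ?case using trig.scl[OF scl(2), of a] by (simp add: mult_ac)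
qed

lemma trig_periodic: "f \<in> trig \<Longrightarrow> f (t + 2 * pi * of_int n) = f t"
proof (induction rule: trig.induct)
  case (basis j)
  have "cis (of_int j * (t + 2 * pi * of_int n)) = cis (of_int j * t) * cis (2 * pi * of_int (j * n))"
    by (simp add: cis_mult algebra_simps)
  also have "cis (2 * pi * of_int (j * n)) = 1" by (rule cis_multiple_2pi) simp
  finally show ?case by simp
qed auto

lemma trig_real_poly: "real_polynomial_function h \<Longrightarrow> (\<lambda>t. complex_of_real (h (cis t))) \<in> trig"
proof (induction rule: real_polynomial_function.induct)
  case (linear h)
  interpret bounded_linear h by fact
  have h: "complex_of_real (h (cis t)) = (of_real (h 1) / 2 + of_real (h \<i>) / (2 * \<i>)) * cis (of_int 1 * t) +
     (of_real (h 1) / 2 - of_real (h \<i>) / (2 * \<i>)) * cis (of_int (-1) * t)" for t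
  proof -
    have "cis t = cos t *\<^sub>R 1 + sin t *\<^sub>R \<i>" by (simp add: complex_eq_iff)
    then have "h (cis t) = cos t * h 1 + sin t * h \<i>" by (simp only: add scaleR) simp
    then show ?thesis by (simp add: complex_eq_iff Re_divide Im_divide)
  qed
  show ?case unfolding h by (intro trig.add trig.scl trig.basis)
next
  case (const c) then show ?case by (rule trig_const)
next
  case (add f g) then show ?case using trig.add by simp
next
  case (mult f g) then show ?case using trig_mult by simp
qed

lemma trig_approx:
  fixes f :: "real \<Rightarrow> complex"
  assumes f: "continuous_on {0..1} f" "f 0 = f 1" and e: "e > 0"
  shows "\<exists>\<phi>\<in>trig. \<forall>x\<in>{0..1}. cmod (f x - \<phi> (2 * pi * x)) < e"
proof -
  \<comment> \<open>\<open>Arg2pi\<close> jumps at 1. That a closed path nevertheless descends to a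
    continuous function on the circle is extracted from the passage between loops and circle maps,
    applied to the constant homotopy.\<close>
  have "homotopic_loops UNIV f f"
    using f by (simp add: homotopic_loops_refl path_def pathstart_def pathfinish_def)
  then have "homotopic_with_canon (\<lambda>h. True) (sphere 0 1) UNIV (f \<circ> (\<lambda>z. Arg2pi z / (2 * pi))) (f \<circ> (\<lambda>z. Arg2pi z / (2 * pi)))"
    by (rule homotopic_loops_imp_homotopic_circlemaps)
  then have "continuous_on (sphere 0 1) (f \<circ> (\<lambda>z. Arg2pi z / (2 * pi)))"
    by (rule homotopic_with_imp_continuous[THEN conjunct1])
  then obtain g where g: "polynomial_function g" "\<And>z. z \<in> sphere 0 1 \<Longrightarrow> norm ((f \<circ> (\<lambda>z. Arg2pi z / (2 * pi))) z - g z) < e"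
    using Stone_Weierstrass_polynomial_function[OF compact_sphere _ e] by metis
  have "real_polynomial_function (Re \<circ> g)" "real_polynomial_function (Im \<circ> g)"
    using g(1) bounded_linear_Re bounded_linear_Im unfolding polynomial_function_def by blast+
  from this[THEN trig_real_poly] have "(\<lambda>t. complex_of_real (Re (g (cis t))) + \<i> * complex_of_real (Im (g (cis t)))) \<in> trig"
    by (auto intro: trig.add trig.scl)
  then have "(\<lambda>t. g (cis t)) \<in> trig" using complex_eq[symmetric] by simp
  moreover have "cmod (f x - g (cis (2 * pi * x))) < e" if x: "x \<in> {0..1}" for x
  proof -
    have "f (Arg2pi (cis (2 * pi * x)) / (2 * pi)) = f x"
    proof (cases "x = 1")
      case True then show ?thesis using f(2) by (simp add: Arg2pi_of_real[of 1, simplified])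
    next
      case False
      then have "Arg2pi (cis (2 * pi * x)) = 2 * pi * x"
        by (intro Arg2pi_unique[of 1]) (use x in \<open>auto simp: cis_conv_exp\<close>)
      then show ?thesis by simp
    qed
    then show ?thesis using g(2)[of "cis (2 * pi * x)"] by simp
  qed
  ultimately show ?thesis by (intro bexI[of _ "\<lambda>t. g (cis t)"] ballI)
qed

subsection \<open>Closed spaces of functions on the cube\<close>

lemma integral_cub_mono:
  fixes f g :: "heis \<Rightarrow> real"
  assumes "continuous_on UNIV f" "continuous_on UNIV g" "\<And>p. p \<in> cub \<Longrightarrow> f p \<le> g p"
  shows "integral cub f \<le> integral cub g"
  by (rule integral_le) (use assms integrable_cub in auto)

lemma integral_cub_const: "integral cub (\<lambda>p. c::real) = c"
proof -
  have "measure lborel cub = 1" by (simp add: content_Pair)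
  then show ?thesis by simp
qed

text \<open>Models the functions orthogonal to a given vector: a linear space, closed for the
  L^2-distance on the cube. A density statement is thereby expressed as membership in every such
  space that contains the given functions.\<close>

locale null_space =
  fixes Z :: "(heis \<Rightarrow> complex) set"
  assumes Zcont: "f \<in> Z \<Longrightarrow> continuous_on UNIV f"
    and Zadd: "f \<in> Z \<Longrightarrow> g \<in> Z \<Longrightarrow> (\<lambda>p. f p + g p) \<in> Z"
    and Zscl: "f \<in> Z \<Longrightarrow> (\<lambda>p. a * f p) \<in> Z"
    and Zlim2: "continuous_on UNIV f \<Longrightarrow> (\<And>e. e > 0 \<Longrightarrow> \<exists>g\<in>Z. integral cub (\<lambda>p. (cmod (f p - g p))\<^sup>2) \<le> e) \<Longrightarrow> f \<in> Z"
begin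

lemma Zlim:
  assumes f: "continuous_on UNIV f" and a: "\<And>e. e > 0 \<Longrightarrow> \<exists>g\<in>Z. \<forall>p\<in>cub. cmod (f p - g p) \<le> e"
  shows "f \<in> Z"
proof (rule Zlim2[OF f])
  fix e :: real assume "e > 0"
  then obtain g where g: "g \<in> Z" "\<forall>p\<in>cub. cmod (f p - g p) \<le> sqrt e" using a[of "sqrt e"] by auto
  have "integral cub (\<lambda>p. (cmod (f p - g p))\<^sup>2) \<le> integral cub (\<lambda>p. e)"
  proof (rule integral_cub_mono)
    show "continuous_on UNIV (\<lambda>p. (cmod (f p - g p))\<^sup>2)" by (intro continuous_intros f Zcont[OF g(1)])
    show "(cmod (f p - g p))\<^sup>2 \<le> e" if "p \<in> cub" for p
      using power_mono[of "cmod (f p - g p)" "sqrt e" 2] g(2) that \<open>e > 0\<close> by simp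
  qed simp
  then show "\<exists>g\<in>Z. integral cub (\<lambda>p. (cmod (f p - g p))\<^sup>2) \<le> e"
    using g(1) by (auto simp only: integral_cub_const)
qed

lemma Zcong:
  assumes "f \<in> Z" "continuous_on UNIV g" "\<And>p. p \<in> cub \<Longrightarrow> g p = f p"
  shows "g \<in> Z"
proof (rule Zlim[OF assms(2)])
  show "\<exists>h\<in>Z. \<forall>p\<in>cub. cmod (g p - h p) \<le> e" if "e > 0" for e :: real
    using that assms(1,3) by (intro bexI[of _ f] ballI) (simp_all del: split_paired_All)
qed

end

text \<open>Vanishing at both ends of the interval serves twice: a twisted bump is still periodic,
  and over the cube only one term of its theta series survives.\<close>

definition bump :: "(real \<Rightarrow> complex) \<Rightarrow> bool" where
  "bump c \<longleftrightarrow> continuous_on UNIV c \<and> (\<forall>x. x \<le> 0 \<or> x \<ge> 1 \<longrightarrow> c x = 0)"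

definition sep :: "(real \<Rightarrow> complex) \<Rightarrow> (real \<Rightarrow> complex) \<Rightarrow> (real \<Rightarrow> complex) \<Rightarrow> heis \<Rightarrow> complex" where
  "sep a b c p = a (fst (fst p)) * b (snd (fst p)) * c (snd p)"

lemma sep_cont:
  assumes "continuous_on UNIV a" "continuous_on UNIV b" "continuous_on UNIV c"
  shows "continuous_on UNIV (sep a b c)"
  unfolding sep_def[abs_def]
  by (intro continuous_intros continuous_on_compose2[OF assms(1)] continuous_on_compose2[OF assms(2)] continuous_on_compose2[OF assms(3)]) auto

lemma trig_cont: "f \<in> trig \<Longrightarrow> continuous_on UNIV f"
proof (induction rule: trig.induct)
  case (basis j) show ?case by (simp add: cis_conv_exp) (intro continuous_intros)
qed (auto intro: continuous_intros)

lemma cis_lin_cont: "continuous_on UNIV (\<lambda>x. cis (a * x))"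
  by (simp add: cis_conv_exp) (intro continuous_intros)

lemma bounded_01:
  fixes a :: "real \<Rightarrow> complex"
  assumes "continuous_on UNIV a" shows "\<exists>B>0. \<forall>x\<in>{0..1}. cmod (a x) \<le> B"
proof -
  have "compact (a ` {0..1})" by (rule compact_continuous_image) (use assms continuous_on_subset in auto)
  then obtain B where "B > 0" "\<forall>y\<in>a ` {0..1}. norm y \<le> B" using compact_imp_bounded bounded_pos by metis
  then show ?thesis by auto
qed

text \<open>Removing the factor \<open>cis (pi * n * x)\<close> before the periodic approximation
  and restoring it afterwards leaves only frequencies of the parity of \<open>n\<close>. The
  function vanishes at both ends, so the twist does not spoil periodicity.\<close>

lemma bump_trig_approx:
  assumes a: "bump a" and e: "e > 0"
  shows "\<exists>\<phi>\<in>trig. \<forall>x\<in>{0..1}. cmod (a x - cis (pi * of_int n * x) * \<phi> (2 * pi * x)) < e"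
proof -
  have ac: "continuous_on UNIV a" "a 0 = 0" "a 1 = 0" using a by (auto simp: bump_def)
  have "\<exists>\<phi>\<in>trig. \<forall>x\<in>{0..1}. cmod (a x * cis (- (pi * of_int n) * x) - \<phi> (2 * pi * x)) < e"
  proof (rule trig_approx[of "\<lambda>x. a x * cis (- (pi * of_int n) * x)" e])
    show "continuous_on {0..1} (\<lambda>x. a x * cis (- (pi * of_int n) * x))"
      by (rule continuous_on_subset[OF continuous_on_mult[OF ac(1) cis_lin_cont]]) simp
  qed (use ac e in auto)
  then obtain \<phi> where \<phi>: "\<phi> \<in> trig" "\<forall>x\<in>{0..1}. cmod (a x * cis (- (pi * of_int n) * x) - \<phi> (2 * pi * x)) < e"
    by (elim bexE) simp
  have "cmod (a x - cis (pi * of_int n * x) * \<phi> (2 * pi * x)) < e" if "x \<in> {0..1}" for x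
  proof -
    have "a x - cis (pi * of_int n * x) * \<phi> (2 * pi * x) = cis (pi * of_int n * x) * (a x * cis (- (pi * of_int n) * x) - \<phi> (2 * pi * x))"
      by (simp add: algebra_simps cis_mult)
    then show ?thesis using bspec[OF \<phi>(2) that] by (simp add: norm_mult)
  qed
  then show ?thesis using \<phi>(1) by (intro bexI[of _ \<phi>] ballI)
qed

context null_space begin

lemma sep_trig:
  assumes modes: "\<And>N M. even (N - q1) \<Longrightarrow> even (M - q2) \<Longrightarrow> sep (\<lambda>x. cis (pi * of_int N * x)) (\<lambda>x. cis (pi * of_int M * x)) c \<in> Z"
    and \<phi>: "\<phi> \<in> trig" and \<psi>: "\<psi> \<in> trig"
  shows "sep (\<lambda>x. cis (pi * of_int q1 * x) * \<phi> (2 * pi * x)) (\<lambda>x. cis (pi * of_int q2 * x) * \<psi> (2 * pi * x)) c \<in> Z"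
  using \<phi>
proof induction
  case (basis j)
  show ?case using \<psi>
  proof induction
    case (basis k)
    show ?case using modes[of "q1 + 2 * j" "q2 + 2 * k"] by (simp add: cis_mult algebra_simps)
  next
    case (add f g) then show ?case using Zadd[OF add(3,4)] by (simp add: sep_def[abs_def] algebra_simps)
  next
    case (scl f a) then show ?case using Zscl[OF scl(2), of a] by (simp add: sep_def[abs_def] mult_ac)
  qed
next
  case (add f g) then show ?case using Zadd[OF add(3,4)] by (simp add: sep_def[abs_def] algebra_simps)
next
  case (scl f a) then show ?case using Zscl[OF scl(2), of a] by (simp add: sep_def[abs_def] mult_ac)
qed

lemma sep_approx:
  assumes b: "continuous_on UNIV a" "continuous_on UNIV b" "continuous_on UNIV c"
    and ap: "\<And>e. e > 0 \<Longrightarrow> \<exists>a'. (\<forall>x\<in>{0..1}. cmod (a x - a' x) < e) \<and> sep a' b c \<in> Z"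
  shows "sep a b c \<in> Z"
proof (rule Zlim[OF sep_cont[OF b]])
  fix e :: real assume "e > 0"
  obtain B C where BC: "B > 0" "C > 0" "\<And>x. x \<in> {0..1} \<Longrightarrow> cmod (b x) \<le> B" "\<And>x. x \<in> {0..1} \<Longrightarrow> cmod (c x) \<le> C"
    using bounded_01[OF b(2)] bounded_01[OF b(3)] by auto
  then have "e / (B * C) > 0" using \<open>e > 0\<close> by simp
  then obtain a' where a': "\<And>x. x \<in> {0..1} \<Longrightarrow> cmod (a x - a' x) < e / (B * C)" "sep a' b c \<in> Z" using ap by metis
  have "cmod (sep a b c p - sep a' b c p) \<le> e" if "p \<in> cub" for p
  proof -
    have p: "fst (fst p) \<in> {0..1}" "snd (fst p) \<in> {0..1}" "snd p \<in> {0..1}" using that by (auto simp: cub_eq)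
    have "cmod (sep a b c p - sep a' b c p) = cmod (a (fst (fst p)) - a' (fst (fst p))) * (cmod (b (snd (fst p))) * cmod (c (snd p)))"
      unfolding sep_def norm_mult[symmetric] by (simp add: algebra_simps)
    also have "\<dots> \<le> (e / (B * C)) * (B * C)"
      by (intro mult_mono less_imp_le[OF a'(1)] BC p) (use BC \<open>e > 0\<close> in auto)
    finally show ?thesis using BC by simp
  qed
  then show "\<exists>g\<in>Z. \<forall>p\<in>cub. cmod (sep a b c p - g p) \<le> e" using a'(2) by blast
qed

lemma sep_approx2:
  assumes b: "continuous_on UNIV a" "continuous_on UNIV b" "continuous_on UNIV c"
    and ap: "\<And>e. e > 0 \<Longrightarrow> \<exists>b'. (\<forall>x\<in>{0..1}. cmod (b x - b' x) < e) \<and> sep a b' c \<in> Z"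
  shows "sep a b c \<in> Z"
proof (rule Zlim[OF sep_cont[OF b]])
  fix e :: real assume "e > 0"
  obtain B C where BC: "B > 0" "C > 0" "\<And>x. x \<in> {0..1} \<Longrightarrow> cmod (a x) \<le> B" "\<And>x. x \<in> {0..1} \<Longrightarrow> cmod (c x) \<le> C"
    using bounded_01[OF b(1)] bounded_01[OF b(3)] by auto
  then have "e / (B * C) > 0" using \<open>e > 0\<close> by simp
  then obtain b' where b': "\<And>x. x \<in> {0..1} \<Longrightarrow> cmod (b x - b' x) < e / (B * C)" "sep a b' c \<in> Z" using ap by metis
  have "cmod (sep a b c p - sep a b' c p) \<le> e" if "p \<in> cub" for p
  proof -
    have p: "fst (fst p) \<in> {0..1}" "snd (fst p) \<in> {0..1}" "snd p \<in> {0..1}" using that by (auto simp: cub_eq)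
    have "cmod (sep a b c p - sep a b' c p) = cmod (b (snd (fst p)) - b' (snd (fst p))) * (cmod (a (fst (fst p))) * cmod (c (snd p)))"
      unfolding sep_def norm_mult[symmetric] by (simp add: algebra_simps)
    also have "\<dots> \<le> (e / (B * C)) * (B * C)"
      by (intro mult_mono less_imp_le[OF b'(1)] BC p) (use BC \<open>e > 0\<close> in auto)
    finally show ?thesis using BC by simp
  qed
  then show "\<exists>g\<in>Z. \<forall>p\<in>cub. cmod (sep a b c p - g p) \<le> e" using b'(2) by blast
qed

lemma sep_approx3:
  assumes b: "continuous_on UNIV a" "continuous_on UNIV b" "continuous_on UNIV c"
    and ap: "\<And>e. e > 0 \<Longrightarrow> \<exists>c'. (\<forall>x\<in>{0..1}. cmod (c x - c' x) < e) \<and> sep a b c' \<in> Z"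
  shows "sep a b c \<in> Z"
proof (rule Zlim[OF sep_cont[OF b]])
  fix e :: real assume "e > 0"
  obtain B C where BC: "B > 0" "C > 0" "\<And>x. x \<in> {0..1} \<Longrightarrow> cmod (a x) \<le> B" "\<And>x. x \<in> {0..1} \<Longrightarrow> cmod (b x) \<le> C"
    using bounded_01[OF b(1)] bounded_01[OF b(2)] by auto
  then have "e / (B * C) > 0" using \<open>e > 0\<close> by simp
  then obtain c' where c': "\<And>x. x \<in> {0..1} \<Longrightarrow> cmod (c x - c' x) < e / (B * C)" "sep a b c' \<in> Z" using ap by metis
  have "cmod (sep a b c p - sep a b c' p) \<le> e" if "p \<in> cub" for p
  proof -
    have p: "fst (fst p) \<in> {0..1}" "snd (fst p) \<in> {0..1}" "snd p \<in> {0..1}" using that by (auto simp: cub_eq)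
    have "cmod (sep a b c p - sep a b c' p) = cmod (c (snd p) - c' (snd p)) * (cmod (a (fst (fst p))) * cmod (b (snd (fst p))))"
      unfolding sep_def norm_mult[symmetric] by (simp add: algebra_simps)
    also have "\<dots> \<le> (e / (B * C)) * (B * C)"
      by (intro mult_mono less_imp_le[OF c'(1)] BC p) (use BC \<open>e > 0\<close> in auto)
    finally show ?thesis using BC by simp
  qed
  then show "\<exists>g\<in>Z. \<forall>p\<in>cub. cmod (sep a b c p - g p) \<le> e" using c'(2) by blast
qed

text \<open>One factor is replaced at a time; the other two are bounded on the unit interval, so the
  error stays controlled.\<close>

lemma sep_bump:
  assumes modes: "\<And>N M c. even (N - q1) \<Longrightarrow> even (M - q2) \<Longrightarrow> bump c \<Longrightarrow> sep (\<lambda>x. cis (pi * of_int N * x)) (\<lambda>x. cis (pi * of_int M * x)) c \<in> Z"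
    and a: "bump a" and b: "bump b" and c: "bump c"
  shows "sep a b c \<in> Z"
proof -
  have cont: "continuous_on UNIV a" "continuous_on UNIV b" "continuous_on UNIV c" using a b c by (auto simp: bump_def)
  have tc: "continuous_on UNIV (\<lambda>x. cis (pi * of_int n * x) * \<psi> (2 * pi * x))" if "\<psi> \<in> trig" for \<psi> n
    by (intro continuous_intros cis_lin_cont continuous_on_compose2[OF trig_cont[OF that]]) auto
  have 1: "sep a (\<lambda>x. cis (pi * of_int q2 * x) * \<psi> (2 * pi * x)) c \<in> Z" if \<psi>: "\<psi> \<in> trig" for \<psi>
  proof (rule sep_approx[OF cont(1) tc[OF \<psi>] cont(3)])
    fix e :: real assume "e > 0"
    obtain \<phi> where \<phi>: "\<phi> \<in> trig" "\<forall>x\<in>{0..1}. cmod (a x - cis (pi * of_int q1 * x) * \<phi> (2 * pi * x)) < e"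
      using bump_trig_approx[OF a \<open>e > 0\<close>, where n = q1] by (elim bexE) simp
    show "\<exists>a'. (\<forall>x\<in>{0..1}. cmod (a x - a' x) < e) \<and> sep a' (\<lambda>x. cis (pi * of_int q2 * x) * \<psi> (2 * pi * x)) c \<in> Z"
      by (intro exI[of _ "\<lambda>x. cis (pi * of_int q1 * x) * \<phi> (2 * pi * x)"] conjI \<phi>(2) sep_trig[OF modes[OF _ _ c] \<phi>(1) \<psi>])
  qed
  show ?thesis
  proof (rule sep_approx2[OF cont])
    fix e :: real assume "e > 0"
    obtain \<psi> where \<psi>: "\<psi> \<in> trig" "\<forall>x\<in>{0..1}. cmod (b x - cis (pi * of_int q2 * x) * \<psi> (2 * pi * x)) < e"
      using bump_trig_approx[OF b \<open>e > 0\<close>, where n = q2] by (elim bexE) simp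
    show "\<exists>b'. (\<forall>x\<in>{0..1}. cmod (b x - b' x) < e) \<and> sep a b' c \<in> Z"
      by (intro exI[of _ "\<lambda>x. cis (pi * of_int q2 * x) * \<psi> (2 * pi * x)"] conjI \<psi>(2) 1[OF \<psi>(1)])
  qed
qed

text \<open>For central frequency 0 no theta functions are at hand; the third factor too is
  approximated by exponentials of the right parity.\<close>

lemma sep_mode:
  assumes modes: "\<And>K. even (K - q3) \<Longrightarrow> sep (\<lambda>x. 1) (\<lambda>x. cis (pi * of_int M * x)) (\<lambda>x. cis (pi * of_int K * x)) \<in> Z" and c: "bump c"
  shows "sep (\<lambda>x. 1) (\<lambda>x. cis (pi * of_int M * x)) c \<in> Z"
proof (rule sep_approx3)
  fix e :: real assume "e > 0"
  obtain \<phi> where \<phi>: "\<phi> \<in> trig" "\<forall>x\<in>{0..1}. cmod (c x - cis (pi * of_int q3 * x) * \<phi> (2 * pi * x)) < e"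
    using bump_trig_approx[OF c \<open>e > 0\<close>, where n = q3] by (elim bexE) simp
  have "sep (\<lambda>x. 1) (\<lambda>x. cis (pi * of_int M * x)) (\<lambda>x. cis (pi * of_int q3 * x) * \<phi> (2 * pi * x)) \<in> Z"
    using \<phi>(1)
  proof induction
    case (basis j)
    show ?case using modes[of "q3 + 2 * j"] by (simp add: cis_mult algebra_simps)
  next
    case (add f g) then show ?case using Zadd[OF add(3,4)] by (simp add: sep_def[abs_def] algebra_simps)
  next
    case (scl f a) then show ?case using Zscl[OF scl(2), of a] by (simp add: sep_def[abs_def] mult_ac)
  qed
  then show "\<exists>c'. (\<forall>x\<in>{0..1}. cmod (c x - c' x) < e) \<and> sep (\<lambda>x. 1) (\<lambda>x. cis (pi * of_int M * x)) c' \<in> Z"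
    by (intro exI[of _ "\<lambda>x. cis (pi * of_int q3 * x) * \<phi> (2 * pi * x)"] conjI \<phi>(2))
qed (use c cis_lin_cont in \<open>auto simp: bump_def\<close>)

end

text \<open>A cutoff that vanishes at the ends of the unit interval and outside it, and differs from
  1 inside by at most \<open>(2 * x - 1) ^ (2 * L)\<close>. The integral of this defect is
  \<open>1 / (2 * L + 1)\<close>, which makes the L^2-error explicit.\<close>

definition chi :: "nat \<Rightarrow> real \<Rightarrow> real" where "chi L x = max 0 (1 - (2 * x - 1) ^ (2 * L))"

inductive_set sepr :: "(heis \<Rightarrow> complex) set" where
  base: "continuous_on UNIV a \<Longrightarrow> continuous_on UNIV b \<Longrightarrow> continuous_on UNIV c \<Longrightarrow> sep a b c \<in> sepr"
| add: "f \<in> sepr \<Longrightarrow> g \<in> sepr \<Longrightarrow> (\<lambda>p. f p + g p) \<in> sepr"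

lemma sepr_mult:
  assumes "f \<in> sepr" "g \<in> sepr" shows "(\<lambda>p. f p * g p) \<in> sepr"
  using assms(1)
proof induction
  case (base a b c)
  note abc = base
  show ?case using assms(2)
  proof induction
    case (base a' b' c')
    have "sep (\<lambda>x. a x * a' x) (\<lambda>x. b x * b' x) (\<lambda>x. c x * c' x) \<in> sepr"
      by (intro sepr.base continuous_intros abc base)
    then show ?case by (simp add: sep_def[abs_def] mult_ac)
  next
    case (add f g) then show ?case using sepr.add[OF add(3,4)] by (simp add: algebra_simps)
  qed
next
  case (add f h) then show ?case using sepr.add[OF add(3,4)] by (simp add: algebra_simps)
qed

lemma sepr_const: "(\<lambda>p. a) \<in> sepr"
  using sepr.base[of "\<lambda>x. a" "\<lambda>x. 1" "\<lambda>x. 1"] by (simp add: sep_def[abs_def])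

lemma sepr_real_poly: "real_polynomial_function h \<Longrightarrow> (\<lambda>p::heis. complex_of_real (h p)) \<in> sepr"
proof (induction rule: real_polynomial_function.induct)
  case (linear h)
  interpret bounded_linear h by fact
  define k1 k2 k3 where "k1 = complex_of_real (h ((1, 0), 0))" and "k2 = complex_of_real (h ((0, 1), 0))"
    and "k3 = complex_of_real (h ((0, 0), 1))"
  have "complex_of_real (h p) = sep (\<lambda>x. of_real x * k1) (\<lambda>x. 1) (\<lambda>x. 1) p +
     (sep (\<lambda>x. 1) (\<lambda>x. of_real x * k2) (\<lambda>x. 1) p + sep (\<lambda>x. 1) (\<lambda>x. 1) (\<lambda>x. of_real x * k3) p)" for p
  proof -
    have "p = fst (fst p) *\<^sub>R ((1, 0), 0) + (snd (fst p) *\<^sub>R ((0, 1), 0) + snd p *\<^sub>R ((0, 0), 1))"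
      by (cases p; cases "fst p") auto
    then have "h p = h (fst (fst p) *\<^sub>R ((1, 0), 0) + (snd (fst p) *\<^sub>R ((0, 1), 0) + snd p *\<^sub>R ((0, 0), 1)))" by (rule arg_cong)
    then show ?thesis unfolding k1_def k2_def k3_def by (simp only: add scaleR sep_def) simp
  qed
  moreover have "(\<lambda>p. sep (\<lambda>x. of_real x * k1) (\<lambda>x. 1) (\<lambda>x. 1) p +
     (sep (\<lambda>x. 1) (\<lambda>x. of_real x * k2) (\<lambda>x. 1) p + sep (\<lambda>x. 1) (\<lambda>x. 1) (\<lambda>x. of_real x * k3) p)) \<in> sepr"
    by (intro sepr.add sepr.base continuous_intros)
  ultimately show ?case by simp
next
  case (const c) then show ?case by (rule sepr_const)
next
  case (add f g) then show ?case using sepr.add by simp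
next
  case (mult f g) then show ?case using sepr_mult by simp
qed

lemma chi_bounds: "x \<in> {0..1} \<Longrightarrow> 0 \<le> chi L x" "x \<in> {0..1} \<Longrightarrow> chi L x \<le> 1"
  "x \<in> {0..1} \<Longrightarrow> 1 - chi L x \<le> (2 * x - 1) ^ (2 * L)"
  by (auto simp: chi_def)

lemma chi_bump: "continuous_on UNIV a \<Longrightarrow> L > 0 \<Longrightarrow> bump (\<lambda>x. a x * of_real (chi L x))"
proof -
  assume a: "continuous_on UNIV a" and L: "L > 0"
  have "chi L x = 0" if "x \<le> 0 \<or> x \<ge> 1" for x
  proof -
    have "1 \<le> \<bar>2 * x - 1\<bar>" using that by auto
    then have "1 \<le> \<bar>2 * x - 1\<bar> ^ (2 * L)" by (rule one_le_power)
    then show ?thesis by (simp add: chi_def power_even_abs)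
  qed
  then show ?thesis using a unfolding bump_def chi_def by (auto intro!: continuous_intros)
qed

lemma integral_odd_power: "integral {0..1} (\<lambda>x::real. (2 * x - 1) ^ (2 * L)) = 1 / (2 * real L + 1)"
proof -
  have "((\<lambda>x::real. (2 * x - 1) ^ (2 * L)) has_integral ((2 * 1 - 1) ^ Suc (2 * L) / (2 * (2 * real L + 1)) - (2 * 0 - 1) ^ Suc (2 * L) / (2 * (2 * real L + 1)))) {0..1}"
  proof (rule fundamental_theorem_of_calculus)
    fix x :: real
    have "((\<lambda>x. (2 * x - 1) ^ Suc (2 * L) / (2 * (2 * real L + 1))) has_real_derivative (2 * x - 1) ^ (2 * L)) (at x within {0..1})"
    proof -
      have "((\<lambda>x. (2 * x - 1) ^ Suc (2 * L) / (2 * (2 * real L + 1))) has_real_derivative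
          (real (Suc (2 * L)) * (2 * x - 1) ^ (2 * L) * 2) / (2 * (2 * real L + 1))) (at x within {0..1})"
        by (auto intro!: derivative_eq_intros simp del: power_Suc)
      moreover have "(real (Suc (2 * L)) * (2 * x - 1) ^ (2 * L) * 2) / (2 * (2 * real L + 1)) = (2 * x - 1) ^ (2 * L)"
        by (simp add: field_simps)
      ultimately show ?thesis by simp
    qed
    then show "((\<lambda>x. (2 * x - 1) ^ Suc (2 * L) / (2 * (2 * real L + 1))) has_vector_derivative (2 * x - 1) ^ (2 * L)) (at x within {0..1})"
      by (simp add: has_real_derivative_iff_has_vector_derivative)
  qed simp
  then have "integral {0..1} (\<lambda>x::real. (2 * x - 1) ^ (2 * L)) = (2 * 1 - 1) ^ Suc (2 * L) / (2 * (2 * real L + 1)) - (2 * 0 - 1) ^ Suc (2 * L) / (2 * (2 * real L + 1))"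
    by (rule integral_unique)
  then show ?thesis by (simp add: field_simps)
qed

context null_space begin

text \<open>Products of bumps vanish on the boundary of the cube, so they cannot approximate
  \<open>f\<close> uniformly. A polynomial does so, and the cutoff then changes it only in L^2, by
  an amount that tends to 0 with growing \<open>L\<close>.\<close>

lemma total:
  assumes modes: "\<And>N M c. even (N - q1) \<Longrightarrow> even (M - q2) \<Longrightarrow> bump c \<Longrightarrow> sep (\<lambda>x. cis (pi * of_int N * x)) (\<lambda>x. cis (pi * of_int M * x)) c \<in> Z"
    and f: "continuous_on UNIV f"
  shows "f \<in> Z"
proof (rule Zlim2[OF f])
  fix e :: real assume "e > 0"
  have cf: "compact (f ` cub)" by (rule compact_continuous_image) (use f continuous_on_subset in auto)
  then obtain B where B: "B > 0" "\<And>p. p \<in> cub \<Longrightarrow> cmod (f p) \<le> B"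
    using compact_imp_bounded bounded_pos by (metis imageI)
  \<comment> \<open>The bound 1 keeps the polynomial below \<open>B + 1\<close>; the other half of
    the minimum makes \<open>2 * \<delta>^2\<close> at most half of the tolerance.\<close>
  define \<delta> where "\<delta> = min 1 (sqrt (e / 4))"
  have \<delta>: "\<delta> > 0" "2 * \<delta>\<^sup>2 \<le> e / 2"
  proof -
    show "\<delta> > 0" using \<open>e > 0\<close> by (simp add: \<delta>_def)
    have "\<delta>\<^sup>2 \<le> (sqrt (e / 4))\<^sup>2" by (rule power_mono) (use \<open>\<delta> > 0\<close> in \<open>auto simp: \<delta>_def\<close>)
    then show "2 * \<delta>\<^sup>2 \<le> e / 2" using \<open>e > 0\<close> by simp
  qed
  obtain P where P: "polynomial_function P" "\<And>p. p \<in> cub \<Longrightarrow> norm (f p - P p) < \<delta>"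
    using Stone_Weierstrass_polynomial_function[OF compact_cbox _ \<delta>(1), of "((0,0),0)" "((1,1),1)" f] f continuous_on_subset by blast
  have "real_polynomial_function (Re \<circ> P)" "real_polynomial_function (Im \<circ> P)"
    using P(1) bounded_linear_Re bounded_linear_Im unfolding polynomial_function_def by blast+
  from sepr.add[OF sepr_real_poly[OF this(1)] sepr_mult[OF sepr_const[of \<i>] sepr_real_poly[OF this(2)]]]
  have "(\<lambda>p. complex_of_real (Re (P p)) + \<i> * complex_of_real (Im (P p))) \<in> sepr" by (simp only: o_def)
  then have Ps: "P \<in> sepr" using complex_eq[symmetric] by simp
  \<comment> \<open>The cutoff contributes \<open>2 * (B + 1)^2\<close> times the integral
    \<open>3 / (2 * L + 1)\<close> of the three defects; this is the other half.\<close>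
  obtain L :: nat where L: "L > 0" "6 * (B + 1)\<^sup>2 / (2 * real L + 1) \<le> e / 2"
  proof -
    obtain L :: nat where "12 * (B + 1)\<^sup>2 / e < real L" using reals_Archimedean2 by blast
    then have a: "12 * (B + 1)\<^sup>2 < e * real L" using \<open>e > 0\<close> by (simp add: pos_divide_less_eq mult.commute)
    have "e * (2 * real L + 1) = 2 * (e * real L) + e" "0 \<le> e * real L" using \<open>e > 0\<close> by (simp_all add: algebra_simps)
    then have "12 * (B + 1)\<^sup>2 \<le> e * (2 * real L + 1)" using a \<open>e > 0\<close> by linarith
    then have "6 * (B + 1)\<^sup>2 / (2 * real L + 1) \<le> e / 2" by (simp add: field_simps)
    moreover have "L > 0"
    proof (rule ccontr)
      assume "\<not> L > 0"
      then have "12 * (B + 1)\<^sup>2 < 0" using a by simp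
      then show False using zero_le_power2[of "B + 1"] by linarith
    qed
    ultimately show ?thesis using that by blast
  qed
  define X where "X p = chi L (fst (fst p)) * chi L (snd (fst p)) * chi L (snd p)" for p :: heis
  have PX: "(\<lambda>p. g p * of_real (X p)) \<in> Z" if "g \<in> sepr" for g
    using that
  proof induction
    case (base a b c)
    have "sep (\<lambda>x. a x * of_real (chi L x)) (\<lambda>x. b x * of_real (chi L x)) (\<lambda>x. c x * of_real (chi L x)) \<in> Z"
      by (rule sep_bump[OF modes]) (auto intro: chi_bump base L)
    then show ?case by (simp add: sep_def[abs_def] X_def mult_ac)
  next
    case (add f g) then show ?case using Zadd[OF add(3,4)] by (simp add: algebra_simps)
  qed
  define Y where "Y p = (2 * fst (fst p) - 1) ^ (2 * L) + (2 * snd (fst p) - 1) ^ (2 * L) + (2 * snd p - 1) ^ (2 * L)" for p :: heis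
  have Yc: "continuous_on UNIV Y" unfolding Y_def[abs_def] by (intro continuous_intros)
  have IY: "integral cub Y = 3 / (2 * real L + 1)"
  proof -
    have c: "continuous_on UNIV (\<lambda>p::heis. (2 * fst (fst p) - 1) ^ (2 * L))" "continuous_on UNIV (\<lambda>p::heis. (2 * snd (fst p) - 1) ^ (2 * L))"
      "continuous_on UNIV (\<lambda>p::heis. (2 * snd p - 1) ^ (2 * L))" by (intro continuous_intros)+
    have "integral cub (\<lambda>p. (2 * fst (fst p) - 1) ^ (2 * L)) = 1 / (2 * real L + 1)"
      "integral cub (\<lambda>p. (2 * snd (fst p) - 1) ^ (2 * L)) = 1 / (2 * real L + 1)"
      "integral cub (\<lambda>p. (2 * snd p - 1) ^ (2 * L)) = 1 / (2 * real L + 1)"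
      unfolding cub_iter(1)[OF c(1)] cub_iter(1)[OF c(2)] cub_iter(1)[OF c(3)] by (simp_all add: integral_odd_power)
    moreover have "integral cub Y = integral cub (\<lambda>p. (2 * fst (fst p) - 1) ^ (2 * L)) + integral cub (\<lambda>p. (2 * snd (fst p) - 1) ^ (2 * L)) + integral cub (\<lambda>p. (2 * snd p - 1) ^ (2 * L))"
      unfolding Y_def[abs_def] using integral_add[OF integrable_cub[OF continuous_on_add[OF c(1,2)]] integrable_cub[OF c(3)]]
        integral_add[OF integrable_cub[OF c(1)] integrable_cub[OF c(2)]] by simp
    ultimately show ?thesis by simp
  qed
  have pt: "(cmod (f p - P p * of_real (X p)))\<^sup>2 \<le> 2 * \<delta>\<^sup>2 + 2 * (B + 1)\<^sup>2 * Y p" if p: "p \<in> cub" for p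
  proof -
    define x y s where "x = chi L (fst (fst p))" and "y = chi L (snd (fst p))" and "s = chi L (snd p)"
    have p': "fst (fst p) \<in> {0..1}" "snd (fst p) \<in> {0..1}" "snd p \<in> {0..1}" using p by (auto simp: cub_eq)
    have b: "0 \<le> x" "x \<le> 1" "0 \<le> y" "y \<le> 1" "0 \<le> s" "s \<le> 1" using chi_bounds p' by (auto simp: x_def y_def s_def)
    have Xb: "0 \<le> X p" "X p \<le> 1" "1 - X p \<le> Y p"
    proof -
      have X: "X p = x * y * s" by (simp add: X_def x_def y_def s_def)
      have xy: "0 \<le> x * y" "x * y \<le> 1" using b by (auto intro: mult_le_one)
      show "0 \<le> X p" "X p \<le> 1" unfolding X using xy b by (auto intro: mult_le_one)
      have "1 - x * y \<le> (1 - x) + (1 - y)" using mult_nonneg_nonneg[of "1 - x" "1 - y"] b by (simp add: algebra_simps)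
      moreover have "1 - (x * y) * s \<le> (1 - x * y) + (1 - s)" using mult_nonneg_nonneg[of "1 - x * y" "1 - s"] b xy by (simp add: algebra_simps)
      moreover have "1 - x \<le> (2 * fst (fst p) - 1) ^ (2 * L)" "1 - y \<le> (2 * snd (fst p) - 1) ^ (2 * L)" "1 - s \<le> (2 * snd p - 1) ^ (2 * L)"
        unfolding x_def y_def s_def by (intro chi_bounds p')+
      ultimately show "1 - X p \<le> Y p" unfolding X Y_def by linarith
    qed
    have PB: "cmod (P p) \<le> B + 1"
      using P(2)[OF p] B(2)[OF p] norm_triangle_sub[of "P p" "f p"] by (simp add: norm_minus_commute \<delta>_def)
    have "cmod (f p - P p * of_real (X p)) \<le> cmod (f p - P p) + cmod (P p * of_real (1 - X p))"
      using norm_triangle_ineq[of "f p - P p" "P p * of_real (1 - X p)"] by (simp add: algebra_simps)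
    also have "\<dots> \<le> \<delta> + (B + 1) * (1 - X p)"
      using P(2)[OF p] PB Xb B by (intro add_mono) (auto simp: norm_mult intro!: mult_mono simp del: of_real_diff)
    finally have "(cmod (f p - P p * of_real (X p)))\<^sup>2 \<le> (\<delta> + (B + 1) * (1 - X p))\<^sup>2"
      by (rule power_mono) simp
    also have "\<dots> \<le> 2 * \<delta>\<^sup>2 + 2 * ((B + 1) * (1 - X p))\<^sup>2"
      using sum_squares_bound[of \<delta> "(B + 1) * (1 - X p)"] by (simp add: power2_sum)
    also have "((B + 1) * (1 - X p))\<^sup>2 \<le> (B + 1)\<^sup>2 * Y p"
    proof -
      \<comment> \<open>As \<open>1 - X p\<close> lies between 0 and 1, its square is dominated by
        itself, and so by the integrable defect \<open>Y\<close>.\<close>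
      have "(1 - X p)\<^sup>2 \<le> 1 - X p" using Xb mult_left_le[of "1 - X p" "1 - X p"] by (simp add: power2_eq_square)
      then show ?thesis unfolding power_mult_distrib using Xb by (intro mult_left_mono) auto
    qed
    finally show ?thesis by simp
  qed
  have "integral cub (\<lambda>p. (cmod (f p - P p * of_real (X p)))\<^sup>2) \<le> integral cub (\<lambda>p. 2 * \<delta>\<^sup>2 + 2 * (B + 1)\<^sup>2 * Y p)"
    by (intro integral_cub_mono pt continuous_intros f Zcont[OF PX[OF Ps]] Yc)
  also have "\<dots> = 2 * \<delta>\<^sup>2 + 2 * (B + 1)\<^sup>2 * integral cub Y"
  proof -
    have "integral cub (\<lambda>p. 2 * \<delta>\<^sup>2 + 2 * (B + 1)\<^sup>2 * Y p) = integral cub (\<lambda>p. 2 * \<delta>\<^sup>2) + integral cub (\<lambda>p. 2 * (B + 1)\<^sup>2 * Y p)"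
      by (rule integral_add; rule integrable_cub; intro continuous_intros Yc)
    then show ?thesis by (simp only: integral_cub_const integral_mult_right)
  qed
  also have "\<dots> \<le> e" using \<delta>(2) L(2) unfolding IY by simp
  finally show "\<exists>g\<in>Z. integral cub (\<lambda>p. (cmod (f p - g p))\<^sup>2) \<le> e"
    using PX[OF Ps] by (intro bexI[of _ "\<lambda>p. P p * of_real (X p)"])
qed

end

subsection \<open>Density of the Gaussian theta functions\<close>

lemma power_fact_le_exp:
  assumes "(y::real) \<ge> 0" shows "y ^ m \<le> fact m * exp y"
proof -
  have "(\<Sum>i\<in>{m}. y ^ i /\<^sub>R fact i) \<le> (\<Sum>i. y ^ i /\<^sub>R fact i)"
    by (rule sum_le_suminf[OF summable_exp_generic]) (use assms in auto)
  then have "y ^ m / fact m \<le> exp y" by (simp add: exp_def field_simps)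
  then show ?thesis by (simp add: field_simps)
qed

text \<open>The Taylor remainder of the exponential grows with \<open>x\<close>, but half of the
  exponent of the Gaussian absorbs it, and the other half pays for the weight
  \<open>1 + x^2\<close>. A factor \<open>B ^ (j + 1) / fact j\<close> remains, which tends to
  0.\<close>

lemma cis_gauss_approx:
  assumes \<kappa>: "\<kappa> > 0" and \<eta>: "\<eta> > 0"
  shows "\<exists>q. \<forall>x. (1 + x\<^sup>2) * cmod (cis (b * x) * of_real (exp (- \<kappa> * x\<^sup>2 / 2)) - poly q (of_real x) * of_real (exp (- \<kappa> * x\<^sup>2 / 2))) \<le> \<eta>"
proof -
  obtain C where C: "\<And>x::real. (1 + x\<^sup>2) ^ 1 * exp (- (\<kappa> / 2) * x\<^sup>2 / 2) \<le> C" using gaussian_power_bound[of "\<kappa> / 2" 1] \<kappa> by auto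
  have "C > 0" using C[of 0] by simp
  \<comment> \<open>Chosen so that \<open>(b * x)^2 = B * (\<kappa> * x^2 / 4)\<close>.\<close>
  define B where "B = 4 * b\<^sup>2 / \<kappa>"
  have "(\<lambda>j. B * (inverse (fact j) * B ^ j) * C) \<longlonglongrightarrow> B * 0 * C"
    by (intro tendsto_mult tendsto_const summable_LIMSEQ_zero summable_exp)
  then have "\<forall>\<^sub>F j in sequentially. B * (inverse (fact j) * B ^ j) * C < \<eta>"
    using \<eta> by (intro order_tendstoD(2)) auto
  then obtain j where j: "B * (inverse (fact j) * B ^ j) * C < \<eta>" using eventually_sequentially by auto
  \<comment> \<open>Odd, so that \<open>Suc n = 2 * Suc j\<close> and the remainder is a power of
    \<open>(b * x)^2\<close>; moreover \<open>fact n\<close> is at least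
    \<open>fact (Suc j) * fact j\<close>.\<close>
  define n where "n = 2 * j + 1"
  define q where "q = (\<Sum>i\<le>n. monom ((\<i> * of_real b) ^ i / fact i) i)"
  have q: "poly q (of_real x) = (\<Sum>i\<le>n. (\<i> * of_real (b * x)) ^ i / fact i)" for x
    by (simp add: q_def poly_sum poly_monom power_mult_distrib mult_ac)
  have "(1 + x\<^sup>2) * cmod (cis (b * x) * of_real (exp (- \<kappa> * x\<^sup>2 / 2)) - poly q (of_real x) * of_real (exp (- \<kappa> * x\<^sup>2 / 2))) \<le> \<eta>" for x
  proof -
    let ?E = "exp (- \<kappa> * x\<^sup>2 / 2)" and ?y = "\<kappa> * x\<^sup>2 / 4"
    have T: "cmod (cis (b * x) - poly q (of_real x)) \<le> \<bar>b * x\<bar> ^ Suc n / fact n"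
      using Taylor_exp[of "\<i> * of_real (b * x)" n] unfolding q cis_conv_exp by (simp add: norm_mult abs_mult)
    have "\<bar>b * x\<bar> ^ Suc n = (B * ?y) ^ Suc j"
    proof -
      have "\<bar>b * x\<bar> ^ Suc n = (\<bar>b * x\<bar>\<^sup>2) ^ Suc j" unfolding power_mult[symmetric] by (simp add: n_def)
      also have "\<bar>b * x\<bar>\<^sup>2 = B * ?y" using \<kappa> by (simp add: B_def power_mult_distrib)
      finally show ?thesis .
    qed
    also have "\<dots> = B ^ Suc j * ?y ^ Suc j" by (rule power_mult_distrib)
    also have "\<dots> \<le> B ^ Suc j * (fact (Suc j) * exp ?y)"
      by (intro mult_left_mono power_fact_le_exp) (use \<kappa> in \<open>auto simp: B_def\<close>)
    finally have 1: "\<bar>b * x\<bar> ^ Suc n \<le> B ^ Suc j * (fact (Suc j) * exp ?y)" .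
    have "fact (Suc j) * fact j \<le> (fact n :: nat)"
      using dvd_imp_le[OF fact_fact_dvd_fact[of "Suc j" j]] by (simp add: n_def mult_2 add.commute)
    then have "real (fact (Suc j) * fact j) \<le> real (fact n)" by (rule of_nat_mono)
    then have 2: "fact (Suc j) * fact j \<le> (fact n :: real)" by (simp only: of_nat_mult of_nat_fact)
    have "\<bar>b * x\<bar> ^ Suc n / fact n \<le> B ^ Suc j * (fact (Suc j) * exp ?y) / (fact (Suc j) * fact j)"
      by (intro frac_le 1 2) (use \<kappa> in \<open>auto simp: B_def simp del: power_Suc fact_Suc\<close>)
    also have "\<dots> = (B * (inverse (fact j) * B ^ j)) * exp ?y" by (simp add: field_simps del: fact_Suc)
    finally have 3: "cmod (cis (b * x) - poly q (of_real x)) \<le> (B * (inverse (fact j) * B ^ j)) * exp ?y" using T by linarith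
    have "(1 + x\<^sup>2) * cmod (cis (b * x) * of_real ?E - poly q (of_real x) * of_real ?E) = (1 + x\<^sup>2) * (cmod (cis (b * x) - poly q (of_real x)) * ?E)"
      unfolding left_diff_distrib[symmetric] norm_mult by simp
    also have "\<dots> \<le> (1 + x\<^sup>2) * (((B * (inverse (fact j) * B ^ j)) * exp ?y) * ?E)"
      by (intro mult_left_mono mult_right_mono 3) auto
    also have "\<dots> = (B * (inverse (fact j) * B ^ j)) * ((1 + x\<^sup>2) * (exp ?y * ?E))" by (simp only: mult_ac)
    also have "exp ?y * ?E = exp (- (\<kappa> / 2) * x\<^sup>2 / 2)" unfolding exp_add[symmetric] by (rule arg_cong[of _ _ exp]) simp
    also have "(B * (inverse (fact j) * B ^ j)) * ((1 + x\<^sup>2) * exp (- (\<kappa> / 2) * x\<^sup>2 / 2)) \<le> (B * (inverse (fact j) * B ^ j)) * C"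
      using C[of x] \<kappa> by (intro mult_left_mono) (auto simp: B_def)
    finally show ?thesis using j by linarith
  qed
  then show ?thesis by blast
qed

lemma decay_add: "decay C u \<Longrightarrow> decay D v \<Longrightarrow> decay (C + D) (\<lambda>t. u t + v t)"
  unfolding decay_def
proof (intro allI)
  fix t assume a: "\<forall>t. (1 + t\<^sup>2) * cmod (u t) \<le> C" "\<forall>t. (1 + t\<^sup>2) * cmod (v t) \<le> D"
  have "(1 + t\<^sup>2) * cmod (u t + v t) \<le> (1 + t\<^sup>2) * (cmod (u t) + cmod (v t))"
    by (intro mult_left_mono norm_triangle_ineq) simp
  then show "(1 + t\<^sup>2) * cmod (u t + v t) \<le> C + D" using spec[OF a(1), of t] spec[OF a(2), of t] by (simp add: distrib_left)
qed

lemma decay_scl: "decay C u \<Longrightarrow> decay (cmod a * C) (\<lambda>t. a * u t)"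
  unfolding decay_def
proof (intro allI)
  fix t assume a: "\<forall>t. (1 + t\<^sup>2) * cmod (u t) \<le> C"
  have eq: "(1 + t\<^sup>2) * cmod (a * u t) = cmod a * ((1 + t\<^sup>2) * cmod (u t))" by (simp add: norm_mult)
  show "(1 + t\<^sup>2) * cmod (a * u t) \<le> cmod a * C"
    unfolding eq by (intro mult_left_mono spec[OF a]) simp
qed

context null_space begin

text \<open>The profiles whose theta series lies in \<open>Z\<close>. Density is thereby transferred
  from the cube to functions on the line with the weight \<open>1 + t^2\<close>.\<close>

definition U :: "nat \<Rightarrow> int \<Rightarrow> int \<Rightarrow> int \<Rightarrow> (real \<Rightarrow> complex) set" where
  "U r e N M = {u. (\<exists>C. decay C u) \<and> continuous_on UNIV u \<and> theta r e N M u \<in> Z}"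

lemma U_add:
  assumes "u \<in> U r e N M" "v \<in> U r e N M" shows "(\<lambda>t. u t + v t) \<in> U r e N M"
proof -
  obtain C D where CD: "decay C u" "decay D v" using assms by (auto simp: U_def)
  have "theta r e N M (\<lambda>t. u t + v t) = (\<lambda>p. theta r e N M u p + theta r e N M v p)"
    using theta_lin[OF CD, of r e N M 1 1] by (simp add: fun_eq_iff)
  moreover have "\<dots> \<in> Z" using assms by (intro Zadd) (auto simp: U_def)
  ultimately show ?thesis using decay_add[OF CD] assms unfolding U_def by (auto intro: continuous_intros)
qed

lemma U_scl:
  assumes "u \<in> U r e N M" shows "(\<lambda>t. a * u t) \<in> U r e N M"
proof -
  obtain C where C: "decay C u" using assms by (auto simp: U_def)
  have "theta r e N M (\<lambda>t. a * u t) = (\<lambda>p. a * theta r e N M u p)"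
    using theta_lin[OF C C, of r e N M a 0] by (simp add: fun_eq_iff)
  moreover have "\<dots> \<in> Z" using assms by (intro Zscl) (auto simp: U_def)
  ultimately show ?thesis using decay_scl[OF C, of a] assms unfolding U_def by (auto intro: continuous_intros)
qed

lemma U_lim:
  assumes u: "decay C u" "continuous_on UNIV u"
    and ap: "\<And>\<eta>. \<eta> > 0 \<Longrightarrow> \<exists>v\<in>U r e N M. decay \<eta> (\<lambda>t. u t - v t)"
  shows "u \<in> U r e N M"
proof -
  have "theta r e N M u \<in> Z"
  proof (rule Zlim[OF theta_cont[OF u]])
    fix \<epsilon> :: real assume "\<epsilon> > 0"
    let ?W = "infsum wt UNIV"
    have W: "?W \<ge> 0" by (rule infsum_nonneg) (use wt_pos in \<open>auto simp: less_imp_le\<close>)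
    \<comment> \<open>On the cube \<open>1 + s^2 \<le> 2\<close>, so the bound for the theta series
      becomes \<open>4 * \<eta> * ?W\<close>; the summand 1 avoids a division by 0.\<close>
    define \<eta> where "\<eta> = \<epsilon> / (4 * ?W + 1)"
    have \<eta>: "\<eta> > 0" "4 * \<eta> * ?W \<le> \<epsilon>" using \<open>\<epsilon> > 0\<close> W by (simp_all add: \<eta>_def field_simps)
    obtain v where v: "v \<in> U r e N M" "decay \<eta> (\<lambda>t. u t - v t)" using ap[OF \<eta>(1)] by blast
    obtain D where D: "decay D v" using v by (auto simp: U_def)
    have "cmod (theta r e N M u p - theta r e N M v p) \<le> \<epsilon>" if "p \<in> cub" for p
    proof -
      have s: "(snd p)\<^sup>2 \<le> 1" using that by (auto simp: cub_eq abs_square_le_1)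
      have "theta r e N M u p - theta r e N M v p = theta r e N M (\<lambda>t. u t - v t) p"
        using theta_lin[OF u(1) D, of r e N M 1 "-1" p] by simp
      then have "cmod (theta r e N M u p - theta r e N M v p) \<le> 2 * \<eta> * (1 + (snd p)\<^sup>2) * ?W"
        using theta_bound[OF v(2), of r e N M p] by simp
      also have "\<dots> \<le> 2 * \<eta> * 2 * ?W"
        by (intro mult_right_mono mult_left_mono) (use s \<eta> W in auto)
      finally show ?thesis using \<eta>(2) by simp
    qed
    then show "\<exists>g\<in>Z. \<forall>p\<in>cub. cmod (theta r e N M u p - g p) \<le> \<epsilon>" using v(1)
      by (intro bexI[of _ "theta r e N M v"] ballI) (auto simp: U_def simp del: split_paired_All)
  qed
  then show ?thesis using u by (auto simp: U_def)
qed

lemma sector_density: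
  assumes rd: "r > 0" "d > 0" and N: "N \<noteq> 0" and tgs: "\<And>k. tg r e N M (herm r d N k) \<in> Z" and c: "bump c"
  shows "sep (\<lambda>x. cis (pi * of_int N * x)) (\<lambda>x. cis (pi * of_int M * x)) c \<in> Z"
proof -
  define t0 where "t0 = of_int M / (of_int N * real r)"
  define \<kappa> where "\<kappa> = kap r N"
  have \<kappa>: "\<kappa> > 0" using kap_pos[OF rd(1) N] by (simp add: \<kappa>_def)
  let ?U = "U r e N M"
  let ?E = "\<lambda>t. complex_of_real (exp (- \<kappa> * (t + t0)\<^sup>2 / 2))"
  have gU: "gau \<kappa> t0 q \<in> ?U" for q
  proof -
    have "tg r e N M q \<in> Z" using hspan_UNIV[OF rd N, of q]
    proof induction
      case (herm k) show ?case by (rule tgs)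
    next
      case (add p q)
      then show ?case using Zadd[OF add(3,4)] tg_add[OF rd(1) N, of e M p q] by (simp add: fun_eq_iff[symmetric])
    next
      case (smult p a)
      then show ?case using Zscl[OF smult(2), of a] tg_smult[OF rd(1) N, of e M a p] by (simp add: fun_eq_iff[symmetric])
    qed
    then show ?thesis using gau_decay[OF \<kappa>, of t0 q] gau_cont by (auto simp: U_def tg_def \<kappa>_def t0_def)
  qed
  have Edec: "\<exists>C. decay C ?E" using gau_decay[OF \<kappa>, of t0 1] by (simp add: gau_def[abs_def])
  have Econt: "continuous_on UNIV ?E" by (intro continuous_intros) auto
  have cisU: "(\<lambda>t. cis (b * (t + t0)) * ?E t) \<in> ?U" for b
  proof -
    obtain C where C: "decay C ?E" using Edec by blast
    have "decay C (\<lambda>t. cis (b * (t + t0)) * ?E t)" using C by (simp add: decay_def norm_mult)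
    moreover have "continuous_on UNIV (\<lambda>t. cis (b * (t + t0)) * ?E t)"
      by (intro continuous_intros Econt continuous_on_compose2[OF cis_lin_cont[of b]]) auto
    ultimately show ?thesis
    proof (rule U_lim)
      fix \<eta> :: real assume "\<eta> > 0"
      then have "\<eta> / (2 * (1 + t0\<^sup>2)) > 0" by (simp add: add_pos_nonneg)
      from cis_gauss_approx[OF \<kappa> this, of b] obtain q where
        q: "\<And>x. (1 + x\<^sup>2) * cmod (cis (b * x) * of_real (exp (- \<kappa> * x\<^sup>2 / 2)) - poly q (of_real x) * of_real (exp (- \<kappa> * x\<^sup>2 / 2))) \<le> \<eta> / (2 * (1 + t0\<^sup>2))" by blast
      have "decay (2 * (1 + t0\<^sup>2) * (\<eta> / (2 * (1 + t0\<^sup>2)))) (\<lambda>t. cis (b * (t + t0)) * ?E t - gau \<kappa> t0 q t)"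
        by (rule decayI_shift) (use q in \<open>simp add: gau_def\<close>)
      moreover have "2 * (1 + t0\<^sup>2) * (\<eta> / (2 * (1 + t0\<^sup>2))) = \<eta>" using add_pos_nonneg[of 1 "t0\<^sup>2"] by (simp add: field_simps)
      ultimately have "decay \<eta> (\<lambda>t. cis (b * (t + t0)) * ?E t - gau \<kappa> t0 q t)" by simp
      then show "\<exists>v\<in>?U. decay \<eta> (\<lambda>t. cis (b * (t + t0)) * ?E t - v t)" using gU by blast
    qed
  qed
  have trigU: "(\<lambda>t. \<phi> (a * (t + t0) + b) * ?E t) \<in> ?U" if "\<phi> \<in> trig" for \<phi> a b
    using that
  proof induction
    case (basis j)
    have "(\<lambda>t. cis (of_int j * b) * (cis ((of_int j * a) * (t + t0)) * ?E t)) \<in> ?U" by (intro U_scl cisU)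
    moreover have "(\<lambda>t. cis (of_int j * b) * (cis ((of_int j * a) * (t + t0)) * ?E t)) = (\<lambda>t. cis (of_int j * (a * (t + t0) + b)) * ?E t)"
      by (simp add: fun_eq_iff mult.assoc[symmetric] cis_mult) (simp add: algebra_simps)
    ultimately show ?case by simp
  next
    case (add f g) then show ?case using U_add[OF add(3,4)] by (simp add: algebra_simps)
  next
    case (scl f x) then show ?case using U_scl[OF scl(2), of x] by (simp add: mult_ac)
  qed
  have cc: "continuous_on UNIV c" and c0: "\<And>x. x \<le> 0 \<or> x \<ge> 1 \<Longrightarrow> c x = 0" using c by (auto simp: bump_def)
  obtain B where B: "B > 0" "\<And>x. x \<in> {0..1} \<Longrightarrow> cmod (c x * of_real (exp (\<kappa> * (x + t0)\<^sup>2 / 2))) \<le> B"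
  proof -
    have "continuous_on UNIV (\<lambda>x. c x * of_real (exp (\<kappa> * (x + t0)\<^sup>2 / 2)))" by (intro continuous_intros cc) auto
    from bounded_01[OF this] show ?thesis using that by blast
  qed
  have Bc: "cmod (c x * of_real (exp (\<kappa> * (x + t0)\<^sup>2 / 2))) \<le> B" for x
    using B c0[of x] by (cases "x \<in> {0..1}") auto
  obtain C1 where C1: "\<And>x::real. (1 + x\<^sup>2) ^ 2 * exp (- \<kappa> * x\<^sup>2 / 2) \<le> C1" using gaussian_power_bound[OF \<kappa>, of 2] by blast
  have C1p: "C1 > 0" using C1[of 0] by simp
  have C1': "(1 + x\<^sup>2) * exp (- \<kappa> * x\<^sup>2 / 2) \<le> C1 / (1 + x\<^sup>2)" for x :: real
    using C1[of x] by (simp add: pos_le_divide_eq add_pos_nonneg power2_eq_square mult_ac)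
  have C1'': "(1 + x\<^sup>2) * exp (- \<kappa> * x\<^sup>2 / 2) \<le> C1" for x :: real
  proof -
    have "C1 / (1 + x\<^sup>2) \<le> C1" using C1p by (simp add: pos_divide_le_eq add_pos_nonneg)
    then show ?thesis using C1'[of x] by linarith
  qed
  have cU: "c \<in> ?U"
  proof (rule U_lim)
    have "(1 + x\<^sup>2) * cmod (c (x - t0)) \<le> B * C1" for x
    proof -
      have "cmod (c (x - t0)) = cmod (c (x - t0) * of_real (exp (\<kappa> * (x - t0 + t0)\<^sup>2 / 2))) * exp (- \<kappa> * x\<^sup>2 / 2)"
        by (simp add: norm_mult mult.assoc exp_add[symmetric])
      also have "\<dots> \<le> B * exp (- \<kappa> * x\<^sup>2 / 2)" by (intro mult_right_mono Bc) auto
      finally have "(1 + x\<^sup>2) * cmod (c (x - t0)) \<le> (1 + x\<^sup>2) * (B * exp (- \<kappa> * x\<^sup>2 / 2))" by (rule mult_left_mono) simp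
      also have "\<dots> = B * ((1 + x\<^sup>2) * exp (- \<kappa> * x\<^sup>2 / 2))" by simp
      also have "\<dots> \<le> B * C1" by (rule mult_left_mono[OF C1'']) (use B in simp)
      finally show ?thesis .
    qed
    then show "decay (2 * (1 + t0\<^sup>2) * (B * C1)) c" by (rule decayI_shift)
    show "continuous_on UNIV c" by (rule cc)
    fix \<eta>' :: real assume "\<eta>' > 0"
    define \<eta> where "\<eta> = \<eta>' / (2 * (1 + t0\<^sup>2))"
    have \<eta>: "\<eta> > 0" using \<open>\<eta>' > 0\<close> by (simp add: \<eta>_def add_pos_nonneg)
    have \<eta>': "2 * (1 + t0\<^sup>2) * \<eta> = \<eta>'" using add_pos_nonneg[of 1 "t0\<^sup>2"] by (simp add: \<eta>_def field_simps)
    \<comment> \<open>\<open>\<delta> * C1 \<le> \<eta>\<close> is the error inside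
      \<open>[- L, L]\<close>, and \<open>\<delta> \<le> 1\<close> bounds the trigonometric
      polynomial by \<open>B + 1\<close>.\<close>
    define \<delta> where "\<delta> = min 1 (\<eta> / C1)"
    have \<delta>: "\<delta> > 0" "\<delta> \<le> 1" "\<delta> * C1 \<le> \<eta>"
      using \<eta> C1p mult_right_mono[OF min.cobounded2[of 1 "\<eta> / C1"], of C1] by (auto simp: \<delta>_def)
    \<comment> \<open>The first two summands place the translated support of \<open>c\<close> inside
      \<open>[- L, L]\<close>. The third makes the tail \<open>(B + 1) * C1 / (1 + x^2)\<close> at
      most \<open>\<eta>\<close> outside.\<close>
    define L where "L = 1 + \<bar>t0\<bar> + (B + 1) * C1 / \<eta>"
    have L: "L \<ge> 1 + \<bar>t0\<bar>" "L \<ge> 1" "(B + 1) * C1 \<le> \<eta> * L" using B C1p \<eta> by (auto simp: L_def field_simps)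
    \<comment> \<open>\<open>c\<close> divided by the Gaussian, with \<open>[- L, L]\<close>
      rescaled to the unit interval; both endpoints fall outside the support, so \<open>f\<close> is
      periodic.\<close>
    define f where "f x = c (2 * L * x - L - t0) * of_real (exp (\<kappa> * (2 * L * x - L)\<^sup>2 / 2))" for x
    have "continuous_on {0..1} f"
    proof -
      have "continuous_on UNIV (\<lambda>x. c (2 * L * x - L - t0))"
        by (rule continuous_on_compose2[OF cc]) (auto intro!: continuous_intros)
      then have "continuous_on UNIV f" unfolding f_def[abs_def] by (intro continuous_intros) auto
      then show ?thesis using continuous_on_subset by blast
    qed
    moreover have "f 0 = f 1"
    proof -
      have "- L - t0 \<le> 0" "L - t0 \<ge> 1" using L(1) by linarith+
      then show ?thesis using c0[of "- L - t0"] c0[of "L - t0"] by (simp add: f_def)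
    qed
    ultimately have "\<exists>\<phi>\<in>trig. \<forall>x\<in>{0..1}. cmod (f x - \<phi> (2 * pi * x)) < \<delta>"
      by (rule trig_approx[OF _ _ \<delta>(1)])
    then obtain \<phi> where \<phi>: "\<phi> \<in> trig" "\<forall>x\<in>{0..1}. cmod (f x - \<phi> (2 * pi * x)) < \<delta>"
      by (elim bexE) simp
    have fB: "cmod (f x) \<le> B" for x using Bc[of "2 * L * x - L - t0"] by (simp add: f_def)
    \<comment> \<open>The approximation is known over one period only; by periodicity the bound
      holds on the whole line, which controls the tail.\<close>
    have \<phi>B: "cmod (\<phi> y) \<le> B + 1" for y
    proof -
      define x where "x = frac (y / (2 * pi))"
      have x: "x \<in> {0..1}" using frac_lt_1[of "y / (2 * pi)"] by (simp add: x_def less_imp_le)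
      have "y = 2 * pi * x + 2 * pi * of_int \<lfloor>y / (2 * pi)\<rfloor>" by (simp add: x_def frac_def field_simps)
      then have "\<phi> y = \<phi> (2 * pi * x)" using trig_periodic[OF \<phi>(1)] by metis
      then show ?thesis using bspec[OF \<phi>(2) x] fB[of x] \<delta>(2) norm_triangle_sub[of "\<phi> y" "f x"] by (simp add: norm_minus_commute)
    qed
    define v where "v = (\<lambda>t. \<phi> (pi / L * (t + t0) + pi) * ?E t)"
    have "(1 + x\<^sup>2) * cmod (c (x - t0) - v (x - t0)) \<le> \<eta>" for x
    proof (cases "\<bar>x\<bar> \<le> L")
      case True
      define z where "z = (x + L) / (2 * L)"
      have z: "z \<in> {0..1}" "2 * L * z - L = x" "2 * pi * z = pi / L * x + pi" using True L(2) by (auto simp: z_def field_simps)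
      have fz: "f z = c (x - t0) * of_real (exp (\<kappa> * x\<^sup>2 / 2))" unfolding f_def z(2) ..
      have "c (x - t0) - v (x - t0) = (f z - \<phi> (2 * pi * z)) * of_real (exp (- \<kappa> * x\<^sup>2 / 2))"
        unfolding v_def z(3) fz by (simp add: left_diff_distrib mult.assoc of_real_mult[symmetric] exp_add[symmetric] del: of_real_mult)
      then have "(1 + x\<^sup>2) * cmod (c (x - t0) - v (x - t0)) = cmod (f z - \<phi> (2 * pi * z)) * ((1 + x\<^sup>2) * exp (- \<kappa> * x\<^sup>2 / 2))"
        by (simp add: norm_mult)
      also have "\<dots> \<le> \<delta> * C1" by (intro mult_mono C1'' less_imp_le[OF bspec[OF \<phi>(2) z(1)]]) (use \<delta> in auto)
      finally show ?thesis using \<delta>(3) by linarith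
    next
      case False
      then have "c (x - t0) = 0" using L by (intro c0) auto
      then have "(1 + x\<^sup>2) * cmod (c (x - t0) - v (x - t0)) = cmod (\<phi> (pi / L * x + pi)) * ((1 + x\<^sup>2) * exp (- \<kappa> * x\<^sup>2 / 2))"
        by (simp add: v_def norm_mult)
      also have "\<dots> \<le> (B + 1) * (C1 / (1 + x\<^sup>2))" by (intro mult_mono \<phi>B C1') (use B in auto)
      also have "\<dots> \<le> \<eta>"
      proof -
        have "L * L \<le> x\<^sup>2" using False L(2) abs_le_square_iff[of L x] by (simp add: power2_eq_square)
        moreover have "L \<le> L * L" using L(2) by simp
        ultimately have "L \<le> 1 + x\<^sup>2" by linarith
        then have "\<eta> * L \<le> \<eta> * (1 + x\<^sup>2)" using \<eta> by (intro mult_left_mono) auto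
        then have "(B + 1) * C1 \<le> \<eta> * (1 + x\<^sup>2)" using L(3) by linarith
        then show ?thesis by (simp add: pos_divide_le_eq add_pos_nonneg)
      qed
      finally show ?thesis .
    qed
    then have "decay (2 * (1 + t0\<^sup>2) * \<eta>) (\<lambda>t. c t - v t)" by (rule decayI_shift)
    moreover have "v \<in> ?U" unfolding v_def by (rule trigU[OF \<phi>(1)])
    ultimately show "\<exists>v\<in>?U. decay \<eta>' (\<lambda>t. c t - v t)" unfolding \<eta>' by (intro bexI[of _ v])
  qed
  show ?thesis
  proof (rule Zcong)
    show "theta r e N M c \<in> Z" using cU by (simp add: U_def)
    show "continuous_on UNIV (sep (\<lambda>x. cis (pi * of_int N * x)) (\<lambda>x. cis (pi * of_int M * x)) c)"
      by (intro sep_cont cis_lin_cont cc)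
    fix p assume p: "p \<in> cub"
    \<comment> \<open>The integer translates of the support of a bump do not overlap in their
      interiors, so over the cube the theta series is the separated product itself.\<close>
    have "thT r e N M c k p = 0" if "k \<noteq> 0" for k
    proof -
      have "snd p - of_int k \<le> 0 \<or> snd p - of_int k \<ge> 1"
      proof (cases "k > 0")
        case True then have "of_int k \<ge> (1::real)" by simp
        then show ?thesis using p by (auto simp: cub_eq)
      next
        case False
        then have "of_int k \<le> (of_int (-1)::real)" using that by (simp only: of_int_le_iff)
        then show ?thesis using p by (auto simp: cub_eq)
      qed
      then show ?thesis by (simp add: thT_def c0)
    qed
    then have "theta r e N M c p = (\<Sum>\<^sub>\<infinity>k\<in>{0}. thT r e N M c k p)"
      unfolding theta_def by (intro infsum_cong_neutral) auto
    then show "sep (\<lambda>x. cis (pi * of_int N * x)) (\<lambda>x. cis (pi * of_int M * x)) c p = theta r e N M c p"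
      by (simp add: thT_def sep_def cis_mult algebra_simps)
  qed
qed

end

subsection \<open>Completeness\<close>

abbreviation pair_with :: "l2_vec \<Rightarrow> (heis \<Rightarrow> complex) \<Rightarrow> complex^2 \<Rightarrow> complex" where
  "pair_with \<Phi> g w \<equiv> S.lip \<Phi> (L2_embed (tens g w))"

definition annih :: "l2_vec \<Rightarrow> (heis \<Rightarrow> complex) set" where
  "annih \<Phi> = {g. continuous_on UNIV g \<and> (\<forall>w. pair_with \<Phi> g w = 0)}"

lemma nrm_embed:
  assumes "\<phi> \<in> V0" shows "L.nrm (L2_embed \<phi>) = sqrt (integral cub (\<lambda>p. (norm (\<phi> p))\<^sup>2))"
  by (simp add: L.nrm_def lip_embed sec_inner_self[OF assms])

lemma tens_add: "tens (\<lambda>p. f p + g p) w = sadd (tens f w) (tens g w)"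
  by (simp add: tens_def fun_eq_iff vec_eq_iff algebra_simps)

lemma tens_scl: "tens (\<lambda>p. a * f p) w = sscl a (tens f w)"
  by (simp add: tens_def fun_eq_iff vec_eq_iff)

lemma pair_lin:
  assumes \<Phi>: "\<Phi> \<in> S.Cseq" and f: "continuous_on UNIV f" and g: "continuous_on UNIV g"
  shows "pair_with \<Phi> (\<lambda>p. f p + g p) w = pair_with \<Phi> f w + pair_with \<Phi> g w"
    and "pair_with \<Phi> (\<lambda>p. a * f p) w = cnj a * pair_with \<Phi> f w"
proof -
  have 1: "L2_embed (sadd \<phi> \<psi>) = ladd (L2_embed \<phi>) (L2_embed \<psi>)" "L2_embed (sscl a \<phi>) = lscl a (L2_embed \<phi>)" for \<phi> \<psi>
    by (simp_all add: L2_embed_def)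
  show "pair_with \<Phi> (\<lambda>p. f p + g p) w = pair_with \<Phi> f w + pair_with \<Phi> g w"
    unfolding tens_add 1 by (intro L.ip_add_right embed_Cseq tens_V0 f g \<Phi>)
  show "pair_with \<Phi> (\<lambda>p. a * f p) w = cnj a * pair_with \<Phi> f w"
    unfolding tens_scl 1 by (intro L.ip_scl_right embed_Cseq tens_V0 f g \<Phi>)
qed

text \<open>Closedness is the inequality of Cauchy and Schwarz; the tolerance \<open>e\<close> is
  chosen so that the pairing would be at most half of its own modulus.\<close>

lemma null_space_annih:
  assumes \<Phi>: "\<Phi> \<in> S.Cseq" shows "null_space (annih \<Phi>)"
proof
  fix f g :: "heis \<Rightarrow> complex" and a :: complex
  show "f \<in> annih \<Phi> \<Longrightarrow> continuous_on UNIV f" by (simp add: annih_def)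
  show "f \<in> annih \<Phi> \<Longrightarrow> g \<in> annih \<Phi> \<Longrightarrow> (\<lambda>p. f p + g p) \<in> annih \<Phi>"
    by (auto simp: annih_def pair_lin[OF \<Phi>] intro: continuous_intros)
  show "f \<in> annih \<Phi> \<Longrightarrow> (\<lambda>p. a * f p) \<in> annih \<Phi>"
    by (auto simp: annih_def pair_lin(2)[OF \<Phi>] intro: continuous_intros)
  assume f: "continuous_on UNIV f"
    and ap: "\<And>e. e > 0 \<Longrightarrow> \<exists>g\<in>annih \<Phi>. integral cub (\<lambda>p. (cmod (f p - g p))\<^sup>2) \<le> e"
  have "pair_with \<Phi> f w = 0" for w
  proof (rule ccontr)
    assume nz: "pair_with \<Phi> f w \<noteq> 0"
    define C where "C = L.nrm \<Phi> * norm w + 1"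
    have C: "C > 0" using L.nrm_nonneg[OF \<Phi>] by (simp add: C_def add_nonneg_pos)
    define e where "e = (cmod (pair_with \<Phi> f w) / (2 * C))\<^sup>2"
    have "e > 0" using nz C by (simp add: e_def)
    from ap[OF this] obtain g where g: "g \<in> annih \<Phi>" "integral cub (\<lambda>p. (cmod (f p - g p))\<^sup>2) \<le> e" by blast
    have gc: "continuous_on UNIV g" "pair_with \<Phi> g w = 0" using g by (auto simp: annih_def)
    have dc: "continuous_on UNIV (\<lambda>p. f p + (-1) * g p)" by (intro continuous_intros f gc)
    have mc: "continuous_on UNIV (\<lambda>p. (-1) * g p)" by (intro continuous_intros gc)
    have "pair_with \<Phi> f w = pair_with \<Phi> (\<lambda>p. f p + (-1) * g p) w"
      unfolding pair_lin(1)[OF \<Phi> f mc] pair_lin(2)[OF \<Phi> gc(1) gc(1)] gc(2) by simp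
    also have "cmod \<dots> \<le> L.nrm \<Phi> * L.nrm (L2_embed (tens (\<lambda>p. f p + (-1) * g p) w))"
      by (rule L.Cauchy_Schwarz[OF \<Phi> embed_Cseq[OF tens_V0[OF dc]]])
    also have "L.nrm (L2_embed (tens (\<lambda>p. f p + (-1) * g p) w)) = norm w * sqrt (integral cub (\<lambda>p. (cmod (f p - g p))\<^sup>2))"
    proof -
      have "(\<lambda>p. (norm (tens (\<lambda>p. f p + (-1) * g p) w p))\<^sup>2) = (\<lambda>p. (norm w)\<^sup>2 * (cmod (f p - g p))\<^sup>2)"
        by (simp only: tens_def norm_smult power_mult_distrib) (simp add: mult.commute)
      then show ?thesis unfolding nrm_embed[OF tens_V0[OF dc]] by (simp add: real_sqrt_mult)
    qed
    also have "L.nrm \<Phi> * (norm w * sqrt (integral cub (\<lambda>p. (cmod (f p - g p))\<^sup>2))) \<le> L.nrm \<Phi> * (norm w * sqrt e)"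
      using L.nrm_nonneg[OF \<Phi>] g(2) by (intro mult_left_mono) auto
    also have "\<dots> \<le> C * sqrt e" using \<open>e > 0\<close> by (simp add: C_def algebra_simps)
    also have "\<dots> = cmod (pair_with \<Phi> f w) / 2" using C by (simp add: e_def)
    finally show False using nz by simp
  qed
  then show "f \<in> annih \<Phi>" using f by (simp add: annih_def)
qed

text \<open>The members of the sequence \<open>\<Phi>\<close> are themselves continuous, so
  \<open>\<Phi>\<close> is orthogonal to its own approximants, and \<open><\<Phi>, \<Phi>>\<close>
  is a limit of arbitrarily small numbers.\<close>

lemma annih_all_imp_zero:
  assumes \<Phi>: "\<Phi> \<in> S.Cseq" and all: "\<And>g. continuous_on UNIV g \<Longrightarrow> g \<in> annih \<Phi>"
  shows "S.lip \<Phi> \<Phi> = 0"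
proof -
  have emb: "S.lip \<Phi> (L2_embed \<psi>) = 0" if "\<psi> \<in> V0" for \<psi>
  proof -
    have c: "continuous_on UNIV (\<lambda>p. \<psi> p $ j)" for j using that by (auto intro!: continuous_intros)
    have "\<psi> = sadd (tens (\<lambda>p. \<psi> p $ 1) (axis 1 1)) (tens (\<lambda>p. \<psi> p $ 2) (axis 2 1))"
      by (simp add: tens_def fun_eq_iff vec_eq_iff forall_2 axis_def)
    then have "L2_embed \<psi> = ladd (L2_embed (tens (\<lambda>p. \<psi> p $ 1) (axis 1 1))) (L2_embed (tens (\<lambda>p. \<psi> p $ 2) (axis 2 1)))"
      unfolding L2_embed_def by (rule arg_cong)
    moreover have "pair_with \<Phi> (\<lambda>p. \<psi> p $ j) w = 0" for j w using all[OF c] by (simp add: annih_def)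
    ultimately show ?thesis
      by (simp only: L.ip_add_right[OF embed_Cseq[OF tens_V0[OF c]] embed_Cseq[OF tens_V0[OF c]] \<Phi>]) simp
  qed
  have V: "\<Phi> n \<in> V0" for n using \<Phi> by (simp add: S.Cseq_def)
  obtain B where B: "B > 0" "\<And>n. S.nrm (\<Phi> n) \<le> B" using S.Cseq_bounded[OF \<Phi>] by blast
  have "cmod (S.lip \<Phi> \<Phi>) \<le> e" if e: "e > 0" for e
  proof -
    obtain N where N: "\<forall>m\<ge>N. \<forall>n\<ge>N. S.dst (\<Phi> m) (\<Phi> n) < e / B" using S.CseqD[OF \<Phi>, of "e / B"] e B by auto
    have "(\<lambda>n. sec_inner (\<Phi> n) (\<Phi> n) - sec_inner (\<Phi> n) (\<Phi> N)) \<longlonglongrightarrow> S.lip \<Phi> \<Phi> - 0"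
      using S.lip_conv[OF \<Phi> \<Phi>] S.lip_conv[OF \<Phi> embed_Cseq[OF V[of N]]] emb[OF V[of N]]
      by (intro tendsto_diff) (simp_all add: L2_embed_def)
    then have lim: "(\<lambda>n. cmod (sec_inner (\<Phi> n) (\<Phi> n) - sec_inner (\<Phi> n) (\<Phi> N))) \<longlonglongrightarrow> cmod (S.lip \<Phi> \<Phi>)"
      using tendsto_norm by fastforce
    have "cmod (sec_inner (\<Phi> n) (\<Phi> n) - sec_inner (\<Phi> n) (\<Phi> N)) \<le> e" if "n \<ge> N" for n
    proof -
      have "cmod (sec_inner (\<Phi> n) (\<Phi> n) - sec_inner (\<Phi> n) (\<Phi> N)) \<le> S.dst (\<Phi> n) (\<Phi> n) * S.nrm (\<Phi> n) + S.nrm (\<Phi> n) * S.dst (\<Phi> n) (\<Phi> N)"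
        by (rule S.ip_diff_le[OF V V V V])
      also have "\<dots> \<le> B * (e / B)"
      proof -
        have "S.nrm (\<Phi> n) * S.dst (\<Phi> n) (\<Phi> N) \<le> B * (e / B)"
          by (rule mult_mono) (use B N[rule_format, of n N] that S.dst_nonneg[OF V V, of n N] in simp_all)
        then show ?thesis by (simp add: S.dst_self[OF V])
      qed
      finally show ?thesis using B by simp
    qed
    then show ?thesis using LIMSEQ_le_const2[OF lim] by blast
  qed
  then have "cmod (S.lip \<Phi> \<Phi>) \<le> 0" by (rule field_le_epsilon[of _ 0, simplified])
  then show ?thesis by simp
qed

text \<open>The change of \<open>M\<close> moves the centre of the Gaussian by the integer
  \<open>j\<close>, which a shift of the summation index undoes. So \<open>M\<close> matters only
  modulo \<open>r * \<bar>N\<bar>\<close>.\<close>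

lemma tg_shift:
  assumes "r > 0" "N \<noteq> 0"
  shows "tg r e N (M + N * int r * j) q p = cis (pi * of_int (e * j)) * tg r e N M q p"
proof -
  let ?t0 = "of_int M / (of_int N * real r)"
  have t: "of_int (M + N * int r * j) / (of_int N * real r) = ?t0 + of_int j" using assms by (simp add: field_simps)
  have g: "gau (kap r N) (?t0 + of_int j) q (s - of_int (k + j)) = gau (kap r N) ?t0 q (s - of_int k)" for k s
    by (simp add: gau_def algebra_simps)
  have "thT r e N (M + N * int r * j) (gau (kap r N) (?t0 + of_int j) q) (k + j) p =
      cis (pi * of_int (e * j)) * thT r e N M (gau (kap r N) ?t0 q) k p" for k
    unfolding thT_def g by (simp add: cis_mult mult.assoc[symmetric]) (simp add: algebra_simps)
  moreover have "bij_betw (\<lambda>k. k + j) UNIV UNIV" by (rule bij_betw_byWitness[of _ "\<lambda>k. k - j"]) auto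
  ultimately have "tg r e N (M + N * int r * j) q p = (\<Sum>\<^sub>\<infinity>k. cis (pi * of_int (e * j)) * thT r e N M (gau (kap r N) ?t0 q) k p)"
    unfolding tg_def theta_def t using infsum_reindex_bij_betw[of "\<lambda>k. k + j" UNIV UNIV
        "\<lambda>k. thT r e N (M + N * int r * j) (gau (kap r N) (?t0 + of_int j) q) k p"] by simp
  also have "\<dots> = cis (pi * of_int (e * j)) * tg r e N M q p"
    unfolding tg_def theta_def by (rule infsum_cmult_right')
  finally show ?thesis .
qed

text \<open>The separated products with the admissible parities suffice for density. Those with
  \<open>N \<noteq> 0\<close> come from the theta functions, after reduction of \<open>M\<close> to
  a representative. Those with \<open>N = 0\<close> come from the exponentials and are present
  exactly when the character is trivial on the centre.\<close>

lemma completeness: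
  assumes eps: "eps \<in> hom (heis_lattice r) (integer_mod_group 2)" and rd: "r > 0" "d > 0" and \<Phi>: "\<Phi> \<in> S.Cseq"
    and H1: "\<And>N M k. N \<noteq> 0 \<Longrightarrow> even (N - eps ((1, 0), 0)) \<Longrightarrow> even (M - eps ((0, 1), 0)) \<Longrightarrow> 0 \<le> M \<Longrightarrow> M < int r * \<bar>N\<bar> \<Longrightarrow>
       tg r (eps ((0, 0), 1)) N M (herm r d N k) \<in> annih \<Phi>"
    and H2: "\<And>M K. even (eps ((1, 0), 0)) \<Longrightarrow> even (M - eps ((0, 1), 0)) \<Longrightarrow> even (K - eps ((0, 0), 1)) \<Longrightarrow> mode M K \<in> annih \<Phi>"
  shows "S.lip \<Phi> \<Phi> = 0"
proof (rule annih_all_imp_zero[OF \<Phi>])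
  interpret null_space "annih \<Phi>" by (rule null_space_annih[OF \<Phi>])
  fix g :: "heis \<Rightarrow> complex" assume g: "continuous_on UNIV g"
  show "g \<in> annih \<Phi>"
  proof (rule total[OF _ g])
    fix N M c assume N: "even (N - eps ((1, 0), 0))" and M: "even (M - eps ((0, 1), 0))" and c: "bump c"
    show "sep (\<lambda>x. cis (pi * of_int N * x)) (\<lambda>x. cis (pi * of_int M * x)) c \<in> annih \<Phi>"
    proof (cases "N = 0")
      case False
      show ?thesis
      proof (rule sector_density[OF rd False _ c])
        fix k
        define n where "n = int r * \<bar>N\<bar>"
        have n: "n > 0" using rd False by (simp add: n_def)
        \<comment> \<open>The sign turns the multiple of \<open>\<bar>N\<bar>\<close> from the
          division into a multiple of \<open>N\<close>.\<close>
        define j where "j = sgn N * (M div n)"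
        have "N * sgn N = \<bar>N\<bar>" by (simp add: abs_sgn)
        then have Mj: "M = M mod n + N * int r * j"
        proof -
          have "N * int r * j = (N * sgn N) * int r * (M div n)" by (simp add: j_def)
          also have "\<dots> = n * (M div n)" unfolding \<open>N * sgn N = \<bar>N\<bar>\<close> n_def by simp
          finally show ?thesis by simp
        qed
        have "even (N * int r)" using eps_character(3)[OF eps] N by auto
        then have "even (M mod n - eps ((0, 1), 0))" using M Mj by (metis dvd_mult2 even_add even_diff)
        then have "tg r (eps ((0, 0), 1)) N (M mod n) (herm r d N k) \<in> annih \<Phi>"
          using H1[OF False N, of "M mod n"] n by (simp add: n_def)
        from Zscl[OF this, of "cis (pi * of_int (eps ((0, 0), 1) * j))"]
        have "(\<lambda>p. cis (pi * of_int (eps ((0, 0), 1) * j)) * tg r (eps ((0, 0), 1)) N (M mod n) (herm r d N k) p) \<in> annih \<Phi>" .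
        then show "tg r (eps ((0, 0), 1)) N M (herm r d N k) \<in> annih \<Phi>"
          unfolding tg_shift[OF rd(1) False, symmetric] Mj[symmetric] .
      qed
    next
      case True
      have "sep (\<lambda>x. 1) (\<lambda>x. cis (pi * of_int M * x)) c \<in> annih \<Phi>"
      proof (rule sep_mode[OF _ c])
        fix K assume "even (K - eps ((0, 0), 1))"
        then have "mode M K \<in> annih \<Phi>" using H2[of M K] N M True by simp
        moreover have "mode M K = sep (\<lambda>x. 1) (\<lambda>x. cis (pi * of_int M * x)) (\<lambda>x. cis (pi * of_int K * x))"
          by (simp add: fun_eq_iff mode_def sep_def cis_mult algebra_simps)
        ultimately show "sep (\<lambda>x. 1) (\<lambda>x. cis (pi * of_int M * x)) (\<lambda>x. cis (pi * of_int K * x)) \<in> annih \<Phi>" by simp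
      qed
      then show ?thesis using True by simp
    qed
  qed
qed

subsection \<open>Orthogonality and norms of the scalar modes\<close>

lemma sip_lin:
  assumes "continuous_on UNIV f" "continuous_on UNIV g"
  shows "sip (\<lambda>p. a * f p) g = a * sip f g" "sip f (\<lambda>p. a * g p) = cnj a * sip f g" "sip g f = cnj (sip f g)"
proof -
  show "sip (\<lambda>p. a * f p) g = a * sip f g" by (simp add: sip_def mult.assoc)
  have "sip f (\<lambda>p. a * g p) = integral cub (\<lambda>p. cnj a * (f p * cnj (g p)))" by (simp add: sip_def mult_ac)
  then show "sip f (\<lambda>p. a * g p) = cnj a * sip f g" by (simp add: sip_def)
  have "cnj (sip f g) = integral cub (\<lambda>p. cnj (f p * cnj (g p)))" unfolding sip_def by (rule integral_cnj)
  then show "sip g f = cnj (sip f g)" by (simp add: sip_def mult.commute)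
qed

text \<open>Eigenfunctions of a skew operator for different imaginary eigenvalues are
  orthogonal.\<close>

lemma skew_orthogonal:
  assumes "sip (P f) g = - sip f (P g)" "continuous_on UNIV f" "continuous_on UNIV g"
    and "P f = (\<lambda>p. \<i> * of_real a * f p)" "P g = (\<lambda>p. \<i> * of_real b * g p)" "a \<noteq> b"
  shows "sip f g = 0"
proof -
  have "\<i> * of_real a * sip f g = \<i> * of_real b * sip f g"
    using assms(1) unfolding assms(4,5) sip_lin[OF assms(2,3)] by simp
  then show ?thesis using assms(6) by simp
qed

lemma smooth_C1':
  fixes f :: "heis \<Rightarrow> 'b::real_normed_vector"
  shows "smooth f \<Longrightarrow> C_k (Suc 0) f" "smooth f \<Longrightarrow> continuous_on UNIV f"
proof -
  show "smooth f \<Longrightarrow> C_k (Suc 0) f" by (rule smooth_C1)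
  show "smooth f \<Longrightarrow> continuous_on UNIV f" by (rule C_1D(3)[OF smooth_C1])
qed

lemma orthogonal_N:
  assumes f: "smooth f" "scal_equiv r eps f" "ptl 0 f = (\<lambda>p. \<i> * of_real (pi * of_int N) * f p)"
    and g: "smooth g" "scal_equiv r eps g" "ptl 0 g = (\<lambda>p. \<i> * of_real (pi * of_int N') * g p)" and ne: "N \<noteq> N'"
  shows "sip f g = 0"
  by (rule skew_orthogonal[OF sip_skew(2)[OF smooth_C1'(1)[OF f(1)] smooth_C1'(1)[OF g(1)] lat_inv_equiv[OF f(2) g(2)]]
      smooth_C1'(2)[OF f(1)] smooth_C1'(2)[OF g(1)] f(3) g(3)]) (use ne in simp)

lemma orthogonal_mode:
  assumes rd: "r > 0" "d > 0" and e: "scal_equiv r eps (mode M K)" "scal_equiv r eps (mode M' K')" and ne: "M \<noteq> M' \<or> K \<noteq> K'"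
  shows "sip (mode M K) (mode M' K') = 0"
proof -
  note sk = sip_skew(1)[OF smooth_C1'(1)[OF mode_smooth] smooth_C1'(1)[OF mode_smooth] lat_inv_equiv[OF e]]
  note c = smooth_C1'(2)[OF mode_smooth]
  show ?thesis
  proof (cases "M = M'")
    case False
    \<comment> \<open>Integration by parts holds for a frame of any scale: the scale 1 is used here
      and the scale \<open>r\<close> in the other case, so that the eigenvalues are, up to sign,
      \<open>pi\<close> times the frequencies.\<close>
    show ?thesis
      by (rule skew_orthogonal[OF sk[of 1 2] c c, of "- (pi * of_int M)" "- (pi * of_int M')"])
         (use False in \<open>auto simp: along_mode fun_eq_iff\<close>)
  next
    case True
    then have "K \<noteq> K'" using ne by simp
    then show ?thesis
      by (intro skew_orthogonal[OF sk[of "real r" 3] c c, of "pi * of_int K" "pi * of_int K'"])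
         (use rd in \<open>auto simp: along_mode fun_eq_iff\<close>)
  qed
qed

lemma sip_shift:
  assumes f: "continuous_on UNIV f" and g: "continuous_on UNIV g" and inv: "lat_inv r (\<lambda>p. f p * cnj (g p))"
  shows "sip (\<lambda>p. f ((fst (fst p), snd (fst p) + t), snd p)) (\<lambda>p. g ((fst (fst p), snd (fst p) + t), snd p)) = sip f g"
proof -
  define h where "h = (\<lambda>p. f p * cnj (g p))"
  have hc: "continuous_on UNIV h" unfolding h_def by (intro continuous_intros f g)
  have hc': "continuous_on UNIV (\<lambda>p::heis. h ((fst (fst p), snd (fst p) + t), snd p))"
    by (rule continuous_on_compose2[OF hc]) (auto intro!: continuous_intros)
  have "integral {0..1} (\<lambda>y. h ((x, y + t), s)) = integral {0..1} (\<lambda>y. h ((x, y), s))" for x s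
  proof (rule integral_periodic_shift)
    show "continuous_on UNIV (\<lambda>y. h ((x, y), s))" by (rule continuous_on_compose2[OF hc]) (auto intro!: continuous_intros)
  qed (use lat_invD(2)[OF inv] in \<open>simp add: h_def\<close>)
  then have "integral cub (\<lambda>p. h ((fst (fst p), snd (fst p) + t), snd p)) = integral cub h"
    unfolding cub_iter(2)[OF hc] cub_iter(2)[OF hc'] by simp
  then show ?thesis by (simp add: sip_def h_def)
qed

lemma tg_shift_x2:
  assumes "r > 0" "N \<noteq> 0"
  shows "tg r e N M q ((fst (fst p), snd (fst p) + 2 / (of_int N * real r)), snd p) = cis (2 * pi * (of_int M / (of_int N * real r))) * tg r e N M q p"
proof -
  let ?u = "gau (kap r N) (of_int M / (of_int N * real r)) q" and ?p' = "((fst (fst p), snd (fst p) + 2 / (of_int N * real r)), snd p)"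
  have "thT r e N M ?u k ?p' = cis (2 * pi * (of_int M / (of_int N * real r))) * thT r e N M ?u k p" for k
  proof -
    have "pi * (of_int N * fst (fst ?p') + (of_int M - of_int N * real r * of_int k) * snd (fst ?p') + of_int (e * k)) =
      2 * pi * (of_int M / (of_int N * real r)) + (2 * pi * of_int (- k) + pi * (of_int N * fst (fst p) + (of_int M - of_int N * real r * of_int k) * snd (fst p) + of_int (e * k)))"
      using assms by (simp add: field_simps)
    moreover have "cis (2 * pi * of_int (- k)) = 1" by (rule cis_multiple_2pi) simp
    ultimately show ?thesis unfolding thT_def by (simp only: cis_mult[symmetric]) simp
  qed
  then show ?thesis unfolding tg_def theta_def by (simp only: infsum_cmult_right')
qed

text \<open>Translation by \<open>2 / (N * r)\<close> in the second coordinate preserves the inner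
  product and multiplies the theta functions by \<open>cis (2 * pi * M / (N * r))\<close>, for every
  summand alike. These phases differ for different representatives \<open>M\<close> modulo
  \<open>r * \<bar>N\<bar>\<close>.\<close>

lemma orthogonal_M:
  assumes eps: "eps \<in> hom (heis_lattice r) (integer_mod_group 2)" and r: "r > 0" and N: "N \<noteq> 0" "even (N - eps ((1, 0), 0))"
    and M: "even (M - eps ((0, 1), 0))" "0 \<le> M" "M < int r * \<bar>N\<bar>"
    and M': "even (M' - eps ((0, 1), 0))" "0 \<le> M'" "M' < int r * \<bar>N\<bar>" and ne: "M \<noteq> M'"
  shows "sip (tg r (eps ((0, 0), 1)) N M q) (tg r (eps ((0, 0), 1)) N M' q') = 0"
proof -
  let ?f = "tg r (eps ((0, 0), 1)) N M q" and ?g = "tg r (eps ((0, 0), 1)) N M' q'"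
  have e: "scal_equiv r eps ?f" "scal_equiv r eps ?g" by (rule tg_equiv[OF eps r N M(1)], rule tg_equiv[OF eps r N M'(1)])
  note c = tg_cont[OF r N(1)]
  define a b where "a = of_int M / (of_int N * real r)" and "b = of_int M' / (of_int N * real r)"
  have c': "continuous_on UNIV (\<lambda>p. cis (2 * pi * b) * ?g p)" by (intro continuous_intros c)
  have "sip (\<lambda>p. cis (2 * pi * a) * ?f p) (\<lambda>p. cis (2 * pi * b) * ?g p) = sip ?f ?g"
    using sip_shift[OF c c lat_inv_equiv[OF e], of "2 / (of_int N * real r)"] unfolding tg_shift_x2[OF r N(1)] a_def b_def .
  then have "cis (2 * pi * a) * (cnj (cis (2 * pi * b)) * sip ?f ?g) = sip ?f ?g"
    unfolding sip_lin(1)[OF c c'] sip_lin(2)[OF c c] .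
  moreover have "cis (2 * pi * (a - b)) = cis (2 * pi * a) * cnj (cis (2 * pi * b))"
    by (simp add: cis_cnj cis_mult right_diff_distrib)
  ultimately have "cis (2 * pi * (a - b)) * sip ?f ?g = sip ?f ?g" by (simp only: mult.assoc)
  moreover have "cis (2 * pi * (a - b)) \<noteq> 1"
  proof
    assume "cis (2 * pi * (a - b)) = 1"
    then have "cos (2 * pi * (a - b)) = 1" by (metis cis.sel(1) one_complex.sel(1))
    then obtain n :: int where "2 * pi * (a - b) = of_int n * 2 * pi" using cos_one_2pi_int by auto
    then have "a - b = of_int n" by simp
    then have "real_of_int (M - M') = real_of_int (n * N * int r)" using r N(1) by (simp add: a_def b_def diff_divide_distrib[symmetric] field_simps)
    then have MM: "M - M' = n * N * int r" by (simp only: of_int_eq_iff)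
    moreover have "n \<noteq> 0" using MM ne by auto
    ultimately have "\<bar>M - M'\<bar> \<ge> int r * \<bar>N\<bar>" using r N(1) by (simp add: abs_mult mult_ac)
    then show False using M M' by linarith
  qed
  ultimately show ?thesis by simp
qed

lemma sip_pos_or_zero: "continuous_on UNIV f \<Longrightarrow> sip f f = of_real (integral cub (\<lambda>p. (cmod (f p))\<^sup>2))"
proof -
  assume f: "continuous_on UNIV f"
  have "integral cub (complex_of_real \<circ> (\<lambda>p. (cmod (f p))\<^sup>2)) = of_real (integral cub (\<lambda>p. (cmod (f p))\<^sup>2))"
    by (rule integral_linear[OF integrable_cub bounded_linear_of_real]) (intro continuous_intros f)
  then show ?thesis unfolding sip_def o_def complex_norm_square .
qed

lemma mode_norm: "sip (mode M K) (mode M K) = 1"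
  unfolding sip_pos_or_zero[OF smooth_C1'(2)[OF mode_smooth]] by (simp only: mode_def norm_cis power_one integral_cub_const of_real_1)

subsection \<open>The eigenvalue equation in a single sector\<close>

lemma sip_add:
  assumes "continuous_on UNIV f" "continuous_on UNIV g" "continuous_on UNIV h"
  shows "sip (\<lambda>p. f p + g p) h = sip f h + sip g h" "sip h (\<lambda>p. f p + g p) = sip h f + sip h g"
proof -
  have "integral cub (\<lambda>p. f p * cnj (h p) + g p * cnj (h p)) = sip f h + sip g h"
    unfolding sip_def by (rule integral_add; rule integrable_cub; intro continuous_intros assms)
  then show "sip (\<lambda>p. f p + g p) h = sip f h + sip g h" by (simp add: sip_def distrib_right)
  have "integral cub (\<lambda>p. h p * cnj (f p) + h p * cnj (g p)) = sip h f + sip h g"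
    unfolding sip_def by (rule integral_add; rule integrable_cub; intro continuous_intros assms)
  then show "sip h (\<lambda>p. f p + g p) = sip h f + sip h g" by (simp add: sip_def distrib_left)
qed

lemma Zop_adjoint:
  assumes f: "smooth f" "scal_equiv r eps f" and g: "smooth g" "scal_equiv r eps g"
  shows "sip (Zop r d \<sigma> f) g = - sip f (Zop r d (- \<sigma>) g)"
proof -
  note sk = sip_skew(1)[OF smooth_C1'(1)[OF f(1)] smooth_C1'(1)[OF g(1)] lat_inv_equiv[OF f(2) g(2)]]
  note cf = along_frame_cont[OF smooth_C1'(1)[OF f(1)]] and cg = along_frame_cont[OF smooth_C1'(1)[OF g(1)]]
  note c = smooth_C1'(2)[OF f(1)] smooth_C1'(2)[OF g(1)]
  have cf': "continuous_on UNIV (\<lambda>p. \<i> * of_real \<sigma> * along (s_frame r d 3) f p)" by (intro continuous_intros cf)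
  have cg': "continuous_on UNIV (\<lambda>p. \<i> * of_real (- \<sigma>) * along (s_frame r d 3) g p)" by (intro continuous_intros cg)
  show ?thesis unfolding Zop_def[abs_def] sip_add(1)[OF cf cf' c(2)] sip_add(2)[OF cg cg' c(1)]
      sip_lin(1)[OF cf c(2)] sip_lin(2)[OF c(1) cg] sk by simp
qed

lemma smooth_tg: "r > 0 \<Longrightarrow> N \<noteq> 0 \<Longrightarrow> C_k (Suc 0) (tg r e N M q)"
  by (rule smooth_C1'(1)[OF tg_smooth])

lemma nu_pos: "d > 0 \<Longrightarrow> N \<noteq> 0 \<Longrightarrow> nu d N > 0"
  by (simp add: nu_def)

lemma tg_norm_step:
  assumes eps: "eps \<in> hom (heis_lattice r) (integer_mod_group 2)" and rd: "r > 0" "d > 0" and N: "N \<noteq> 0"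
    and par: "even (N - eps ((1, 0), 0))" "even (M - eps ((0, 1), 0))"
  defines "h \<equiv> \<lambda>k. tg r (eps ((0, 0), 1)) N M (herm r d N k)"
  shows "sip (h (Suc k)) (h (Suc k)) = of_real (nu d N * real (Suc k)) * sip (h k) (h k)"
proof -
  have sm: "smooth (h k)" "scal_equiv r eps (h k)" for k
    unfolding h_def by (rule tg_smooth[OF rd(1) N], rule tg_equiv[OF eps rd(1) N par])
  have up: "h (Suc k) = Zop r d (of_int (sgn N)) (h k)" by (simp add: h_def Zop_tg[OF rd(1) N])
  have down: "Zop r d (- of_int (sgn N)) (h (Suc k)) = (\<lambda>p. (- of_real (nu d N * real (Suc k))) * h k p)"
    unfolding h_def Zop_tg[OF rd(1) N] lower_herm[OF rd(1) N] by (rule ext) (rule tg_smult[OF rd(1) N])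
  have "sip (h (Suc k)) (h (Suc k)) = - sip (h k) (Zop r d (- of_int (sgn N)) (h (Suc k)))"
    by (subst (1) up) (rule Zop_adjoint[OF sm sm])
  then show ?thesis
    unfolding down sip_lin(2)[OF smooth_C1'(2)[OF sm(1)] smooth_C1'(2)[OF sm(1)]] by simp
qed

text \<open>The theta integrals are not evaluated. By the ladder relation, one vanishing norm makes
  all norms of the sector vanish; a separated product, which the sector approximates, would then be
  orthogonal to itself, although it is nonzero in the middle of the cube.\<close>

lemma tg_norm_nonzero:
  assumes eps: "eps \<in> hom (heis_lattice r) (integer_mod_group 2)" and rd: "r > 0" "d > 0" and N: "N \<noteq> 0"
    and par: "even (N - eps ((1, 0), 0))" "even (M - eps ((0, 1), 0))"
  defines "h \<equiv> \<lambda>k. tg r (eps ((0, 0), 1)) N M (herm r d N k)"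
  shows "sip (h k) (h k) \<noteq> 0"
proof
  assume z: "sip (h k) (h k) = 0"
  have st: "sip (h (Suc j)) (h (Suc j)) = 0 \<longleftrightarrow> sip (h j) (h j) = 0" for j
  proof -
    have "complex_of_real (nu d N * real (Suc j)) \<noteq> 0" using nu_pos[OF rd(2) N] unfolding of_real_eq_0_iff by simp
    then show ?thesis unfolding h_def tg_norm_step[OF eps rd N par] by (simp only: mult_eq_0_iff) simp
  qed
  have iff0: "sip (h j) (h j) = 0 \<longleftrightarrow> sip (h 0) (h 0) = 0" for j
    by (induction j) (simp_all add: st)
  have zero: "sip (h j) (h j) = 0" for j using z iff0[of j] iff0[of k] by simp
  have hc: "continuous_on UNIV (h j)" for j unfolding h_def by (rule tg_cont[OF rd(1) N])
  \<comment> \<open>Any bump that is nonzero at \<open>1 / 2\<close> would do; this one has the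
    value 1 there.\<close>
  define c where "c = (\<lambda>x. 1 * complex_of_real (chi 1 x))"
  have c: "bump c" unfolding c_def by (rule chi_bump) auto
  define f where "f = sep (\<lambda>x. cis (pi * of_int N * x)) (\<lambda>x. cis (pi * of_int M * x)) c"
  have fc: "continuous_on UNIV f" unfolding f_def by (intro sep_cont cis_lin_cont) (use c in \<open>simp add: bump_def\<close>)
  define \<phi> where "\<phi> = tens f (axis 1 1)"
  have \<phi>: "\<phi> \<in> V0" unfolding \<phi>_def by (rule tens_V0[OF fc])
  interpret null_space "annih (L2_embed \<phi>)" by (rule null_space_annih[OF embed_Cseq[OF \<phi>]])
  have "f \<in> annih (L2_embed \<phi>)" unfolding f_def
  proof (rule sector_density[OF rd N _ c])
    fix j
    have "pair_with (L2_embed \<phi>) (h j) w = 0" for w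
    proof -
      have "S.nrm (tens (h j) w) = 0" by (simp add: S.nrm_def sip_tens[OF hc hc] zero)
      then show ?thesis using S.Cauchy_Schwarz[OF \<phi> tens_V0[OF hc], of j w] by (simp add: lip_embed)
    qed
    then show "tg r (eps ((0, 0), 1)) N M (herm r d N j) \<in> annih (L2_embed \<phi>)"
      using hc[of j] by (simp add: annih_def h_def)
  qed
  then have "sec_inner \<phi> (tens f (axis 1 1)) = 0" by (simp add: annih_def lip_embed)
  then have "sip f f = 0" unfolding \<phi>_def sip_tens[OF fc fc] by (simp add: cdot_def sum_2 axis_def)
  then have 0: "integral cub (\<lambda>p. (cmod (f p))\<^sup>2) = 0" using sip_pos_or_zero[OF fc] by simp
  have c2: "continuous_on UNIV (\<lambda>p. (cmod (f p))\<^sup>2)" by (intro continuous_intros fc)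
  have "((\<lambda>p. (cmod (f p))\<^sup>2) has_integral 0) cub" using integrable_integral[OF integrable_cub[OF c2]] 0 by simp
  moreover have "((0, 0), 1 / 2) \<in> cub" by (simp add: cub_eq)
  moreover have "box ((0, 0), 0) ((1, 1), 1 :: real) \<noteq> ({} :: heis set)"
    by (simp add: box_ne_empty Basis_prod_def)
  ultimately have "(cmod (f ((0, 0), 1 / 2)))\<^sup>2 = 0"
    by (intro has_integral_0_cbox_imp_0[of "((0, 0), 0)" "((1, 1), 1)" "\<lambda>p. (cmod (f p))\<^sup>2"])
       (auto intro: continuous_on_subset[OF c2])
  then show False by (simp add: f_def sep_def c_def chi_def)
qed

lemma pair_zero: "\<Phi> \<in> S.Cseq \<Longrightarrow> pair_with \<Phi> (\<lambda>p. 0) w = 0"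
  using pair_lin(2)[of \<Phi> "\<lambda>p. 0" "\<lambda>p. 0" 0 w] by simp

text \<open>The operator couples the level \<open>k\<close> of the first component only with the
  level \<open>k + 1\<close> of the second. The sector splits into blocks of size two and the single
  ground state of the second component.\<close>

lemma sector_recurrence:
  assumes eps: "eps \<in> hom (heis_lattice r) (integer_mod_group 2)" and rd: "r > 0" "d > 0" and N: "N \<noteq> 0"
    and par: "even (N - eps ((1, 0), 0))" "even (M - eps ((0, 1), 0))"
    and K: "koszul_connection r d nabla" and c: "cpair c (- of_int (sgn N)) vp vm wp wm"
    and \<Phi>: "\<Phi> \<in> eigenspace r eps (sub_dirac r d nabla c) \<mu>"
  defines "h \<equiv> \<lambda>k. tg r (eps ((0, 0), 1)) N M (herm r d N k)"
  shows "of_real \<mu> * pair_with \<Phi> (h k) wp = pair_with \<Phi> (h (Suc k)) wm"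
    and "of_real \<mu> * pair_with \<Phi> (h (Suc k)) wm = of_real (nu d N * real (Suc k)) * pair_with \<Phi> (h k) wp"
    and "of_real \<mu> * pair_with \<Phi> (h 0) wm = 0"
proof -
  have C: "\<Phi> \<in> S.Cseq" using \<Phi> by (auto elim!: eigenspaceD simp: L2_Cseq)
  have C1: "C_k (Suc 0) (h k)" for k unfolding h_def by (rule smooth_tg[OF rd(1) N])
  have eq: "scal_equiv r eps (h k)" for k unfolding h_def by (rule tg_equiv[OF eps rd(1) N par])
  have hc: "continuous_on UNIV (h k)" for k unfolding h_def by (rule tg_cont[OF rd(1) N])
  note W = eigenspace_weak[OF rd K c \<Phi> C1 eq]
  show "of_real \<mu> * pair_with \<Phi> (h k) wp = pair_with \<Phi> (h (Suc k)) wm"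
    using W(1)[of k] by (simp add: h_def Zop_tg[OF rd(1) N])
  have "Zop r d (- of_int (sgn N)) (h (Suc k)) = (\<lambda>p. (- of_real (nu d N * real (Suc k))) * h k p)"
    unfolding h_def Zop_tg[OF rd(1) N] lower_herm[OF rd(1) N] by (rule ext) (rule tg_smult[OF rd(1) N])
  then show "of_real \<mu> * pair_with \<Phi> (h (Suc k)) wm = of_real (nu d N * real (Suc k)) * pair_with \<Phi> (h k) wp"
    using W(2)[of "Suc k"] by (simp only: pair_lin(2)[OF C hc hc]) simp
  have "tg r e N M 0 p = 0" for e p using tg_smult[OF rd(1) N, of e M 0 0 p] by simp
  then have "Zop r d (- of_int (sgn N)) (h 0) = (\<lambda>p. 0)"
    unfolding h_def Zop_tg[OF rd(1) N] lower_herm[OF rd(1) N] by (simp add: fun_eq_iff)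
  then show "of_real \<mu> * pair_with \<Phi> (h 0) wm = 0" using W(2)[of 0] pair_zero[OF C] by simp
qed

lemma sector_annih:
  assumes c: "cpair c \<sigma> vp vm wp wm" and \<Phi>: "\<Phi> \<in> S.Cseq" and h: "continuous_on UNIV h"
    and "pair_with \<Phi> h wp = 0" "pair_with \<Phi> h wm = 0"
  shows "h \<in> annih \<Phi>"
  using lip_tens_cpair[OF c \<Phi> h] assms by (simp add: annih_def)

text \<open>Composing the two relations of a block gives \<open>\<mu>^2\<close> and
  \<open>nu d N * (k + 1)\<close> as factors of the same coefficient, which therefore
  vanishes.\<close>

lemma sector_empty:
  assumes eps: "eps \<in> hom (heis_lattice r) (integer_mod_group 2)" and rd: "r > 0" "d > 0" and N: "N \<noteq> 0"
    and par: "even (N - eps ((1, 0), 0))" "even (M - eps ((0, 1), 0))"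
    and K: "koszul_connection r d nabla" and cl: "clifford_module c"
    and \<Phi>: "\<Phi> \<in> eigenspace r eps (sub_dirac r d nabla c) \<mu>"
    and \<mu>: "\<mu> \<noteq> 0" "\<And>k. \<mu>\<^sup>2 \<noteq> nu d N * real (Suc k)"
  shows "tg r (eps ((0, 0), 1)) N M (herm r d N k) \<in> annih \<Phi>"
proof -
  have "(- real_of_int (sgn N)) = 1 \<or> (- real_of_int (sgn N)) = - 1" using N by (auto simp: sgn_if)
  from cpair_exists[OF cl this] obtain vp vm wp wm where c: "cpair c (- of_int (sgn N)) vp vm wp wm" by blast
  have C: "\<Phi> \<in> S.Cseq" using \<Phi> by (auto elim!: eigenspaceD simp: L2_Cseq)
  let ?h = "\<lambda>k. tg r (eps ((0, 0), 1)) N M (herm r d N k)"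
  note R = sector_recurrence[OF eps rd N par K c \<Phi>]
  have p: "pair_with \<Phi> (?h k) wp = 0" for k
  proof -
    have "of_real (\<mu>\<^sup>2) * pair_with \<Phi> (?h k) wp = of_real \<mu> * (of_real \<mu> * pair_with \<Phi> (?h k) wp)" by (simp add: power2_eq_square)
    also have "\<dots> = of_real (nu d N * real (Suc k)) * pair_with \<Phi> (?h k) wp" unfolding R(1) R(2) ..
    finally have "of_real (\<mu>\<^sup>2 - nu d N * real (Suc k)) * pair_with \<Phi> (?h k) wp = 0" unfolding of_real_diff left_diff_distrib by simp
    then show ?thesis using \<mu>(2)[of k] by (simp only: mult_eq_0_iff of_real_eq_0_iff) simp
  qed
  have "of_real \<mu> * pair_with \<Phi> (?h k) wm = 0" for k
    by (cases k) (simp_all only: R(2,3) p mult_zero_right)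
  then have "pair_with \<Phi> (?h k) wm = 0" for k using \<mu>(1) by simp
  then show ?thesis using sector_annih[OF c C tg_cont[OF rd(1) N] p] by blast
qed

lemma sector_eigen:
  assumes eps: "eps \<in> hom (heis_lattice r) (integer_mod_group 2)" and rd: "r > 0" "d > 0" and N: "N \<noteq> 0"
    and par: "even (N - eps ((1, 0), 0))" "even (M - eps ((0, 1), 0))"
    and K: "koszul_connection r d nabla" and c: "cpair c (- of_int (sgn N)) vp vm wp wm"
    and q: "lower r d N qb = smult (- of_real \<mu>) qa" "raise r d N qa = smult (of_real \<mu>) qb"
  defines "e \<equiv> eps ((0, 0), 1)"
  defines "\<psi> \<equiv> sadd (tens (tg r e N M qa) vp) (tens (tg r e N M qb) vm)"
  shows "\<psi> \<in> smooth_sections r eps" "sub_dirac r d nabla c \<psi> = sscl (of_real \<mu>) \<psi>"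
proof -
  have "smooth (tens h v)" if "smooth h" for h v
    unfolding tens_def by (rule smooth_bounded_linear[OF bounded_linear_smult that])
  then have "tens (tg r e N M q) v \<in> smooth_sections r eps" for q v
    using tg_smooth[OF rd(1) N] equivariant_tens[OF tg_equiv[OF eps rd(1) N par]] by (simp add: smooth_sections_def e_def)
  then show "\<psi> \<in> smooth_sections r eps" unfolding \<psi>_def by (intro smooth_sections_add)
  have 1: "Zop r d (- of_int (sgn N)) (tg r e N M qb) = (\<lambda>p. - of_real \<mu> * tg r e N M qa p)"
    unfolding Zop_tg[OF rd(1) N] q by (rule ext) (rule tg_smult[OF rd(1) N])
  have 2: "Zop r d (- (- of_int (sgn N))) (tg r e N M qa) = (\<lambda>p. of_real \<mu> * tg r e N M qb p)"
    unfolding minus_minus Zop_tg[OF rd(1) N] q by (rule ext) (rule tg_smult[OF rd(1) N])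
  show "sub_dirac r d nabla c \<psi> = sscl (of_real \<mu>) \<psi>"
    unfolding \<psi>_def dirac_tens[OF rd K c smooth_tg[OF rd(1) N] smooth_tg[OF rd(1) N]] 1 2
    by (simp add: tens_def fun_eq_iff vec_eq_iff algebra_simps)
qed

lemma cdot_cpair_nz:
  assumes "cpair c \<sigma> vp vm wp wm" shows "cdot vp vp \<noteq> 0" "cdot vm vm \<noteq> 0" "Re (cdot vp vp) > 0" "Re (cdot vm vm) > 0"
proof -
  have "vp \<noteq> 0" "vm \<noteq> 0" using cpairD(2,5)[OF assms] by (auto simp: cdot_def)
  then show "cdot vp vp \<noteq> 0" "cdot vm vm \<noteq> 0" "Re (cdot vp vp) > 0" "Re (cdot vm vm) > 0" by (simp_all add: cdot_self)
qed

lemma pair_sadd: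
  assumes \<Phi>: "\<Phi> \<in> S.Cseq" and f: "continuous_on UNIV f" and g: "continuous_on UNIV g"
  shows "S.lip \<Phi> (L2_embed (sadd (tens f v) (tens g w))) = pair_with \<Phi> f v + pair_with \<Phi> g w"
proof -
  have "L2_embed (sadd (tens f v) (tens g w)) = ladd (L2_embed (tens f v)) (L2_embed (tens g w))" by (simp add: L2_embed_def)
  then show ?thesis by (simp only: L.ip_add_right[OF embed_Cseq[OF tens_V0[OF f]] embed_Cseq[OF tens_V0[OF g]] \<Phi>])
qed

text \<open>The part of the eigenspace in one sector is a line: the ground state for
  \<open>\<mu> = 0\<close>, otherwise one vector of the single block whose level matches
  \<open>\<mu>^2\<close>. Totality is stated through the whole ladder, in the form required by
  completeness.\<close>

lemma sector_basis:
  assumes eps: "eps \<in> hom (heis_lattice r) (integer_mod_group 2)" and rd: "r > 0" "d > 0" and N: "N \<noteq> 0"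
    and par: "even (N - eps ((1, 0), 0))" "even (M - eps ((0, 1), 0))"
    and K: "koszul_connection r d nabla" and cl: "clifford_module c"
    and \<mu>: "\<mu> = 0 \<or> (\<exists>k. \<mu>\<^sup>2 = nu d N * real (Suc k))"
  defines "e \<equiv> eps ((0, 0), 1)"
  shows "\<exists>\<psi>. \<psi> \<in> smooth_sections r eps \<and> sub_dirac r d nabla c \<psi> = sscl (of_real \<mu>) \<psi> \<and> sec_inner \<psi> \<psi> = 1 \<and>
     (\<exists>qa qb va vb. \<psi> = sadd (tens (tg r e N M qa) va) (tens (tg r e N M qb) vb)) \<and>
     (\<forall>\<Phi>\<in>eigenspace r eps (sub_dirac r d nabla c) \<mu>. S.lip \<Phi> (L2_embed \<psi>) = 0 \<longrightarrow> (\<forall>k. tg r e N M (herm r d N k) \<in> annih \<Phi>))"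
proof -
  have "(- real_of_int (sgn N)) = 1 \<or> (- real_of_int (sgn N)) = - 1" using N by (auto simp: sgn_if)
  from cpair_exists[OF cl this] obtain vp vm wp wm where c: "cpair c (- of_int (sgn N)) vp vm wp wm" by blast
  let ?h = "\<lambda>k. tg r e N M (herm r d N k)"
  have tc: "continuous_on UNIV (tg r e N M q)" for q by (rule tg_cont[OF rd(1) N])
  have tz: "tg r e N M 0 = (\<lambda>p. 0)" using tg_smult[OF rd(1) N, of e M 0 0] by (simp add: fun_eq_iff)
  note R = sector_recurrence[OF eps rd N par K c, folded e_def]
  note nz = tg_norm_nonzero[OF eps rd N par, folded e_def]
  note \<nu> = nu_pos[OF rd(2) N]
  obtain qa qb where q: "lower r d N qb = smult (- of_real \<mu>) qa" "raise r d N qa = smult (of_real \<mu>) qb"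
    and n0: "sec_inner (sadd (tens (tg r e N M qa) vp) (tens (tg r e N M qb) vm)) (sadd (tens (tg r e N M qa) vp) (tens (tg r e N M qb) vm)) \<noteq> 0"
    and tot: "\<And>\<Phi> k. \<Phi> \<in> eigenspace r eps (sub_dirac r d nabla c) \<mu> \<Longrightarrow>
       S.lip \<Phi> (L2_embed (sadd (tens (tg r e N M qa) vp) (tens (tg r e N M qb) vm))) = 0 \<Longrightarrow> ?h k \<in> annih \<Phi>"
  proof (cases "\<mu> = 0")
    case True
    show ?thesis
    proof (rule that[of "herm r d N 0" 0])
      show "lower r d N (herm r d N 0) = smult (- of_real \<mu>) 0" unfolding lower_herm[OF rd(1) N] by simp
      show "raise r d N 0 = smult (of_real \<mu>) (herm r d N 0)" by (simp add: raise_def True)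
      have "sadd (tens (\<lambda>p. 0) vp) (tens (?h 0) vm) = tens (?h 0) vm" by (simp add: tens_def fun_eq_iff vec_eq_iff)
      then show "sec_inner (sadd (tens (tg r e N M 0) vp) (tens (?h 0) vm)) (sadd (tens (tg r e N M 0) vp) (tens (?h 0) vm)) \<noteq> 0"
        unfolding tz using nz[of 0] cdot_cpair_nz[OF c] by (simp only: sip_tens[OF tc tc]) simp
      fix \<Phi> k assume \<Phi>: "\<Phi> \<in> eigenspace r eps (sub_dirac r d nabla c) \<mu>"
        and z: "S.lip \<Phi> (L2_embed (sadd (tens (tg r e N M 0) vp) (tens (?h 0) vm))) = 0"
      have C: "\<Phi> \<in> S.Cseq" using \<Phi> by (auto elim!: eigenspaceD simp: L2_Cseq)
      have p: "pair_with \<Phi> (?h k) wp = 0" for k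
      proof -
        have "of_real (nu d N * real (Suc k)) * pair_with \<Phi> (?h k) wp = 0" using R(2)[OF \<Phi>, of k] True by simp
        then show ?thesis using \<nu> by (simp only: mult_eq_0_iff of_real_eq_0_iff) simp
      qed
      have "pair_with \<Phi> (?h 0) vm = 0" using z unfolding pair_sadd[OF C tc tc] by (simp add: tz pair_zero[OF C])
      then have "pair_with \<Phi> (?h 0) wm = 0"
        unfolding lip_tens_cpair[OF c C tc, of _ vm] p using cdot_cpair_nz[OF c] by simp
      then have "pair_with \<Phi> (?h k) wm = 0" using R(1)[OF \<Phi>] True by (cases k) (simp_all del: herm.simps)
      then show "?h k \<in> annih \<Phi>" by (intro sector_annih[OF c C tc p])
    qed
  next
    case False
    then obtain k0 where k0: "\<mu>\<^sup>2 = nu d N * real (Suc k0)" using \<mu> by blast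
    have k0u: "k = k0" if "\<mu>\<^sup>2 = nu d N * real (Suc k)" for k using that k0 \<nu> by simp
    show ?thesis
    \<comment> \<open>The raising equation forces \<open>1 / \<mu>\<close> times the next Hermite
      polynomial as second component; the lowering equation then holds by the value of
      \<open>\<mu>^2\<close>.\<close>
    proof (rule that[of "smult (of_real (1 / \<mu>)) (herm r d N (Suc k0))" "herm r d N k0"])
      let ?qb = "smult (of_real (1 / \<mu>)) (herm r d N (Suc k0))"
      let ?\<psi> = "sadd (tens (?h k0) vp) (tens (tg r e N M ?qb) vm)"
      have "lower r d N ?qb = smult (of_real (1 / \<mu>)) (lower r d N (herm r d N (Suc k0)))" by (simp add: lower_def pderiv_smult mult.commute)
      also have "\<dots> = smult (- of_real (1 / \<mu> * (nu d N * real (Suc k0)))) (herm r d N k0)" unfolding lower_herm[OF rd(1) N] by simp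
      also have "1 / \<mu> * (nu d N * real (Suc k0)) = \<mu>" unfolding k0[symmetric] using False by (simp add: power2_eq_square)
      finally show "lower r d N ?qb = smult (- of_real \<mu>) (herm r d N k0)" .
      show "raise r d N (herm r d N k0) = smult (of_real \<mu>) ?qb" using False by simp
      have \<psi>V: "?\<psi> \<in> V0" by (intro S.add_in tens_V0 tc)
      show "sec_inner ?\<psi> ?\<psi> \<noteq> 0"
      proof
        \<comment> \<open>\<open>vp\<close> and \<open>vm\<close> need not be orthogonal, so the
          norm is not compared component by component; the dual vector \<open>wp\<close> isolates
          the first one.\<close>
        assume "sec_inner ?\<psi> ?\<psi> = 0"
        then have "S.nrm ?\<psi> = 0" by (simp add: S.nrm_def)
        then have "sec_inner ?\<psi> (tens (?h k0) wp) = 0" using S.Cauchy_Schwarz[OF \<psi>V tens_V0[OF tc], of "herm r d N k0" wp] by simp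
        then have "cdot vp wp * sip (?h k0) (?h k0) + cdot vm wp * sip (tg r e N M ?qb) (?h k0) = 0"
          unfolding S.ip_add[OF tens_V0[OF tc] tens_V0[OF tc] tens_V0[OF tc]] sip_tens[OF tc tc] .
        then show False using nz[of k0] by (simp add: cpairD[OF c])
      qed
      fix \<Phi> k assume \<Phi>: "\<Phi> \<in> eigenspace r eps (sub_dirac r d nabla c) \<mu>" and z: "S.lip \<Phi> (L2_embed ?\<psi>) = 0"
      have C: "\<Phi> \<in> S.Cseq" using \<Phi> by (auto elim!: eigenspaceD simp: L2_Cseq)
      let ?p = "\<lambda>k. pair_with \<Phi> (?h k) wp" and ?q = "\<lambda>k. pair_with \<Phi> (?h k) wm"
      have p0: "?p k = 0" if "k \<noteq> k0" for k
      proof -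
        have "of_real (\<mu>\<^sup>2) * ?p k = of_real \<mu> * (of_real \<mu> * ?p k)" by (simp add: power2_eq_square)
        also have "\<dots> = of_real (nu d N * real (Suc k)) * ?p k" unfolding R(1)[OF \<Phi>] R(2)[OF \<Phi>] ..
        finally have "of_real (\<mu>\<^sup>2 - nu d N * real (Suc k)) * ?p k = 0" unfolding of_real_diff left_diff_distrib by simp
        moreover have "\<mu>\<^sup>2 - nu d N * real (Suc k) \<noteq> 0" using k0u[of k] that by auto
        ultimately show ?thesis by (simp only: mult_eq_0_iff of_real_eq_0_iff) simp
      qed
      have q0: "?q 0 = 0" using R(3)[OF \<Phi>] False by (simp del: herm.simps)
      have qS: "?q (Suc k) = of_real \<mu> * ?p k" for k using R(1)[OF \<Phi>, of k] by (rule sym)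
      \<comment> \<open>Pairing with \<open>vp\<close> also sees the second component at level
        \<open>k0\<close>. It belongs to the block below, or is the ground state, and
        vanishes.\<close>
      have qk0: "?q k0 = 0"
      proof (cases k0)
        case 0 then show ?thesis using q0 by simp
      next
        case (Suc j)
        have "?p j = 0" by (rule p0) (use Suc in simp)
        then show ?thesis unfolding Suc qS by simp
      qed
      have "pair_with \<Phi> (tg r e N M ?qb) vm = cnj (of_real (1 / \<mu>)) * pair_with \<Phi> (?h (Suc k0)) vm"
        unfolding tg_smult[OF rd(1) N, abs_def] by (rule pair_lin(2)[OF C tc tc])
      also have "pair_with \<Phi> (?h (Suc k0)) vm = cdot vm vm * (of_real \<mu> * ?p k0)"
        unfolding lip_tens_cpair[OF c C tc, of _ vm] qS using p0[of "Suc k0"] by simp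
      finally have 1: "pair_with \<Phi> (tg r e N M ?qb) vm = cdot vm vm * ?p k0" using False by simp
      have 2: "pair_with \<Phi> (?h k0) vp = cdot vp vp * ?p k0"
        unfolding lip_tens_cpair[OF c C tc, of _ vp] qk0 by simp
      have "(cdot vp vp + cdot vm vm) * ?p k0 = 0" using z unfolding pair_sadd[OF C tc tc] 1 2 by (simp add: distrib_right)
      moreover have "cdot vp vp + cdot vm vm \<noteq> 0"
      proof
        assume "cdot vp vp + cdot vm vm = 0"
        then have "Re (cdot vp vp) + Re (cdot vm vm) = 0" by (metis plus_complex.sel(1) zero_complex.sel(1))
        then show False using cdot_cpair_nz(3,4)[OF c] by linarith
      qed
      ultimately have "?p k0 = 0" by simp
      then have pz: "?p k = 0" for k using p0[of k] by (cases "k = k0") simp_all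
      have "?q k = 0" by (cases k) (simp_all only: q0 qS pz mult_zero_right)
      then show "?h k \<in> annih \<Phi>" by (intro sector_annih[OF c C tc pz])
    qed
  qed
  let ?\<psi> = "sadd (tens (tg r e N M qa) vp) (tens (tg r e N M qb) vm)"
  have \<psi>V: "?\<psi> \<in> V0" by (intro S.add_in tens_V0 tc)
  define t where "t = Re (sec_inner ?\<psi> ?\<psi>)"
  have t: "sec_inner ?\<psi> ?\<psi> = of_real t" unfolding t_def by (rule S.ip_self_real[OF \<psi>V])
  have tpos: "t > 0" using S.ip_nonneg[OF \<psi>V] n0 t by (cases "t = 0") (simp_all add: t_def[symmetric])
  define a where "a = complex_of_real (1 / sqrt t)"
  let ?\<psi>' = "sadd (tens (tg r e N M (smult a qa)) vp) (tens (tg r e N M (smult a qb)) vm)"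
  have eq: "?\<psi>' = sscl a ?\<psi>" by (simp add: tens_def fun_eq_iff vec_eq_iff tg_smult[OF rd(1) N] algebra_simps)
  have "lower r d N (smult a qb) = smult (- of_real \<mu>) (smult a qa)"
    using arg_cong[OF q(1), of "smult a"] by (simp add: lower_def pderiv_smult mult_ac)
  moreover have "raise r d N (smult a qa) = smult (of_real \<mu>) (smult a qb)"
    unfolding raise_smult q by (simp add: mult.commute)
  ultimately have "?\<psi>' \<in> smooth_sections r eps" "sub_dirac r d nabla c ?\<psi>' = sscl (of_real \<mu>) ?\<psi>'"
    using sector_eigen[OF eps rd N par K c, folded e_def] by blast+
  moreover have "sec_inner ?\<psi>' ?\<psi>' = 1"
  proof -
    have "sec_inner ?\<psi>' ?\<psi>' = a * (cnj a * of_real t)"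
      unfolding eq S.ip_scl[OF \<psi>V S.scl_in[OF \<psi>V]] S.ip_scl_right[OF \<psi>V \<psi>V] t ..
    also have "\<dots> = of_real (1 / sqrt t * (1 / sqrt t * t))"
      by (simp only: a_def complex_cnj_complex_of_real of_real_mult)
    also have "1 / sqrt t * (1 / sqrt t * t) = 1" using tpos by (simp add: field_simps)
    finally show ?thesis by simp
  qed
  moreover have "?h k \<in> annih \<Phi>" if \<Phi>: "\<Phi> \<in> eigenspace r eps (sub_dirac r d nabla c) \<mu>" and z: "S.lip \<Phi> (L2_embed ?\<psi>') = 0" for \<Phi> k
  proof -
    have C: "\<Phi> \<in> S.Cseq" using \<Phi> by (auto elim!: eigenspaceD simp: L2_Cseq)
    have "L2_embed ?\<psi>' = lscl a (L2_embed ?\<psi>)" unfolding eq by (simp add: L2_embed_def)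
    then have "cnj a * S.lip \<Phi> (L2_embed ?\<psi>) = 0" using z L.ip_scl_right[OF embed_Cseq[OF \<psi>V] C, of a] by simp
    then have "S.lip \<Phi> (L2_embed ?\<psi>) = 0" using tpos by (simp add: a_def)
    then show ?thesis by (rule tot[OF \<Phi>])
  qed
  ultimately show ?thesis by (intro exI[of _ ?\<psi>']) blast
qed

subsection \<open>The eigenvalue equation for the modes constant along the centre\<close>

text \<open>The symbol of \<open>Zop\<close> for \<open>\<sigma> = 1\<close> at the frequency
  \<open>(M, K)\<close>; its modulus is the absolute value of the eigenvalues there.\<close>

definition zeta :: "nat \<Rightarrow> real \<Rightarrow> int \<Rightarrow> int \<Rightarrow> complex" where
  "zeta r d M K = - of_real (pi * d / real r * of_int K) - \<i> * of_real (pi * d * of_int M)"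

lemma Zop_mode:
  "Zop r d 1 (mode M K) = (\<lambda>p. zeta r d M K * mode M K p)"
  "Zop r d (- 1) (mode M K) = (\<lambda>p. - cnj (zeta r d M K) * mode M K p)"
proof -
  have 1: "- (\<i> * of_real x) * m + \<i> * of_real 1 * (\<i> * of_real y * m) = (- of_real y - \<i> * of_real x) * m"
    "- (\<i> * of_real x) * m + \<i> * of_real (- 1) * (\<i> * of_real y * m) = - cnj (- of_real y - \<i> * of_real x) * m" for x y m
    by (simp_all add: complex_eq_iff algebra_simps)
  show "Zop r d 1 (mode M K) = (\<lambda>p. zeta r d M K * mode M K p)"
    "Zop r d (- 1) (mode M K) = (\<lambda>p. - cnj (zeta r d M K) * mode M K p)"
    unfolding Zop_def[abs_def] along_mode 1 zeta_def by (simp_all add: mult_ac)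
qed

lemma zeta_norm:
  assumes "r > 0" shows "zeta r d M K * cnj (zeta r d M K) = of_real ((pi * d / real r)\<^sup>2 * ((of_int K)\<^sup>2 + (real r)\<^sup>2 * (of_int M)\<^sup>2))"
proof -
  have "zeta r d M K * cnj (zeta r d M K) = of_real ((pi * d / real r * of_int K)\<^sup>2 + (pi * d * of_int M)\<^sup>2)"
    by (simp add: complex_eq_iff zeta_def power2_eq_square)
  also have "(pi * d / real r * of_int K)\<^sup>2 + (pi * d * of_int M)\<^sup>2 = (pi * d / real r)\<^sup>2 * ((of_int K)\<^sup>2 + (real r)\<^sup>2 * (of_int M)\<^sup>2)"
    using assms by (simp add: power_mult_distrib power_divide field_simps)
  finally show ?thesis .
qed

lemma mode_recurrence:
  assumes eps: "eps \<in> hom (heis_lattice r) (integer_mod_group 2)" and rd: "r > 0" "d > 0"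
    and par: "even (eps ((1, 0), 0))" "even (M - eps ((0, 1), 0))" "even (K' - eps ((0, 0), 1))"
    and K: "koszul_connection r d nabla" and c: "cpair c 1 vp vm wp wm"
    and \<Phi>: "\<Phi> \<in> eigenspace r eps (sub_dirac r d nabla c) \<mu>"
  shows "of_real \<mu> * pair_with \<Phi> (mode M K') wp = - zeta r d M K' * pair_with \<Phi> (mode M K') wm"
    and "of_real \<mu> * pair_with \<Phi> (mode M K') wm = - cnj (zeta r d M K') * pair_with \<Phi> (mode M K') wp"
proof -
  have C: "\<Phi> \<in> S.Cseq" using \<Phi> by (auto elim!: eigenspaceD simp: L2_Cseq)
  note mc = smooth_C1'(2)[OF mode_smooth]
  note W = eigenspace_weak[OF rd K c \<Phi> smooth_C1'(1)[OF mode_smooth] mode_equiv[OF eps par]]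
  show "of_real \<mu> * pair_with \<Phi> (mode M K') wp = - zeta r d M K' * pair_with \<Phi> (mode M K') wm"
    using W(1) unfolding Zop_mode pair_lin(2)[OF C mc mc] by simp
  show "of_real \<mu> * pair_with \<Phi> (mode M K') wm = - cnj (zeta r d M K') * pair_with \<Phi> (mode M K') wp"
    using W(2) unfolding Zop_mode pair_lin(2)[OF C mc mc] by simp
qed

lemma mode_empty:
  assumes eps: "eps \<in> hom (heis_lattice r) (integer_mod_group 2)" and rd: "r > 0" "d > 0"
    and par: "even (eps ((1, 0), 0))" "even (M - eps ((0, 1), 0))" "even (K' - eps ((0, 0), 1))"
    and K: "koszul_connection r d nabla" and cl: "clifford_module c"
    and \<Phi>: "\<Phi> \<in> eigenspace r eps (sub_dirac r d nabla c) \<mu>"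
    and ne: "\<mu>\<^sup>2 \<noteq> (pi * d / real r)\<^sup>2 * ((of_int K')\<^sup>2 + (real r)\<^sup>2 * (of_int M)\<^sup>2)"
  shows "mode M K' \<in> annih \<Phi>"
proof -
  obtain vp vm wp wm where c: "cpair c 1 vp vm wp wm" using cpair_exists[OF cl, of 1] by auto
  have C: "\<Phi> \<in> S.Cseq" using \<Phi> by (auto elim!: eigenspaceD simp: L2_Cseq)
  note R = mode_recurrence[OF eps rd par K c \<Phi>]
  let ?z = "zeta r d M K'" and ?p = "pair_with \<Phi> (mode M K') wp" and ?q = "pair_with \<Phi> (mode M K') wm"
  have n: "of_real (\<mu>\<^sup>2) - ?z * cnj ?z \<noteq> 0" unfolding zeta_norm[OF rd(1)] using ne by (metis eq_iff_diff_eq_0 of_real_eq_iff)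
  have "of_real (\<mu>\<^sup>2) * ?p = of_real \<mu> * (of_real \<mu> * ?p)" by (simp add: power2_eq_square)
  also have "\<dots> = - ?z * (of_real \<mu> * ?q)" unfolding R(1) by simp
  also have "\<dots> = ?z * cnj ?z * ?p" unfolding R(2) by simp
  finally have "(of_real (\<mu>\<^sup>2) - ?z * cnj ?z) * ?p = 0" by (simp add: left_diff_distrib)
  then have p: "?p = 0" using n by simp
  have "of_real (\<mu>\<^sup>2) * ?q = of_real \<mu> * (of_real \<mu> * ?q)" by (simp add: power2_eq_square)
  also have "\<dots> = - cnj ?z * (of_real \<mu> * ?p)" unfolding R(2) by simp
  also have "\<dots> = ?z * cnj ?z * ?q" unfolding R(1) by simp
  finally have "(of_real (\<mu>\<^sup>2) - ?z * cnj ?z) * ?q = 0" by (simp add: left_diff_distrib)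
  then have q: "?q = 0" using n by simp
  show ?thesis by (rule sector_annih[OF c C smooth_C1'(2)[OF mode_smooth] p q])
qed

lemma mode_eigen:
  assumes eps: "eps \<in> hom (heis_lattice r) (integer_mod_group 2)" and rd: "r > 0" "d > 0"
    and par: "even (eps ((1, 0), 0))" "even (M - eps ((0, 1), 0))" "even (K' - eps ((0, 0), 1))"
    and K: "koszul_connection r d nabla" and c: "cpair c 1 vp vm wp wm"
    and v: "- zeta r d M K' * cdot v wm = of_real \<mu> * cdot v wp" "- cnj (zeta r d M K') * cdot v wp = of_real \<mu> * cdot v wm"
  shows "tens (mode M K') v \<in> smooth_sections r eps"
    "sub_dirac r d nabla c (tens (mode M K') v) = sscl (of_real \<mu>) (tens (mode M K') v)"
proof -
  show "tens (mode M K') v \<in> smooth_sections r eps"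
    using smooth_bounded_linear[OF bounded_linear_smult mode_smooth] equivariant_tens[OF mode_equiv[OF eps par]]
    by (simp add: smooth_sections_def) (simp add: tens_def)
  let ?f = "\<lambda>p. cdot v wp * mode M K' p" and ?g = "\<lambda>p. cdot v wm * mode M K' p"
  have C1: "C_k (Suc 0) (\<lambda>p. a * mode M K' p)" for a
    by (rule C_k_bounded_linear[OF bounded_linear_mult_right smooth_C1'(1)[OF mode_smooth]])
  have Z: "Zop r d \<sigma> (\<lambda>p. a * mode M K' p) = (\<lambda>p. a * Zop r d \<sigma> (mode M K') p)" for \<sigma> a
    unfolding Zop_def[abs_def] along_bounded_linear[OF bounded_linear_mult_right[of a] C_1D(1)[OF smooth_C1'(1)[OF mode_smooth]]]
    by (simp add: algebra_simps)
  have split: "tens h v = sadd (tens (\<lambda>p. cdot v wp * h p) vp) (tens (\<lambda>p. cdot v wm * h p) vm)" for h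
  proof
    fix p
    have "h p *s v = h p *s (cdot v wp *s vp + cdot v wm *s vm)" using cpairD(1)[OF c, of v] by metis
    then show "tens h v p = tens (\<lambda>p. cdot v wp * h p) vp p + tens (\<lambda>p. cdot v wm * h p) vm p"
      by (simp add: tens_def vec_eq_iff algebra_simps)
  qed
  have "sub_dirac r d nabla c (tens (mode M K') v) =
      sadd (tens (\<lambda>p. - (cdot v wm * (zeta r d M K' * mode M K' p))) vp) (tens (\<lambda>p. cdot v wp * (- cnj (zeta r d M K') * mode M K' p)) vm)"
    unfolding split dirac_tens[OF rd K c C1 C1] Z Zop_mode ..
  also have "\<dots> = sadd (tens (\<lambda>p. (- zeta r d M K' * cdot v wm) * mode M K' p) vp) (tens (\<lambda>p. (- cnj (zeta r d M K') * cdot v wp) * mode M K' p) vm)"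
    by (simp add: mult_ac)
  also have "\<dots> = sscl (of_real \<mu>) (tens (mode M K') v)"
    unfolding v split by (simp add: tens_def fun_eq_iff vec_eq_iff algebra_simps)
  finally show "sub_dirac r d nabla c (tens (mode M K') v) = sscl (of_real \<mu>) (tens (mode M K') v)" .
qed

text \<open>At a fixed frequency the operator is a matrix with zero diagonal and off-diagonal
  entries \<open>- zeta\<close> and \<open>- cnj zeta\<close>. For \<open>\<mu> \<noteq> 0\<close>
  its eigenvalues are \<open>\<mu>\<close> and \<open>- \<mu>\<close>, and each eigenspace is a
  line; for \<open>\<mu> = 0\<close> the matrix is 0 and all of \<open>\<complex>^2\<close> belongs
  to the kernel. The bit enumerates the basis, and \<open>True\<close> counts only in the second
  case.\<close>

lemma mode_basis:
  assumes eps: "eps \<in> hom (heis_lattice r) (integer_mod_group 2)" and rd: "r > 0" "d > 0"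
    and par: "even (eps ((1, 0), 0))" "even (M - eps ((0, 1), 0))" "even (K' - eps ((0, 0), 1))"
    and K: "koszul_connection r d nabla" and cl: "clifford_module c"
    and \<mu>: "\<mu>\<^sup>2 = (pi * d / real r)\<^sup>2 * ((of_int K')\<^sup>2 + (real r)\<^sup>2 * (of_int M)\<^sup>2)"
  shows "\<exists>v. (\<forall>b. (b \<longrightarrow> \<mu> = 0) \<longrightarrow> tens (mode M K') (v b) \<in> smooth_sections r eps \<and>
        sub_dirac r d nabla c (tens (mode M K') (v b)) = sscl (of_real \<mu>) (tens (mode M K') (v b)) \<and> cdot (v b) (v b) = 1) \<and>
     (\<mu> = 0 \<longrightarrow> cdot (v True) (v False) = 0) \<and>
     (\<forall>\<Phi>\<in>eigenspace r eps (sub_dirac r d nabla c) \<mu>.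
        (\<forall>b. (b \<longrightarrow> \<mu> = 0) \<longrightarrow> pair_with \<Phi> (mode M K') (v b) = 0) \<longrightarrow> mode M K' \<in> annih \<Phi>)"
proof -
  obtain vp vm wp wm where c: "cpair c 1 vp vm wp wm" using cpair_exists[OF cl, of 1] by auto
  note mc = smooth_C1'(2)[OF mode_smooth]
  note E = mode_eigen[OF eps rd par K c]
  note R = mode_recurrence[OF eps rd par K c]
  let ?z = "zeta r d M K'"
  have zz: "?z * cnj ?z = of_real (\<mu>\<^sup>2)" unfolding zeta_norm[OF rd(1)] \<mu> ..
  show ?thesis
  proof (cases "\<mu> = 0")
    case True
    then have z: "?z = 0" using zz by simp
    \<comment> \<open>The standard basis rather than \<open>vp\<close>, \<open>vm\<close>, which
      need not be orthogonal; every vector lies in the kernel here.\<close>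
    define v where "v b = (axis (if b then 1 else 2) 1 :: complex^2)" for b :: bool
    have cv: "cdot u (v True) = u $ 1" "cdot u (v False) = u $ 2" for u by (simp_all add: v_def cdot_def sum_2 axis_def)
    show ?thesis
    proof (intro exI[of _ v] conjI allI impI ballI)
      fix b
      show "tens (mode M K') (v b) \<in> smooth_sections r eps" by (rule E(1)[where \<mu> = \<mu>]) (simp_all add: z True)
      show "sub_dirac r d nabla c (tens (mode M K') (v b)) = sscl (of_real \<mu>) (tens (mode M K') (v b))" by (rule E(2)) (simp_all add: z True)
      show "cdot (v b) (v b) = 1" by (cases b) (simp_all add: v_def cdot_def sum_2 axis_def)
    next
      show "cdot (v True) (v False) = 0" by (simp add: v_def cdot_def sum_2 axis_def)
    next
      fix \<Phi> assume \<Phi>: "\<Phi> \<in> eigenspace r eps (sub_dirac r d nabla c) \<mu>"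
        and a: "\<forall>b. (b \<longrightarrow> \<mu> = 0) \<longrightarrow> pair_with \<Phi> (mode M K') (v b) = 0"
      have C: "\<Phi> \<in> S.Cseq" using \<Phi> by (auto elim!: eigenspaceD simp: L2_Cseq)
      have "pair_with \<Phi> (mode M K') w = 0" for w
      proof -
        have "tens (mode M K') w = sadd (sscl (w $ 1) (tens (mode M K') (v True))) (sscl (w $ 2) (tens (mode M K') (v False)))"
          by (simp add: tens_def fun_eq_iff vec_eq_iff forall_2 v_def axis_def)
        then have "L2_embed (tens (mode M K') w) = ladd (lscl (w $ 1) (L2_embed (tens (mode M K') (v True)))) (lscl (w $ 2) (L2_embed (tens (mode M K') (v False))))"
          by (simp add: L2_embed_def)
        then show ?thesis using a True embed_Cseq[OF tens_V0[OF mc]] C by (simp add: L.ip_add_right L.ip_scl_right L.scl_in)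
      qed
      then show "mode M K' \<in> annih \<Phi>" using mc by (simp add: annih_def)
    qed
  next
    case False
    \<comment> \<open>The second coordinate forced by the second scalar equation when the first
      coordinate is 1.\<close>
    define B where "B = - cnj ?z / of_real \<mu>"
    define v0 where "v0 = vp + B *s vm"
    have v0: "cdot v0 wp = 1" "cdot v0 wm = B" unfolding v0_def cdot_add cdot_scl cpairD[OF c] by simp_all
    define t where "t = (norm v0)\<^sup>2"
    have cvv: "cdot v0 v0 = of_real t" by (simp add: cdot_self t_def)
    have "v0 \<noteq> 0" using v0(1) by (auto simp: cdot_def)
    then have tpos: "t > 0" by (simp add: t_def)
    define a where "a = complex_of_real (1 / sqrt t)"
    define v where "v = a *s v0"
    have aa: "a * (cnj a * of_real t) = 1"
    proof -
      have "a * (cnj a * of_real t) = of_real (1 / sqrt t * (1 / sqrt t * t))"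
      by (simp only: a_def complex_cnj_complex_of_real of_real_mult)
      also have "1 / sqrt t * (1 / sqrt t * t) = 1" using tpos by (simp add: field_simps)
      finally show ?thesis by simp
    qed
    have zB: "- ?z * B = of_real \<mu>"
    proof -
      have "- ?z * B = ?z * cnj ?z / of_real \<mu>" by (simp add: B_def)
      then show ?thesis unfolding zz using False by (simp add: power2_eq_square)
    qed
    have Bz: "- cnj ?z = of_real \<mu> * B" using False by (simp add: B_def)
    have ea: "- ?z * cdot v wm = of_real \<mu> * cdot v wp"
      unfolding v_def cdot_scl v0 using arg_cong[OF zB, of "\<lambda>x. a * x"] by (simp add: mult_ac)
    have eb: "- cnj ?z * cdot v wp = of_real \<mu> * cdot v wm"
      unfolding v_def cdot_scl v0 Bz by simp
    show ?thesis
    proof (intro exI[of _ "\<lambda>b. v"] conjI allI impI ballI)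
      show "tens (mode M K') v \<in> smooth_sections r eps" by (rule E(1)[OF ea eb])
      show "sub_dirac r d nabla c (tens (mode M K') v) = sscl (of_real \<mu>) (tens (mode M K') v)" by (rule E(2)[OF ea eb])
      show "cdot v v = 1" unfolding v_def cdot_scl cvv using aa by (simp add: mult_ac)
    next
      assume "\<mu> = 0" then show "cdot v v = 0" using False by simp
    next
      fix \<Phi> assume \<Phi>: "\<Phi> \<in> eigenspace r eps (sub_dirac r d nabla c) \<mu>"
        and b: "\<forall>b. (b \<longrightarrow> \<mu> = 0) \<longrightarrow> pair_with \<Phi> (mode M K') v = 0"
      have C: "\<Phi> \<in> S.Cseq" using \<Phi> by (auto elim!: eigenspaceD simp: L2_Cseq)
      let ?p = "pair_with \<Phi> (mode M K') wp" and ?q = "pair_with \<Phi> (mode M K') wm"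
      have q: "?q = B * ?p" using R(2)[OF \<Phi>] False by (simp add: B_def field_simps)
      have "pair_with \<Phi> (mode M K') v = cdot vp v * ?p + cdot vm v * ?q" by (rule lip_tens_cpair[OF c C mc])
      also have "\<dots> = cdot v0 v * ?p" unfolding q v0_def cdot_add cdot_scl by (simp add: algebra_simps)
      also have "cdot v0 v = cnj a * of_real t" unfolding v_def cdot_scl cvv ..
      finally have "cnj a * of_real t * ?p = 0" using b by auto
      then have p: "?p = 0" using tpos by (simp add: a_def)
      show "mode M K' \<in> annih \<Phi>" by (rule sector_annih[OF c C mc p]) (simp add: q p)
    qed
  qed
qed

subsection \<open>Orthonormal bases of the eigenspaces\<close>

lemma hilbert_dim_eqI:
  assumes K: "L.subsp K" and E: "L.onb K n E"
  shows "hilbert_dim K = n"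
proof -
  have "orthonormal_basis K m F \<longleftrightarrow> L.onb K m F" for m F
    unfolding orthonormal_basis_def L.onb_def L2_inner_lip ..
  then show ?thesis unfolding hilbert_dim_def
    using E L.onb_le[OF K] by (intro the_equality) (auto intro: antisym)
qed

text \<open>
  \<open>Inl (N, M)\<close> stands for the theta functions with central character \<open>exp (\<i> \<pi> N x\<^sub>1)\<close>, and
  \<open>Inr (M, K, b)\<close> for the exponentials without central frequency; the latter contribute two dimensions
  (hence the bit \<open>b\<close>) only at the eigenvalue 0.
\<close>

definition theta_labels :: "nat \<Rightarrow> real \<Rightarrow> (heis \<Rightarrow> int) \<Rightarrow> real \<Rightarrow> (int \<times> int) set" where
  "theta_labels r d eps \<mu> = {(N, M). N \<noteq> 0 \<and> even (N - eps ((1, 0), 0)) \<and> even (M - eps ((0, 1), 0)) \<and> 0 \<le> M \<and>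
     M < int r * \<bar>N\<bar> \<and> (\<mu> = 0 \<or> (\<exists>k. \<mu>\<^sup>2 = nu d N * real (Suc k)))}"

definition mode_labels :: "nat \<Rightarrow> real \<Rightarrow> (heis \<Rightarrow> int) \<Rightarrow> real \<Rightarrow> (int \<times> int \<times> bool) set" where
  "mode_labels r d eps \<mu> = {(M, K, b). even (eps ((1, 0), 0)) \<and> even (M - eps ((0, 1), 0)) \<and> even (K - eps ((0, 0), 1)) \<and>
     \<mu>\<^sup>2 = (pi * d / real r)\<^sup>2 * ((of_int K)\<^sup>2 + (real r)\<^sup>2 * (of_int M)\<^sup>2) \<and> (b \<longrightarrow> \<mu> = 0)}"

lemma sec_inner_sadd_zero:
  assumes c: "continuous_on UNIV f1" "continuous_on UNIV f2" "continuous_on UNIV g1" "continuous_on UNIV g2"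
    and z: "sip f1 g1 = 0" "sip f1 g2 = 0" "sip f2 g1 = 0" "sip f2 g2 = 0"
  shows "sec_inner (sadd (tens f1 v1) (tens f2 v2)) (sadd (tens g1 w1) (tens g2 w2)) = 0"
proof -
  note T = tens_V0[OF c(1)] tens_V0[OF c(2)] tens_V0[OF c(3)] tens_V0[OF c(4)]
  show ?thesis
    unfolding S.ip_add[OF T(1) T(2) S.add_in[OF T(3) T(4)]] S.ip_add_right[OF T(3) T(4) T(1)] S.ip_add_right[OF T(3) T(4) T(2)]
      sip_tens[OF c(1) c(3)] sip_tens[OF c(1) c(4)] sip_tens[OF c(2) c(3)] sip_tens[OF c(2) c(4)] z by simp
qed

text \<open>Distinct labels are separated by the central frequency, by translation in the second
  coordinate, or by the torus frequency, whence orthogonality. An element of the eigenspace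
  orthogonal to the chosen vectors pairs to 0 with the whole complete family, because the
  recurrences kill the other members; so it has norm 0.\<close>

lemma spectral_mult_labels:
  assumes eps: "eps \<in> hom (heis_lattice r) (integer_mod_group 2)" and rd: "r > 0" "d > 0"
    and K: "koszul_connection r d nabla" and cl: "clifford_module c"
  shows "spectral_mult r eps (sub_dirac r d nabla c) \<mu> =
    (let J = theta_labels r d eps \<mu> <+> mode_labels r d eps \<mu> in if finite J then enat (card J) else \<infinity>)"
proof -
  let ?D = "sub_dirac r d nabla c" and ?K = "eigenspace r eps (sub_dirac r d nabla c) \<mu>" and ?e = "eps ((0, 0), 1)"
  define J where "J = theta_labels r d eps \<mu> <+> mode_labels r d eps \<mu>"
  define P where "P N M \<psi> \<longleftrightarrow> \<psi> \<in> smooth_sections r eps \<and> ?D \<psi> = sscl (of_real \<mu>) \<psi> \<and> sec_inner \<psi> \<psi> = 1 \<and>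
     (\<exists>qa qb va vb. \<psi> = sadd (tens (tg r ?e N M qa) va) (tens (tg r ?e N M qb) vb)) \<and>
     (\<forall>\<Phi>\<in>?K. S.lip \<Phi> (L2_embed \<psi>) = 0 \<longrightarrow> (\<forall>k. tg r ?e N M (herm r d N k) \<in> annih \<Phi>))" for N M \<psi>
  define Q where "Q M K' v \<longleftrightarrow> (\<forall>b. (b \<longrightarrow> \<mu> = 0) \<longrightarrow> tens (mode M K') (v b) \<in> smooth_sections r eps \<and>
        ?D (tens (mode M K') (v b)) = sscl (of_real \<mu>) (tens (mode M K') (v b)) \<and> cdot (v b) (v b) = 1) \<and>
     (\<mu> = 0 \<longrightarrow> cdot (v True) (v False) = 0) \<and>
     (\<forall>\<Phi>\<in>?K. (\<forall>b. (b \<longrightarrow> \<mu> = 0) \<longrightarrow> pair_with \<Phi> (mode M K') (v b) = 0) \<longrightarrow> mode M K' \<in> annih \<Phi>)" for M K' and v :: "bool \<Rightarrow> complex^2"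
  define psi1 where "psi1 N M = (SOME \<psi>. P N M \<psi>)" for N M
  \<comment> \<open>One choice covers both bits, so that the two vectors at the eigenvalue 0 are
    orthogonal to each other.\<close>
  define vv where "vv M K' = (SOME v. Q M K' v)" for M K'
  have P: "P N M (psi1 N M)" if "(N, M) \<in> theta_labels r d eps \<mu>" for N M
    unfolding psi1_def
  proof (rule someI_ex[of "P N M"])
    show "\<exists>\<psi>. P N M \<psi>" unfolding P_def
      by (rule sector_basis[OF eps rd _ _ _ K cl]) (use that in \<open>auto simp: theta_labels_def\<close>)
  qed
  have Q: "Q M K' (vv M K')" if "(M, K', b) \<in> mode_labels r d eps \<mu>" for M K' b
    unfolding vv_def
  proof (rule someI_ex[of "Q M K'"])
    show "\<exists>v. Q M K' v" unfolding Q_def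
      by (rule mode_basis[OF eps rd _ _ _ K cl]) (use that in \<open>auto simp: mode_labels_def\<close>)
  qed
  define psi where "psi j = (case j of Inl (N, M) \<Rightarrow> psi1 N M | Inr (M, K', b) \<Rightarrow> tens (mode M K') (vv M K' b))" for j
  note mc = smooth_C1'(2)[OF mode_smooth]
  have good: "psi j \<in> smooth_sections r eps \<and> ?D (psi j) = sscl (of_real \<mu>) (psi j) \<and> sec_inner (psi j) (psi j) = 1" if "j \<in> J" for j
  proof (cases j)
    case (Inl a)
    obtain N M where a: "a = (N, M)" by (cases a)
    show ?thesis using P[of N M] that by (auto simp: J_def Inl a psi_def P_def)
  next
    case (Inr a)
    obtain M K' b where a: "a = (M, K', b)" by (cases a)
    have m: "(M, K', b) \<in> mode_labels r d eps \<mu>" using that by (auto simp: J_def Inr a)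
    then have b: "b \<longrightarrow> \<mu> = 0" by (simp add: mode_labels_def)
    show ?thesis using Q[OF m] b by (simp add: Inr a psi_def Q_def sip_tens[OF mc mc] mode_norm)
  qed
  have psiV: "psi j \<in> V0" if "j \<in> J" for j using good[OF that] sections_V0 by blast
  have th: "\<exists>qa qb va vb. psi1 N M = sadd (tens (tg r ?e N M qa) va) (tens (tg r ?e N M qb) vb)"
    if "(N, M) \<in> theta_labels r d eps \<mu>" for N M using P[OF that] by (auto simp: P_def)
  have ortho_tt: "sec_inner (psi1 N M) (psi1 N' M') = 0"
    if a: "(N, M) \<in> theta_labels r d eps \<mu>" and b: "(N', M') \<in> theta_labels r d eps \<mu>" and ne: "(N, M) \<noteq> (N', M')" for N M N' M'
  proof -
    have N: "N \<noteq> 0" "N' \<noteq> 0" "even (N - eps ((1, 0), 0))" "even (N' - eps ((1, 0), 0))" "even (M - eps ((0, 1), 0))" "even (M' - eps ((0, 1), 0))"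
      "0 \<le> M" "M < int r * \<bar>N\<bar>" "0 \<le> M'" "M' < int r * \<bar>N'\<bar>"
      using a b by (auto simp: theta_labels_def)
    have "sip (tg r ?e N M q) (tg r ?e N' M' q') = 0" for q q'
    proof (cases "N = N'")
      case True
      then show ?thesis using ne N by (auto intro!: orthogonal_M[OF eps rd(1)])
    next
      case False
      show ?thesis
        by (rule orthogonal_N[OF tg_smooth[OF rd(1) N(1)] tg_equiv[OF eps rd(1) N(1) N(3) N(5)] _ tg_smooth[OF rd(1) N(2)] tg_equiv[OF eps rd(1) N(2) N(4) N(6)] _ False])
           (rule ext, rule along_tg(3)[OF rd(1)], rule N)+
    qed
    then show ?thesis using th[OF a] th[OF b] sec_inner_sadd_zero[OF tg_cont[OF rd(1) N(1)] tg_cont[OF rd(1) N(1)] tg_cont[OF rd(1) N(2)] tg_cont[OF rd(1) N(2)]]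
      by (elim exE) simp
  qed
  have ortho_tm: "sec_inner (psi1 N M) (tens (mode M' K') v) = 0"
    if a: "(N, M) \<in> theta_labels r d eps \<mu>" and b: "(M', K', b) \<in> mode_labels r d eps \<mu>" for N M M' K' b v
  proof -
    have N: "N \<noteq> 0" "even (N - eps ((1, 0), 0))" "even (M - eps ((0, 1), 0))"
      "even (eps ((1, 0), 0))" "even (M' - eps ((0, 1), 0))" "even (K' - eps ((0, 0), 1))"
      using a b by (auto simp: theta_labels_def mode_labels_def)
    have z: "sip (tg r ?e N M q) (mode M' K') = 0" for q
      by (rule orthogonal_N[OF tg_smooth[OF rd(1) N(1)] tg_equiv[OF eps rd(1) N(1,2,3)] _ mode_smooth mode_equiv[OF eps N(4,5,6)], where N = N and N' = 0])
         (simp_all add: fun_eq_iff along_tg(3)[OF rd(1) N(1)] along_mode N(1))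
    have "tens (mode M' K') v = sadd (tens (mode M' K') v) (tens (mode M' K') 0)" by (simp add: tens_def fun_eq_iff vec_eq_iff)
    moreover obtain qa qb va vb where "psi1 N M = sadd (tens (tg r ?e N M qa) va) (tens (tg r ?e N M qb) vb)" using th[OF a] by blast
    ultimately show ?thesis
      using sec_inner_sadd_zero[OF tg_cont[OF rd(1) N(1)] tg_cont[OF rd(1) N(1)] mc mc z z z z, of qa va qb vb v 0] by simp
  qed
  have on: "sec_inner (psi i) (psi j) = (if i = j then 1 else 0)" if i: "i \<in> J" and j: "j \<in> J" for i j
  proof (cases "i = j")
    case True then show ?thesis using good[OF i] by simp
  next
    case ne: False
    have "sec_inner (psi i) (psi j) = 0"
    proof (cases i)
      case (Inl a)
      obtain N M where a: "a = (N, M)" by (cases a)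
      have ia: "(N, M) \<in> theta_labels r d eps \<mu>" using i by (auto simp: J_def Inl a)
      show ?thesis
      proof (cases j)
        case (Inl b)
        obtain N' M' where b: "b = (N', M')" by (cases b)
        show ?thesis using ortho_tt[OF ia, of N' M'] j ne by (auto simp: J_def \<open>i = Inl a\<close> Inl a b psi_def)
      next
        case (Inr b)
        obtain M' K' t where b: "b = (M', K', t)" by (cases b)
        show ?thesis using ortho_tm[OF ia, of M' K' t] j by (auto simp: J_def \<open>i = Inl a\<close> Inr a b psi_def)
      qed
    next
      case (Inr a)
      obtain M K' t where a: "a = (M, K', t)" by (cases a)
      have ia: "(M, K', t) \<in> mode_labels r d eps \<mu>" using i by (auto simp: J_def Inr a)
      show ?thesis
      proof (cases j)
        case (Inl b)
        obtain N' M' where b: "b = (N', M')" by (cases b)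
        have jb: "(N', M') \<in> theta_labels r d eps \<mu>" using j by (auto simp: J_def Inl b)
        have "sec_inner (psi j) (psi i) = 0" using ortho_tm[OF jb ia] by (simp add: \<open>i = Inr a\<close> Inl a b psi_def)
        then show ?thesis using S.ip_herm[OF psiV[OF j] psiV[OF i]] by simp
      next
        case (Inr b)
        obtain M' K'' t' where b: "b = (M', K'', t')" by (cases b)
        have jb: "(M', K'', t') \<in> mode_labels r d eps \<mu>" using j by (auto simp: J_def Inr b)
        show ?thesis
        proof (cases "M = M' \<and> K' = K''")
          case True
          then have t: "t \<noteq> t'" using ne by (simp add: \<open>i = Inr a\<close> Inr a b)
          have "\<mu> = 0" using t ia jb by (auto simp: mode_labels_def)
          then have "cdot (vv M K' True) (vv M K' False) = 0" using Q[OF ia] by (simp add: Q_def)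
          moreover from this have "cdot (vv M K' False) (vv M K' True) = 0" by (subst cdot_commute) simp
          ultimately have "cdot (vv M K' t) (vv M K' t') = 0" using t by (cases t; cases t') auto
          then show ?thesis using True by (simp add: \<open>i = Inr a\<close> Inr a b psi_def sip_tens[OF mc mc])
        next
          case False
          have "sip (mode M K') (mode M' K'') = 0"
            by (rule orthogonal_mode[OF rd mode_equiv[OF eps] mode_equiv[OF eps]])
               (use ia jb False in \<open>auto simp: mode_labels_def\<close>)
          then show ?thesis by (simp add: \<open>i = Inr a\<close> Inr a b psi_def sip_tens[OF mc mc])
        qed
      qed
    qed
    then show ?thesis using ne by simp
  qed
  have tot: "S.lip x x = 0" if x: "x \<in> ?K" and z: "\<And>i. i \<in> J \<Longrightarrow> S.lip x (L2_embed (psi i)) = 0" for x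
  proof (rule completeness[OF eps rd])
    show "x \<in> S.Cseq" using x by (auto elim!: eigenspaceD simp: L2_Cseq)
  next
    fix N M k assume N: "N \<noteq> 0" "even (N - eps ((1, 0), 0))" "even (M - eps ((0, 1), 0))" "0 \<le> M" "M < int r * \<bar>N\<bar>"
    show "tg r ?e N M (herm r d N k) \<in> annih x"
    proof (cases "\<mu> = 0 \<or> (\<exists>k. \<mu>\<^sup>2 = nu d N * real (Suc k))")
      case True
      then have l: "(N, M) \<in> theta_labels r d eps \<mu>" using N by (auto simp: theta_labels_def)
      have "S.lip x (L2_embed (psi1 N M)) = 0" using z[of "Inl (N, M)", unfolded J_def, OF InlI[OF l]] by (simp add: psi_def)
      then show ?thesis using P[OF l] x by (simp add: P_def)
    next
      case False
      then show ?thesis by (intro sector_empty[OF eps rd N(1,2,3) K cl x]) auto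
    qed
  next
    fix M K' assume M: "even (eps ((1, 0), 0))" "even (M - eps ((0, 1), 0))" "even (K' - eps ((0, 0), 1))"
    show "mode M K' \<in> annih x"
    proof (cases "\<mu>\<^sup>2 = (pi * d / real r)\<^sup>2 * ((of_int K')\<^sup>2 + (real r)\<^sup>2 * (of_int M)\<^sup>2)")
      case True
      have l: "(M, K', b) \<in> mode_labels r d eps \<mu>" if "b \<longrightarrow> \<mu> = 0" for b using True M that by (simp add: mode_labels_def)
      have "pair_with x (mode M K') (vv M K' b) = 0" if "b \<longrightarrow> \<mu> = 0" for b
        using z[of "Inr (M, K', b)", unfolded J_def, OF InrI[OF l[OF that]]] by (simp add: psi_def)
      then show ?thesis using Q[OF l[of False]] x by (simp add: Q_def)
    next
      case False
      then show ?thesis by (intro mode_empty[OF eps rd M K cl x])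
    qed
  qed
  have "\<exists>F. L.onb ?K (if finite J then enat (card J) else \<infinity>) F"
  proof (rule L.onb_from_countable[where E = "\<lambda>j. L2_embed (psi j)"])
    show "countable J" by (rule countableI_type)
    show "L2_embed (psi i) \<in> ?K" if "i \<in> J" for i using good[OF that] by (intro embed_eigenvector[OF rd K]) auto
    show "S.lip (L2_embed (psi i)) (L2_embed (psi j)) = (if i = j then 1 else 0)" if "i \<in> J" "j \<in> J" for i j
      unfolding lip_embed by (rule on[OF that])
    show "S.lip x x = 0" if "x \<in> ?K" "\<And>i. i \<in> J \<Longrightarrow> S.lip x (L2_embed (psi i)) = 0" for x by (rule tot[OF that])
  qed
  then show ?thesis
    unfolding spectral_mult_def Let_def J_def[symmetric] using hilbert_dim_eqI[OF eigenspace_subsp[OF rd K]] by blast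
qed

subsection \<open>Counting\<close>

lemma infsum_enat_finite:
  fixes f :: "'a \<Rightarrow> enat"
  assumes "finite F" "F \<subseteq> A" "\<And>x. x \<in> A - F \<Longrightarrow> f x = 0"
  shows "infsum f A = sum f F"
proof -
  have "infsum f A = infsum f F" by (rule infsum_cong_neutral) (use assms in auto)
  then show ?thesis using assms(1) by simp
qed

lemma infsum_delta_inj:
  assumes "inj_on f A"
  shows "(\<Sum>\<^sub>\<infinity>k\<in>A. delta (f k) y) = (if \<exists>k\<in>A. f k = y then 1 else 0)"
proof (cases "\<exists>k\<in>A. f k = y")
  case True
  then obtain k where k: "k \<in> A" "f k = y" by blast
  have "(\<Sum>\<^sub>\<infinity>k\<in>A. delta (f k) y) = (\<Sum>k\<in>{k}. delta (f k) y)"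
    by (rule infsum_enat_finite) (use k assms in \<open>auto simp: delta_def inj_on_def\<close>)
  then show ?thesis using True k by (simp add: delta_def)
next
  case False
  have "(\<Sum>\<^sub>\<infinity>k\<in>A. delta (f k) y) = (\<Sum>k\<in>{}. delta (f k) y)"
    by (rule infsum_enat_finite) (use False in \<open>auto simp: delta_def\<close>)
  then show ?thesis using False by simp
qed

lemma infsum_delta_card:
  fixes f :: "'a \<Rightarrow> 'b \<Rightarrow> real"
  assumes fin: "finite {(k, l). f k l = y}"
  shows "(\<Sum>\<^sub>\<infinity>k. \<Sum>\<^sub>\<infinity>l. delta (f k l) y) = enat (card {(k, l). f k l = y})"
proof -
  let ?S = "{(k, l). f k l = y}" and ?L = "\<lambda>k. {l. f k l = y}"
  have L: "finite (?L k)" for k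
    by (rule finite_subset[OF _ finite_imageI[OF fin, of snd]]) force
  have in1: "(\<Sum>\<^sub>\<infinity>l. delta (f k l) y) = enat (card (?L k))" for k
  proof -
    have "(\<Sum>\<^sub>\<infinity>l. delta (f k l) y) = (\<Sum>l\<in>?L k. delta (f k l) y)"
      by (rule infsum_enat_finite[OF L]) (auto simp: delta_def)
    also have "\<dots> = (\<Sum>l\<in>?L k. 1)" by (rule sum.cong) (auto simp: delta_def)
    finally show ?thesis by (simp add: of_nat_eq_enat)
  qed
  have F: "finite (fst ` ?S)" using fin by simp
  have "(\<Sum>\<^sub>\<infinity>k. enat (card (?L k))) = (\<Sum>k\<in>fst ` ?S. enat (card (?L k)))"
  proof (rule infsum_enat_finite[OF F])
    fix k assume "k \<in> UNIV - fst ` ?S"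
    then have "?L k = {}" by force
    then show "enat (card (?L k)) = 0" by (simp add: zero_enat_def)
  qed simp
  also have "\<dots> = enat (\<Sum>k\<in>fst ` ?S. card (?L k))" by (simp add: of_nat_eq_enat[symmetric])
  also have "(\<Sum>k\<in>fst ` ?S. card (?L k)) = card (Sigma (fst ` ?S) ?L)" using F L by simp
  also have "Sigma (fst ` ?S) ?L = ?S" by force
  finally show ?thesis unfolding in1 .
qed

lemma card_parity:
  assumes "p \<in> {0, 1}" shows "card {M::int. even (M - p) \<and> 0 \<le> M \<and> M < 2 * int h} = h" "finite {M::int. even (M - p) \<and> 0 \<le> M \<and> M < 2 * int h}"
proof -
  have "{M::int. even (M - p) \<and> 0 \<le> M \<and> M < 2 * int h} = (\<lambda>i. 2 * i + p) ` {0..<int h}"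
  proof (intro Set.set_eqI iffI)
    fix M assume M: "M \<in> {M::int. even (M - p) \<and> 0 \<le> M \<and> M < 2 * int h}"
    then have "even (M - p)" by (simp only: mem_Collect_eq)
    then obtain i where i: "M - p = 2 * i" by (rule evenE)
    have "i \<in> {0..<int h}" using M i assms by auto
    then show "M \<in> (\<lambda>i. 2 * i + p) ` {0..<int h}" using i by (intro image_eqI[of _ _ i]) auto
  qed (use assms in auto)
  moreover have "inj_on (\<lambda>i::int. 2 * i + p) {0..<int h}" by (auto simp: inj_on_def)
  ultimately show "card {M::int. even (M - p) \<and> 0 \<le> M \<and> M < 2 * int h} = h" "finite {M::int. even (M - p) \<and> 0 \<le> M \<and> M < 2 * int h}"
    by (simp_all add: card_image)
qed

text \<open>The possible values of \<open>\<bar>N\<bar>\<close> for which the oscillators with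
  central frequency \<open>N\<close> and \<open>- N\<close> have the eigenvalue
  \<open>\<mu>\<close>.\<close>

definition levels :: "real \<Rightarrow> int \<Rightarrow> real \<Rightarrow> nat set" where
  "levels d p \<mu> = {n. n > 0 \<and> even (int n - p) \<and> (\<exists>k. \<mu>\<^sup>2 = 2 * pi * d\<^sup>2 * real n * real (Suc k))}"

lemma finite_levels:
  assumes "d > 0" shows "finite (levels d p \<mu>)"
proof (rule finite_subset)
  show "finite {n. n \<le> nat \<lceil>\<mu>\<^sup>2 / (2 * pi * d\<^sup>2)\<rceil>}" by simp
  show "levels d p \<mu> \<subseteq> {n. n \<le> nat \<lceil>\<mu>\<^sup>2 / (2 * pi * d\<^sup>2)\<rceil>}"
  proof
    fix n assume "n \<in> levels d p \<mu>"
    then obtain k where k: "\<mu>\<^sup>2 = 2 * pi * d\<^sup>2 * real n * real (Suc k)" by (auto simp: levels_def)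
    have "2 * pi * d\<^sup>2 * real n * 1 \<le> 2 * pi * d\<^sup>2 * real n * real (Suc k)" by (intro mult_left_mono) auto
    then have "real n * (2 * pi * d\<^sup>2) \<le> \<mu>\<^sup>2" unfolding k[symmetric] by (simp add: mult.commute)
    then have "real n \<le> \<mu>\<^sup>2 / (2 * pi * d\<^sup>2)" using assms by (subst pos_le_divide_eq) auto
    then show "n \<in> {n. n \<le> nat \<lceil>\<mu>\<^sup>2 / (2 * pi * d\<^sup>2)\<rceil>}" by simp linarith
  qed
qed

text \<open>Each \<open>N\<close> admits the \<open>M\<close> of one parity below
  \<open>r * \<bar>N\<bar>\<close>. This bound is even because the character is trivial on the
  \<open>r\<close>-th power of the central generator, so exactly half of the range qualifies; the
  two signs of \<open>N\<close> restore the factor 2.\<close>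

lemma theta_labels_card:
  assumes eps: "eps \<in> hom (heis_lattice r) (integer_mod_group 2)" and rd: "r > 0" "d > 0" and \<mu>: "\<mu> \<noteq> 0"
  shows "card (theta_labels r d eps \<mu>) = (\<Sum>n\<in>levels d (eps ((1, 0), 0)) \<mu>. r * n)" "finite (theta_labels r d eps \<mu>)"
proof -
  let ?p = "eps ((1, 0), 0)" and ?q = "eps ((0, 1), 0)"
  have q: "?q \<in> {0, 1}" by (rule eps_character(1)[OF eps]) (simp add: lattice_pts_def)
  define T where "T s = (SIGMA n:levels d ?p \<mu>. {M::int. even (M - ?q) \<and> 0 \<le> M \<and> M < int (r * n)})" for s :: int
  define g where "g s = (\<lambda>(n, M). (s * int n, M :: int))" for s
  have ev: "even (r * n)" if "n \<in> levels d ?p \<mu>" for n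
  proof -
    have "even (int n - ?p)" using that by (simp add: levels_def)
    then have "even (int r * int n)" using eps_character(3)[OF eps] by auto
    then show ?thesis by (metis even_of_nat of_nat_mult)
  qed
  have M: "card {M::int. even (M - ?q) \<and> 0 \<le> M \<and> M < int (r * n)} = r * n div 2" "finite {M::int. even (M - ?q) \<and> 0 \<le> M \<and> M < int (r * n)}"
    if "n \<in> levels d ?p \<mu>" for n
  proof -
    have "int (r * n) = 2 * int (r * n div 2)" using ev[OF that] by presburger
    then show "card {M::int. even (M - ?q) \<and> 0 \<le> M \<and> M < int (r * n)} = r * n div 2" "finite {M::int. even (M - ?q) \<and> 0 \<le> M \<and> M < int (r * n)}"
      using card_parity[OF q, of "r * n div 2"] by metis+
  qed
  have fT: "finite (T s)" for s unfolding T_def by (intro finite_SigmaI finite_levels rd M(2))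
  have cT: "card (T s) = (\<Sum>n\<in>levels d ?p \<mu>. r * n div 2)" for s
    unfolding T_def using finite_levels[OF rd(2)] M by simp
  have eq: "theta_labels r d eps \<mu> = g 1 ` T 1 \<union> g (- 1) ` T (- 1)"
  proof (intro Set.set_eqI iffI)
    fix a assume a: "a \<in> theta_labels r d eps \<mu>"
    obtain N M where NM: "a = (N, M)" by (cases a)
    have h: "N \<noteq> 0" "even (N - ?p)" "even (M - ?q)" "0 \<le> M" "M < int r * \<bar>N\<bar>" "\<exists>k. \<mu>\<^sup>2 = nu d N * real (Suc k)"
      using a \<mu> by (auto simp: NM theta_labels_def)
    have lev: "nat \<bar>N\<bar> \<in> levels d ?p \<mu>"
      using h(1,2,6) by (auto simp: levels_def nu_def)
    have "(nat \<bar>N\<bar>, M) \<in> T s" for s using lev h(3,4,5) by (simp add: T_def)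
    moreover have "a = g (sgn N) (nat \<bar>N\<bar>, M)" by (simp add: g_def NM sgn_mult_abs)
    moreover have "sgn N = 1 \<or> sgn N = - 1" using h(1) by (auto simp: sgn_if)
    ultimately show "a \<in> g 1 ` T 1 \<union> g (- 1) ` T (- 1)" by fastforce
  next
    fix a assume "a \<in> g 1 ` T 1 \<union> g (- 1) ` T (- 1)"
    then obtain s b where s: "s = 1 \<or> s = - 1" and b: "b \<in> T s" "a = g s b" by blast
    obtain n M where "b = (n, M)" by (cases b)
    with b have n: "n \<in> levels d ?p \<mu>" "even (M - ?q)" "0 \<le> M" "M < int (r * n)" "a = (s * int n, M)"
      by (simp_all add: g_def T_def)
    then show "a \<in> theta_labels r d eps \<mu>"
      using s by (auto simp: theta_labels_def levels_def nu_def)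
  qed
  have inj: "inj_on (g s) (T s)" if "s = 1 \<or> s = - 1" for s
    using that by (auto simp: inj_on_def g_def)
  have disj: "g 1 ` T 1 \<inter> g (- 1) ` T (- 1) = {}"
    by (auto simp: g_def T_def levels_def)
  show "finite (theta_labels r d eps \<mu>)" unfolding eq using fT by simp
  have "card (theta_labels r d eps \<mu>) = card (T 1) + card (T (- 1))"
    unfolding eq using fT disj by (simp add: card_Un_disjoint card_image inj)
  also have "\<dots> = (\<Sum>n\<in>levels d ?p \<mu>. 2 * (r * n div 2))" by (simp add: cT mult_2 sum.distrib)
  also have "\<dots> = (\<Sum>n\<in>levels d ?p \<mu>. r * n)" by (rule sum.cong) (use ev in auto)
  finally show "card (theta_labels r d eps \<mu>) = (\<Sum>n\<in>levels d ?p \<mu>. r * n)" .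
qed

lemma theta_labels_infinite:
  assumes eps: "eps \<in> hom (heis_lattice r) (integer_mod_group 2)" and rd: "r > 0" "d > 0"
  shows "infinite (theta_labels r d eps 0)"
proof
  assume "finite (theta_labels r d eps 0)"
  let ?p = "eps ((1, 0), 0)" and ?q = "eps ((0, 1), 0)"
  have pq: "?p \<in> {0, 1}" "?q \<in> {0, 1}" by (rule eps_character(1)[OF eps]; simp add: lattice_pts_def)+
  \<comment> \<open>A positive central frequency of the right parity; \<open>r\<close> times it is
    at least 2, so \<open>?q\<close>, being 0 or 1, is an admissible \<open>M\<close>.\<close>
  have "(2 * int n + 2 + ?p, ?q) \<in> theta_labels r d eps 0" for n
  proof -
    have "int r * (2 * int n + 2 + ?p) \<ge> 1 * 2" by (rule mult_mono) (use rd pq in auto)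
    then show ?thesis using pq by (auto simp: theta_labels_def)
  qed
  then have "range (\<lambda>n. (2 * int n + 2 + ?p, ?q)) \<subseteq> theta_labels r d eps 0" by blast
  then have "finite (range (\<lambda>n. (2 * int n + 2 + ?p, ?q)))" using \<open>finite _\<close> finite_subset by blast
  moreover have "inj (\<lambda>n. (2 * int n + 2 + ?p, ?q))" by (auto simp: inj_on_def)
  ultimately show False using finite_imageD infinite_UNIV_nat by blast
qed

lemma finite_int_sq: "finite {k::int. (of_int k)\<^sup>2 \<le> (B::real)}"
proof (rule finite_subset)
  show "finite {- \<lceil>B\<rceil>..\<lceil>B\<rceil>}" by simp
  show "{k::int. (of_int k)\<^sup>2 \<le> B} \<subseteq> {- \<lceil>B\<rceil>..\<lceil>B\<rceil>}"
  proof
    fix k :: int assume "k \<in> {k. (of_int k)\<^sup>2 \<le> B}"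
    then have "real_of_int (k\<^sup>2) \<le> B" by simp
    moreover have "\<bar>k\<bar> \<le> k\<^sup>2"
    proof (cases "k = 0")
      case False
      then have "\<bar>k\<bar> * 1 \<le> \<bar>k\<bar> * \<bar>k\<bar>" by (intro mult_left_mono) auto
      then show ?thesis by (simp add: power2_eq_square)
    qed simp
    ultimately have "real_of_int \<bar>k\<bar> \<le> B" by (metis of_int_le_iff order_trans)
    then show "k \<in> {- \<lceil>B\<rceil>..\<lceil>B\<rceil>}" by (simp, linarith)
  qed
qed

text \<open>The condition on a label involves only the square of \<open>\<mu>\<close>, so both signs
  are counted by the positive branch at \<open>\<bar>\<mu>\<bar>\<close>.\<close>

lemma mode_labels_card:
  assumes eps: "eps \<in> hom (heis_lattice r) (integer_mod_group 2)" and rd: "r > 0" "d > 0" and \<mu>: "\<mu> > 0 \<or> \<mu> < 0"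
    and p: "eps ((1, 0), 0) = 0"
  shows "enat (card (mode_labels r d eps \<mu>)) = m1 1 r d eps \<bar>\<mu>\<bar>" "finite (mode_labels r d eps \<mu>)"
proof -
  let ?q = "eps ((0, 1), 0)" and ?s = "eps ((0, 0), 1)" and ?c = "pi * d / real r"
  let ?Y = "\<lambda>k l::int. (2 * of_int k + of_int ?s)\<^sup>2 + (real r)\<^sup>2 * (2 * of_int l + of_int ?q)\<^sup>2"
  define f where "f k l = 1 * (?c * sqrt (?Y k l))" for k l
  have c: "?c > 0" using rd by simp
  have fY: "f k l = \<bar>\<mu>\<bar> \<longleftrightarrow> \<mu>\<^sup>2 = ?c\<^sup>2 * ?Y k l" for k l
  proof -
    have Y: "?Y k l \<ge> 0" by simp
    have "f k l \<ge> 0" unfolding f_def mult_1 by (intro mult_nonneg_nonneg less_imp_le[OF c] real_sqrt_ge_zero Y)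
    then have "f k l = \<bar>\<mu>\<bar> \<longleftrightarrow> (f k l)\<^sup>2 = \<bar>\<mu>\<bar>\<^sup>2" by (subst power2_eq_iff_nonneg) auto
    also have "(f k l)\<^sup>2 = ?c\<^sup>2 * ?Y k l" unfolding f_def mult_1 power_mult_distrib real_sqrt_pow2[OF Y] ..
    finally show ?thesis by auto
  qed
  define g where "g = (\<lambda>(k, l). (2 * l + ?q, 2 * k + ?s, False))"
  have eq: "mode_labels r d eps \<mu> = g ` {(k, l). f k l = \<bar>\<mu>\<bar>}"
  proof (intro Set.set_eqI iffI)
    fix a assume a: "a \<in> mode_labels r d eps \<mu>"
    obtain M K b where MK: "a = (M, K, b)" by (cases a)
    have h: "even (M - ?q)" "even (K - ?s)" "\<mu>\<^sup>2 = ?c\<^sup>2 * ((of_int K)\<^sup>2 + (real r)\<^sup>2 * (of_int M)\<^sup>2)" "\<not> b"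
      using a \<mu> by (auto simp: MK mode_labels_def)
    obtain l k where lk: "M = 2 * l + ?q" "K = 2 * k + ?s" using h(1,2) by (metis diff_add_cancel evenE)
    have "f k l = \<bar>\<mu>\<bar>" unfolding fY using h(3) by (simp add: lk)
    then show "a \<in> g ` {(k, l). f k l = \<bar>\<mu>\<bar>}" using h(4) by (intro image_eqI[of _ _ "(k, l)"]) (auto simp: MK g_def lk)
  next
    fix a assume "a \<in> g ` {(k, l). f k l = \<bar>\<mu>\<bar>}"
    then obtain k l where "f k l = \<bar>\<mu>\<bar>" "a = (2 * l + ?q, 2 * k + ?s, False)" by (auto simp: g_def)
    then show "a \<in> mode_labels r d eps \<mu>" unfolding fY using p by (simp add: mode_labels_def)
  qed
  have inj: "inj_on g A" for A by (auto simp: inj_on_def g_def)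
  have fin: "finite {(k, l). f k l = \<bar>\<mu>\<bar>}"
  proof -
    define B where "B = \<mu>\<^sup>2 / ?c\<^sup>2"
    have "{(k, l). f k l = \<bar>\<mu>\<bar>} \<subseteq> ((\<lambda>K. (K - ?s) div 2) ` {K. (of_int K)\<^sup>2 \<le> B}) \<times> ((\<lambda>M. (M - ?q) div 2) ` {M. (of_int M)\<^sup>2 \<le> B})"
    proof (rule subrelI)
      fix k l assume "(k, l) \<in> {(k, l). f k l = \<bar>\<mu>\<bar>}"
      then have "f k l = \<bar>\<mu>\<bar>" by simp
      then have "\<mu>\<^sup>2 = ?c\<^sup>2 * ?Y k l" by (simp only: fY)
      moreover have "?c\<^sup>2 \<noteq> 0" using c by (intro power_not_zero) linarith
      ultimately have Y: "?Y k l = B" unfolding B_def by (simp only: nonzero_mult_div_cancel_left simp_thms)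
      have "(2 * of_int l + of_int ?q)\<^sup>2 \<le> (real r)\<^sup>2 * (2 * of_int l + of_int ?q)\<^sup>2"
        using rd mult_right_mono[of 1 "(real r)\<^sup>2" "(2 * of_int l + of_int ?q)\<^sup>2"] by (simp add: one_le_power)
      then have "(2 * of_int l + of_int ?q)\<^sup>2 \<le> B" using Y zero_le_power2[of "2 * of_int k + of_int ?s :: real"] by linarith
      moreover have "(2 * of_int k + of_int ?s)\<^sup>2 \<le> B"
        using Y zero_le_mult_iff[of "(real r)\<^sup>2" "(2 * of_int l + of_int ?q)\<^sup>2"] by (smt (verit) zero_le_power2)
      ultimately show "(k, l) \<in> ((\<lambda>K. (K - ?s) div 2) ` {K. (of_int K)\<^sup>2 \<le> B}) \<times> ((\<lambda>M. (M - ?q) div 2) ` {M. (of_int M)\<^sup>2 \<le> B})"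
        by (intro SigmaI image_eqI[of k _ "2 * k + ?s"] image_eqI[of l _ "2 * l + ?q"]) auto
    qed
    then show ?thesis by (rule finite_subset) (intro finite_cartesian_product finite_imageI finite_int_sq)
  qed
  show "finite (mode_labels r d eps \<mu>)" unfolding eq using fin by simp
  show "enat (card (mode_labels r d eps \<mu>)) = m1 1 r d eps \<bar>\<mu>\<bar>"
    unfolding eq card_image[OF inj] infsum_delta_card[OF fin, symmetric] by (simp only: m1_def f_def)
qed

text \<open>Counts both parities at once: \<open>w l\<close> is \<open>2 * l\<close> with
  \<open>l \<ge> 1\<close>, or \<open>2 * l + 1\<close> with \<open>l \<ge> 0\<close>. For a given
  \<open>l\<close> at most one \<open>k\<close> reaches the eigenvalue, so the inner sum is 0 or 1,
  and only finitely many \<open>l\<close> contribute.\<close>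

lemma infsum_levels:
  assumes rd: "r > 0" "d > 0" and y: "\<mu> \<noteq> 0" and p: "p \<in> {0, 1}"
    and w: "bij_betw w A {n::nat. n > 0 \<and> even (int n - p)}"
    and s: "\<And>l k. l \<in> A \<Longrightarrow> (s l k)\<^sup>2 = 2 * pi * d\<^sup>2 * real (w l) * real k" "\<And>l k. l \<in> A \<Longrightarrow> s l k \<ge> 0"
  shows "(\<Sum>\<^sub>\<infinity>l\<in>A. of_nat (r * w l) * (\<Sum>\<^sub>\<infinity>k\<in>{1::nat..}. delta (s l k) \<bar>\<mu>\<bar>)) = enat (\<Sum>n\<in>levels d p \<mu>. r * n)"
proof -
  have wA: "w l > 0" "even (int (w l) - p)" if "l \<in> A" for l using w that by (auto simp: bij_betw_def)
  have sm: "s l k = \<bar>\<mu>\<bar> \<longleftrightarrow> \<mu>\<^sup>2 = 2 * pi * d\<^sup>2 * real (w l) * real k" if "l \<in> A" for l k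
  proof -
    have "s l k = \<bar>\<mu>\<bar> \<longleftrightarrow> (s l k)\<^sup>2 = \<bar>\<mu>\<bar>\<^sup>2" using s(2)[OF that] by (subst power2_eq_iff_nonneg) auto
    then show ?thesis unfolding s(1)[OF that] by auto
  qed
  have ex: "(\<exists>k\<in>{1::nat..}. s l k = \<bar>\<mu>\<bar>) \<longleftrightarrow> w l \<in> levels d p \<mu>" if lA: "l \<in> A" for l
  proof
    assume "\<exists>k\<in>{1::nat..}. s l k = \<bar>\<mu>\<bar>"
    then obtain k where "k \<ge> 1" "\<mu>\<^sup>2 = 2 * pi * d\<^sup>2 * real (w l) * real k" using sm[OF lA] by auto
    moreover from this have "real k = real (Suc (k - 1))" by simp
    ultimately show "w l \<in> levels d p \<mu>" using wA[OF lA] by (auto simp only: levels_def mem_Collect_eq)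
  next
    assume "w l \<in> levels d p \<mu>"
    then obtain k where "\<mu>\<^sup>2 = 2 * pi * d\<^sup>2 * real (w l) * real (Suc k)" by (auto simp: levels_def)
    then show "\<exists>k\<in>{1::nat..}. s l k = \<bar>\<mu>\<bar>" using sm[OF lA, of "Suc k"] by (intro bexI[of _ "Suc k"]) auto
  qed
  have inj: "inj_on (s l) {1::nat..}" if "l \<in> A" for l
  proof (rule inj_onI)
    fix k k' assume "s l k = s l k'"
    then have "2 * pi * d\<^sup>2 * real (w l) * real k = 2 * pi * d\<^sup>2 * real (w l) * real k'" using s(1)[OF that] by metis
    then show "k = k'" using wA(1)[OF that] rd by simp
  qed
  define F where "F = {l \<in> A. w l \<in> levels d p \<mu>}"
  have "levels d p \<mu> \<subseteq> w ` A" unfolding bij_betw_imp_surj_on[OF w] levels_def by blast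
  then have "w ` F = levels d p \<mu>" unfolding F_def by blast
  then have bF: "bij_betw w F (levels d p \<mu>)" by (intro bij_betw_subset[OF w]) (auto simp: F_def)
  have fF: "finite F" using bij_betw_finite[OF bF] finite_levels[OF rd(2)] by simp
  have "(\<Sum>\<^sub>\<infinity>l\<in>A. of_nat (r * w l) * (\<Sum>\<^sub>\<infinity>k\<in>{1::nat..}. delta (s l k) \<bar>\<mu>\<bar>)) = (\<Sum>\<^sub>\<infinity>l\<in>A. of_nat (r * w l) * (if w l \<in> levels d p \<mu> then 1 else 0 :: enat))"
  proof (rule infsum_cong)
    fix l assume "l \<in> A"
    show "of_nat (r * w l) * (\<Sum>\<^sub>\<infinity>k\<in>{1::nat..}. delta (s l k) \<bar>\<mu>\<bar>) = of_nat (r * w l) * (if w l \<in> levels d p \<mu> then 1 else 0 :: enat)"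
      unfolding infsum_delta_inj[OF inj[OF \<open>l \<in> A\<close>]] ex[OF \<open>l \<in> A\<close>] ..
  qed
  also have "\<dots> = (\<Sum>l\<in>F. of_nat (r * w l) * (if w l \<in> levels d p \<mu> then 1 else 0 :: enat))"
    by (rule infsum_enat_finite[OF fF]) (auto simp: F_def)
  also have "\<dots> = (\<Sum>l\<in>F. of_nat (r * w l))" by (rule sum.cong) (auto simp: F_def)
  also have "\<dots> = of_nat (\<Sum>l\<in>F. r * w l)" by (rule of_nat_sum[symmetric])
  also have "(\<Sum>l\<in>F. r * w l) = (\<Sum>n\<in>levels d p \<mu>. r * n)" by (rule sum.reindex_bij_betw[OF bF])
  finally show ?thesis by (simp only: of_nat_eq_enat)
qed

lemma delta_uminus: "delta (- a) x = delta a (- x)"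
  by (simp add: delta_def minus_equation_iff[of x] eq_commute[of x])

text \<open>Away from 0 only the branch with the sign of \<open>x\<close> contributes, since the
  square roots are nonnegative.\<close>

lemma m1_signs:
  assumes "r > 0" "d > 0" "x \<noteq> 0" shows "m1 1 r d eps x + m1 (- 1) r d eps x = m1 1 r d eps \<bar>x\<bar>"
proof -
  have neg: "m1 1 r d eps y = 0" if "y < 0" for y
  proof -
    have z: "delta (1 * (pi * d / real r * sqrt ((2 * of_int k + of_int (eps ((0, 0), 1)))\<^sup>2 + (real r)\<^sup>2 * (2 * of_int l + of_int (eps ((0, 1), 0)))\<^sup>2))) y = 0" for k l :: int
    proof -
      have "0 \<le> pi * d / real r * sqrt ((2 * of_int k + of_int (eps ((0, 0), 1)))\<^sup>2 + (real r)\<^sup>2 * (2 * of_int l + of_int (eps ((0, 1), 0)))\<^sup>2)"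
        using assms by (intro mult_nonneg_nonneg) auto
      then show ?thesis using that by (simp add: delta_def)
    qed
    show ?thesis unfolding m1_def z by simp
  qed
  have flip: "m1 (- 1) r d eps x = m1 1 r d eps (- x)"
    unfolding m1_def by (simp add: delta_uminus)
  show ?thesis unfolding flip using neg[of x] neg[of "- x"] assms(3) by (cases "x > 0") auto
qed

lemma m2_signs:
  assumes "x \<noteq> 0" shows "m2 1 r d x + m2 (- 1) r d x = m2 1 r d \<bar>x\<bar>"
proof -
  have neg: "m2 1 r d y = 0" if "y < 0" for y
  proof -
    have z: "delta (1 * sqrt (4 * pi * d\<^sup>2 * real k * real l)) y = 0" for k l
    proof -
      have "0 \<le> sqrt (4 * pi * d\<^sup>2 * real k * real l)" by simp
      then show ?thesis using that by (simp add: delta_def del: real_sqrt_ge_0_iff)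
    qed
    show ?thesis unfolding m2_def z by simp
  qed
  have flip: "m2 (- 1) r d x = m2 1 r d (- x)"
    unfolding m2_def by (simp add: delta_uminus)
  show ?thesis unfolding flip using neg[of x] neg[of "- x"] assms by (cases "x > 0") auto
qed

theorem mainTheorem6:
  fixes r :: nat and d :: real
    and eps :: "heis \<Rightarrow> int"
    and nabla :: "vfield \<Rightarrow> vfield \<Rightarrow> vfield"
    and c :: "nat \<Rightarrow> complex^2^2"
  assumes "r > 0" and "d > 0"
    and "eps \<in> hom (heis_lattice r) (integer_mod_group 2)"
    and "koszul_connection r d nabla"
    and "clifford_module c"
  shows "(eps ((1, 0), 0) = 0 \<longrightarrow>
            spectral_mult r eps (sub_dirac r d nabla c) =
              (\<lambda>x. \<infinity> * delta 0 x + m1 1 r d eps x + m1 (-1) r d eps x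
                   + m2 1 r d x + m2 (-1) r d x)) \<and>
         (eps ((1, 0), 0) = 1 \<longrightarrow>
            spectral_mult r eps (sub_dirac r d nabla c) =
              (\<lambda>x. \<infinity> * delta 0 x +
                   (\<Sum>\<^sub>\<infinity>l\<in>(UNIV :: nat set). of_nat ((2 * l + 1) * r) *
                      (\<Sum>\<^sub>\<infinity>k\<in>{1 :: nat..}.
                         delta (sqrt (2 * pi * d\<^sup>2 * real k * (2 * real l + 1))) x
                         + delta (- sqrt (2 * pi * d\<^sup>2 * real k * (2 * real l + 1))) x))))"
proof -
  note rd = assms(1,2) and eps = assms(3)
  let ?p = "eps ((1, 0), 0)"
  \<comment> \<open>At 0 the infinitely many ground states decide; \<open>\<infinity>\<close>
    absorbs whatever the other summands contribute there.\<close>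
  have S0: "spectral_mult r eps (sub_dirac r d nabla c) 0 = \<infinity>"
    unfolding spectral_mult_labels[OF eps rd assms(4,5)] Let_def
    using theta_labels_infinite[OF eps rd] by simp
  have d0: "\<infinity> * delta 0 0 = \<infinity>" "x \<noteq> 0 \<Longrightarrow> \<infinity> * delta 0 x = 0" for x by (simp_all add: delta_def)
  have Sx: "spectral_mult r eps (sub_dirac r d nabla c) x = enat (\<Sum>n\<in>levels d ?p x. r * n) + enat (card (mode_labels r d eps x))"
    if "x \<noteq> 0" "finite (mode_labels r d eps x)" for x
    unfolding spectral_mult_labels[OF eps rd assms(4,5)] Let_def
    using that theta_labels_card[OF eps rd that(1)] by (simp add: card_Plus)
  show ?thesis
  proof (intro conjI impI ext)
    fix x assume p: "?p = 0"
    show "spectral_mult r eps (sub_dirac r d nabla c) x =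
      \<infinity> * delta 0 x + m1 1 r d eps x + m1 (-1) r d eps x + m2 1 r d x + m2 (-1) r d x"
    proof (cases "x = 0")
      case True
      then show ?thesis using S0 d0(1) by simp
    next
      case False
      have "m2 1 r d \<bar>x\<bar> = (\<Sum>\<^sub>\<infinity>l\<in>{1 :: nat..}. of_nat (r * (2 * l)) * (\<Sum>\<^sub>\<infinity>k\<in>{1 :: nat..}. delta (sqrt (4 * pi * d\<^sup>2 * real k * real l)) \<bar>x\<bar>))"
        unfolding m2_def by (simp add: mult_ac)
      also have "\<dots> = enat (\<Sum>n\<in>levels d ?p x. r * n)"
      proof (rule infsum_levels[OF rd False])
        show "bij_betw (\<lambda>l. 2 * l) {1::nat..} {n. 0 < n \<and> even (int n - ?p)}"
          by (rule bij_betw_byWitness[of _ "\<lambda>n. n div 2"]) (auto simp: p elim!: evenE)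
      qed (simp_all add: p)
      finally have m2: "m2 1 r d \<bar>x\<bar> = enat (\<Sum>n\<in>levels d ?p x. r * n)" .
      have x: "x > 0 \<or> x < 0" using False by auto
      have "\<infinity> * delta 0 x + m1 1 r d eps x + m1 (-1) r d eps x + m2 1 r d x + m2 (-1) r d x
        = (m1 1 r d eps x + m1 (-1) r d eps x) + (m2 1 r d x + m2 (-1) r d x)"
        unfolding d0(2)[OF False] by (simp add: add.assoc)
      then show ?thesis
        unfolding m1_signs[OF rd False] m2_signs[OF False] m2 mode_labels_card(1)[OF eps rd x p, symmetric]
          Sx[OF False mode_labels_card(2)[OF eps rd x p]] by (simp only: add.commute)
    qed
  next
    fix x assume p: "?p = 1"
    show "spectral_mult r eps (sub_dirac r d nabla c) x = \<infinity> * delta 0 x +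
                   (\<Sum>\<^sub>\<infinity>l\<in>(UNIV :: nat set). of_nat ((2 * l + 1) * r) *
                      (\<Sum>\<^sub>\<infinity>k\<in>{1 :: nat..}.
                         delta (sqrt (2 * pi * d\<^sup>2 * real k * (2 * real l + 1))) x
                         + delta (- sqrt (2 * pi * d\<^sup>2 * real k * (2 * real l + 1))) x))"
    proof (cases "x = 0")
      case True
      then show ?thesis using S0 d0(1) by simp
    next
      case False
      \<comment> \<open>The central frequency 0 has the wrong parity here, so the torus contributes
        nothing.\<close>
      have ml: "mode_labels r d eps x = {}" by (auto simp: mode_labels_def p)
      \<comment> \<open>At a nonzero point exactly one of the two signs can match, and it does so
        when the root equals \<open>\<bar>x\<bar>\<close>.\<close>
      have dd: "delta (sqrt y) x + delta (- sqrt y) x = delta (sqrt y) \<bar>x\<bar>" if "y \<ge> 0" for y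
      proof -
        have "sqrt y \<ge> 0" using that by simp
        then show ?thesis using False by (auto simp: delta_def abs_if)
      qed
      have "(\<Sum>\<^sub>\<infinity>l\<in>(UNIV :: nat set). of_nat ((2 * l + 1) * r) *
                      (\<Sum>\<^sub>\<infinity>k\<in>{1 :: nat..}.
                         delta (sqrt (2 * pi * d\<^sup>2 * real k * (2 * real l + 1))) x
                         + delta (- sqrt (2 * pi * d\<^sup>2 * real k * (2 * real l + 1))) x))
         = (\<Sum>\<^sub>\<infinity>l\<in>(UNIV :: nat set). of_nat (r * (2 * l + 1)) * (\<Sum>\<^sub>\<infinity>k\<in>{1 :: nat..}. delta (sqrt (2 * pi * d\<^sup>2 * real k * (2 * real l + 1))) \<bar>x\<bar>))"
        by (subst dd) (simp_all only: mult.commute[of r] zero_le_mult_iff, simp)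
      also have "\<dots> = enat (\<Sum>n\<in>levels d ?p x. r * n)"
      proof (rule infsum_levels[OF rd False])
        show "bij_betw (\<lambda>l. 2 * l + 1) UNIV {n. 0 < n \<and> even (int n - ?p)}"
          by (rule bij_betw_byWitness[of _ "\<lambda>n. n div 2"]) (auto simp: p elim!: oddE)
      qed (simp_all add: p mult_ac)
      finally show ?thesis unfolding d0(2)[OF False] using Sx[OF False] by (simp add: ml zero_enat_def[symmetric])
    qed
  qed
qed

end
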